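(* Let $A\in\mathcal S(\mathbb R)$ be a Schwartz class function and let $0<\bar\Theta_0\le\Theta\le\bar\Theta_1<\pi/2$. For $k>0$ let $u$ be the exact solution of the Helmholtz equation $\Delta u+k^2(1-x)u=0$ and let $u_{GB}$ be the first order Gaussian beam approximation, both as defined in the context, and let $x_c=\cos^2\Theta$. Then there is a constant $C$ independent of $k$ such that $$\|u_{GB}(x_c,\cdot)-u(x_c,\cdot)\|_{L^\infty(\mathbb R)}\le C\,k^{-5/6}.$$
   Context: Notation: $k>0$ is the wave number; $\xi_0=\cos\Theta$, $\eta_0=\sin\Theta$, $x_c=\xi_0^2$, $\alpha=e^{i\pi/3}$, $\bar\alpha=e^{-i\pi/3}$. The $k$-scaled Fourier transform is $\hat f(\eta)=\sqrt{\frac{k}{2\pi}}\int f(x)e^{-ikx\eta}\,dx$, with inverse $f(x)=\sqrt{\frac{k}{2\pi}}\int\hat f(\eta)e^{ikx\eta}\,d\eta$. $\mathrm{Ai}$ is the Airy function of the first kind. Exact solution. The incident wave is $u_{\rm inc}(0,y)=A(y)e^{ik\eta_0y}$. With $X(\eta)=1-(\eta_0+\eta)^2$, the exact solution $u(x,y)$ is defined, for $0\le x\le x_c$, by its $k$-scaled Fourier transform in $y$, $$\hat u(x,\eta_0+\eta)=\bar\alpha\,\frac{\mathrm{Ai}\bigl(k^{2/3}(x-X(\eta))\bigr)}{\mathrm{Ai}\bigl(\alpha k^{2/3}X(\eta)\bigr)}\,\hat A(\eta),\qquad \eta\in\mathbb R.$$ Gaussian beam approximation. Let $\beta=1+2i\xi_0$,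 $q(s)=1+2is-\beta s^2$, and $$x(s)=2s\xi_0-s^2,\quad \xi(s)=\xi_0-s,\quad S(s;z)=\eta_0z+2s-2s^2\xi_0+\tfrac23s^3,$$ $$m_{11}(s)=\frac{2i-(\xi_0+s)\beta}{2q(s)},\quad m_{22}(0)=\tfrac12\xi_0\beta,\quad a(s;z)=\frac{A(z)}{\sqrt{q(s)}}\sqrt{-i\,m_{22}(0)}.$$ Here $\sqrt{-i\,m_{22}(0)}$ is the principal square root, and $\sqrt{q(s)}$ is the square root with branch cut along $\{-t\beta: t\ge0\}$, i.e. $\sqrt{q(s)}:=\sqrt{q(s)\bar\beta}\,/\sqrt{\bar\beta}$ with principal square roots on the right (this is smooth in $s\in\mathbb R$). Then $$u_{GB}(x,y)=\sqrt{\frac{k}{2\pi}}\int_{\mathbb R}v_{\rm beam}(x,y;z)\,dz,$$ $$v_{\rm beam}(x,y;z)=a(s^*;z)\exp\Bigl[ik\Bigl(S(s^*;z)+(x-x(s^* ))\xi(s^* )+\tfrac12m_{11}(s^* )(x-x(s^* ))^2\Bigr)\Bigr],\qquad s^*=\frac{y-z}{2\eta_0}.$$ *)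

theory Defs
  imports "HOL-Probability.Essential_Supremum"
begin

section \<open>Function spaces, Fourier transform and Airy function\<close>

definition nth_deriv :: "nat \<Rightarrow> (real \<Rightarrow> complex) \<Rightarrow> real \<Rightarrow> complex" where
  "nth_deriv n f = ((\<lambda>g x. vector_derivative g (at x)) ^^ n) f"

text \<open>The Schwartz space of complex-valued functions on the real line.\<close>
definition schwartz :: "(real \<Rightarrow> complex) \<Rightarrow> bool" where
  "schwartz f \<longleftrightarrow>
     (\<forall>n x. nth_deriv n f differentiable (at x)) \<and>
     (\<forall>m n. bounded (range (\<lambda>x. x ^ m *\<^sub>R nth_deriv n f x)))"

text \<open>Since \<^const>\<open>esssup\<close> is infinite for non-measurable functions, a finite bound on this norm
  includes measurability.\<close>
definition Linfty_norm :: "(real \<Rightarrow> complex) \<Rightarrow> ereal" where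
  "Linfty_norm f = esssup lborel (\<lambda>y. ereal (cmod (f y)))"

definition kfourier :: "real \<Rightarrow> (real \<Rightarrow> complex) \<Rightarrow> real \<Rightarrow> complex" where
  "kfourier k f \<eta> =
     sqrt (k / (2 * pi)) * (LINT x|lborel. f x * exp (- \<i> * k * x * \<eta>))"

definition kfourier_inv :: "real \<Rightarrow> (real \<Rightarrow> complex) \<Rightarrow> real \<Rightarrow> complex" where
  "kfourier_inv k g x =
     sqrt (k / (2 * pi)) * (LINT \<eta>|lborel. g \<eta> * exp (\<i> * k * x * \<eta>))"

definition \<alpha> :: complex where
  "\<alpha> = exp (\<i> * pi / 3)"

text \<open>The Airy function of the first kind on the whole complex plane,
  \<open>Ai(z) = 1 / (2 \<pi> i) \<integral> exp (t\<^sup>3 / 3 - z t) dt\<close>, where the contour comes in from infinity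
  along the ray \<open>t = cnj \<alpha> * r\<close> and goes out to infinity along the ray \<open>t = \<alpha> * r\<close>
  (\<open>r \<ge> 0\<close>). Both \<open>\<alpha>\<^sup>3\<close> and \<open>(cnj \<alpha>)\<^sup>3\<close> equal \<open>-1\<close>, so the integrals over the two rays
  converge absolutely for every \<open>z\<close>.\<close>
definition Ai :: "complex \<Rightarrow> complex" where
  "Ai z = 1 / (2 * pi * \<i>) *
     ((LINT r:{0..}|lborel. \<alpha> * exp ((\<alpha> * complex_of_real r) ^ 3 / 3 - z * (\<alpha> * complex_of_real r)))
    - (LINT r:{0..}|lborel. cnj \<alpha> * exp ((cnj \<alpha> * complex_of_real r) ^ 3 / 3 - z * (cnj \<alpha> * complex_of_real r))))"

section \<open>The exact solution\<close>

definition \<xi>\<^sub>0 :: "real \<Rightarrow> real" where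
  "\<xi>\<^sub>0 \<Theta> = cos \<Theta>"

definition \<eta>\<^sub>0 :: "real \<Rightarrow> real" where
  "\<eta>\<^sub>0 \<Theta> = sin \<Theta>"

definition x_c :: "real \<Rightarrow> real" where
  "x_c \<Theta> = (\<xi>\<^sub>0 \<Theta>)\<^sup>2"

definition X_turn :: "real \<Rightarrow> real \<Rightarrow> real" where
  "X_turn \<Theta> \<eta> = 1 - (\<eta>\<^sub>0 \<Theta> + \<eta>)\<^sup>2"

text \<open>\<open>u_hat_shifted\<close> is the transform at frequency \<open>\<eta>\<^sub>0 + \<eta>\<close>, as a function of \<open>\<eta>\<close>.\<close>
definition u_hat_shifted :: "real \<Rightarrow> real \<Rightarrow> (real \<Rightarrow> complex) \<Rightarrow> real \<Rightarrow> real \<Rightarrow> complex" where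
  "u_hat_shifted k \<Theta> A x \<eta> =
     cnj \<alpha> * (Ai (complex_of_real (k powr (2/3) * (x - X_turn \<Theta> \<eta>)))
              / Ai (\<alpha> * complex_of_real (k powr (2/3) * X_turn \<Theta> \<eta>))) * kfourier k A \<eta>"

definition u_hat :: "real \<Rightarrow> real \<Rightarrow> (real \<Rightarrow> complex) \<Rightarrow> real \<Rightarrow> real \<Rightarrow> complex" where
  "u_hat k \<Theta> A x \<zeta> = u_hat_shifted k \<Theta> A x (\<zeta> - \<eta>\<^sub>0 \<Theta>)"

definition u_exact :: "real \<Rightarrow> real \<Rightarrow> (real \<Rightarrow> complex) \<Rightarrow> real \<Rightarrow> real \<Rightarrow> complex" where
  "u_exact k \<Theta> A x = kfourier_inv k (u_hat k \<Theta> A x)"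

section \<open>The Gaussian beam approximation\<close>

definition \<beta> :: "real \<Rightarrow> complex" where
  "\<beta> \<Theta> = 1 + 2 * \<i> * \<xi>\<^sub>0 \<Theta>"

definition q_beam :: "real \<Rightarrow> real \<Rightarrow> complex" where
  "q_beam \<Theta> s = 1 + 2 * \<i> * s - \<beta> \<Theta> * s\<^sup>2"

text \<open>The square root of \<open>q(s)\<close> with branch cut \<open>{-t \<beta> | t \<ge> 0}\<close>.\<close>
definition sqrt_q :: "real \<Rightarrow> real \<Rightarrow> complex" where
  "sqrt_q \<Theta> s = csqrt (q_beam \<Theta> s * cnj (\<beta> \<Theta>)) / csqrt (cnj (\<beta> \<Theta>))"

definition x_ray :: "real \<Rightarrow> real \<Rightarrow> real" where
  "x_ray \<Theta> s = 2 * s * \<xi>\<^sub>0 \<Theta> - s\<^sup>2"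

definition \<xi>_ray :: "real \<Rightarrow> real \<Rightarrow> real" where
  "\<xi>_ray \<Theta> s = \<xi>\<^sub>0 \<Theta> - s"

definition S_phase :: "real \<Rightarrow> real \<Rightarrow> real \<Rightarrow> real" where
  "S_phase \<Theta> s z = \<eta>\<^sub>0 \<Theta> * z + 2 * s - 2 * s\<^sup>2 * \<xi>\<^sub>0 \<Theta> + 2 / 3 * s ^ 3"

definition m11 :: "real \<Rightarrow> real \<Rightarrow> complex" where
  "m11 \<Theta> s = (2 * \<i> - (\<xi>\<^sub>0 \<Theta> + s) * \<beta> \<Theta>) / (2 * q_beam \<Theta> s)"

text \<open>The value of \<open>m\<^sub>2\<^sub>2\<close> at \<open>s = 0\<close>.\<close>
definition m22_0 :: "real \<Rightarrow> complex" where
  "m22_0 \<Theta> = 1 / 2 * \<xi>\<^sub>0 \<Theta> * \<beta> \<Theta>"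

definition amplitude :: "real \<Rightarrow> (real \<Rightarrow> complex) \<Rightarrow> real \<Rightarrow> real \<Rightarrow> complex" where
  "amplitude \<Theta> A s z = A z / sqrt_q \<Theta> s * csqrt (- \<i> * m22_0 \<Theta>)"

definition v_beam :: "real \<Rightarrow> real \<Rightarrow> (real \<Rightarrow> complex) \<Rightarrow> real \<Rightarrow> real \<Rightarrow> real \<Rightarrow> complex" where
  "v_beam k \<Theta> A x y z =
     (let s = (y - z) / (2 * \<eta>\<^sub>0 \<Theta>) in
      amplitude \<Theta> A s z *
      exp (\<i> * k * (S_phase \<Theta> s z + (x - x_ray \<Theta> s) * \<xi>_ray \<Theta> s
                     + 1 / 2 * m11 \<Theta> s * (x - x_ray \<Theta> s)\<^sup>2)))"

definition u_GB :: "real \<Rightarrow> real \<Rightarrow> (real \<Rightarrow> complex) \<Rightarrow> real \<Rightarrow> real \<Rightarrow> complex" where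
  "u_GB k \<Theta> A x y = sqrt (k / (2 * pi)) * (LINT z|lborel. v_beam k \<Theta> A x y z)"

end

theory Submission
  imports Defs "HOL-Probability.Probability" "HOL-Complex_Analysis.Complex_Analysis" "HOL-Real_Asymp.Real_Asymp"
begin

text \<open>
On the caustic \<open>x = x\<^sub>c\<close> both solutions reduce to the same Airy-type integral. With \<open>\<xi> = cos \<Theta>\<close>,
\<open>\<eta> = sin \<Theta>\<close> and \<open>w = y - 2 \<eta> \<xi>\<close>, this integral is
\<open>I(w) = \<integral> A(w - 2 \<eta> \<sigma>) exp (- i k \<sigma>\<^sup>3 / 3) d\<sigma>\<close>, and both \<open>u_GB(x\<^sub>c, y)\<close> and \<open>u(x\<^sub>c, y)\<close> equal an
explicit factor of size \<open>k^(1/2)\<close> times \<open>I(w)\<close>, up to an error that is uniform in \<open>y\<close>.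

The beams. Measure the ray parameter from the caustic, \<open>s = \<xi> + \<sigma>\<close>. Then \<open>x\<^sub>c - x(s) = \<sigma>\<^sup>2\<close>, the quadratic
\<open>q(s)\<close> is \<open>\<beta> p(\<sigma>)\<close> with \<open>p(\<sigma>) = \<eta>\<^sup>2 + 2 \<gamma> \<sigma> - \<sigma>\<^sup>2\<close> and \<open>Im \<gamma> > 0\<close>, and the superposition of beams becomes
the integral \<open>I(w)\<close> with the additional amplitude \<open>g = \<eta> / sqrt p\<close>, where \<open>g(0) = 1\<close>, and the additional phase
\<open>P = m \<sigma>\<^sup>4 / 2\<close>, \<open>m = m11\<close>. At the Airy scale \<open>\<sigma> \<approx> k^(-1/3)\<close> each of \<open>g - 1\<close> and \<open>k P\<close> is of relative size
\<open>k^(-1/3)\<close>, and an estimate of the two separately gives only \<open>k^(-2/3)\<close> for the integral. The two leading terms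
cancel, however: an integration by parts turns \<open>i k m \<sigma>\<^sup>4 / 2\<close> into the amplitude \<open>m \<sigma>\<close>, while
\<open>g - 1 = - 2 \<sigma> m / (1 + g)\<close> (lemma \<open>g_minus_1\<close>), whose leading term is \<open>- m \<sigma>\<close>. What remains has an amplitude
\<open>O(\<sigma>\<^sup>2)\<close>, and for such an amplitude one more integration by parts followed by a degenerate van der Corput
estimate gives \<open>k^(-4/3)\<close> (lemma \<open>oscillatory_integral_square_bound\<close>). The cancellation is used along a homotopy
from the Airy phase to the beam phase (lemma \<open>J'_bound\<close>). For large \<open>\<sigma>\<close> the phase \<open>P\<close> is comparable with
\<open>\<sigma>\<^sup>3 / 3\<close> and could create new stationary points; there \<open>P\<close> is cut off, at the price of an error
\<open>O(k^(-3/2))\<close>, because \<open>Im P\<close> is bounded below away from \<open>0\<close> (lemma \<open>cut_error_pointwise\<close>). The result is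
\<open>gaussian_beam_integral_bound\<close>; multiplied by the factor \<open>k^(1/2)\<close> it gives \<open>O(k^(-5/6))\<close>.

The exact solution. In the unscaled frequency \<open>z = k \<eta>'\<close>, where \<open>\<eta>'\<close> is the offset of the scaled frequency from
\<open>\<eta>\<close>, the solution is the Fourier integral of the transform of \<open>A\<close> against the quotient of Airy functions,
\<open>transfer k \<Theta> z\<close>. The denominator \<open>Ai (\<alpha> t)\<close>, \<open>t = k^(2/3) X\<close>, has
no real zero and is known to relative accuracy \<open>t^(-3/2)\<close>, that is \<open>k^(-1)\<close>; expanding phase and amplitude around
\<open>z = 0\<close> costs the same relative error, times a power of \<open>1 + |z|\<close> that the rapidly decreasing transform of \<open>A\<close>
absorbs. Since the quotient is of size \<open>k^(1/6)\<close>, the error is \<open>O(k^(-5/6))\<close> (lemma \<open>transfer_asymptotics\<close>), and the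
main term is exactly the common multiple of \<open>I(w)\<close>, because the Fourier transform of the Airy function is
\<open>exp (- i v\<^sup>3 / 3)\<close> (lemma \<open>fourier_times_airy\<close>).

For \<open>k \<le> 1\<close> both solutions are bounded while \<open>k^(-5/6) \<ge> 1\<close>.
\<close>

section \<open>Integration over the real line\<close>

lemma integral_FTC_symmetric_limit:
  fixes G g :: "real \<Rightarrow> complex" and X :: "nat \<Rightarrow> real"
  assumes d: "\<And>x. (G has_vector_derivative g x) (at x)"
    and i: "integrable lborel g"
    and X: "filterlim X at_top sequentially"
  shows "(\<lambda>n. G (X n) - G (- X n)) \<longlonglongrightarrow> (LINT x|lborel. g x)"
proof -
  have 1: "(\<lambda>n. LINT x|lborel. indicator {- X n..X n} x *\<^sub>R g x) \<longlonglongrightarrow> (LINT x|lborel. g x)"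
  proof (rule integral_dominated_convergence)
    show "g \<in> borel_measurable lborel" using i by auto
    show "(\<lambda>x. indicator {- X n..X n} x *\<^sub>R g x) \<in> borel_measurable lborel" for n :: nat
      using i by measurable
    show "integrable lborel (\<lambda>x. norm (g x))" using i by (rule integrable_norm)
    show "AE x in lborel. (\<lambda>n::nat. indicat_real {- X n..X n} x *\<^sub>R g x) \<longlonglongrightarrow> g x"
    proof
      fix x :: real
      have "eventually (\<lambda>n. X n \<ge> \<bar>x\<bar>) sequentially"
        using X by (simp add: filterlim_at_top)
      then have "eventually (\<lambda>n::nat. indicat_real {- X n..X n} x *\<^sub>R g x = g x) sequentially"
        by eventually_elim (auto simp: indicator_def)
      then show "(\<lambda>n::nat. indicat_real {- X n..X n} x *\<^sub>R g x) \<longlonglongrightarrow> g x"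
        by (rule tendsto_eventually)
    qed
  qed (auto simp: indicator_def)
  have 2: "(LINT x|lborel. indicator {- X n..X n} x *\<^sub>R g x) = G (X n) - G (- X n)" if "X n \<ge> 0" for n
  proof -
    have si: "set_integrable lborel {- X n..X n} g"
      unfolding set_integrable_def using i
      by (intro integrable_mult_indicator) auto
    have "(g has_integral (G (X n) - G (- X n))) {- X n..X n}"
      using that by (intro fundamental_theorem_of_calculus) (auto intro: d has_vector_derivative_at_within)
    then show ?thesis
      using set_borel_integral_eq_integral(2)[OF si] by (simp add: set_lebesgue_integral_def integral_unique)
  qed
  have "eventually (\<lambda>n. X n \<ge> 0) sequentially"
    using X by (simp add: filterlim_at_top)
  then have "eventually (\<lambda>n. (LINT x|lborel. indicator {- X n..X n} x *\<^sub>R g x) = G (X n) - G (- X n)) sequentially"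
    by eventually_elim (rule 2)
  with 1 show ?thesis by (rule Lim_transform_eventually)
qed

text \<open>
Every integration by parts over the whole line below is an application of this lemma to the product \<open>G\<close> of an amplitude and an exponential.
\<close>
lemma integral_vector_derivative_eq_0:
  fixes G g :: "real \<Rightarrow> complex"
  assumes d: "\<And>x. (G has_vector_derivative g x) (at x)"
    and i: "integrable lborel g"
    and t: "(G \<longlongrightarrow> 0) at_top" and b: "(G \<longlongrightarrow> 0) at_bot"
  shows "(LINT x|lborel. g x) = 0"
proof -
  have "(\<lambda>n::nat. G (real n) - G (- real n)) \<longlonglongrightarrow> 0 - 0"
    by (intro tendsto_diff filterlim_compose[OF t] filterlim_compose[OF b] filterlim_real_sequentially
        filterlim_compose[OF filterlim_uminus_at_bot_at_top])
  then show ?thesis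
    using LIMSEQ_unique[OF integral_FTC_symmetric_limit[OF d i filterlim_real_sequentially]] by simp
qed

lemma has_vector_derivative_at_iff_quotient:
  fixes f :: "real \<Rightarrow> 'a::real_normed_vector"
  shows "(f has_vector_derivative D) (at t) \<longleftrightarrow> ((\<lambda>s. (f s - f t) /\<^sub>R (s - t)) \<longlongrightarrow> D) (at t)"
proof -
  have *: "norm (f y - f t - (y - t) *\<^sub>R D) / norm (y - t) = norm ((f y - f t) /\<^sub>R (y - t) - D)"
    if "y \<noteq> t" for y
  proof -
    have "(f y - f t) /\<^sub>R (y - t) - D = (f y - f t - (y - t) *\<^sub>R D) /\<^sub>R (y - t)"
      using that by (simp add: scaleR_diff_right)
    then show ?thesis by (simp add: divide_inverse abs_inverse mult.commute)
  qed
  have "(f has_vector_derivative D) (at t) \<longleftrightarrow>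
      ((\<lambda>y. norm (f y - f t - (y - t) *\<^sub>R D) / norm (y - t)) \<longlongrightarrow> 0) (at t)"
    unfolding has_vector_derivative_def has_derivative_iff_norm by (simp add: bounded_linear_scaleR_left)
  also have "\<dots> \<longleftrightarrow> ((\<lambda>y. norm ((f y - f t) /\<^sub>R (y - t) - D)) \<longlongrightarrow> 0) (at t)"
    by (rule Lim_cong_within[OF refl refl refl]) (rule *)
  also have "\<dots> \<longleftrightarrow> ((\<lambda>s. (f s - f t) /\<^sub>R (s - t)) \<longlongrightarrow> D) (at t)"
    by (simp add: tendsto_norm_zero_iff LIM_zero_iff)
  finally show ?thesis .
qed

text \<open>
Differentiation under the integral sign: the dominated derivative bounds the difference quotients by the mean
value inequality, and dominated convergence applies along every sequence \<open>s\<^sub>n \<rightarrow> t\<close>.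
\<close>
lemma has_vector_derivative_integral:
  fixes f :: "real \<Rightarrow> 'a \<Rightarrow> complex"
  assumes S: "open S" "convex S" "t \<in> S"
    and d: "\<And>s x. s \<in> S \<Longrightarrow> x \<in> space M \<Longrightarrow> ((\<lambda>s. f s x) has_vector_derivative f' s x) (at s)"
    and i: "\<And>s. s \<in> S \<Longrightarrow> integrable M (f s)"
    and m': "f' t \<in> borel_measurable M"
    and bd: "\<And>s x. s \<in> S \<Longrightarrow> x \<in> space M \<Longrightarrow> norm (f' s x) \<le> w x"
    and w: "integrable M w"
  shows "((\<lambda>s. LINT x|M. f s x) has_vector_derivative (LINT x|M. f' t x)) (at t)"
proof -
  have lip: "norm (f s x - f t x) \<le> w x * \<bar>s - t\<bar>" if "s \<in> S" "x \<in> space M" for s x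
  proof -
    have "norm (f s x - f t x) \<le> w x * norm (s - t)"
    proof (rule differentiable_bound[OF S(2) _ _ that(1) S(3)])
      fix u assume "u \<in> S"
      then show "((\<lambda>s. f s x) has_derivative (\<lambda>h. h *\<^sub>R f' u x)) (at u within S)"
        using d[of u x] that(2) unfolding has_vector_derivative_def by (blast intro: has_derivative_at_withinI)
      show "onorm (\<lambda>h. h *\<^sub>R f' u x) \<le> w x"
        by (rule onorm_le) (use bd[OF \<open>u \<in> S\<close> that(2)] in \<open>auto simp: mult.commute intro: mult_left_mono\<close>)
    qed
    then show ?thesis by simp
  qed
  have "((\<lambda>s. ((LINT x|M. f s x) - (LINT x|M. f t x)) /\<^sub>R (s - t)) \<longlongrightarrow> (LINT x|M. f' t x)) (at t within S)"
    unfolding tendsto_at_iff_sequentially comp_def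
  proof (intro allI impI)
    fix X :: "nat \<Rightarrow> real" assume X: "\<forall>i. X i \<in> S - {t}" and Xt: "X \<longlonglongrightarrow> t"
    have "(\<lambda>n. LINT x|M. (f (X n) x - f t x) /\<^sub>R (X n - t)) \<longlonglongrightarrow> (LINT x|M. f' t x)"
    proof (rule integral_dominated_convergence[OF m' _ w])
      show "(\<lambda>x. (f (X n) x - f t x) /\<^sub>R (X n - t)) \<in> borel_measurable M" for n
        using X i[of "X n"] i[OF S(3)] by auto
      show "AE x in M. (\<lambda>n. (f (X n) x - f t x) /\<^sub>R (X n - t)) \<longlonglongrightarrow> f' t x"
      proof (rule AE_I2)
        fix x assume "x \<in> space M"
        have "((\<lambda>s. (f s x - f t x) /\<^sub>R (s - t)) \<longlongrightarrow> f' t x) (at t)"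
          using d[OF S(3) \<open>x \<in> space M\<close>]
          by (simp add: has_vector_derivative_at_iff_quotient)
        then show "(\<lambda>n. (f (X n) x - f t x) /\<^sub>R (X n - t)) \<longlonglongrightarrow> f' t x"
          using X Xt unfolding tendsto_at_iff_sequentially comp_def by blast
      qed
      show "AE x in M. norm ((f (X n) x - f t x) /\<^sub>R (X n - t)) \<le> w x" for n
      proof (rule AE_I2)
        fix x assume x: "x \<in> space M"
        have pos: "\<bar>X n - t\<bar> > 0" using X by simp
        have "norm ((f (X n) x - f t x) /\<^sub>R (X n - t)) = norm (f (X n) x - f t x) / \<bar>X n - t\<bar>"
          by (simp add: divide_inverse abs_inverse mult.commute)
        also have "\<dots> \<le> w x"
          using lip[of "X n" x] X x pos by (simp add: pos_divide_le_eq)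
        finally show "norm ((f (X n) x - f t x) /\<^sub>R (X n - t)) \<le> w x" .
      qed
    qed
    moreover have "(LINT x|M. (f (X n) x - f t x) /\<^sub>R (X n - t)) = ((LINT x|M. f (X n) x) - (LINT x|M. f t x)) /\<^sub>R (X n - t)" for n
      using X i[of "X n"] i[OF S(3)] by (subst integral_scaleR_right) (auto simp: integral_diff)
    ultimately show "(\<lambda>n. ((LINT x|M. f (X n) x) - (LINT x|M. f t x)) /\<^sub>R (X n - t)) \<longlonglongrightarrow> (LINT x|M. f' t x)"
      by (simp only:)
  qed
  then have "((\<lambda>s. ((LINT x|M. f s x) - (LINT x|M. f t x)) /\<^sub>R (s - t)) \<longlongrightarrow> (LINT x|M. f' t x)) (at t)"
    unfolding at_within_open[OF S(3) S(1)] .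
  then show ?thesis
    by (simp add: has_vector_derivative_at_iff_quotient)
qed

text \<open>
The exponential has derivative at most \<open>exp M\<close> on the half-plane \<open>Re z \<le> M\<close>, which is convex. This is how small
perturbations of a phase are compared with the unperturbed one without losing its decay.
\<close>
lemma cmod_exp_diff_le:
  fixes a b :: complex
  assumes "Re a \<le> M" "Re b \<le> M"
  shows "cmod (exp a - exp b) \<le> exp M * cmod (a - b)"
proof (rule field_differentiable_bound[where S="{z. Re z \<le> M}"])
  show "convex {z. Re z \<le> M}" by (simp add: convex_halfspace_Re_le)
qed (use assms in \<open>auto intro!: derivative_eq_intros\<close>)

lemma has_bochner_integral_inverse_1_plus_square:
  fixes c d :: real
  assumes "c \<noteq> 0"
  shows "has_bochner_integral lborel (\<lambda>x. 1 / (1 + (d + c * x)\<^sup>2)) (pi / \<bar>c\<bar>)"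
proof -
  have i: "integrable lborel (\<lambda>x::real. 1 / (1 + x\<^sup>2))"
    using integrable_inverse_1_plus_square by (simp add: set_integrable_def einterval_def field_simps)
  moreover have "(LINT x|lborel. 1 / (1 + x\<^sup>2)) = pi"
    using LBINT_inverse_1_plus_square
    by (simp add: interval_lebesgue_integral_def set_lebesgue_integral_def einterval_def field_simps)
  ultimately have "has_bochner_integral lborel (\<lambda>x::real. 1 / (1 + x\<^sup>2)) pi"
    by (simp add: has_bochner_integral_iff)
  then show ?thesis
    using lborel_has_bochner_integral_real_affine_iff[OF assms, of "\<lambda>x. 1 / (1 + x\<^sup>2)" pi d] by (simp add: field_simps)
qed

lemma has_bochner_integral_gaussian:
  fixes c :: real
  assumes "c > 0"
  shows "has_bochner_integral lborel (\<lambda>x. exp (- (c * x\<^sup>2))) (sqrt (pi / c))"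
proof -
  have "has_bochner_integral lborel (\<lambda>x. exp (- x\<^sup>2)) (2 *\<^sub>R (sqrt pi / 2))"
    using has_bochner_integral_even_function[OF gaussian_moment_0] by simp
  then have "has_bochner_integral lborel (\<lambda>x::real. exp (- x\<^sup>2)) (sqrt pi)" by simp
  then show ?thesis
    using lborel_has_bochner_integral_real_affine_iff[of "sqrt c" "\<lambda>x. exp (- x\<^sup>2)" "sqrt pi" 0] assms
    by (simp add: power_mult_distrib real_sqrt_divide field_simps)
qed

lemma integrable_majorized:
  fixes f :: "real \<Rightarrow> complex" and g :: "real \<Rightarrow> real"
  assumes "integrable lborel g" "f \<in> borel_measurable borel" "\<And>x. cmod (f x) \<le> g x"
  shows "integrable lborel f"
proof (rule Bochner_Integration.integrable_bound[OF assms(1)])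
  show "AE x in lborel. norm (f x) \<le> norm (g x)"
    by (rule AE_I2) (use assms(3) in \<open>auto intro: order_trans[OF _ abs_ge_self]\<close>)
qed (use assms(2) in simp)

lemma power_le_exp: "y \<ge> 0 \<Longrightarrow> y ^ n \<le> real n ^ n * exp (y::real)"
proof (cases "n = 0")
  case False
  assume y: "y \<ge> 0"
  have "y ^ n = real n ^ n * (y / real n) ^ n" using False by (simp add: power_divide)
  also have "\<dots> \<le> real n ^ n * (1 + y / real n) ^ n" using y by (intro mult_left_mono power_mono) auto
  also have "\<dots> \<le> real n ^ n * exp y" using exp_ge_one_plus_x_over_n_power_n[of n y] False y by (intro mult_left_mono) auto
  finally show ?thesis .
qed simp

lemma cmod_cis_diff: "cmod (cis a - cis b) \<le> \<bar>a - b\<bar>"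
proof -
  have "cmod (exp (\<i> * complex_of_real a) - exp (\<i> * complex_of_real b)) \<le> exp 0 * cmod (\<i> * complex_of_real a - \<i> * complex_of_real b)"
    by (rule cmod_exp_diff_le) auto
  also have "cmod (\<i> * complex_of_real a - \<i> * complex_of_real b) = \<bar>a - b\<bar>"
    by (simp flip: right_diff_distrib of_real_diff add: norm_mult)
  finally show ?thesis by (simp add: cis_conv_exp)
qed

section \<open>The Airy function as an integral over a vertical line\<close>

lemma entire_primitive:
  assumes "f holomorphic_on UNIV"
  shows "\<exists>F. \<forall>z. (F has_field_derivative f z) (at z)"
  using holomorphic_convex_primitive'[OF convex_UNIV open_UNIV assms] by (metis UNIV_I)

lemma has_vector_derivative_along_line:
  fixes F :: "complex \<Rightarrow> complex"
  assumes "\<And>z. (F has_field_derivative f z) (at z)"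
  shows "((\<lambda>r::real. F (a + of_real r * b)) has_vector_derivative b * f (a + of_real r * b)) (at r)"
proof -
  have "((\<lambda>r::real. a + of_real r * b) has_vector_derivative b) (at r)"
    by (auto intro!: derivative_eq_intros)
  from field_vector_diff_chain_at[OF this assms] show ?thesis by (simp add: o_def)
qed

lemma alpha_eq: "\<alpha> = Complex (1/2) (sqrt 3 / 2)"
  by (simp add: \<alpha>_def exp_eq_polar cis.ctr cos_60 sin_60 complex_eq_iff flip: cis_conv_exp)

lemma Re_alpha: "Re \<alpha> = 1/2" and Im_alpha: "Im \<alpha> = sqrt 3 / 2" and norm_alpha: "cmod \<alpha> = 1"
  by (simp_all add: alpha_eq complex_norm power_divide)

lemma alpha_cube: "\<alpha> ^ 3 = -1"
  by (simp add: alpha_eq complex_eq_iff power3_eq_cube algebra_simps)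

text \<open>
The cubic decay on the contour beats every linear growth by a Gaussian margin, so all integrands on the rays
have one Gaussian majorant.
\<close>
lemma cubic_minus_square_bounded_below:
  fixes c :: real
  assumes "c \<ge> 0"
  obtains K where "\<And>r. r \<ge> 0 \<Longrightarrow> - (r ^ 3 / 3) + c * r \<le> K - r\<^sup>2"
proof (rule that)
  fix r :: real assume r: "r \<ge> 0"
  \<comment> \<open>Beyond R the coefficient r / 3 of r^2 exceeds 2 + c.\<close>
  define R where "R = 6 + 3 * c"
  show "- (r ^ 3 / 3) + c * r \<le> (c * R + R\<^sup>2) - r\<^sup>2"
  proof (cases "r \<ge> R")
    case True
    then have r1: "r \<ge> 1" using assms by (simp add: R_def)
    have "(2 + c) * r\<^sup>2 \<le> r / 3 * r\<^sup>2"
      using True by (intro mult_right_mono) (auto simp: R_def)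
    moreover have "c * r \<le> c * r\<^sup>2"
      using r1 assms by (intro mult_left_mono) (auto simp: power2_eq_square)
    moreover have "r / 3 * r\<^sup>2 = r ^ 3 / 3" by (simp add: power2_eq_square power3_eq_cube)
    moreover have "c * R + R\<^sup>2 \<ge> 0" using assms by (simp add: R_def)
    moreover have "r\<^sup>2 \<ge> 0" by simp
    ultimately show ?thesis unfolding distrib_right distrib_left by linarith
  next
    case False
    then have "c * r \<le> c * R" "r\<^sup>2 \<le> R\<^sup>2" using r assms by (auto intro: mult_left_mono power_mono)
    moreover have "0 \<le> r ^ 3" using r by simp
    ultimately show ?thesis by linarith
  qed
qed

definition airy_kernel :: "complex \<Rightarrow> complex \<Rightarrow> complex" where
  "airy_kernel z t = exp (t ^ 3 / 3 - z * t)"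

lemma norm_airy_kernel_ray:
  assumes "\<omega> ^ 3 = -1" "cmod \<omega> = 1" "r \<ge> 0"
  shows "cmod (airy_kernel z (\<omega> * complex_of_real r)) \<le> exp (- (r ^ 3 / 3) + cmod z * r)"
proof -
  have "- Re (z * \<omega>) * r \<le> cmod z * r"
    using assms abs_Re_le_cmod[of "z * \<omega>"] by (intro mult_right_mono) (auto simp: norm_mult)
  then show ?thesis
    using assms by (simp add: airy_kernel_def power_mult_distrib algebra_simps flip: of_real_power)
qed

lemma integrable_airy_kernel_ray:
  assumes "\<omega> ^ 3 = -1" "cmod \<omega> = 1"
  shows "set_integrable lborel {0..} (\<lambda>r. \<omega> * airy_kernel z (\<omega> * complex_of_real r))"
proof -
  obtain K where K: "\<And>r. r \<ge> 0 \<Longrightarrow> - (r ^ 3 / 3) + cmod z * r \<le> K - r\<^sup>2"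
    using cubic_minus_square_bounded_below[of "cmod z"] by auto
  show ?thesis unfolding set_integrable_def
  proof (rule Bochner_Integration.integrable_bound)
    show "integrable lborel (\<lambda>r. exp K * exp (- (1 * r\<^sup>2)))"
      using has_bochner_integral_gaussian[of 1] by (intro integrable_mult_right) (auto simp: has_bochner_integral_iff)
    show "(\<lambda>x. indicat_real {0..} x *\<^sub>R (\<omega> * airy_kernel z (\<omega> * complex_of_real x))) \<in> borel_measurable lborel"
      unfolding airy_kernel_def by measurable
    show "AE x in lborel. norm (indicat_real {0..} x *\<^sub>R (\<omega> * airy_kernel z (\<omega> * complex_of_real x)))
                     \<le> norm (exp K * exp (- (1 * x\<^sup>2)))"
    proof (rule AE_I2)
      fix x :: real
      show "norm (indicat_real {0..} x *\<^sub>R (\<omega> * airy_kernel z (\<omega> * complex_of_real x)))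
                     \<le> norm (exp K * exp (- (1 * x\<^sup>2)))"
      proof (cases "x \<ge> 0")
        case True
        have "exp (- (x ^ 3 / 3) + cmod z * x) \<le> exp (K - x\<^sup>2)" using K[OF True] by simp
        also have "\<dots> = exp K * exp (- x\<^sup>2)" by (simp add: exp_diff exp_minus field_simps)
        finally show ?thesis
          using norm_airy_kernel_ray[OF assms True, of z] assms(2) True by (simp add: norm_mult)
      qed simp
    qed
  qed
qed

lemma Ai_eq_kernel:
  "Ai z = 1 / (2 * pi * \<i>) *
     ((LINT r:{0..}|lborel. \<alpha> * airy_kernel z (\<alpha> * complex_of_real r))
    - (LINT r:{0..}|lborel. cnj \<alpha> * airy_kernel z (cnj \<alpha> * complex_of_real r)))"
  by (simp add: Ai_def airy_kernel_def)

lemma Re_line_cube: "Re ((complex_of_real a + \<i> * complex_of_real v) ^ 3) = a ^ 3 - 3 * a * v\<^sup>2"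
  by (simp add: power3_eq_cube power2_eq_square algebra_simps)

text \<open>
On a vertical line the kernel is a Gaussian in \<open>v\<close>, whose width is set by the free parameter \<open>a\<close>; on the original rays
the integrand grows with \<open>z\<close> before it decays.
\<close>
lemma norm_airy_kernel_line:
  "cmod (airy_kernel z (complex_of_real a + \<i> * complex_of_real v))
     = exp (a ^ 3 / 3 - Re z * a + Im z * v - a * v\<^sup>2)"
proof -
  have "Re ((complex_of_real a + \<i> * complex_of_real v) ^ 3 / 3) = a ^ 3 / 3 - a * v\<^sup>2"
    using Re_line_cube[of a v] by (simp add: Re_divide_numeral)
  then show ?thesis by (simp add: airy_kernel_def)
qed

lemma integrable_airy_kernel_line:
  assumes "a > 0"
  shows "integrable lborel (\<lambda>v. airy_kernel z (complex_of_real a + \<i> * complex_of_real v))"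
proof (rule Bochner_Integration.integrable_bound)
  let ?K = "a ^ 3 / 3 - Re z * a + (Im z)\<^sup>2 / (2 * a)"
  show "integrable lborel (\<lambda>r. exp ?K * exp (- (a / 2 * r\<^sup>2)))"
    using has_bochner_integral_gaussian[of "a/2"] assms by (intro integrable_mult_right) (auto simp: has_bochner_integral_iff)
  show "(\<lambda>v. airy_kernel z (complex_of_real a + \<i> * complex_of_real v)) \<in> borel_measurable lborel"
    unfolding airy_kernel_def by measurable
  show "AE v in lborel. norm (airy_kernel z (complex_of_real a + \<i> * complex_of_real v))
           \<le> norm (exp ?K * exp (- (a / 2 * v\<^sup>2)))"
  proof (rule AE_I2)
    fix v :: real
    have "0 \<le> (Im z - a * v)\<^sup>2 / (2 * a)" using assms by simp
    also have "\<dots> = (Im z)\<^sup>2 / (2 * a) - Im z * v + a / 2 * v\<^sup>2"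
      using assms by (simp add: power2_diff field_simps power2_eq_square)
    finally have "a ^ 3 / 3 - Re z * a + Im z * v - a * v\<^sup>2 \<le> ?K - a / 2 * v\<^sup>2" by simp
    then have "exp (a ^ 3 / 3 - Re z * a + Im z * v - a * v\<^sup>2) \<le> exp (?K - a / 2 * v\<^sup>2)" by simp
    also have "\<dots> = exp ?K * exp (- (a / 2 * v\<^sup>2))" by (simp only: exp_diff exp_minus) (simp add: field_simps)
    finally show "norm (airy_kernel z (complex_of_real a + \<i> * complex_of_real v))
           \<le> norm (exp ?K * exp (- (a / 2 * v\<^sup>2)))"
      by (simp add: norm_airy_kernel_line)
  qed
qed

text \<open>
The horizontal segment that closes the contour, from the end \<open>n \<alpha>\<close> (or its conjugate) of the truncated ray to the line
\<open>Re t = a\<close>. There \<open>Re (t\<^sup>3) = x\<^sup>3 - 3 x y\<^sup>2\<close> with \<open>x \<le> n / 2\<close> and \<open>y\<^sup>2 = 3 n\<^sup>2 / 4\<close>, which is at most \<open>- 2 a n\<^sup>2\<close>.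
\<close>
lemma primitive_airy_kernel_cap:
  assumes F: "\<And>t. (F has_field_derivative airy_kernel z t) (at t)"
    and a: "a > 0" and n: "n \<ge> 2 * a" and y: "y\<^sup>2 = 3 * n\<^sup>2 / 4"
  shows "cmod (F (Complex (n/2) y) - F (Complex a y)) \<le> exp (- (2 / 3 * a * n\<^sup>2) + cmod z * n) * n"
proof -
  let ?S = "closed_segment (Complex (n/2) y) (Complex a y)"
  have B: "cmod (airy_kernel z t) \<le> exp (- (2 / 3 * a * n\<^sup>2) + cmod z * n)" if "t \<in> ?S" for t
  proof -
    from that obtain u where "0 \<le> u \<and> u \<le> 1 \<and> t = (1 - u) *\<^sub>R Complex (n/2) y + u *\<^sub>R Complex a y"
      unfolding in_segment(1) ..
    then have u: "0 \<le> u" "u \<le> 1" "t = (1 - u) *\<^sub>R Complex (n/2) y + u *\<^sub>R Complex a y" by blast+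
    define x where "x = (1 - u) * (n/2) + u * a"
    have t: "t = complex_of_real x + \<i> * complex_of_real y"
      by (subst u(3)) (simp add: complex_eq_iff x_def field_simps)
    have xa: "a \<le> x"
    proof -
      have "(1 - u) * a \<le> (1 - u) * (n/2)" using n u by (intro mult_left_mono) auto
      then show ?thesis by (simp add: x_def field_simps)
    qed
    have xn: "x \<le> n / 2"
    proof -
      have "u * a \<le> u * (n/2)" using n u by (intro mult_left_mono) auto
      then show ?thesis by (simp add: x_def field_simps)
    qed
    have x2: "x\<^sup>2 \<le> n\<^sup>2 / 4" using xa xn a power_mono[of x "n/2" 2] by (simp add: power_divide)
    have "x ^ 3 - 3 * x * y\<^sup>2 = x * (x\<^sup>2 - 3 * y\<^sup>2)"
      by (simp add: power3_eq_cube power2_eq_square algebra_simps)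
    also have "\<dots> = x * (x\<^sup>2 - 9 / 4 * n\<^sup>2)" by (simp add: y)
    also have "\<dots> \<le> x * (- 2 * n\<^sup>2)" using x2 xa a by (intro mult_left_mono) auto
    also have "\<dots> \<le> a * (- 2 * n\<^sup>2)" using xa by (intro mult_right_mono_neg) auto
    finally have 1: "Re (t ^ 3) \<le> - (2 * a * n\<^sup>2)" by (simp add: t Re_line_cube)
    have "(cmod t)\<^sup>2 \<le> n\<^sup>2" using x2 y by (simp add: t cmod_power2)
    then have "cmod t \<le> n" by (rule power2_le_imp_le) (use n a in linarith)
    then have 2: "- Re (z * t) \<le> cmod z * n"
      using abs_Re_le_cmod[of "z * t"] mult_left_mono[of "cmod t" n "cmod z"] by (simp add: norm_mult)
    have "Re (t ^ 3 / 3 - z * t) \<le> - (2 / 3 * a * n\<^sup>2) + cmod z * n"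
      using 1 2 by (simp add: Re_divide_numeral)
    then show ?thesis by (simp add: airy_kernel_def)
  qed
  have "cmod (F (Complex (n/2) y) - F (Complex a y))
      \<le> exp (- (2 / 3 * a * n\<^sup>2) + cmod z * n) * cmod (Complex (n/2) y - Complex a y)"
    by (rule field_differentiable_bound[where S="?S", OF _ _ B])
      (auto intro: has_field_derivative_at_within F)
  also have "Complex (n/2) y - Complex a y = of_real (n/2 - a)" by (simp add: complex_eq_iff)
  also have "cmod (of_real (n/2 - a)) \<le> n" unfolding norm_of_real using n a by simp
  finally show ?thesis by simp
qed

text \<open>
The kernel is entire, so it has a primitive \<open>F\<close>, and the contour is deformed by comparing differences of \<open>F\<close>: two
truncated rays, two horizontal caps and the truncated line form a closed path.
\<close>
lemma Ai_line_real:
  assumes a: "a > 0"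
  shows "Ai z = 1 / (2 * pi) * (LINT v|lborel. airy_kernel z (complex_of_real a + \<i> * complex_of_real v))"
proof -
  have "airy_kernel z holomorphic_on UNIV"
    unfolding airy_kernel_def[abs_def] by (intro holomorphic_intros) auto
  then obtain F where F: "\<And>t. (F has_field_derivative airy_kernel z t) (at t)"
    using entire_primitive by blast
  define Y where "Y n = sqrt 3 / 2 * real n" for n :: nat
  have ray: "(\<lambda>n. F (\<omega> * of_real (real n)) - F 0) \<longlonglongrightarrow> (LINT r:{0..}|lborel. \<omega> * airy_kernel z (\<omega> * complex_of_real r))"
    if w: "\<omega> ^ 3 = -1" "cmod \<omega> = 1" for \<omega>
  proof -
    have si: "set_integrable lborel {0..} (\<lambda>r. \<omega> * airy_kernel z (\<omega> * complex_of_real r))"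
      by (rule integrable_airy_kernel_ray[OF w])
    have "(\<lambda>n::nat. LINT r:{0..real n}|lborel. \<omega> * airy_kernel z (\<omega> * complex_of_real r)) \<longlonglongrightarrow>
       (LINT r:{0..}|lborel. \<omega> * airy_kernel z (\<omega> * complex_of_real r))"
      by (rule filterlim_compose[OF tendsto_set_lebesgue_integral_at_top filterlim_real_sequentially])
        (use si in auto)
    moreover have "(LINT r:{0..real n}|lborel. \<omega> * airy_kernel z (\<omega> * complex_of_real r)) = F (\<omega> * of_real (real n)) - F 0" for n
    proof -
      have "set_integrable lborel {0..real n} (\<lambda>r. \<omega> * airy_kernel z (\<omega> * complex_of_real r))"
        by (rule set_integrable_subset[OF si]) auto
      from set_borel_integral_eq_integral(2)[OF this]
      have "(LINT r:{0..real n}|lborel. \<omega> * airy_kernel z (\<omega> * complex_of_real r))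
         = integral {0..real n} (\<lambda>r. \<omega> * airy_kernel z (\<omega> * complex_of_real r))" .
      also have "((\<lambda>r. \<omega> * airy_kernel z (\<omega> * complex_of_real r)) has_integral
          (F (0 + of_real (real n) * \<omega>) - F (0 + of_real 0 * \<omega>))) {0..real n}"
        using has_vector_derivative_along_line[of F "airy_kernel z" 0 \<omega>, OF F]
        by (intro fundamental_theorem_of_calculus) (auto intro: has_vector_derivative_at_within simp: mult.commute)
      then have "integral {0..real n} (\<lambda>r. \<omega> * airy_kernel z (\<omega> * complex_of_real r)) = F (\<omega> * of_real (real n)) - F 0"
        by (intro integral_unique) (simp add: mult.commute)
      finally show ?thesis .
    qed
    ultimately show ?thesis by simp
  qed
  have cap: "(\<lambda>n. F (Complex (real n/2) (s * Y n)) - F (Complex a (s * Y n))) \<longlonglongrightarrow> 0" if s: "s = 1 \<or> s = -1" for s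
  proof (rule Lim_null_comparison)
    show "eventually (\<lambda>n. norm (F (Complex (real n/2) (s * Y n)) - F (Complex a (s * Y n)))
        \<le> exp (- (2 / 3 * a * (real n)\<^sup>2) + cmod z * real n) * real n) sequentially"
    proof (rule eventually_sequentiallyI[of "nat \<lceil>2 * a\<rceil>"])
      fix n assume "n \<ge> nat \<lceil>2 * a\<rceil>"
      then have "real n \<ge> 2 * a" by linarith
      moreover have "(s * Y n)\<^sup>2 = 3 * (real n)\<^sup>2 / 4"
        using s by (auto simp: Y_def power_mult_distrib power_divide)
      ultimately show "norm (F (Complex (real n/2) (s * Y n)) - F (Complex a (s * Y n)))
        \<le> exp (- (2 / 3 * a * (real n)\<^sup>2) + cmod z * real n) * real n"
        using primitive_airy_kernel_cap[OF F a] by blast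
    qed
    show "(\<lambda>n. exp (- (2 / 3 * a * (real n)\<^sup>2) + cmod z * real n) * real n) \<longlonglongrightarrow> 0"
      using a by real_asymp
  qed
  have line: "(\<lambda>n. F (a + of_real (Y n) * \<i>) - F (a + of_real (- Y n) * \<i>)) \<longlonglongrightarrow>
     (LINT v|lborel. \<i> * airy_kernel z (a + of_real v * \<i>))"
  proof (rule integral_FTC_symmetric_limit)
    show "((\<lambda>v. F (a + of_real v * \<i>)) has_vector_derivative \<i> * airy_kernel z (a + of_real v * \<i>)) (at v)" for v
      by (rule has_vector_derivative_along_line[OF F])
    show "integrable lborel (\<lambda>v. \<i> * airy_kernel z (a + of_real v * \<i>))"
      using integrable_airy_kernel_line[OF a, of z] by (intro integrable_mult_right) (simp add: mult.commute)
    show "filterlim Y at_top sequentially" unfolding Y_def by real_asymp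
  qed
  have 1: "\<alpha> * of_real (real n) = Complex (real n/2) (1 * Y n)" for n
    by (simp add: complex_eq_iff Re_alpha Im_alpha Y_def)
  have 2: "cnj \<alpha> * of_real (real n) = Complex (real n/2) (-1 * Y n)" for n
    by (simp add: complex_eq_iff Re_alpha Im_alpha Y_def)
  have 3: "complex_of_real a + of_real (Y n) * \<i> = Complex a (1 * Y n)" for n by (simp add: complex_eq_iff)
  have 4: "complex_of_real a + of_real (- Y n) * \<i> = Complex a (-1 * Y n)" for n by (simp add: complex_eq_iff)
  have ca: "cnj \<alpha> ^ 3 = -1" using alpha_cube by (metis complex_cnj_minus complex_cnj_one complex_cnj_power)
  let ?R1 = "LINT r:{0..}|lborel. \<alpha> * airy_kernel z (\<alpha> * complex_of_real r)"
  let ?R2 = "LINT r:{0..}|lborel. cnj \<alpha> * airy_kernel z (cnj \<alpha> * complex_of_real r)"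
  have "(\<lambda>n. ((F (\<alpha> * of_real (real n)) - F 0) - (F (cnj \<alpha> * of_real (real n)) - F 0))
     - (F (Complex (real n/2) (1 * Y n)) - F (Complex a (1 * Y n)))
     + (F (Complex (real n/2) (-1 * Y n)) - F (Complex a (-1 * Y n)))) \<longlonglongrightarrow> ?R1 - ?R2 - 0 + 0"
    by (intro tendsto_diff tendsto_add ray cap) (auto simp: alpha_cube norm_alpha ca)
  then have "(\<lambda>n. F (a + of_real (Y n) * \<i>) - F (a + of_real (- Y n) * \<i>)) \<longlonglongrightarrow> ?R1 - ?R2"
    unfolding 1 2 3 4 by (simp add: algebra_simps)
  with line have "?R1 - ?R2 = (LINT v|lborel. \<i> * airy_kernel z (a + of_real v * \<i>))"
    by (rule LIMSEQ_unique[symmetric])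
  also have "\<dots> = \<i> * (LINT v|lborel. airy_kernel z (a + \<i> * of_real v))"
    by (simp add: mult.commute)
  finally show ?thesis
    unfolding Ai_eq_kernel by (simp add: field_simps)
qed

lemma Ai_line:
  assumes a: "Re a > 0"
  shows "Ai z = 1 / (2 * pi) * (LINT v|lborel. airy_kernel z (a + \<i> * complex_of_real v))"
proof -
  have "(LINT v|lborel. airy_kernel z (complex_of_real (Re a) + \<i> * complex_of_real v)) =
     (LINT v|lborel. airy_kernel z (complex_of_real (Re a) + \<i> * complex_of_real (Im a + 1 * v)))"
    by (subst lborel_integral_real_affine[where c=1 and t="Im a"]) auto
  also have "(\<lambda>v. complex_of_real (Re a) + \<i> * complex_of_real (Im a + 1 * v)) = (\<lambda>v. a + \<i> * complex_of_real v)"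
    by (auto simp: fun_eq_iff complex_eq_iff)
  then have "(LINT v|lborel. airy_kernel z (complex_of_real (Re a) + \<i> * complex_of_real (Im a + 1 * v)))
     = (LINT v|lborel. airy_kernel z (a + \<i> * complex_of_real v))" by (metis (mono_tags, lifting))
  finally show ?thesis using Ai_line_real[OF a, of z] by simp
qed

section \<open>Bounds for the Airy function on the real line\<close>

lemma norm_Ai_real_le:
  assumes a: "a > 0"
  shows "cmod (Ai (complex_of_real s)) \<le> exp (a ^ 3 / 3 - s * a) * sqrt (pi / a) / (2 * pi)"
proof -
  have "norm (LINT v|lborel. airy_kernel s (complex_of_real a + \<i> * complex_of_real v))
     \<le> (LINT v|lborel. norm (airy_kernel s (complex_of_real a + \<i> * complex_of_real v)))"
    by (rule integral_norm_bound)
  also have "\<dots> = (LINT v|lborel. exp (a ^ 3 / 3 - s * a) * exp (- (a * v\<^sup>2)))"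
    by (simp add: norm_airy_kernel_line flip: exp_add)
  also have "\<dots> = exp (a ^ 3 / 3 - s * a) * sqrt (pi / a)"
    using has_bochner_integral_gaussian[OF a] by (simp add: has_bochner_integral_iff)
  finally show ?thesis
    using a by (subst Ai_line_real[OF a]) (simp add: norm_divide divide_right_mono)
qed

text \<open>
The line \<open>Re t = 1\<close>. The true decay is faster, but only \<open>exp (- s)\<close> is needed to keep regularised integrals bounded.
\<close>
lemma Ai_real_exp_decay:
  obtains C where "C > 0" "\<And>s::real. cmod (Ai s) \<le> C * exp (- s)"
proof
  show "exp (1/3) * sqrt pi / (2 * pi) > 0" by simp
  show "cmod (Ai s) \<le> exp (1/3) * sqrt pi / (2 * pi) * exp (- s)" for s :: real
  proof -
    have "exp (1 ^ 3 / 3 - s * 1) = exp (1/3) * exp (- s)" by (simp flip: exp_add)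
    then show ?thesis using norm_Ai_real_le[of 1 s] by (simp only: div_by_1 zero_less_one mult_ac times_divide_eq_left times_divide_eq_right)
  qed
qed

text \<open>
The line \<open>Re t = a\<close> costs \<open>exp (- s a)\<close>, which is bounded for \<open>a = 1 / (1 + |s|)\<close>; the price is the width
\<open>a^(-1/2)\<close> of the Gaussian.
\<close>
lemma Ai_real_linear_growth:
  obtains C where "C > 0" "\<And>s::real. cmod (Ai s) \<le> C * (1 + \<bar>s\<bar>)"
proof
  show "exp (4/3) * sqrt pi / (2 * pi) > 0" by simp
  fix s :: real
  define a where "a = 1 / (1 + \<bar>s\<bar>)"
  have a: "a > 0" "a \<le> 1" by (auto simp: a_def)
  have 1: "a ^ 3 \<le> 1" using a by (simp add: power_le_one)
  have 2: "- s * a \<le> 1"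
    using mult_right_mono[of "- s" "1 + \<bar>s\<bar>" a] a by (simp add: a_def)
  have 3: "sqrt (pi / a) \<le> sqrt pi * (1 + \<bar>s\<bar>)"
  proof -
    have "sqrt (pi / a) = sqrt pi * sqrt (1 + \<bar>s\<bar>)" by (simp add: a_def real_sqrt_mult)
    also have "sqrt (1 + \<bar>s\<bar>) \<le> 1 + \<bar>s\<bar>" by (rule real_le_lsqrt) (auto simp: power2_eq_square algebra_simps)
    finally show ?thesis by simp
  qed
  have "cmod (Ai s) \<le> exp (a ^ 3 / 3 - s * a) * sqrt (pi / a) / (2 * pi)"
    by (rule norm_Ai_real_le[OF a(1)])
  also have "\<dots> \<le> exp (4/3) * (sqrt pi * (1 + \<bar>s\<bar>)) / (2 * pi)"
    using 1 2 3 a by (intro divide_right_mono mult_mono) auto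
  finally show "cmod (Ai s) \<le> exp (4/3) * sqrt pi / (2 * pi) * (1 + \<bar>s\<bar>)" by simp
qed

text \<open>
The same choice of the line, now with \<open>a = 1 / (1 + |s| + |h|)\<close>, so that \<open>exp (- s' a)\<close> is bounded for both arguments
\<open>s\<close> and \<open>s + h\<close>. The factor \<open>t\<close> that a change of \<open>s\<close> produces is absorbed by half of the Gaussian.
\<close>
lemma Ai_real_lipschitz:
  obtains C where "C > 0" "\<And>s h::real. cmod (Ai (complex_of_real (s + h)) - Ai (complex_of_real s)) \<le> C * \<bar>h\<bar> * (1 + \<bar>s\<bar> + \<bar>h\<bar>)\<^sup>2"
proof
  let ?C = "3 * exp (4/3) * sqrt (2 * pi) / (2 * pi)"
  show "?C > 0" by simp
  fix s h :: real
  define L where "L = 1 + \<bar>s\<bar> + \<bar>h\<bar>"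
  define a where "a = 1 / L"
  have L: "L \<ge> 1" by (auto simp: L_def)
  have a: "a > 0" "a \<le> 1" using L by (auto simp: a_def)
  let ?t = "\<lambda>v. complex_of_real a + \<i> * complex_of_real v"
  let ?k = "\<lambda>s v. airy_kernel (complex_of_real s) (?t v)"
  have pt: "cmod (?k (s + h) v - ?k s v) \<le> 3 * exp (4/3) * \<bar>h\<bar> * L * exp (- (a / 2 * v\<^sup>2))" for v
  proof -
    have re: "Re (?t v ^ 3 / 3 - complex_of_real s' * ?t v) \<le> 4/3 - a * v\<^sup>2" if "\<bar>s'\<bar> \<le> L" for s'
    proof -
      have "a ^ 3 \<le> 1" using a by (simp add: power_le_one)
      moreover have "\<bar>s' * a\<bar> \<le> 1"
        using mult_right_mono[OF that, of a] a L by (simp add: abs_mult) (simp add: a_def)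
      ultimately show ?thesis
        using Re_line_cube[of a v] unfolding abs_le_iff by (simp add: Re_divide_numeral diff_divide_distrib)
    qed
    have "cmod (?k (s + h) v - ?k s v) \<le> exp (4/3 - a * v\<^sup>2)
        * cmod ((?t v ^ 3 / 3 - complex_of_real (s + h) * ?t v) - (?t v ^ 3 / 3 - complex_of_real s * ?t v))"
      unfolding airy_kernel_def by (intro cmod_exp_diff_le re) (auto simp: L_def)
    also have "(?t v ^ 3 / 3 - complex_of_real (s + h) * ?t v) - (?t v ^ 3 / 3 - complex_of_real s * ?t v)
       = - (complex_of_real h * ?t v)" by (simp add: algebra_simps)
    also have "cmod (- (complex_of_real h * ?t v)) \<le> \<bar>h\<bar> * (3 * L * exp (a / 2 * v\<^sup>2))"
    proof -
      have "cmod (?t v) \<le> a + \<bar>v\<bar>"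
        using norm_triangle_ineq[of "complex_of_real a" "\<i> * complex_of_real v"] a by (simp add: norm_mult)
      also have "\<dots> \<le> 3 * L * exp (a / 2 * v\<^sup>2)"
      proof -
        have e: "1 + (a * v\<^sup>2) / 2 \<le> exp (a / 2 * v\<^sup>2)" using exp_ge_add_one_self[of "a / 2 * v\<^sup>2"] by simp
        have "0 \<le> (a * \<bar>v\<bar> - 1)\<^sup>2" by simp
        then have "a * \<bar>v\<bar> * 2 \<le> 1 + a * a * v\<^sup>2"
          by (simp add: power2_diff power2_eq_square algebra_simps abs_mult_self_eq)
        also have "a * a * v\<^sup>2 \<le> 1 * a * v\<^sup>2" using a by (intro mult_right_mono) auto
        finally have "2 * (a * \<bar>v\<bar>) \<le> 1 + a * v\<^sup>2" by (simp add: mult_ac)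
        moreover have "0 \<le> a * v\<^sup>2" using a by simp
        ultimately have "a * \<bar>v\<bar> \<le> 2 * exp (a / 2 * v\<^sup>2)" using e by linarith
        then have v: "\<bar>v\<bar> \<le> 2 * L * exp (a / 2 * v\<^sup>2)" using L by (simp add: a_def field_simps)
        have "0 \<le> a / 2 * v\<^sup>2" using a by simp
        then have "1 * 1 \<le> L * exp (a / 2 * v\<^sup>2)" using L by (intro mult_mono) auto
        with v a show ?thesis by linarith
      qed
      finally show ?thesis by (auto simp: norm_mult intro: mult_left_mono)
    qed
    also have "exp (4/3 - a * v\<^sup>2) * (\<bar>h\<bar> * (3 * L * exp (a / 2 * v\<^sup>2)))
        = 3 * exp (4/3) * \<bar>h\<bar> * L * (exp (a / 2 * v\<^sup>2) * exp (- (a * v\<^sup>2)))"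
    proof -
      have "exp (4/3 - a * v\<^sup>2) = exp (4/3) * exp (- (a * v\<^sup>2))" by (simp flip: exp_add)
      then show ?thesis by (simp only: mult_ac)
    qed
    also have "exp (a / 2 * v\<^sup>2) * exp (- (a * v\<^sup>2)) = exp (- (a / 2 * v\<^sup>2))"
      by (simp flip: exp_add add: field_simps)
    finally show ?thesis by (simp add: mult_left_mono)
  qed
  have int: "integrable lborel (?k s)" for s by (rule integrable_airy_kernel_line[OF a(1)])
  have "norm (LINT v|lborel. ?k (s + h) v - ?k s v) \<le> (LINT v|lborel. 3 * exp (4/3) * \<bar>h\<bar> * L * exp (- (a / 2 * v\<^sup>2)))"
  proof (rule Bochner_Integration.integral_norm_bound_integral)
    show "integrable lborel (\<lambda>v. 3 * exp (4/3) * \<bar>h\<bar> * L * exp (- (a / 2 * v\<^sup>2)))"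
      using has_bochner_integral_gaussian[of "a/2"] a by (intro integrable_mult_right) (auto simp: has_bochner_integral_iff)
  qed (intro Bochner_Integration.integrable_diff int, rule pt)
  also have "\<dots> = 3 * exp (4/3) * \<bar>h\<bar> * L * sqrt (pi / (a / 2))"
    using has_bochner_integral_gaussian[of "a/2"] a by (simp add: has_bochner_integral_iff)
  also have "sqrt (pi / (a / 2)) \<le> sqrt (2 * pi) * L"
  proof -
    have "sqrt (pi / (a / 2)) = sqrt (2 * pi) * sqrt L" by (simp add: a_def real_sqrt_mult field_simps)
    also have "sqrt L \<le> L" using L by (intro real_le_lsqrt) (auto simp: power2_eq_square)
    finally show ?thesis by simp
  qed
  finally have "norm (LINT v|lborel. ?k (s + h) v - ?k s v) \<le> 3 * exp (4/3) * \<bar>h\<bar> * L * (sqrt (2 * pi) * L)"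
    using L by (simp add: mult_left_mono)
  moreover have "Ai (complex_of_real (s + h)) - Ai (complex_of_real s) = (LINT v|lborel. ?k (s + h) v - ?k s v) / (2 * pi)"
    unfolding Ai_line_real[OF a(1)]
    by (subst Bochner_Integration.integral_diff[OF int int]) (simp add: diff_divide_distrib)
  ultimately have "cmod (Ai (complex_of_real (s + h)) - Ai (complex_of_real s))
      \<le> (3 * exp (4/3) * \<bar>h\<bar> * L * (sqrt (2 * pi) * L)) / (2 * pi)"
    by (simp only: norm_divide) (simp add: divide_right_mono)
  then show "cmod (Ai (complex_of_real (s + h)) - Ai (complex_of_real s)) \<le> ?C * \<bar>h\<bar> * (1 + \<bar>s\<bar> + \<bar>h\<bar>)\<^sup>2"
    by (simp add: L_def power2_eq_square mult_ac)
qed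

lemma continuous_on_Ai_real: "continuous_on UNIV (\<lambda>s::real. Ai s)"
proof -
  obtain C where C: "C > 0" "\<And>s h::real. cmod (Ai (complex_of_real (s + h)) - Ai (complex_of_real s)) \<le> C * \<bar>h\<bar> * (1 + \<bar>s\<bar> + \<bar>h\<bar>)\<^sup>2"
    using Ai_real_lipschitz by blast
  have "((\<lambda>h. Ai (complex_of_real (s + h))) \<longlongrightarrow> Ai (complex_of_real s)) (at 0)" for s :: real
  proof (rule LIM_zero_cancel, rule Lim_null_comparison)
    show "eventually (\<lambda>h. norm (Ai (complex_of_real (s + h)) - Ai (complex_of_real s)) \<le> C * \<bar>h\<bar> * (1 + \<bar>s\<bar> + \<bar>h\<bar>)\<^sup>2) (at 0)"
      using C by (intro always_eventually) auto
    show "((\<lambda>h. C * \<bar>h\<bar> * (1 + \<bar>s\<bar> + \<bar>h\<bar>)\<^sup>2) \<longlongrightarrow> 0) (at 0)"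
      by (auto intro!: tendsto_eq_intros)
  qed
  then show ?thesis
    by (auto simp: continuous_on_eq_continuous_at isCont_iff)
qed

section \<open>Saddle-point asymptotics of \<open>Ai (\<alpha> t)\<close>\<close>

text \<open>
The line of integration is rotated by the angle \<open>\<pi> / 12\<close>; on the segment joining the end points
\<open>n\<close> and \<open>n cis (\<pi> / 12)\<close> the real part of \<open>z\<^sup>2\<close> stays at least \<open>cos (\<pi> / 6) n\<^sup>2\<close>, so the connecting
integrals vanish in the limit.
\<close>
lemma gaussian_rotated:
  "(LINT v|lborel. exp (- (cis (pi/6) * (complex_of_real v)\<^sup>2))) = sqrt pi * cis (- (pi/12))"
proof -
  define \<omega> where "\<omega> = cis (pi/12)"
  have w2: "\<omega>\<^sup>2 = cis (pi/6)" by (simp add: \<omega>_def Complex.DeMoivre)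
  have "(\<lambda>z. exp (- (z\<^sup>2)) :: complex) holomorphic_on UNIV" by (intro holomorphic_intros)
  then obtain F :: "complex \<Rightarrow> complex" where F: "\<And>z. (F has_field_derivative exp (- (z\<^sup>2))) (at z)"
    using entire_primitive by blast
  have c6: "cos (pi/6) = sqrt 3 / 2" by (simp add: cos_30)
  have sq: "(cos (pi/12))\<^sup>2 - (sin (pi/12))\<^sup>2 = sqrt 3 / 2"
    using cos_double[of "pi/12"] c6 by simp
  have cs: "0 \<le> sin (pi/12)" "0 \<le> cos (pi/12)" by (auto intro!: sin_ge_zero cos_ge_zero)
  have cap: "(\<lambda>n. F (of_real (s * real n) * \<omega>) - F (of_real (s * real n))) \<longlonglongrightarrow> 0" if s: "s = 1 \<or> s = -1" for s
  proof (rule Lim_null_comparison)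
    show "(\<lambda>n. exp (- (sqrt 3 / 2 * (real n)\<^sup>2)) * (2 * real n)) \<longlonglongrightarrow> 0" by real_asymp
    show "eventually (\<lambda>n. norm (F (of_real (s * real n) * \<omega>) - F (of_real (s * real n)))
          \<le> exp (- (sqrt 3 / 2 * (real n)\<^sup>2)) * (2 * real n)) sequentially"
    proof (rule always_eventually, rule allI)
      fix n :: nat
      let ?S = "closed_segment (of_real (s * real n) * \<omega>) (of_real (s * real n))"
      have "cmod (exp (- (z\<^sup>2))) \<le> exp (- (sqrt 3 / 2 * (real n)\<^sup>2))" if "z \<in> ?S" for z
      proof -
        from that obtain u where "0 \<le> u \<and> u \<le> 1 \<and> z = (1 - u) *\<^sub>R (of_real (s * real n) * \<omega>) + u *\<^sub>R of_real (s * real n)"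
          unfolding in_segment(1) ..
        then have u: "0 \<le> u" "u \<le> 1" and z: "z = (1 - u) *\<^sub>R (of_real (s * real n) * \<omega>) + u *\<^sub>R of_real (s * real n)" by blast+
        define c where "c = (1 - u) * cos (pi/12) + u"
        define d where "d = (1 - u) * sin (pi/12)"
        have "z = of_real (s * real n) * Complex c d"
          by (subst z) (simp add: complex_eq_iff \<omega>_def c_def d_def scaleR_conv_of_real algebra_simps)
        then have re: "Re (z\<^sup>2) = (real n)\<^sup>2 * (c\<^sup>2 - d\<^sup>2)"
          using s by (auto simp: power2_eq_square algebra_simps)
        have "(1 - u) * cos (pi/12) + u * cos (pi/12) \<le> c" unfolding c_def using u
          by (intro add_left_mono mult_left_le) auto
        then have "cos (pi/12) \<le> c" by (simp add: algebra_simps)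
        then have "(cos (pi/12))\<^sup>2 \<le> c\<^sup>2" using cs by (intro power_mono) auto
        moreover have "d\<^sup>2 \<le> (sin (pi/12))\<^sup>2" using u cs by (intro power_mono) (auto simp: d_def mult_left_le_one_le)
        ultimately have "sqrt 3 / 2 \<le> c\<^sup>2 - d\<^sup>2" using sq by linarith
        then have "(real n)\<^sup>2 * (sqrt 3 / 2) \<le> (real n)\<^sup>2 * (c\<^sup>2 - d\<^sup>2)" by (intro mult_left_mono) auto
        then show ?thesis by (simp add: re mult.commute)
      qed
      then have "norm (F (of_real (s * real n) * \<omega>) - F (of_real (s * real n)))
          \<le> exp (- (sqrt 3 / 2 * (real n)\<^sup>2)) * cmod (of_real (s * real n) * \<omega> - of_real (s * real n))"
        by (intro field_differentiable_bound[where S="?S" and f'="\<lambda>z. exp (- (z\<^sup>2))"])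
          (auto intro: has_field_derivative_at_within F)
      also have "cmod (of_real (s * real n) * \<omega> - of_real (s * real n)) \<le> cmod (of_real (s * real n) * \<omega>) + cmod (of_real (s * real n))"
        by (rule norm_triangle_ineq4)
      also have "\<dots> = 2 * real n" using s by (auto simp: norm_mult \<omega>_def)
      finally show "norm (F (of_real (s * real n) * \<omega>) - F (of_real (s * real n)))
          \<le> exp (- (sqrt 3 / 2 * (real n)\<^sup>2)) * (2 * real n)" by simp
    qed
  qed
  have g1: "integrable lborel (\<lambda>v. \<omega> * exp (- (cis (pi/6) * (complex_of_real v)\<^sup>2)))"
  proof (rule integrable_mult_right, rule Bochner_Integration.integrable_bound)
    show "integrable lborel (\<lambda>v. exp (- (cos (pi/6) * v\<^sup>2)))"
      using has_bochner_integral_gaussian[of "cos (pi/6)"] by (simp add: c6 has_bochner_integral_iff)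
  qed (auto simp flip: of_real_power)
  have L1: "(\<lambda>n. F (0 + of_real (real n) * \<omega>) - F (0 + of_real (- real n) * \<omega>)) \<longlonglongrightarrow>
     (LINT v|lborel. \<omega> * exp (- (cis (pi/6) * (complex_of_real v)\<^sup>2)))"
  proof (rule integral_FTC_symmetric_limit[OF _ g1 filterlim_real_sequentially])
    show "((\<lambda>v. F (0 + of_real v * \<omega>)) has_vector_derivative \<omega> * exp (- (cis (pi/6) * (complex_of_real v)\<^sup>2))) (at v)" for v
      using has_vector_derivative_along_line[OF F, of 0 \<omega> v] by (simp add: power_mult_distrib w2 mult.commute)
  qed
  have L2: "(\<lambda>n. F (0 + of_real (real n) * 1) - F (0 + of_real (- real n) * 1)) \<longlonglongrightarrow>
     (LINT v|lborel. complex_of_real (exp (- (1 * v\<^sup>2))))"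
  proof (rule integral_FTC_symmetric_limit[OF _ _ filterlim_real_sequentially])
    show "integrable lborel (\<lambda>v. complex_of_real (exp (- (1 * v\<^sup>2))))"
      using has_bochner_integral_gaussian[of 1] by (simp add: has_bochner_integral_iff)
    show "((\<lambda>v. F (0 + of_real v * 1)) has_vector_derivative complex_of_real (exp (- (1 * v\<^sup>2)))) (at v)" for v
      using has_vector_derivative_along_line[OF F, of 0 1 v] by (simp add: exp_of_real[symmetric])
  qed
  have L3: "(\<lambda>n. (F (0 + of_real (real n) * \<omega>) - F (0 + of_real (- real n) * \<omega>)) -
      (F (0 + of_real (real n) * 1) - F (0 + of_real (- real n) * 1))) \<longlonglongrightarrow> 0 - 0"
    using tendsto_diff[OF cap[of 1] cap[of "-1"]] by (simp add: algebra_simps)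
  have "(LINT v|lborel. \<omega> * exp (- (cis (pi/6) * (complex_of_real v)\<^sup>2))) - (LINT v|lborel. complex_of_real (exp (- (1 * v\<^sup>2)))) = 0"
    using LIMSEQ_unique[OF tendsto_diff[OF L1 L2] L3] by (simp only: diff_zero)
  then have "\<omega> * (LINT v|lborel. exp (- (cis (pi/6) * (complex_of_real v)\<^sup>2))) = sqrt pi"
    using has_bochner_integral_gaussian[of 1] by (simp add: has_bochner_integral_iff)
  then have "cis (- (pi/12)) * \<omega> * (LINT v|lborel. exp (- (cis (pi/6) * (complex_of_real v)\<^sup>2))) = sqrt pi * cis (- (pi/12))"
    by simp
  then show ?thesis by (simp add: \<omega>_def cis_mult)
qed

text \<open>
The leading term of \<open>Ai (\<alpha> t)\<close> as \<open>t \<rightarrow> \<infinity>\<close>.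
\<close>
definition airy_osc :: "real \<Rightarrow> complex" where
  "airy_osc t = exp (- (2/3 * \<i> * complex_of_real (t powr (3/2)))) / (2 * sqrt pi * cis (pi/12) * complex_of_real (t powr (1/4)))"

text \<open>
The vertical line is placed through the saddle point \<open>\<rho>\<close>, \<open>\<rho>\<^sup>2 = \<alpha> t\<close>. The exponent is a cubic polynomial, so
its expansion at \<open>\<rho>\<close> stops: \<open>- 2/3 \<rho>\<^sup>3 - \<rho> v\<^sup>2 - i v\<^sup>3 / 3\<close>. Only the even part of \<open>exp (- i v\<^sup>3 / 3)\<close> contributes, and
\<open>|cos (v\<^sup>3 / 3) - 1| = O(v\<^sup>6)\<close> against a Gaussian of width \<open>t^(-1/4)\<close> is a relative error \<open>t^(-3/2)\<close>. Without the
cancellation of the odd part the argument would give \<open>t^(-3/4)\<close> only.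
\<close>
lemma Ai_alpha_asymptotics:
  obtains C where "C > 0" "\<And>t::real. t > 0 \<Longrightarrow> cmod (Ai (\<alpha> * complex_of_real t) - airy_osc t) \<le> C * t powr (-7/4)"
proof
  \<comment> \<open>The 216 comes from y^3 <= 27 exp y at y = c v^2 / 2, the 18 from (v^3 / 3)^2 / 2.\<close>
  let ?K = "(216/18) * (2 / sqrt 3) ^ 3 * sqrt (4 * pi / sqrt 3) / (2 * pi)"
  show "?K > 0" by simp
  fix t :: real assume t: "t > 0"
  define \<rho> where "\<rho> = cis (pi/6) * complex_of_real (sqrt t)"
  define c where "c = sqrt 3 / 2 * sqrt t"
  have c: "c > 0" using t by (simp add: c_def)
  have re: "Re \<rho> = c" by (simp add: \<rho>_def c_def cos_30)
  have r2: "\<rho>\<^sup>2 = \<alpha> * complex_of_real t"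
    using t by (simp add: \<rho>_def power_mult_distrib Complex.DeMoivre alpha_eq complex_eq_iff cos_60 sin_60 flip: of_real_power)
  have t32: "t powr (3/2) = t * sqrt t"
    using t powr_add[of t 1 "1/2"] by (simp add: powr_half_sqrt)
  have r3: "\<rho> ^ 3 = \<i> * complex_of_real (t powr (3/2))"
  proof -
    have "\<rho> ^ 3 = cis (pi/6) ^ 3 * (complex_of_real (sqrt t)) ^ 3" by (simp add: \<rho>_def power_mult_distrib)
    also have "cis (pi/6) ^ 3 = \<i>" by (simp add: Complex.DeMoivre complex_eq_iff)
    also have "sqrt t ^ 3 = t * sqrt t" using t by (simp add: power3_eq_cube)
    then have "(complex_of_real (sqrt t)) ^ 3 = complex_of_real (t powr (3/2))" by (metis of_real_power t32)
    finally show ?thesis .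
  qed
  let ?E = "exp (- (2/3 * \<i> * complex_of_real (t powr (3/2))))"
  let ?g = "\<lambda>v. exp (- (\<rho> * (complex_of_real v)\<^sup>2))"
  let ?f = "\<lambda>v. ?g v * exp (- (\<i> * complex_of_real (v ^ 3 / 3)))"
  have kern: "airy_kernel (\<alpha> * complex_of_real t) (\<rho> + \<i> * complex_of_real v) = ?E * ?f v" for v
  proof -
    have "(\<rho> + \<i> * complex_of_real v) ^ 3 / 3 - \<rho>\<^sup>2 * (\<rho> + \<i> * complex_of_real v)
       = - (2/3 * \<rho> ^ 3) + (- (\<rho> * (complex_of_real v)\<^sup>2) + - (\<i> * complex_of_real (v ^ 3 / 3)))"
      by (simp add: power2_eq_square power3_eq_cube algebra_simps) (simp add: field_simps)
    then show ?thesis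
      unfolding airy_kernel_def r2[symmetric] by (simp only: exp_add r3 mult.assoc)
  qed
  have gb: "cmod (?g v) = exp (- (c * v\<^sup>2))" for v by (simp add: re flip: of_real_power)
  have gint: "integrable lborel ?g"
    by (rule Bochner_Integration.integrable_bound[where f="\<lambda>v. exp (- (c * v\<^sup>2))"])
      (use has_bochner_integral_gaussian[OF c] in \<open>auto simp: has_bochner_integral_iff gb re\<close>)
  have fint: "integrable lborel ?f"
    by (rule Bochner_Integration.integrable_bound[where f="\<lambda>v. exp (- (c * v\<^sup>2))"])
      (use has_bochner_integral_gaussian[OF c] in \<open>auto simp: has_bochner_integral_iff norm_mult gb re\<close>)
  have fint': "integrable lborel (\<lambda>v. ?f (- v))"
    using lborel_integrable_real_affine[OF fint, of "-1" 0] by simp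
  have "(LINT v|lborel. ?f v) = (LINT v|lborel. ?f (- v))"
    by (subst lborel_integral_real_affine[where c="-1" and t=0]) auto
  then have "2 * (LINT v|lborel. ?f v) = (LINT v|lborel. ?f v + ?f (- v))"
    by (subst Bochner_Integration.integral_add[OF fint fint']) simp
  \<comment> \<open>Symmetrisation in v removes the odd part of the cubic factor.\<close>
  then have sym: "2 * ((LINT v|lborel. ?f v) - (LINT v|lborel. ?g v)) = (LINT v|lborel. ?f v + ?f (- v) - 2 * ?g v)"
    by (subst Bochner_Integration.integral_diff) (use fint fint' gint in \<open>auto simp: algebra_simps\<close>)
  have pt: "cmod (?f v + ?f (- v) - 2 * ?g v) \<le> 2 * (216/18) / c ^ 3 * exp (- (c / 2 * v\<^sup>2))" for v
  proof -
    let ?x = "v ^ 3 / 3"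
    have e: "exp (- (\<i> * complex_of_real x)) + exp (\<i> * complex_of_real x) = complex_of_real (2 * cos x)" for x
      using cis_conv_exp[of x] cis_conv_exp[of "- x"] by (simp add: complex_eq_iff)
    have "?f v + ?f (- v) - 2 * ?g v
        = ?g v * (exp (- (\<i> * complex_of_real ?x)) + exp (\<i> * complex_of_real ?x)) - 2 * ?g v"
      by (simp add: algebra_simps)
    also have "\<dots> = ?g v * complex_of_real (2 * (cos ?x - 1))"
      unfolding e by (simp add: algebra_simps)
    finally have "cmod (?f v + ?f (- v) - 2 * ?g v) = cmod (?g v) * cmod (complex_of_real (2 * (cos ?x - 1)))"
      by (simp only: norm_mult)
    also have "\<dots> = exp (- (c * v\<^sup>2)) * (2 * \<bar>cos ?x - 1\<bar>)"
      unfolding gb norm_of_real by (simp add: abs_mult)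
    also have "\<bar>cos ?x - 1\<bar> \<le> ?x\<^sup>2 / 2"
    proof -
      have "1 - cos ?x = 2 * (sin (?x / 2))\<^sup>2" using cos_double_sin[of "?x/2"] by simp
      moreover have "(sin (?x / 2))\<^sup>2 \<le> (?x / 2)\<^sup>2"
        using abs_sin_x_le_abs_x[of "?x/2"] abs_le_square_iff by blast
      ultimately show ?thesis by (simp add: power_divide field_simps)
    qed
    also have "?x\<^sup>2 / 2 = v ^ 6 / 18" by (simp add: power_divide flip: power_mult)
    also have "v ^ 6 \<le> 216 / c ^ 3 * exp (c / 2 * v\<^sup>2)"
    proof -
      let ?y = "c / 2 * v\<^sup>2"
      have "?y ^ 3 \<le> 27 * exp ?y" using power_le_exp[of ?y 3] c by simp
      moreover have "?y ^ 3 = c ^ 3 * v ^ 6 / 8" by (simp add: power_mult_distrib power_divide flip: power_mult)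
      ultimately show ?thesis using c by (simp add: field_simps)
    qed
    finally have "cmod (?f v + ?f (- v) - 2 * ?g v) \<le> exp (- (c * v\<^sup>2)) * (2 * (216 / c ^ 3 * exp (c / 2 * v\<^sup>2) / 18))"
      by simp
    also have "\<dots> = 2 * (216/18) / c ^ 3 * (exp (c / 2 * v\<^sup>2) * exp (- (c * v\<^sup>2)))"
      by simp
    also have "exp (c / 2 * v\<^sup>2) * exp (- (c * v\<^sup>2)) = exp (- (c / 2 * v\<^sup>2))"
      by (simp flip: exp_add add: field_simps)
    finally show ?thesis .
  qed
  have "norm (LINT v|lborel. ?f v + ?f (- v) - 2 * ?g v) \<le> (LINT v|lborel. 2 * (216/18) / c ^ 3 * exp (- (c / 2 * v\<^sup>2)))"
  proof (rule Bochner_Integration.integral_norm_bound_integral)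
    show "integrable lborel (\<lambda>v. 2 * (216/18) / c ^ 3 * exp (- (c / 2 * v\<^sup>2)))"
      using has_bochner_integral_gaussian[of "c/2"] c by (intro integrable_mult_right) (auto simp: has_bochner_integral_iff)
  qed (use pt fint fint' gint in auto)
  also have "\<dots> = 2 * (216/18) / c ^ 3 * sqrt (2 * pi / c)"
    using has_bochner_integral_gaussian[of "c/2"] c by (simp add: has_bochner_integral_iff mult.commute)
  finally have diff: "cmod ((LINT v|lborel. ?f v) - (LINT v|lborel. ?g v)) \<le> (216/18) / c ^ 3 * sqrt (2 * pi / c)"
    unfolding sym[symmetric] norm_mult by simp
  have gval: "(LINT v|lborel. ?g v) = sqrt pi * cis (- (pi/12)) / complex_of_real (t powr (1/4))"
  proof -
    have q: "t powr (1/4) > 0" using t by simp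
    have "(t powr (1/4))\<^sup>2 = sqrt t" using t by (simp add: powr_half_sqrt[symmetric] power2_eq_square flip: powr_add)
    then have sq: "(complex_of_real (t powr (1/4)))\<^sup>2 = complex_of_real (sqrt t)" by (metis of_real_power)
    have "(LINT v|lborel. exp (- (cis (pi/6) * (complex_of_real v)\<^sup>2))) =
       \<bar>t powr (1/4)\<bar> *\<^sub>R (LINT v|lborel. exp (- (cis (pi/6) * (complex_of_real (0 + t powr (1/4) * v))\<^sup>2)))"
      by (rule lborel_integral_real_affine) (use q in auto)
    also have "(\<lambda>v. exp (- (cis (pi/6) * (complex_of_real (0 + t powr (1/4) * v))\<^sup>2))) = ?g"
      by (simp add: power_mult_distrib sq \<rho>_def mult.assoc)
    finally have "sqrt pi * cis (- (pi/12)) = complex_of_real (t powr (1/4)) * (LINT v|lborel. ?g v)"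
      unfolding gaussian_rotated using q by (simp add: scaleR_conv_of_real)
    then show ?thesis using q by (metis less_irrefl nonzero_mult_div_cancel_left of_real_eq_0_iff)
  qed
  have "Ai (\<alpha> * complex_of_real t) = 1 / (2 * pi) * (?E * (LINT v|lborel. ?f v))"
    by (subst Ai_line[of \<rho>]) (simp_all add: re c kern)
  moreover have "airy_osc t = 1 / (2 * pi) * (?E * (LINT v|lborel. ?g v))"
  proof -
    have "sqrt pi * sqrt pi = pi" by simp
    then have "complex_of_real (sqrt pi) * complex_of_real (sqrt pi) = complex_of_real pi"
      by (metis of_real_mult)
    moreover have "cis (- (pi/12)) = 1 / cis (pi/12)" by (simp add: cis_inverse[symmetric] inverse_eq_divide)
    ultimately show ?thesis unfolding airy_osc_def gval using t by (simp add: field_simps)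
  qed
  ultimately have "Ai (\<alpha> * complex_of_real t) - airy_osc t = 1 / (2 * pi) * ?E * ((LINT v|lborel. ?f v) - (LINT v|lborel. ?g v))"
    by (simp only: right_diff_distrib mult.assoc)
  then have "cmod (Ai (\<alpha> * complex_of_real t) - airy_osc t) = cmod ((LINT v|lborel. ?f v) - (LINT v|lborel. ?g v)) / (2 * pi)"
    by (simp add: norm_mult norm_divide)
  also have "\<dots> \<le> ((216/18) / c ^ 3 * sqrt (2 * pi / c)) / (2 * pi)"
    by (intro divide_right_mono diff) auto
  also have "\<dots> = ?K * (1 / (sqrt t ^ 3 * sqrt (sqrt t)))"
    using t by (simp add: c_def power_mult_distrib power_divide real_sqrt_mult real_sqrt_divide field_simps)
  also have "1 / (sqrt t ^ 3 * sqrt (sqrt t)) = t powr (-7/4)"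
    using t by (simp add: powr_half_sqrt[symmetric] powr_powr powr_realpow[symmetric] powr_minus_divide flip: powr_add)
  finally show "cmod (Ai (\<alpha> * complex_of_real t) - airy_osc t) \<le> ?K * t powr (-7/4)" .
qed

section \<open>The reciprocal of \<open>Ai (\<alpha> t)\<close>\<close>

text \<open>
The \<open>j\<close>-th moment of the Airy kernel along one of the two rays of the contour: there \<open>t\<^sup>3 = - r\<^sup>3\<close>, and \<open>\<omega>\<close> is the
direction of the ray times the direction \<open>\<alpha>\<close> of the argument.
\<close>
definition half_airy :: "nat \<Rightarrow> complex \<Rightarrow> real \<Rightarrow> complex" where
  "half_airy j \<omega> t = (LINT r:{0..}|lborel. complex_of_real (r ^ j) * exp (complex_of_real (- (r ^ 3 / 3)) - \<omega> * complex_of_real (t * r)))"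

lemma norm_half_airy_integrand:
  assumes "cmod \<omega> = 1" "r \<ge> 0" "\<bar>t\<bar> \<le> T"
  shows "cmod (complex_of_real (r ^ j) * exp (complex_of_real (- (r ^ 3 / 3)) - \<omega> * complex_of_real (t * r)))
     \<le> exp (- (r ^ 3 / 3) + (T + real j) * r)"
proof -
  have "r \<le> exp r" using exp_ge_add_one_self[of r] by linarith
  then have "r ^ j \<le> exp r ^ j" using assms by (intro power_mono) auto
  also have "exp r ^ j = exp (real j * r)" by (simp add: exp_of_nat_mult)
  finally have 1: "r ^ j \<le> exp (real j * r)" .
  have "\<bar>Re (\<omega> * complex_of_real (t * r))\<bar> \<le> cmod (\<omega> * complex_of_real (t * r))"
    by (rule abs_Re_le_cmod)
  also have "\<dots> = \<bar>t\<bar> * r" using assms by (simp add: norm_mult abs_mult)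
  also have "\<dots> \<le> T * r" using assms by (intro mult_right_mono) auto
  finally have 2: "- Re (\<omega> * complex_of_real (t * r)) \<le> T * r" by linarith
  have "cmod (complex_of_real (r ^ j) * exp (complex_of_real (- (r ^ 3 / 3)) - \<omega> * complex_of_real (t * r)))
     = r ^ j * exp (- (r ^ 3 / 3) - Re (\<omega> * complex_of_real (t * r)))"
    using assms by (simp only: norm_mult norm_exp_eq_Re norm_of_real minus_complex.sel Re_complex_of_real) simp
  also have "\<dots> \<le> exp (real j * r) * exp (- (r ^ 3 / 3) + T * r)"
    using 1 2 assms by (intro mult_mono) auto
  also have "\<dots> = exp (- (r ^ 3 / 3) + (T + real j) * r)" by (simp add: algebra_simps flip: exp_add)
  finally show ?thesis .
qed

lemma integrable_half_airy_majorant: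
  assumes "c \<ge> 0"
  shows "integrable lborel (\<lambda>r::real. indicator {0..} r * exp (- (r ^ 3 / 3) + c * r))"
proof -
  obtain K where K: "\<And>r. r \<ge> 0 \<Longrightarrow> - (r ^ 3 / 3) + c * r \<le> K - r\<^sup>2"
    using cubic_minus_square_bounded_below[OF assms] by auto
  show ?thesis
  proof (rule Bochner_Integration.integrable_bound)
    show "integrable lborel (\<lambda>r. exp K * exp (- (1 * r\<^sup>2)))"
      using has_bochner_integral_gaussian[of 1] by (intro integrable_mult_right) (auto simp: has_bochner_integral_iff)
    show "AE r in lborel. norm (indicator {0..} r * exp (- (r ^ 3 / 3) + c * r)) \<le> norm (exp K * exp (- (1 * r\<^sup>2)))"
    proof (rule AE_I2)
      fix r :: real
      show "norm (indicator {0..} r * exp (- (r ^ 3 / 3) + c * r)) \<le> norm (exp K * exp (- (1 * r\<^sup>2)))"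
        using K[of r] by (cases "r \<ge> 0") (simp_all flip: exp_add)
    qed
  qed simp
qed

lemma set_integrable_half_airy:
  assumes "cmod \<omega> = 1"
  shows "set_integrable lborel {0..} (\<lambda>r. complex_of_real (r ^ j) * exp (complex_of_real (- (r ^ 3 / 3)) - \<omega> * complex_of_real (t * r)))"
  unfolding set_integrable_def
proof (rule Bochner_Integration.integrable_bound[OF integrable_half_airy_majorant[of "\<bar>t\<bar> + real j"]])
  show "AE r in lborel. norm (indicat_real {0..} r *\<^sub>R (complex_of_real (r ^ j) * exp (complex_of_real (- (r ^ 3 / 3)) - \<omega> * complex_of_real (t * r))))
     \<le> norm (indicat_real {0..} r * exp (- (r ^ 3 / 3) + (\<bar>t\<bar> + real j) * r))"
  proof (rule AE_I2)
    fix r :: real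
    show "norm (indicat_real {0..} r *\<^sub>R (complex_of_real (r ^ j) * exp (complex_of_real (- (r ^ 3 / 3)) - \<omega> * complex_of_real (t * r))))
     \<le> norm (indicat_real {0..} r * exp (- (r ^ 3 / 3) + (\<bar>t\<bar> + real j) * r))"
      using norm_half_airy_integrand[OF assms, of r t "\<bar>t\<bar>" j] by (cases "r \<ge> 0") simp_all
  qed
qed auto

lemma half_airy_has_vector_derivative:
  assumes w: "cmod \<omega> = 1"
  shows "(half_airy j \<omega> has_vector_derivative (- \<omega> * half_airy (Suc j) \<omega> t)) (at t)"
proof -
  let ?e = "\<lambda>t r. exp (complex_of_real (- (r ^ 3 / 3)) - \<omega> * complex_of_real (t * r))"
  let ?f = "\<lambda>t r. indicat_real {0..} r *\<^sub>R (complex_of_real (r ^ j) * ?e t r)"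
  let ?f' = "\<lambda>t r. indicat_real {0..} r *\<^sub>R (- \<omega> * (complex_of_real (r ^ Suc j) * ?e t r))"
  let ?T = "\<bar>t\<bar> + 1"
  have "((\<lambda>s. LINT r|lborel. ?f s r) has_vector_derivative (LINT r|lborel. ?f' t r)) (at t)"
  proof (rule has_vector_derivative_integral[where S="{t-1<..<t+1}"])
    show "((\<lambda>s. ?f s r) has_vector_derivative ?f' s r) (at s)" for s r
    proof -
      have 1: "((\<lambda>s. complex_of_real (- (r ^ 3 / 3)) - \<omega> * complex_of_real (s * r)) has_vector_derivative - \<omega> * complex_of_real r) (at s)"
        unfolding of_real_mult by (auto intro!: derivative_eq_intros)
      have "((\<lambda>s. ?e s r) has_vector_derivative (- \<omega> * complex_of_real r) * ?e s r) (at s)"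
        using field_vector_diff_chain_at[OF 1 DERIV_exp] by (simp add: o_def)
      then have "((\<lambda>s. indicat_real {0..} r *\<^sub>R (complex_of_real (r ^ j) * ?e s r)) has_vector_derivative
           indicat_real {0..} r *\<^sub>R (complex_of_real (r ^ j) * ((- \<omega> * complex_of_real r) * ?e s r))) (at s)"
        by (intro bounded_linear.has_vector_derivative[OF bounded_linear_scaleR_right] has_vector_derivative_mult_right)
      then show ?thesis by (simp add: mult_ac)
    qed
    show "integrable lborel (?f s)" for s
      using set_integrable_half_airy[OF w, of j s] unfolding set_integrable_def .
    show "norm (?f' s r) \<le> indicator {0..} r * exp (- (r ^ 3 / 3) + (?T + real (Suc j)) * r)"
      if "s \<in> {t-1<..<t+1}" for s r
    proof (cases "r \<ge> 0")
      case True
      have "\<bar>s\<bar> \<le> ?T" using that by auto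
      from norm_half_airy_integrand[OF w True this, of "Suc j"] True show ?thesis
        by (simp add: norm_mult w)
    qed simp
    show "integrable lborel (\<lambda>r. indicator {0..} r * exp (- (r ^ 3 / 3) + (?T + real (Suc j)) * r))"
      by (rule integrable_half_airy_majorant) auto
  qed auto
  moreover have "(LINT r|lborel. ?f' t r) = - \<omega> * half_airy (Suc j) \<omega> t"
  proof -
    have "?f' t = (\<lambda>r. - \<omega> * (indicat_real {0..} r *\<^sub>R (complex_of_real (r ^ Suc j) * ?e t r)))"
      by (auto simp: fun_eq_iff)
    then show ?thesis unfolding half_airy_def set_lebesgue_integral_def by (simp only: integral_mult_right_zero)
  qed
  moreover have "(\<lambda>s. LINT r|lborel. ?f s r) = half_airy j \<omega>"
    by (auto simp: half_airy_def set_lebesgue_integral_def fun_eq_iff)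
  ultimately show ?thesis by metis
qed

text \<open>
The integrand is the derivative of \<open>- exp (- r\<^sup>3 / 3 - \<omega> t r)\<close>; the boundary term at \<open>0\<close> is the right-hand side.
\<close>
lemma half_airy_recurrence:
  assumes w: "cmod \<omega> = 1"
  shows "half_airy 2 \<omega> t + \<omega> * complex_of_real t * half_airy 0 \<omega> t = 1"
proof -
  let ?e = "\<lambda>r. exp (complex_of_real (- (r ^ 3 / 3)) - \<omega> * complex_of_real (t * r))"
  let ?g = "\<lambda>r. (complex_of_real (r ^ 2) + \<omega> * complex_of_real t) * ?e r"
  have i2: "set_integrable lborel {0..} (\<lambda>r. complex_of_real (r ^ 2) * ?e r)"
    and i0: "set_integrable lborel {0..} (\<lambda>r. complex_of_real (r ^ 0) * ?e r)"
    by (rule set_integrable_half_airy[OF w])+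
  have i: "set_integrable lborel {0..} ?g"
    using set_integral_add(1)[OF i2 set_integrable_mult_right[OF i0, of "\<omega> * complex_of_real t"]]
    by (simp add: algebra_simps)
  have eq: "(LINT r:{0..}|lborel. ?g r) = half_airy 2 \<omega> t + \<omega> * complex_of_real t * half_airy 0 \<omega> t"
    using set_integral_add(2)[OF i2 set_integrable_mult_right[OF i0, of "\<omega> * complex_of_real t"]]
    by (simp add: half_airy_def algebra_simps)
  have 1: "(\<lambda>n::nat. LINT r:{0..real n}|lborel. ?g r) \<longlonglongrightarrow> (LINT r:{0..}|lborel. ?g r)"
    by (rule filterlim_compose[OF tendsto_set_lebesgue_integral_at_top filterlim_real_sequentially])
      (use i in auto)
  have 2: "(LINT r:{0..real n}|lborel. ?g r) = 1 - ?e (real n)" for n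
  proof -
    have si: "set_integrable lborel {0..real n} ?g"
      by (rule set_integrable_subset[OF i]) auto
    have d: "((\<lambda>r. - ?e r) has_vector_derivative ?g r) (at r)" for r
    proof -
      have 1: "((\<lambda>r. complex_of_real (- (r ^ 3 / 3)) - \<omega> * complex_of_real (t * r)) has_vector_derivative
            (- complex_of_real (r\<^sup>2) - \<omega> * complex_of_real t)) (at r)"
      proof -
        have "((\<lambda>r. - (r ^ 3 / 3)) has_vector_derivative - r\<^sup>2) (at r)"
          by (auto intro!: derivative_eq_intros simp: has_real_derivative_iff_has_vector_derivative[symmetric] power2_eq_square)
        moreover have "((\<lambda>r. t * r) has_vector_derivative t) (at r)"
          by (auto intro!: derivative_eq_intros)
        ultimately have "((\<lambda>r. complex_of_real (- (r ^ 3 / 3)) - \<omega> * complex_of_real (t * r)) has_vector_derivative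
            (complex_of_real (- r\<^sup>2) - \<omega> * complex_of_real t)) (at r)"
          by (intro has_vector_derivative_diff has_vector_derivative_mult_right has_vector_derivative_of_real)
            (simp_all add: has_real_derivative_iff_has_vector_derivative)
        then show ?thesis by simp
      qed
      have "((\<lambda>r. ?e r) has_vector_derivative (- complex_of_real (r\<^sup>2) - \<omega> * complex_of_real t) * ?e r) (at r)"
        using field_vector_diff_chain_at[OF 1 DERIV_exp] by (simp add: o_def)
      from has_vector_derivative_minus[OF this] show ?thesis by (simp add: algebra_simps)
    qed
    have "(?g has_integral (- ?e (real n) - - ?e 0)) {0..real n}"
      by (rule fundamental_theorem_of_calculus, simp, rule has_vector_derivative_at_within, rule d)
    then show ?thesis
      using set_borel_integral_eq_integral(2)[OF si] by (simp add: integral_unique)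
  qed
  have 3: "(\<lambda>n::nat. ?e (real n)) \<longlonglongrightarrow> 0"
  proof (rule Lim_null_comparison)
    show "eventually (\<lambda>n. norm (?e (real n)) \<le> exp (- (real n ^ 3 / 3) + (\<bar>t\<bar> + real 0) * real n)) sequentially"
      using norm_half_airy_integrand[OF w, of _ t "\<bar>t\<bar>" 0] by (intro always_eventually allI) simp
    show "(\<lambda>n. exp (- (real n ^ 3 / 3) + (\<bar>t\<bar> + real 0) * real n)) \<longlonglongrightarrow> 0"
      by real_asymp
  qed
  have "(\<lambda>n::nat. 1 - ?e (real n)) \<longlonglongrightarrow> 1 - 0" by (intro tendsto_diff 3 tendsto_const)
  then have "(LINT r:{0..}|lborel. ?g r) = 1"
    using LIMSEQ_unique[OF 1[unfolded 2]] by simp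
  then show ?thesis using eq by simp
qed

definition airy_moment :: "nat \<Rightarrow> real" where
  "airy_moment j = (LINT r:{0..}|lborel. r ^ j * exp (- (r ^ 3 / 3)))"

lemma half_airy_0: "half_airy j \<omega> 0 = complex_of_real (airy_moment j)"
  unfolding half_airy_def airy_moment_def set_lebesgue_integral_def
  by (subst integral_complex_of_real[symmetric]) (simp add: scaleR_conv_of_real flip: exp_of_real)

lemma airy_moment_pos: "airy_moment j > 0"
proof -
  have i: "set_integrable lborel {0..} (\<lambda>r::real. r ^ j * exp (- (r ^ 3 / 3)))"
  proof -
    have "set_integrable lborel {0..} (\<lambda>r. complex_of_real (r ^ j * exp (- (r ^ 3 / 3))))"
      using set_integrable_half_airy[of 1 j 0] by (simp flip: exp_of_real)
    from integrable_Re[OF this[unfolded set_integrable_def]] show ?thesis unfolding set_integrable_def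
      by (simp only: scaleR_complex.sel Re_complex_of_real real_scaleR_def)
  qed
  have "0 < (LINT r:{1..2::real}|lborel. exp (- (8/3::real)))"
    by (simp add: set_lebesgue_integral_def)
  also have "\<dots> \<le> airy_moment j"
    unfolding airy_moment_def set_lebesgue_integral_def
  proof (rule integral_mono)
    show "integrable lborel (\<lambda>r::real. indicat_real {0..} r *\<^sub>R (r ^ j * exp (- (r ^ 3 / 3))))"
      using i unfolding set_integrable_def .
    fix r :: real
    show "indicat_real {1..2} r *\<^sub>R exp (- (8/3)) \<le> indicat_real {0..} r *\<^sub>R (r ^ j * exp (- (r ^ 3 / 3)))"
    proof (cases "r \<in> {1..2}")
      case True
      then have "1 \<le> r ^ j" "r ^ 3 \<le> 8" using power_mono[of r 2 3] by auto
      then have "1 * exp (- (8/3)) \<le> r ^ j * exp (- (r ^ 3 / 3))" by (intro mult_mono) auto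
      with True show ?thesis by simp
    next
      case False then show ?thesis by (auto simp: indicator_def)
    qed
  qed auto
  finally show ?thesis .
qed

abbreviation ai_alpha :: "real \<Rightarrow> complex" where
  "ai_alpha t \<equiv> Ai (\<alpha> * complex_of_real t)"

definition ai_alpha' :: "real \<Rightarrow> complex" where
  "ai_alpha' t = (half_airy 1 (\<alpha>\<^sup>2) t + cnj \<alpha> * half_airy 1 1 t) / (2 * pi * \<i>)"

lemma cnj_alpha: "cnj \<alpha> = - \<alpha>\<^sup>2" "\<alpha> * cnj \<alpha> = 1" "\<alpha>\<^sup>2 = \<alpha> - 1"
  by (simp_all add: alpha_eq complex_eq_iff power2_eq_square)

lemma ai_alpha_eq: "ai_alpha t = (\<alpha> * half_airy 0 (\<alpha>\<^sup>2) t - cnj \<alpha> * half_airy 0 1 t) / (2 * pi * \<i>)"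
proof -
  have k: "\<omega> * airy_kernel (\<alpha> * complex_of_real t) (\<omega> * complex_of_real r)
     = \<omega> * (complex_of_real (r ^ 0) * exp (complex_of_real (- (r ^ 3 / 3)) - (\<alpha> * \<omega>) * complex_of_real (t * r)))"
    if "\<omega> ^ 3 = -1" for \<omega> r
    using that by (simp add: airy_kernel_def power_mult_distrib mult_ac)
  have ca: "cnj \<alpha> ^ 3 = -1" using alpha_cube by (metis complex_cnj_minus complex_cnj_one complex_cnj_power)
  have pull: "(LINT r:{0..}|lborel. c * f r) = c * (LINT r:{0..}|lborel. f r)" for c :: complex and f :: "real \<Rightarrow> complex"
    unfolding set_lebesgue_integral_def by (subst integral_mult_right_zero[symmetric]) simp
  have ray: "(LINT r:{0..}|lborel. \<omega> * airy_kernel (\<alpha> * complex_of_real t) (\<omega> * complex_of_real r))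
      = \<omega> * half_airy 0 (\<alpha> * \<omega>) t" if "\<omega> ^ 3 = -1" for \<omega>
    unfolding k[OF that] half_airy_def by (rule pull)
  show ?thesis
    unfolding Ai_eq_kernel ray[OF alpha_cube] ray[OF ca] cnj_alpha(2) power2_eq_square by simp
qed

text \<open>
The function \<open>y(t) = Ai (\<alpha> t)\<close> satisfies \<open>y'' = \<alpha>\<^sup>3 t y = - t y\<close>. The boundary terms of the recurrence on
the two rays cancel.
\<close>
lemma ai_alpha_derivative: "((\<lambda>t. ai_alpha t) has_vector_derivative ai_alpha' t) (at t)"
  and ai_alpha'_derivative: "(ai_alpha' has_vector_derivative - (complex_of_real t * ai_alpha t)) (at t)"
proof -
  have n: "cmod (\<alpha>\<^sup>2) = 1" "cmod 1 = 1" by (simp_all add: norm_power norm_alpha)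
  have a3: "\<alpha> * \<alpha>\<^sup>2 = -1" using alpha_cube by (simp add: power3_eq_cube power2_eq_square mult.assoc)
  have "((\<lambda>t. (\<alpha> * half_airy 0 (\<alpha>\<^sup>2) t - cnj \<alpha> * half_airy 0 1 t) / (2 * pi * \<i>)) has_vector_derivative
     (\<alpha> * (- (\<alpha>\<^sup>2) * half_airy (Suc 0) (\<alpha>\<^sup>2) t) - cnj \<alpha> * (- 1 * half_airy (Suc 0) 1 t)) / (2 * pi * \<i>)) (at t)"
    by (intro has_vector_derivative_divide has_vector_derivative_diff has_vector_derivative_mult_right half_airy_has_vector_derivative n)
  moreover have "\<alpha> * (- (\<alpha>\<^sup>2) * half_airy (Suc 0) (\<alpha>\<^sup>2) t) - cnj \<alpha> * (- 1 * half_airy (Suc 0) 1 t)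
     = half_airy 1 (\<alpha>\<^sup>2) t + cnj \<alpha> * half_airy 1 1 t"
    by (simp add: a3 flip: mult.assoc)
  ultimately show "((\<lambda>t. ai_alpha t) has_vector_derivative ai_alpha' t) (at t)"
    unfolding ai_alpha_eq ai_alpha'_def by (simp only:)
  have "((\<lambda>t. (half_airy 1 (\<alpha>\<^sup>2) t + cnj \<alpha> * half_airy 1 1 t) / (2 * pi * \<i>)) has_vector_derivative
     ((- (\<alpha>\<^sup>2) * half_airy (Suc 1) (\<alpha>\<^sup>2) t) + cnj \<alpha> * (- 1 * half_airy (Suc 1) 1 t)) / (2 * pi * \<i>)) (at t)"
    by (intro has_vector_derivative_divide has_vector_derivative_add has_vector_derivative_mult_right half_airy_has_vector_derivative n)
  moreover have "(- (\<alpha>\<^sup>2) * half_airy (Suc 1) (\<alpha>\<^sup>2) t) + cnj \<alpha> * (- 1 * half_airy (Suc 1) 1 t)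
     = - (complex_of_real t * (\<alpha> * half_airy 0 (\<alpha>\<^sup>2) t - cnj \<alpha> * half_airy 0 1 t))"
  proof -
    have 1: "half_airy 2 (\<alpha>\<^sup>2) t = 1 - \<alpha>\<^sup>2 * complex_of_real t * half_airy 0 (\<alpha>\<^sup>2) t"
      using half_airy_recurrence[OF n(1), of t] by (simp add: algebra_simps)
    have 2: "half_airy 2 1 t = 1 - complex_of_real t * half_airy 0 1 t"
      using half_airy_recurrence[OF n(2), of t] by (simp add: algebra_simps)
    have 4: "\<alpha>\<^sup>2 * \<alpha>\<^sup>2 = - \<alpha>" using a3 by (metis mult.assoc mult.commute mult_minus1_right power2_eq_square)
    have "(- (\<alpha>\<^sup>2) * half_airy (Suc 1) (\<alpha>\<^sup>2) t) + cnj \<alpha> * (- 1 * half_airy (Suc 1) 1 t)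
       = - (\<alpha>\<^sup>2) * half_airy 2 (\<alpha>\<^sup>2) t + \<alpha>\<^sup>2 * half_airy 2 1 t"
      by (simp add: cnj_alpha(1) numeral_2_eq_2)
    also have "\<dots> = (\<alpha>\<^sup>2 * \<alpha>\<^sup>2) * complex_of_real t * half_airy 0 (\<alpha>\<^sup>2) t - \<alpha>\<^sup>2 * (complex_of_real t * half_airy 0 1 t)"
      unfolding 1 2 by (simp add: algebra_simps)
    also have "\<dots> = - (complex_of_real t * (\<alpha> * half_airy 0 (\<alpha>\<^sup>2) t - cnj \<alpha> * half_airy 0 1 t))"
      unfolding 4 cnj_alpha(1) by (simp add: algebra_simps)
    finally show ?thesis .
  qed
  ultimately show "(ai_alpha' has_vector_derivative - (complex_of_real t * ai_alpha t)) (at t)"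
    unfolding ai_alpha_eq ai_alpha'_def[abs_def] by simp
qed

text \<open>
The initial data that decide everything: the signs of \<open>Re (cnj y y') = (|y|\<^sup>2)' / 2\<close> and of the Wronskian of \<open>Im y\<close> and \<open>Re y\<close>.
\<close>
lemma ai_alpha_initial:
  "Re (ai_alpha 0) * Re (ai_alpha' 0) + Im (ai_alpha 0) * Im (ai_alpha' 0) < 0"
  "Im (ai_alpha 0) * Re (ai_alpha' 0) - Re (ai_alpha 0) * Im (ai_alpha' 0) > 0"
proof -
  let ?a = "airy_moment 0" and ?b = "airy_moment 1"
  have pos: "?a > 0" "?b > 0" by (rule airy_moment_pos)+
  have "ai_alpha 0 = Complex (sqrt 3 * ?a / (2 * pi)) 0"
    unfolding ai_alpha_eq half_airy_0 by (simp add: complex_eq_iff Re_divide Im_divide Re_alpha Im_alpha power2_eq_square field_simps)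
  then have y: "Re (ai_alpha 0) = sqrt 3 * ?a / (2 * pi)" "Im (ai_alpha 0) = 0" by simp_all
  have "ai_alpha' 0 = Complex (- (sqrt 3 / 2 * ?b / (2 * pi))) (- (3/2 * ?b / (2 * pi)))"
    unfolding ai_alpha'_def half_airy_0 by (simp add: complex_eq_iff Re_divide Im_divide Re_alpha Im_alpha power2_eq_square field_simps)
  then have y': "Re (ai_alpha' 0) = - (sqrt 3 / 2 * ?b / (2 * pi))" "Im (ai_alpha' 0) = - (3/2 * ?b / (2 * pi))" by simp_all
  show "Re (ai_alpha 0) * Re (ai_alpha' 0) + Im (ai_alpha 0) * Im (ai_alpha' 0) < 0"
    unfolding y y' using pos by (simp add: zero_less_mult_iff)
  show "Im (ai_alpha 0) * Re (ai_alpha' 0) - Re (ai_alpha 0) * Im (ai_alpha' 0) > 0"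
    unfolding y y' using pos by (simp add: zero_less_mult_iff)
qed

lemma ai_alpha_components:
  shows "((\<lambda>t. Re (ai_alpha t)) has_real_derivative Re (ai_alpha' t)) (at t)"
    and "((\<lambda>t. Im (ai_alpha t)) has_real_derivative Im (ai_alpha' t)) (at t)"
    and "((\<lambda>t. Re (ai_alpha' t)) has_real_derivative - t * Re (ai_alpha t)) (at t)"
    and "((\<lambda>t. Im (ai_alpha' t)) has_real_derivative - t * Im (ai_alpha t)) (at t)"
  unfolding has_real_derivative_iff_has_vector_derivative
  using bounded_linear.has_vector_derivative[OF bounded_linear_Re ai_alpha_derivative, of t]
    bounded_linear.has_vector_derivative[OF bounded_linear_Im ai_alpha_derivative, of t]
    bounded_linear.has_vector_derivative[OF bounded_linear_Re ai_alpha'_derivative, of t]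
    bounded_linear.has_vector_derivative[OF bounded_linear_Im ai_alpha'_derivative, of t]
  by simp_all

text \<open>
Real and imaginary part of \<open>y\<close> solve the same second order equation, so their Wronskian is constant; a zero of \<open>y\<close> would
make it vanish.
\<close>
lemma ai_alpha_nonzero: "ai_alpha t \<noteq> 0"
proof
  assume z: "ai_alpha t = 0"
  let ?W = "\<lambda>t. Im (ai_alpha t) * Re (ai_alpha' t) - Re (ai_alpha t) * Im (ai_alpha' t)"
  have "(?W has_real_derivative 0) (at t)" for t
    by (rule derivative_eq_intros ai_alpha_components refl)+ (simp add: algebra_simps)
  then have "?W t = ?W 0" by (intro DERIV_isconst_all allI)
  then show False using ai_alpha_initial(2) z by simp
qed

text \<open>
For \<open>t \<le> 0\<close> the equation \<open>y'' = - t y\<close> makes \<open>|y|\<^sup>2\<close> convex, and it is decreasing at \<open>0\<close>; so it decreases on the whole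
half-line.
\<close>
lemma norm_ai_alpha_ge_neg:
  assumes "t \<le> 0"
  shows "cmod (ai_alpha 0) \<le> cmod (ai_alpha t)"
proof -
  let ?R = "\<lambda>t. Re (ai_alpha t) * Re (ai_alpha' t) + Im (ai_alpha t) * Im (ai_alpha' t)"
  let ?N = "\<lambda>t. (Re (ai_alpha t))\<^sup>2 + (Im (ai_alpha t))\<^sup>2"
  have dR: "(?R has_real_derivative ((Re (ai_alpha' s))\<^sup>2 + (Im (ai_alpha' s))\<^sup>2 - s * ?N s)) (at s)" for s
    by (rule derivative_eq_intros ai_alpha_components refl)+ (simp add: algebra_simps power2_eq_square)
  have dN: "(?N has_real_derivative 2 * ?R s) (at s)" for s
    by (rule derivative_eq_intros ai_alpha_components refl)+ (simp add: algebra_simps)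
  have R: "?R s \<le> 0" if "s \<le> 0" for s
  proof -
    have "?R s \<le> ?R 0"
    proof (rule DERIV_nonneg_imp_nondecreasing[OF that])
      fix x assume "s \<le> x" "x \<le> 0"
      then have "x * ?N x \<le> 0" by (intro mult_nonpos_nonneg) auto
      then have "0 \<le> (Re (ai_alpha' x))\<^sup>2 + (Im (ai_alpha' x))\<^sup>2 - x * ?N x"
        by (smt (verit) zero_le_power2)
      with dR show "\<exists>y. (?R has_real_derivative y) (at x) \<and> 0 \<le> y" by blast
    qed
    then show ?thesis using ai_alpha_initial(1) by linarith
  qed
  have "?N 0 \<le> ?N t"
  proof (rule DERIV_nonpos_imp_nonincreasing[OF assms])
    fix x assume "t \<le> x" "x \<le> 0"
    then show "\<exists>y. (?N has_real_derivative y) (at x) \<and> y \<le> 0" using dN[of x] mult_left_mono[OF R[of x], of 2] by auto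
  qed
  then show ?thesis by (simp add: cmod_def)
qed

lemma continuous_on_ai_alpha: "continuous_on S ai_alpha"
  by (intro continuous_at_imp_continuous_on ballI has_vector_derivative_continuous[OF ai_alpha_derivative])

lemma norm_airy_osc: "t > 0 \<Longrightarrow> cmod (airy_osc t) = t powr (-1/4) / (2 * sqrt pi)"
  by (simp add: airy_osc_def norm_divide norm_mult powr_minus_divide)

lemma ai_alpha_lower_bound_large:
  obtains T where "T \<ge> 1" "\<And>t. t \<ge> T \<Longrightarrow> cmod (ai_alpha t) \<ge> t powr (-1/4) / (4 * sqrt pi)"
proof -
  obtain C where C: "C > 0" "\<And>t::real. t > 0 \<Longrightarrow> cmod (ai_alpha t - airy_osc t) \<le> C * t powr (-7/4)"
    using Ai_alpha_asymptotics by blast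
  have "((\<lambda>t::real. C * t powr (-3/2)) \<longlongrightarrow> 0) at_top" by real_asymp
  then have "eventually (\<lambda>t. C * t powr (-3/2) < 1 / (4 * sqrt pi)) at_top"
    by (rule order_tendstoD) simp
  then obtain T0 where T0: "\<And>t. t \<ge> T0 \<Longrightarrow> C * t powr (-3/2) < 1 / (4 * sqrt pi)"
    by (auto simp: eventually_at_top_linorder)
  show ?thesis
  proof (rule that[of "max T0 1"])
    fix t assume "max T0 1 \<le> t"
    then have t: "t \<ge> 1" "C * t powr (-3/2) < 1 / (4 * sqrt pi)" using T0 by auto
    have "C * t powr (-7/4) = (C * t powr (-3/2)) * t powr (-1/4)"
      by (simp add: powr_add[symmetric])
    also have "\<dots> \<le> (1 / (4 * sqrt pi)) * t powr (-1/4)" using t by (intro mult_right_mono) auto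
    finally have "cmod (ai_alpha t - airy_osc t) \<le> t powr (-1/4) / (4 * sqrt pi)" using C(2)[of t] t by simp
    moreover have "cmod (airy_osc t) \<le> cmod (ai_alpha t) + cmod (ai_alpha t - airy_osc t)"
      using norm_triangle_ineq4[of "ai_alpha t" "ai_alpha t - airy_osc t"] by simp
    ultimately show "cmod (ai_alpha t) \<ge> t powr (-1/4) / (4 * sqrt pi)"
      using norm_airy_osc[of t] t by (simp add: field_simps)
  qed simp
qed

text \<open>
Three ranges: \<open>t \<le> 0\<close> by monotonicity, a compact interval by continuity and absence of zeros, and large \<open>t\<close> by
the asymptotics, where \<open>1 / |Ai (\<alpha> t)|\<close> grows like \<open>t^(1/4)\<close>.
\<close>
lemma inverse_ai_alpha_bound:
  obtains C where "C > 0" "\<And>t. 1 / cmod (ai_alpha t) \<le> C * (1 + \<bar>t\<bar>)"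
proof -
  obtain T where T: "T \<ge> 1" "\<And>t. t \<ge> T \<Longrightarrow> cmod (ai_alpha t) \<ge> t powr (-1/4) / (4 * sqrt pi)"
    using ai_alpha_lower_bound_large by blast
  have "\<exists>x\<in>{0..T}. \<forall>y\<in>{0..T}. cmod (ai_alpha x) \<le> cmod (ai_alpha y)"
    using T by (intro continuous_attains_inf continuous_on_norm continuous_on_ai_alpha) auto
  then obtain x where x: "\<And>y. y \<in> {0..T} \<Longrightarrow> cmod (ai_alpha x) \<le> cmod (ai_alpha y)" by blast
  define c where "c = cmod (ai_alpha x)"
  have c: "c > 0" using ai_alpha_nonzero by (simp add: c_def)
  show ?thesis
  proof (rule that[of "1 / c + 4 * sqrt pi"])
    show "1 / c + 4 * sqrt pi > 0" using c by (intro add_pos_pos) auto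
    fix t
    show "1 / cmod (ai_alpha t) \<le> (1 / c + 4 * sqrt pi) * (1 + \<bar>t\<bar>)"
    proof (cases "t < T")
      case True
      have "c \<le> cmod (ai_alpha t)"
      proof (cases "t \<ge> 0")
        case True with \<open>t < T\<close> show ?thesis using x by (simp add: c_def)
      next
        case False
        then have "cmod (ai_alpha 0) \<le> cmod (ai_alpha t)" by (intro norm_ai_alpha_ge_neg) auto
        with x[of 0] T show ?thesis by (simp add: c_def)
      qed
      then have "1 / cmod (ai_alpha t) \<le> 1 / c" using c ai_alpha_nonzero[of t] by (intro divide_left_mono mult_pos_pos) auto
      also have "\<dots> \<le> (1 / c + 4 * sqrt pi) * 1" by simp
      also have "\<dots> \<le> (1 / c + 4 * sqrt pi) * (1 + \<bar>t\<bar>)" using c by (intro mult_left_mono) auto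
      finally show ?thesis .
    next
      case False
      then have t: "t \<ge> T" "t \<ge> 1" using T by auto
      have "1 / cmod (ai_alpha t) \<le> 1 / (t powr (-1/4) / (4 * sqrt pi))"
        using T(2)[OF t(1)] t ai_alpha_nonzero[of t] by (intro divide_left_mono mult_pos_pos) auto
      also have "\<dots> = 4 * sqrt pi * t powr (1/4)" using t by (simp add: powr_minus_divide)
      also have "t powr (1/4) \<le> t powr 1" using t by (intro powr_mono) auto
      also have "t powr 1 \<le> 1 + \<bar>t\<bar>" using t by simp
      also have "4 * sqrt pi * (1 + \<bar>t\<bar>) \<le> (1 / c + 4 * sqrt pi) * (1 + \<bar>t\<bar>)"
        using c by (intro mult_right_mono) auto
      finally show ?thesis by simp
    qed
  qed
qed

text \<open>
The error \<open>t^(-7/4)\<close> of the asymptotics is multiplied by two reciprocals of size \<open>t^(1/4)\<close> each.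
\<close>
lemma inverse_ai_alpha_asymptotics:
  assumes t0: "t0 > 0"
  obtains C where "C > 0" "\<And>t. t \<ge> t0 \<Longrightarrow> cmod (1 / ai_alpha t - 1 / airy_osc t) \<le> C * t powr (-5/4)"
proof -
  obtain T where T: "T \<ge> 1" "\<And>t. t \<ge> T \<Longrightarrow> cmod (ai_alpha t) \<ge> t powr (-1/4) / (4 * sqrt pi)"
    using ai_alpha_lower_bound_large by blast
  obtain C where C: "C > 0" "\<And>t::real. t > 0 \<Longrightarrow> cmod (ai_alpha t - airy_osc t) \<le> C * t powr (-7/4)"
    using Ai_alpha_asymptotics by blast
  obtain D where D: "D > 0" "\<And>t. 1 / cmod (ai_alpha t) \<le> D * (1 + \<bar>t\<bar>)"
    using inverse_ai_alpha_bound by blast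
  define E where "E = max (4 * sqrt pi) (D * (1 + T) * t0 powr (-1/4))"
  have low: "1 / cmod (ai_alpha t) \<le> E * t powr (1/4)" if "t \<ge> t0" for t
  proof (cases "t \<ge> T")
    case True
    have "1 / cmod (ai_alpha t) \<le> 1 / (t powr (-1/4) / (4 * sqrt pi))"
      using T(2)[OF True] T(1) True ai_alpha_nonzero[of t] by (intro divide_left_mono mult_pos_pos) auto
    also have "\<dots> = 4 * sqrt pi * t powr (1/4)" using T(1) True by (simp add: powr_minus_divide)
    also have "\<dots> \<le> E * t powr (1/4)" by (intro mult_right_mono) (auto simp: E_def)
    finally show ?thesis .
  next
    case False
    have "1 / cmod (ai_alpha t) \<le> D * (1 + \<bar>t\<bar>)" by (rule D)
    also have "\<dots> \<le> D * (1 + T)" using False that t0 D by (intro mult_left_mono) auto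
    also have "\<dots> = D * (1 + T) * t0 powr (-1/4) * t0 powr (1/4)" using t0 by (simp flip: powr_add)
    also have "\<dots> \<le> D * (1 + T) * t0 powr (-1/4) * t powr (1/4)"
      using that t0 D T by (intro mult_left_mono powr_mono2) auto
    also have "\<dots> \<le> E * t powr (1/4)" by (intro mult_right_mono) (auto simp: E_def)
    finally show ?thesis .
  qed
  have E: "E > 0" unfolding E_def by (simp add: less_max_iff_disj)
  show ?thesis
  proof (rule that[of "E * C * (2 * sqrt pi)"])
    show "E * C * (2 * sqrt pi) > 0" using E C by simp
    fix t assume "t \<ge> t0"
    then have t: "t > 0" using t0 by simp
    have nz: "airy_osc t \<noteq> 0" using norm_airy_osc[OF t] t by auto
    have "1 / ai_alpha t - 1 / airy_osc t = - (ai_alpha t - airy_osc t) * (1 / ai_alpha t) * (1 / airy_osc t)"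
      using nz ai_alpha_nonzero[of t] by (simp add: field_simps)
    then have "cmod (1 / ai_alpha t - 1 / airy_osc t) = cmod (ai_alpha t - airy_osc t) * (1 / cmod (ai_alpha t)) * (1 / cmod (airy_osc t))"
      by (simp only: norm_mult norm_minus_cancel norm_divide norm_one)
    also have "\<dots> \<le> (C * t powr (-7/4)) * (E * t powr (1/4)) * (2 * sqrt pi * t powr (1/4))"
    proof (intro mult_mono)
      show "1 / cmod (airy_osc t) \<le> 2 * sqrt pi * t powr (1/4)"
        using t by (simp add: norm_airy_osc powr_minus_divide)
    qed (use C(2)[OF t] low[OF \<open>t \<ge> t0\<close>] C E in auto)
    also have "\<dots> = E * C * (2 * sqrt pi) * (t powr (-7/4) * t powr (1/4) * t powr (1/4))" by simp
    also have "t powr (-7/4) * t powr (1/4) * t powr (1/4) = t powr (-5/4)" by (simp flip: powr_add)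
    finally show "cmod (1 / ai_alpha t - 1 / airy_osc t) \<le> E * C * (2 * sqrt pi) * t powr (-5/4)" .
  qed
qed

section \<open>Fourier analysis of Schwartz functions\<close>

lemma schwartz_has_vector_derivative:
  assumes "schwartz A"
  shows "(nth_deriv n A has_vector_derivative nth_deriv (Suc n) A x) (at x)"
  using assms by (auto simp: schwartz_def nth_deriv_def vector_derivative_works)

text \<open>
The square of the integrable weight leaves room for one factor \<open>1 + x\<^sup>2\<close> in later integrals.
\<close>
lemma schwartz_decay_square:
  assumes "schwartz A"
  obtains M where "M > 0" "\<And>x. cmod (nth_deriv n A x) \<le> M * (1 / (1 + x\<^sup>2))\<^sup>2"
proof -
  obtain M0 where M0: "\<And>x. cmod (x ^ 0 *\<^sub>R nth_deriv n A x) \<le> M0"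
    using assms unfolding schwartz_def bounded_iff by (metis rangeI)
  obtain M4 where M4: "\<And>x. cmod (x ^ 4 *\<^sub>R nth_deriv n A x) \<le> M4"
    using assms unfolding schwartz_def bounded_iff by (metis rangeI)
  show ?thesis
  proof (rule that[of "2 * \<bar>M0\<bar> + 2 * \<bar>M4\<bar> + 1"])
    fix x :: real
    have "0 \<le> (x\<^sup>2 - 1)\<^sup>2" by simp
    moreover have x4: "x\<^sup>2 * x\<^sup>2 = x ^ 4" by (simp flip: power_add)
    ultimately have "(1 + x\<^sup>2)\<^sup>2 \<le> 2 + 2 * x ^ 4" by (simp add: power2_eq_square algebra_simps)
    then have "(1 + x\<^sup>2)\<^sup>2 * cmod (nth_deriv n A x) \<le> (2 + 2 * x ^ 4) * cmod (nth_deriv n A x)" by (intro mult_right_mono) auto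
    also have "\<dots> \<le> 2 * \<bar>M0\<bar> + 2 * \<bar>M4\<bar> + 1"
      using M0[of x] M4[of x] by (simp add: algebra_simps)
    finally have "(1 + x\<^sup>2)\<^sup>2 * cmod (nth_deriv n A x) \<le> 2 * \<bar>M0\<bar> + 2 * \<bar>M4\<bar> + 1" .
    then show "cmod (nth_deriv n A x) \<le> (2 * \<bar>M0\<bar> + 2 * \<bar>M4\<bar> + 1) * (1 / (1 + x\<^sup>2))\<^sup>2"
    proof -
      have "(1 + x\<^sup>2)\<^sup>2 > 0" by (intro zero_less_power add_pos_nonneg) auto
      then show ?thesis
        using \<open>(1 + x\<^sup>2)\<^sup>2 * cmod (nth_deriv n A x) \<le> 2 * \<bar>M0\<bar> + 2 * \<bar>M4\<bar> + 1\<close>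
        by (simp add: power_divide pos_le_divide_eq mult.commute)
    qed
  qed simp
qed

lemma schwartz_decay:
  assumes "schwartz A"
  obtains M where "M > 0" "\<And>x. cmod (nth_deriv n A x) \<le> M * (1 / (1 + x\<^sup>2))"
proof -
  obtain M where M: "M > 0" "\<And>x. cmod (nth_deriv n A x) \<le> M * (1 / (1 + x\<^sup>2))\<^sup>2"
    using schwartz_decay_square[OF assms] by blast
  have "M * (1 / (1 + x\<^sup>2))\<^sup>2 \<le> M * (1 / (1 + x\<^sup>2))" for x :: real
    using M(1) power_decreasing[of 1 2 "1 / (1 + x\<^sup>2)"] by (intro mult_left_mono) (auto simp: divide_le_eq_1 add_pos_nonneg)
  with M show ?thesis by (intro that[of M]) (auto intro: order_trans)
qed

lemma schwartz_continuous:
  assumes "schwartz A"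
  shows "continuous_on UNIV (nth_deriv n A)"
  by (intro continuous_at_imp_continuous_on ballI has_vector_derivative_continuous[OF schwartz_has_vector_derivative[OF assms]])

lemma nth_deriv_0 [simp]: "nth_deriv 0 A = A"
  by (simp add: nth_deriv_def)

lemma borel_measurable_schwartz:
  assumes "schwartz A"
  shows "nth_deriv n A \<in> borel_measurable borel"
  by (rule borel_measurable_continuous_onI[OF schwartz_continuous[OF assms]])

lemma integrable_inverse_1_plus_square': "integrable lborel (\<lambda>x::real. M * (1 / (1 + x\<^sup>2)))"
  using has_bochner_integral_inverse_1_plus_square[of 1 0] by (intro integrable_mult_right) (simp add: has_bochner_integral_iff)

lemma schwartz_integrable:
  assumes "schwartz A"
  shows "integrable lborel (nth_deriv n A)"
proof -
  obtain M where M: "M > 0" "\<And>x. cmod (nth_deriv n A x) \<le> M * (1 / (1 + x\<^sup>2))"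
    using schwartz_decay[OF assms, of n] by blast
  show ?thesis
  proof (rule Bochner_Integration.integrable_bound[OF integrable_inverse_1_plus_square'[of M]])
    show "nth_deriv n A \<in> borel_measurable lborel" using borel_measurable_schwartz[OF assms] by simp
    show "AE x in lborel. norm (nth_deriv n A x) \<le> norm (M * (1 / (1 + x\<^sup>2)))"
      by (rule AE_I2) (use M in \<open>auto intro: order_trans\<close>)
  qed
qed

lemma schwartz_tendsto_0:
  assumes "schwartz A"
  shows "(nth_deriv n A \<longlongrightarrow> 0) at_top" "(nth_deriv n A \<longlongrightarrow> 0) at_bot"
proof -
  obtain M where M: "M > 0" "\<And>x. cmod (nth_deriv n A x) \<le> M * (1 / (1 + x\<^sup>2))"
    using schwartz_decay[OF assms, of n] by blast
  have 1: "((\<lambda>x::real. M * (1 / (1 + x\<^sup>2))) \<longlongrightarrow> 0) at_top" by real_asymp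
  have 2: "((\<lambda>x::real. M * (1 / (1 + x\<^sup>2))) \<longlongrightarrow> 0) at_bot" by real_asymp
  show "(nth_deriv n A \<longlongrightarrow> 0) at_top" by (rule Lim_null_comparison[OF _ 1]) (use M in auto)
  show "(nth_deriv n A \<longlongrightarrow> 0) at_bot" by (rule Lim_null_comparison[OF _ 2]) (use M in auto)
qed

definition fourier :: "(real \<Rightarrow> complex) \<Rightarrow> real \<Rightarrow> complex" where
  "fourier f \<zeta> = (LINT x|lborel. f x * iexp (- (x * \<zeta>)))"

lemma norm_fourier_le: "cmod (fourier f \<zeta>) \<le> (LINT x|lborel. cmod (f x))"
proof -
  have "cmod (fourier f \<zeta>) \<le> (LINT x|lborel. cmod (f x * iexp (- (x * \<zeta>))))"
    unfolding fourier_def by (rule integral_norm_bound)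
  then show ?thesis by (simp add: norm_mult)
qed

lemma integrable_mult_iexp:
  fixes f :: "real \<Rightarrow> complex"
  assumes "integrable lborel f" "g \<in> borel_measurable borel"
  shows "integrable lborel (\<lambda>x. f x * iexp (g x))"
  by (rule Bochner_Integration.integrable_bound[OF assms(1)]) (use assms in \<open>auto simp: norm_mult\<close>)

lemma fourier_derivative:
  assumes "schwartz A"
  shows "fourier (nth_deriv (Suc n) A) \<zeta> = \<i> * complex_of_real \<zeta> * fourier (nth_deriv n A) \<zeta>"
proof -
  let ?f = "nth_deriv n A" and ?f' = "nth_deriv (Suc n) A"
  let ?e = "\<lambda>x. iexp (- (x * \<zeta>))"
  have de: "(?e has_vector_derivative (- \<i> * complex_of_real \<zeta>) * ?e x) (at x)" for x
  proof -
    have "((\<lambda>x. \<i> * complex_of_real (- (x * \<zeta>))) has_vector_derivative (- \<i> * complex_of_real \<zeta>)) (at x)"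
      unfolding of_real_minus of_real_mult by (auto intro!: derivative_eq_intros)
    from field_vector_diff_chain_at[OF this DERIV_exp] show ?thesis by (simp add: o_def)
  qed
  have i: "integrable lborel (\<lambda>x. ?f x * ?e x)" "integrable lborel (\<lambda>x. ?f' x * ?e x)"
    by (intro integrable_mult_iexp schwartz_integrable[OF assms]; simp)+
  have "(LINT x|lborel. ?f' x * ?e x - \<i> * complex_of_real \<zeta> * (?f x * ?e x)) = 0"
  proof (rule integral_vector_derivative_eq_0[where G="\<lambda>x. ?f x * ?e x"])
    show "((\<lambda>x. ?f x * ?e x) has_vector_derivative ?f' x * ?e x - \<i> * complex_of_real \<zeta> * (?f x * ?e x)) (at x)" for x
      using has_vector_derivative_mult[OF schwartz_has_vector_derivative[OF assms] de[of x]] by (simp add: algebra_simps)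
    show "integrable lborel (\<lambda>x. ?f' x * ?e x - \<i> * complex_of_real \<zeta> * (?f x * ?e x))"
      by (intro Bochner_Integration.integrable_diff integrable_mult_right i)
    show "((\<lambda>x. ?f x * ?e x) \<longlongrightarrow> 0) at_top" "((\<lambda>x. ?f x * ?e x) \<longlongrightarrow> 0) at_bot"
      by (rule Lim_null_comparison[OF _ tendsto_norm_zero[OF schwartz_tendsto_0(1)[OF assms, of n]]]; simp add: norm_mult)
        (rule Lim_null_comparison[OF _ tendsto_norm_zero[OF schwartz_tendsto_0(2)[OF assms, of n]]]; simp add: norm_mult)
  qed
  then show ?thesis
    by (subst (asm) Bochner_Integration.integral_diff[OF i(2) integrable_mult_right[OF i(1)]]) (simp add: fourier_def)
qed

lemma fourier_decay:
  assumes "schwartz A"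
  obtains C where "C > 0" "\<And>\<zeta>::real. cmod (fourier A \<zeta>) * (1 + \<bar>\<zeta>\<bar>) ^ N \<le> C"
proof -
  have pw: "fourier (nth_deriv n A) \<zeta> = (\<i> * complex_of_real \<zeta>) ^ n * fourier A \<zeta>" for n and \<zeta> :: real
    by (induction n) (simp_all add: fourier_derivative[OF assms] mult.assoc)
  let ?L = "\<lambda>n. LINT x|lborel. cmod (nth_deriv n A x)"
  have L: "\<bar>\<zeta>\<bar> ^ n * cmod (fourier A \<zeta>) \<le> ?L n" for n and \<zeta> :: real
    using norm_fourier_le[of "nth_deriv n A" \<zeta>] by (simp add: pw norm_mult norm_power)
  show ?thesis
  proof (rule that[of "2 ^ N * (?L 0 + ?L N) + 1"])
    have "0 \<le> ?L n" for n by (rule integral_nonneg_AE) simp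
    then show "2 ^ N * (?L 0 + ?L N) + 1 > 0" by (intro add_nonneg_pos mult_nonneg_nonneg add_nonneg_nonneg) auto
    fix \<zeta> :: real
    have "(1 + \<bar>\<zeta>\<bar>) ^ N \<le> 2 ^ N * (1 + \<bar>\<zeta>\<bar> ^ N)"
    proof (cases "\<bar>\<zeta>\<bar> \<le> 1")
      case True
      then have "(1 + \<bar>\<zeta>\<bar>) ^ N \<le> 2 ^ N * 1" by (auto intro: power_mono)
      also have "\<dots> \<le> 2 ^ N * (1 + \<bar>\<zeta>\<bar> ^ N)" by (intro mult_left_mono) auto
      finally show ?thesis .
    next
      case False
      then have "(1 + \<bar>\<zeta>\<bar>) ^ N \<le> (2 * \<bar>\<zeta>\<bar>) ^ N" by (intro power_mono) auto
      also have "\<dots> \<le> 2 ^ N * (1 + \<bar>\<zeta>\<bar> ^ N)" by (simp add: power_mult_distrib)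
      finally show ?thesis .
    qed
    then have "cmod (fourier A \<zeta>) * (1 + \<bar>\<zeta>\<bar>) ^ N \<le> cmod (fourier A \<zeta>) * (2 ^ N * (1 + \<bar>\<zeta>\<bar> ^ N))"
      by (intro mult_left_mono) auto
    also have "\<dots> = 2 ^ N * (\<bar>\<zeta>\<bar> ^ 0 * cmod (fourier A \<zeta>) + \<bar>\<zeta>\<bar> ^ N * cmod (fourier A \<zeta>))"
      by (simp add: algebra_simps)
    also have "\<dots> \<le> 2 ^ N * (?L 0 + ?L N)" by (intro mult_left_mono add_mono L) auto
    finally show "cmod (fourier A \<zeta>) * (1 + \<bar>\<zeta>\<bar>) ^ N \<le> 2 ^ N * (?L 0 + ?L N) + 1" by simp
  qed
qed

lemma borel_measurable_fourier:
  assumes [measurable]: "f \<in> borel_measurable borel"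
  shows "fourier f \<in> borel_measurable borel"
proof -
  have "(\<lambda>\<zeta>. LINT x|lborel. f x * iexp (- (x * \<zeta>))) \<in> borel_measurable borel"
    by (rule lborel.borel_measurable_lebesgue_integral) measurable
  then show ?thesis by (simp add: fourier_def[abs_def])
qed

lemma integrable_fourier_weighted:
  assumes "schwartz A"
  shows "integrable lborel (\<lambda>\<zeta>. (1 + \<bar>\<zeta>\<bar>) ^ N * cmod (fourier A \<zeta>))"
proof -
  obtain C where C: "C > 0" "\<And>\<zeta>. cmod (fourier A \<zeta>) * (1 + \<bar>\<zeta>\<bar>) ^ (N + 2) \<le> C"
    using fourier_decay[OF assms] by blast
  have m[measurable]: "fourier A \<in> borel_measurable borel"
    using borel_measurable_fourier[OF borel_measurable_schwartz[OF assms, of 0]] by simp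
  show ?thesis
  proof (rule Bochner_Integration.integrable_bound[OF integrable_inverse_1_plus_square'[of C]])
    show "AE x in lborel. norm ((1 + \<bar>x\<bar>) ^ N * cmod (fourier A x)) \<le> norm (C * (1 / (1 + x\<^sup>2)))"
    proof (rule AE_I2)
      fix x :: real
      have p: "1 + x\<^sup>2 > 0" by (simp add: add_pos_nonneg)
      have "(1 + \<bar>x\<bar>) ^ N * cmod (fourier A x) * (1 + x\<^sup>2) \<le> (1 + \<bar>x\<bar>) ^ N * cmod (fourier A x) * (1 + \<bar>x\<bar>) ^ 2"
        by (intro mult_left_mono) (auto simp: power2_eq_square algebra_simps)
      also have "\<dots> \<le> C" using C(2)[of x] by (simp add: power_add power2_eq_square mult_ac)
      finally show "norm ((1 + \<bar>x\<bar>) ^ N * cmod (fourier A x)) \<le> norm (C * (1 / (1 + x\<^sup>2)))"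
        using p C by (simp add: pos_le_divide_eq abs_mult)
    qed
  qed measurable
qed

lemma integrable_fourier:
  assumes "schwartz A"
  shows "integrable lborel (fourier A)"
proof (rule Bochner_Integration.integrable_bound[OF integrable_fourier_weighted[OF assms, of 0]])
  show "fourier A \<in> borel_measurable lborel"
    using borel_measurable_fourier[OF borel_measurable_schwartz[OF assms, of 0]] by simp
qed auto

text \<open>
The integrability on the plane that Fubini's theorem asks for.
\<close>
lemma integrable_pair_product_bound:
  fixes f :: "real \<Rightarrow> real \<Rightarrow> complex" and g h :: "real \<Rightarrow> real"
  assumes m: "case_prod f \<in> borel_measurable (borel \<Otimes>\<^sub>M borel)"
    and g: "integrable lborel g" and h: "integrable lborel h"
    and b: "\<And>x y. cmod (f x y) \<le> g x * h y"
  shows "integrable (lborel \<Otimes>\<^sub>M lborel) (case_prod f)"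
proof (rule Bochner_Integration.integrable_bound)
  have [measurable]: "g \<in> borel_measurable borel" "h \<in> borel_measurable borel" using g h by auto
  show "integrable (lborel \<Otimes>\<^sub>M lborel) (\<lambda>(x, y). g x * h y)"
  proof (rule lborel_pair.Fubini_integrable)
    show "(\<lambda>(x, y). g x * h y) \<in> borel_measurable (lborel \<Otimes>\<^sub>M lborel)"
      by measurable
    have "(\<lambda>x. LINT y|lborel. norm (case (x, y) of (x, y) \<Rightarrow> g x * h y)) = (\<lambda>x. \<bar>g x\<bar> * (LINT y|lborel. \<bar>h y\<bar>))"
      by (simp add: abs_mult)
    then show "integrable lborel (\<lambda>x. LINT y|lborel. norm (case (x, y) of (x, y) \<Rightarrow> g x * h y))"
      using g by simp
    show "AE x in lborel. integrable lborel (\<lambda>y. case (x, y) of (x, y) \<Rightarrow> g x * h y)"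
      using h by simp
  qed
  show "case_prod f \<in> borel_measurable (lborel \<Otimes>\<^sub>M lborel)"
  proof -
    have "borel_measurable (lborel \<Otimes>\<^sub>M lborel) = (borel_measurable (borel \<Otimes>\<^sub>M borel) :: (real \<times> real \<Rightarrow> complex) set)"
      by (intro measurable_cong_sets sets_pair_measure_cong) auto
    then show ?thesis using m by blast
  qed
  show "AE z in lborel \<Otimes>\<^sub>M lborel. norm (case_prod f z) \<le> norm (case z of (x, y) \<Rightarrow> g x * h y)"
    by (rule AE_I2) (auto intro: order_trans[OF b])
qed

text \<open>
A rescaled form of the characteristic function of the standard normal distribution.
\<close>
lemma fourier_gaussian:
  fixes t \<epsilon> :: real
  assumes "\<epsilon> > 0"
  shows "(LINT \<zeta>|lborel. complex_of_real (exp (- (\<epsilon>\<^sup>2 / 2 * \<zeta>\<^sup>2))) * iexp (t * \<zeta>)) = complex_of_real (sqrt (2 * pi) / \<epsilon> * exp (- ((t / \<epsilon>)\<^sup>2 / 2)))"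
proof -
  have "char std_normal_distribution (t / \<epsilon>) = complex_of_real (exp (- ((t / \<epsilon>)\<^sup>2 / 2)))"
    by (simp add: char_std_normal_distribution)
  moreover have "char std_normal_distribution (t / \<epsilon>) = (LINT x|lborel. std_normal_density x *\<^sub>R iexp (t / \<epsilon> * x))"
    unfolding char_def by (subst integral_density) (auto simp: normal_density_nonneg)
  moreover have "\<dots> = \<bar>\<epsilon>\<bar> *\<^sub>R (LINT x|lborel. std_normal_density (0 + \<epsilon> * x) *\<^sub>R iexp (t / \<epsilon> * (0 + \<epsilon> * x)))"
    by (rule lborel_integral_real_affine) (use assms in auto)
  moreover have "(\<lambda>x. std_normal_density (0 + \<epsilon> * x) *\<^sub>R iexp (t / \<epsilon> * (0 + \<epsilon> * x)))
     = (\<lambda>x. complex_of_real (1 / sqrt (2 * pi)) * (complex_of_real (exp (- (\<epsilon>\<^sup>2 / 2 * x\<^sup>2))) * iexp (t * x)))"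
    using assms by (auto simp: fun_eq_iff std_normal_density_def scaleR_conv_of_real power_mult_distrib)
  ultimately have "complex_of_real (exp (- ((t / \<epsilon>)\<^sup>2 / 2))) =
     complex_of_real \<epsilon> * (complex_of_real (1 / sqrt (2 * pi)) * (LINT \<zeta>|lborel. complex_of_real (exp (- (\<epsilon>\<^sup>2 / 2 * \<zeta>\<^sup>2))) * iexp (t * \<zeta>)))"
    using assms by (simp only: integral_mult_right_zero scaleR_conv_of_real abs_of_pos)
  then show ?thesis using assms by (simp add: field_simps)
qed

text \<open>
Gaussian regularisation: with the factor \<open>exp (- \<epsilon>\<^sup>2 \<zeta>\<^sup>2 / 2)\<close> the order of integration may be exchanged, and the left-hand
side becomes the convolution of \<open>A\<close> with an approximate identity; both sides converge by dominated convergence as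
\<open>\<epsilon> \<rightarrow> 0\<close>.
\<close>
lemma fourier_inversion:
  assumes A: "schwartz A"
  shows "(LINT \<zeta>|lborel. fourier A \<zeta> * iexp (x * \<zeta>)) = complex_of_real (2 * pi) * A x"
proof -
  define \<epsilon> where "\<epsilon> n = 1 / (real n + 1)" for n :: nat
  have e: "\<epsilon> n > 0" for n by (simp add: \<epsilon>_def)
  have e0: "\<epsilon> \<longlonglongrightarrow> 0" unfolding \<epsilon>_def by real_asymp
  have [measurable]: "A \<in> borel_measurable borel" using borel_measurable_schwartz[OF A, of 0] by simp
  have [measurable]: "fourier A \<in> borel_measurable borel" by (rule borel_measurable_fourier) measurable
  have iA: "integrable lborel A" using schwartz_integrable[OF A, of 0] by simp
  let ?G = "\<lambda>n \<zeta>. complex_of_real (exp (- ((\<epsilon> n)\<^sup>2 / 2 * \<zeta>\<^sup>2)))"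
  have gi: "integrable lborel (\<lambda>\<zeta>. exp (- ((\<epsilon> n)\<^sup>2 / 2 * \<zeta>\<^sup>2)))" for n
    using has_bochner_integral_gaussian[of "(\<epsilon> n)\<^sup>2 / 2"] e[of n] by (simp add: has_bochner_integral_iff)
  have 1: "(\<lambda>n. LINT \<zeta>|lborel. fourier A \<zeta> * iexp (x * \<zeta>) * ?G n \<zeta>) \<longlonglongrightarrow> (LINT \<zeta>|lborel. fourier A \<zeta> * iexp (x * \<zeta>))"
  proof (rule integral_dominated_convergence)
    show "integrable lborel (\<lambda>\<zeta>. cmod (fourier A \<zeta>))" using integrable_fourier[OF A] by (rule integrable_norm)
    show "AE \<zeta> in lborel. (\<lambda>n. fourier A \<zeta> * iexp (x * \<zeta>) * ?G n \<zeta>) \<longlonglongrightarrow> fourier A \<zeta> * iexp (x * \<zeta>)"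
    proof (rule AE_I2)
      fix \<zeta>
      have "(\<lambda>n. ?G n \<zeta>) \<longlonglongrightarrow> complex_of_real (exp (- (0\<^sup>2 / 2 * \<zeta>\<^sup>2)))"
        by (intro tendsto_intros e0) auto
      from tendsto_mult_left[OF this] show "(\<lambda>n. fourier A \<zeta> * iexp (x * \<zeta>) * ?G n \<zeta>) \<longlonglongrightarrow> fourier A \<zeta> * iexp (x * \<zeta>)"
        by simp
    qed
    show "AE \<zeta> in lborel. norm (fourier A \<zeta> * iexp (x * \<zeta>) * ?G n \<zeta>) \<le> cmod (fourier A \<zeta>)" for n
      by (rule AE_I2) (simp add: norm_mult mult_left_le)
  qed measurable
  have 2: "(LINT \<zeta>|lborel. fourier A \<zeta> * iexp (x * \<zeta>) * ?G n \<zeta>)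
      = complex_of_real (sqrt (2 * pi)) * (LINT v|lborel. A (x + \<epsilon> n * v) * complex_of_real (exp (- (1/2 * v\<^sup>2))))" for n
  proof -
    let ?K = "\<lambda>u \<zeta>. A u * (?G n \<zeta> * iexp ((x - u) * \<zeta>))"
    have int: "integrable (lborel \<Otimes>\<^sub>M lborel) (case_prod ?K)"
      by (rule integrable_pair_product_bound[OF _ integrable_norm[OF iA] gi[of n]]) (auto simp: norm_mult)
    have "(LINT \<zeta>|lborel. fourier A \<zeta> * iexp (x * \<zeta>) * ?G n \<zeta>) = (LINT \<zeta>|lborel. LINT u|lborel. ?K u \<zeta>)"
    proof (rule Bochner_Integration.integral_cong[OF refl])
      fix \<zeta>
      have "fourier A \<zeta> * iexp (x * \<zeta>) * ?G n \<zeta> = (LINT u|lborel. A u * iexp (- (u * \<zeta>)) * (iexp (x * \<zeta>) * ?G n \<zeta>))"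
        unfolding fourier_def integral_mult_left_zero by (rule mult.assoc)
      also have "(\<lambda>u. A u * iexp (- (u * \<zeta>)) * (iexp (x * \<zeta>) * ?G n \<zeta>)) = (\<lambda>u. ?K u \<zeta>)"
        by (auto simp: fun_eq_iff algebra_simps simp flip: exp_add)
      finally show "fourier A \<zeta> * iexp (x * \<zeta>) * ?G n \<zeta> = (LINT u|lborel. ?K u \<zeta>)" .
    qed
    also have "\<dots> = (LINT u|lborel. LINT \<zeta>|lborel. ?K u \<zeta>)"
      by (rule lborel_pair.Fubini_integral[OF int])
    also have "\<dots> = (LINT u|lborel. A u * complex_of_real (sqrt (2 * pi) / \<epsilon> n * exp (- (((x - u) / \<epsilon> n)\<^sup>2 / 2))))"
      by (simp only: integral_mult_right_zero fourier_gaussian[OF e])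
    also have "\<dots> = \<bar>\<epsilon> n\<bar> *\<^sub>R (LINT v|lborel. A (x + \<epsilon> n * v) * complex_of_real (sqrt (2 * pi) / \<epsilon> n * exp (- (((x - (x + \<epsilon> n * v)) / \<epsilon> n)\<^sup>2 / 2))))"
      by (rule lborel_integral_real_affine) (use e[of n] in auto)
    also have "(\<lambda>v. A (x + \<epsilon> n * v) * complex_of_real (sqrt (2 * pi) / \<epsilon> n * exp (- (((x - (x + \<epsilon> n * v)) / \<epsilon> n)\<^sup>2 / 2))))
       = (\<lambda>v. complex_of_real (sqrt (2 * pi) / \<epsilon> n) * (A (x + \<epsilon> n * v) * complex_of_real (exp (- (1/2 * v\<^sup>2)))))"
      using e[of n] by (auto simp: fun_eq_iff)
    finally show ?thesis using e[of n] by (simp add: scaleR_conv_of_real)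
  qed
  obtain M where M: "M > 0" "\<And>x. cmod (nth_deriv 0 A x) \<le> M * (1 / (1 + x\<^sup>2))"
    using schwartz_decay[OF A, of 0] by blast
  have AM: "cmod (A u) \<le> M" for u
  proof -
    have "M * (1 / (1 + u\<^sup>2)) \<le> M * 1" using M(1) by (intro mult_left_mono) (auto simp: divide_le_eq_1 add_pos_nonneg)
    then show ?thesis using M(2)[of u] by simp
  qed
  have gh: "has_bochner_integral lborel (\<lambda>v. exp (- (1/2 * v\<^sup>2))) (sqrt (2 * pi))"
    using has_bochner_integral_gaussian[of "1/2"] by (simp add: mult.commute)
  have 3: "(\<lambda>n. LINT v|lborel. A (x + \<epsilon> n * v) * complex_of_real (exp (- (1/2 * v\<^sup>2)))) \<longlonglongrightarrow> (LINT v|lborel. A x * complex_of_real (exp (- (1/2 * v\<^sup>2))))"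
  proof (rule integral_dominated_convergence)
    show "integrable lborel (\<lambda>v. M * exp (- (1/2 * v\<^sup>2)))" using gh by (intro integrable_mult_right) (simp add: has_bochner_integral_iff)
    show "AE v in lborel. (\<lambda>n. A (x + \<epsilon> n * v) * complex_of_real (exp (- (1/2 * v\<^sup>2)))) \<longlonglongrightarrow> A x * complex_of_real (exp (- (1/2 * v\<^sup>2)))"
    proof (rule AE_I2)
      fix v
      have "isCont A x" using schwartz_continuous[OF A, of 0] by (simp add: continuous_on_eq_continuous_at)
      moreover have "(\<lambda>n. x + \<epsilon> n * v) \<longlonglongrightarrow> x + 0 * v" by (intro tendsto_intros e0)
      ultimately have "(\<lambda>n. A (x + \<epsilon> n * v)) \<longlonglongrightarrow> A x" by (intro isCont_tendsto_compose[of x A]) simp_all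
      then show "(\<lambda>n. A (x + \<epsilon> n * v) * complex_of_real (exp (- (1/2 * v\<^sup>2)))) \<longlonglongrightarrow> A x * complex_of_real (exp (- (1/2 * v\<^sup>2)))"
        by (rule tendsto_mult_right)
    qed
    show "AE v in lborel. norm (A (x + \<epsilon> n * v) * complex_of_real (exp (- (1/2 * v\<^sup>2)))) \<le> M * exp (- (1/2 * v\<^sup>2))" for n
      by (rule AE_I2) (simp add: norm_mult AM)
  qed measurable
  have "(LINT \<zeta>|lborel. fourier A \<zeta> * iexp (x * \<zeta>)) = complex_of_real (sqrt (2 * pi)) * (LINT v|lborel. A x * complex_of_real (exp (- (1/2 * v\<^sup>2))))"
    using LIMSEQ_unique[OF 1[unfolded 2] tendsto_mult_left[OF 3]] .
  also have "(LINT v|lborel. A x * complex_of_real (exp (- (1/2 * v\<^sup>2)))) = A x * complex_of_real (sqrt (2 * pi))"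
    using gh by (simp only: integral_mult_right_zero integral_complex_of_real has_bochner_integral_iff)
  also have "complex_of_real (sqrt (2 * pi)) * (A x * complex_of_real (sqrt (2 * pi))) = complex_of_real (sqrt (2 * pi) * sqrt (2 * pi)) * A x"
    by (simp only: of_real_mult mult_ac)
  also have "sqrt (2 * pi) * sqrt (2 * pi) = 2 * pi" by simp
  finally show ?thesis by simp
qed

text \<open>
The Airy function is the Fourier transform of \<open>exp (- i v\<^sup>3 / 3)\<close>, which is not integrable. Written over the line
\<open>Re t = a\<close>, the integral for \<open>exp (s a) Ai s\<close> is the Fourier transform of \<open>exp ((a + i v)\<^sup>3 / 3)\<close>, a function with
Gaussian decay. For \<open>a > 0\<close> Fubini's theorem and Fourier inversion give the identity, and \<open>a \<rightarrow> 0\<close> is allowed by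
dominated convergence on both sides.
\<close>
lemma fourier_times_airy:
  assumes A: "schwartz A" and c: "c \<noteq> 0"
  shows "(LINT \<zeta>|lborel. fourier A \<zeta> * iexp (w * \<zeta>) * Ai (complex_of_real (c * \<zeta>)))
     = (LINT v|lborel. iexp (- (v ^ 3 / 3)) * A (w - c * v))"
proof -
  define a where "a n = 1 / (real n + 1)" for n :: nat
  have a: "a n > 0" "a n \<le> 1" for n by (auto simp: a_def)
  have a0: "a \<longlonglongrightarrow> 0" unfolding a_def by real_asymp
  have [measurable]: "A \<in> borel_measurable borel" using borel_measurable_schwartz[OF A, of 0] by simp
  have [measurable]: "fourier A \<in> borel_measurable borel" by (rule borel_measurable_fourier) measurable
  have [measurable]: "(\<lambda>s. Ai (complex_of_real s)) \<in> borel_measurable borel"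
    by (rule borel_measurable_continuous_onI[OF continuous_on_Ai_real])
  have iA: "integrable lborel A" using schwartz_integrable[OF A, of 0] by simp
  have iA': "integrable lborel (\<lambda>v. A (w - c * v))"
    using lborel_integrable_real_affine[OF iA, of "-c" w] c by simp
  obtain C1 where C1: "C1 > 0" "\<And>s::real. cmod (Ai s) \<le> C1 * exp (- s)" using Ai_real_exp_decay by blast
  obtain C2 where C2: "C2 > 0" "\<And>s::real. cmod (Ai s) \<le> C2 * (1 + \<bar>s\<bar>)" using Ai_real_linear_growth by blast
  \<comment> \<open>The exponential decay of Ai for s > 0 compensates exp (s a) because a <= 1; for s < 0 the factor is at most 1.\<close>
  have dom: "exp (s * a n) * cmod (Ai (complex_of_real s)) \<le> C1 + C2 * (1 + \<bar>s\<bar>)" for n s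
  proof (cases "s \<ge> 0")
    case True
    then have "s * a n \<le> s" using a[of n] by (simp add: mult_left_le)
    then have "exp (s * a n) * cmod (Ai (complex_of_real s)) \<le> exp s * (C1 * exp (- s))"
      using C1(2)[of s] by (intro mult_mono) auto
    also have "\<dots> = C1" by (simp add: exp_minus)
    finally show ?thesis using C2(1) by (simp add: add_increasing2)
  next
    case False
    then have "s * a n \<le> 0" using a[of n] by (simp add: mult_nonpos_nonneg)
    then have "exp (s * a n) * cmod (Ai (complex_of_real s)) \<le> 1 * (C2 * (1 + \<bar>s\<bar>))"
      using C2(2)[of s] by (intro mult_mono) auto
    then show ?thesis using C1(1) by simp
  qed
  let ?E = "\<lambda>n v. exp ((complex_of_real (a n) + \<i> * complex_of_real v) ^ 3 / 3)"
  have nE: "cmod (?E n v) = exp (a n ^ 3 / 3) * exp (- (a n * v\<^sup>2))" for n v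
    using norm_airy_kernel_line[of 0 "a n" v] by (simp add: airy_kernel_def exp_add[symmetric])
  have kE: "airy_kernel (complex_of_real s) (complex_of_real (a n) + \<i> * complex_of_real v)
      = complex_of_real (exp (- (s * a n))) * (?E n v * iexp (- (s * v)))" for s n v
  proof -
    have "(complex_of_real (a n) + \<i> * complex_of_real v) ^ 3 / 3 - complex_of_real s * (complex_of_real (a n) + \<i> * complex_of_real v)
      = complex_of_real (- (s * a n)) + ((complex_of_real (a n) + \<i> * complex_of_real v) ^ 3 / 3 + \<i> * complex_of_real (- (s * v)))"
      by (simp add: algebra_simps)
    then show ?thesis unfolding airy_kernel_def by (simp only: exp_add exp_of_real)
  qed
  have Ei: "integrable lborel (\<lambda>v. exp (a n ^ 3 / 3) * exp (- (a n * v\<^sup>2)))" for n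
    using has_bochner_integral_gaussian[OF a(1)[of n]] by (intro integrable_mult_right) (simp add: has_bochner_integral_iff)
  have eq: "(LINT \<zeta>|lborel. fourier A \<zeta> * iexp (w * \<zeta>) * (complex_of_real (exp (c * \<zeta> * a n)) * Ai (complex_of_real (c * \<zeta>))))
      = (LINT v|lborel. ?E n v * A (w - c * v))" for n
  proof -
    let ?K = "\<lambda>\<zeta> v. fourier A \<zeta> * (?E n v * iexp ((w - c * v) * \<zeta>))"
    have int: "integrable (lborel \<Otimes>\<^sub>M lborel) (case_prod ?K)"
    proof (rule integrable_pair_product_bound[OF _ integrable_norm[OF integrable_fourier[OF A]] Ei[of n]])
      show "case_prod ?K \<in> borel_measurable (borel \<Otimes>\<^sub>M borel)" by measurable
      show "cmod (?K \<zeta> v) \<le> cmod (fourier A \<zeta>) * (exp (a n ^ 3 / 3) * exp (- (a n * v\<^sup>2)))" for \<zeta> v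
        by (simp only: norm_mult nE norm_exp_i_times mult_1_right order_refl)
    qed
    have "(LINT \<zeta>|lborel. fourier A \<zeta> * iexp (w * \<zeta>) * (complex_of_real (exp (c * \<zeta> * a n)) * Ai (complex_of_real (c * \<zeta>))))
       = (LINT \<zeta>|lborel. 1 / (2 * pi) * (LINT v|lborel. ?K \<zeta> v))"
    proof (rule Bochner_Integration.integral_cong[OF refl])
      fix \<zeta>
      let ?s = "c * \<zeta>"
      have "Ai (complex_of_real ?s) = 1 / (2 * pi) * (complex_of_real (exp (- (?s * a n))) * (LINT v|lborel. ?E n v * iexp (- (?s * v))))"
        by (subst Ai_line_real[OF a(1)[of n]]) (simp only: kE integral_mult_right_zero)
      then have "complex_of_real (exp (?s * a n)) * Ai (complex_of_real ?s)
         = 1 / (2 * pi) * ((complex_of_real (exp (?s * a n)) * complex_of_real (exp (- (?s * a n)))) * (LINT v|lborel. ?E n v * iexp (- (?s * v))))"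
        by (simp only: mult_ac)
      also have "complex_of_real (exp (?s * a n)) * complex_of_real (exp (- (?s * a n))) = 1"
        by (simp flip: of_real_mult exp_add)
      finally have "fourier A \<zeta> * iexp (w * \<zeta>) * (complex_of_real (exp (?s * a n)) * Ai (complex_of_real ?s))
         = 1 / (2 * pi) * ((fourier A \<zeta> * iexp (w * \<zeta>)) * (LINT v|lborel. ?E n v * iexp (- (?s * v))))"
        by (simp only: mult_ac mult_1_right mult_1_left)
      also have "(fourier A \<zeta> * iexp (w * \<zeta>)) * (LINT v|lborel. ?E n v * iexp (- (?s * v)))
          = (LINT v|lborel. (fourier A \<zeta> * iexp (w * \<zeta>)) * (?E n v * iexp (- (?s * v))))"
        by (simp only: integral_mult_right_zero)
      also have "(\<lambda>v. (fourier A \<zeta> * iexp (w * \<zeta>)) * (?E n v * iexp (- (?s * v)))) = ?K \<zeta>"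
      proof
        fix v
        have "\<i> * complex_of_real ((w - c * v) * \<zeta>) = \<i> * complex_of_real (w * \<zeta>) + \<i> * complex_of_real (- (?s * v))"
          by (simp add: algebra_simps)
        then have "iexp ((w - c * v) * \<zeta>) = iexp (w * \<zeta>) * iexp (- (?s * v))" by (simp only: exp_add)
        then show "(fourier A \<zeta> * iexp (w * \<zeta>)) * (?E n v * iexp (- (?s * v))) = ?K \<zeta> v" by (simp only: mult_ac)
      qed
      finally show "fourier A \<zeta> * iexp (w * \<zeta>) * (complex_of_real (exp (?s * a n)) * Ai (complex_of_real ?s))
         = 1 / (2 * pi) * (LINT v|lborel. ?K \<zeta> v)" .
    qed
    also have "\<dots> = 1 / (2 * pi) * (LINT \<zeta>|lborel. LINT v|lborel. ?K \<zeta> v)" by (rule integral_mult_right_zero)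
    also have "(LINT \<zeta>|lborel. LINT v|lborel. ?K \<zeta> v) = (LINT v|lborel. LINT \<zeta>|lborel. ?K \<zeta> v)"
      by (rule lborel_pair.Fubini_integral[OF int, symmetric])
    also have "\<dots> = (LINT v|lborel. (2 * pi) * (?E n v * A (w - c * v)))"
    proof (rule Bochner_Integration.integral_cong[OF refl])
      fix v
      have "(LINT \<zeta>|lborel. ?K \<zeta> v) = (LINT \<zeta>|lborel. ?E n v * (fourier A \<zeta> * iexp ((w - c * v) * \<zeta>)))"
        by (simp only: mult_ac)
      also have "\<dots> = ?E n v * (LINT \<zeta>|lborel. fourier A \<zeta> * iexp ((w - c * v) * \<zeta>))"
        by (rule integral_mult_right_zero)
      also have "(LINT \<zeta>|lborel. fourier A \<zeta> * iexp ((w - c * v) * \<zeta>)) = complex_of_real (2 * pi) * A (w - c * v)"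
        by (rule fourier_inversion[OF A])
      finally show "(LINT \<zeta>|lborel. ?K \<zeta> v) = (2 * pi) * (?E n v * A (w - c * v))" by (simp add: mult_ac)
    qed
    also have "\<dots> = (2 * pi) * (LINT v|lborel. ?E n v * A (w - c * v))" by (rule integral_mult_right_zero)
    finally show ?thesis by simp
  qed
  have L1: "(\<lambda>n. LINT \<zeta>|lborel. fourier A \<zeta> * iexp (w * \<zeta>) * (complex_of_real (exp (c * \<zeta> * a n)) * Ai (complex_of_real (c * \<zeta>))))
     \<longlonglongrightarrow> (LINT \<zeta>|lborel. fourier A \<zeta> * iexp (w * \<zeta>) * Ai (complex_of_real (c * \<zeta>)))"
  proof (rule integral_dominated_convergence)
    let ?W = "\<lambda>\<zeta>. (C1 + C2 * (1 + \<bar>c\<bar>)) * ((1 + \<bar>\<zeta>\<bar>) ^ 1 * cmod (fourier A \<zeta>))"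
    show "integrable lborel ?W" by (intro integrable_mult_right integrable_fourier_weighted[OF A])
    show "AE \<zeta> in lborel. norm (fourier A \<zeta> * iexp (w * \<zeta>) * (complex_of_real (exp (c * \<zeta> * a n)) * Ai (complex_of_real (c * \<zeta>)))) \<le> ?W \<zeta>" for n
    proof (rule AE_I2)
      fix \<zeta>
      have "norm (fourier A \<zeta> * iexp (w * \<zeta>) * (complex_of_real (exp (c * \<zeta> * a n)) * Ai (complex_of_real (c * \<zeta>))))
        = cmod (fourier A \<zeta>) * (exp (c * \<zeta> * a n) * cmod (Ai (complex_of_real (c * \<zeta>))))"
        by (simp add: norm_mult)
      also have "\<dots> \<le> cmod (fourier A \<zeta>) * (C1 + C2 * (1 + \<bar>c * \<zeta>\<bar>))"
        by (intro mult_left_mono dom) auto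
      also have "\<dots> \<le> cmod (fourier A \<zeta>) * ((C1 + C2 * (1 + \<bar>c\<bar>)) * (1 + \<bar>\<zeta>\<bar>))"
        using C1(1) C2(1) by (intro mult_left_mono) (simp_all add: abs_mult algebra_simps)
      finally show "norm (fourier A \<zeta> * iexp (w * \<zeta>) * (complex_of_real (exp (c * \<zeta> * a n)) * Ai (complex_of_real (c * \<zeta>)))) \<le> ?W \<zeta>"
        by (simp only: power_one_right mult_ac)
    qed
    show "AE \<zeta> in lborel. (\<lambda>n. fourier A \<zeta> * iexp (w * \<zeta>) * (complex_of_real (exp (c * \<zeta> * a n)) * Ai (complex_of_real (c * \<zeta>))))
       \<longlonglongrightarrow> fourier A \<zeta> * iexp (w * \<zeta>) * Ai (complex_of_real (c * \<zeta>))"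
    proof (rule AE_I2)
      fix \<zeta>
      have "(\<lambda>n. fourier A \<zeta> * iexp (w * \<zeta>) * (complex_of_real (exp (c * \<zeta> * a n)) * Ai (complex_of_real (c * \<zeta>))))
       \<longlonglongrightarrow> fourier A \<zeta> * iexp (w * \<zeta>) * (complex_of_real (exp (c * \<zeta> * 0)) * Ai (complex_of_real (c * \<zeta>)))"
        by (intro tendsto_intros a0)
      then show "(\<lambda>n. fourier A \<zeta> * iexp (w * \<zeta>) * (complex_of_real (exp (c * \<zeta> * a n)) * Ai (complex_of_real (c * \<zeta>))))
       \<longlonglongrightarrow> fourier A \<zeta> * iexp (w * \<zeta>) * Ai (complex_of_real (c * \<zeta>))" by simp
    qed
  qed measurable
  have L2: "(\<lambda>n. LINT v|lborel. ?E n v * A (w - c * v)) \<longlonglongrightarrow> (LINT v|lborel. iexp (- (v ^ 3 / 3)) * A (w - c * v))"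
  proof (rule integral_dominated_convergence)
    show "integrable lborel (\<lambda>v. exp (1/3) * cmod (A (w - c * v)))"
      using iA' by (intro integrable_mult_right integrable_norm)
    show "AE v in lborel. norm (?E n v * A (w - c * v)) \<le> exp (1/3) * cmod (A (w - c * v))" for n
    proof (rule AE_I2)
      fix v
      have "a n ^ 3 \<le> 1" using a[of n] by (simp add: power_le_one)
      moreover have "0 \<le> a n * v\<^sup>2" using a(1)[of n] by simp
      ultimately have "exp (a n ^ 3 / 3) * exp (- (a n * v\<^sup>2)) \<le> exp (1/3)" by (simp flip: exp_add)
      then show "norm (?E n v * A (w - c * v)) \<le> exp (1/3) * cmod (A (w - c * v))"
        unfolding norm_mult nE by (intro mult_right_mono) auto
    qed
    show "AE v in lborel. (\<lambda>n. ?E n v * A (w - c * v)) \<longlonglongrightarrow> iexp (- (v ^ 3 / 3)) * A (w - c * v)"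
    proof (rule AE_I2)
      fix v
      have "(\<lambda>n. ?E n v * A (w - c * v)) \<longlonglongrightarrow> exp ((complex_of_real 0 + \<i> * complex_of_real v) ^ 3 / 3) * A (w - c * v)"
        by (intro tendsto_intros a0) auto
      moreover have "(complex_of_real 0 + \<i> * complex_of_real v) ^ 3 / 3 = \<i> * complex_of_real (- (v ^ 3 / 3))"
        by (simp add: complex_eq_iff power3_eq_cube)
      ultimately show "(\<lambda>n. ?E n v * A (w - c * v)) \<longlonglongrightarrow> iexp (- (v ^ 3 / 3)) * A (w - c * v)" by (simp only:)
    qed
  qed measurable
  show ?thesis
    using LIMSEQ_unique[OF L1[unfolded eq] L2] .
qed

section \<open>Families with uniformly bounded derivatives\<close>

text \<open>
The estimates must be uniform in parameters \<open>i \<in> I\<close>, the homotopy parameter and the observation point. As for symbol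
classes in microlocal analysis, \<open>symbol n W I r\<close> requires \<open>n\<close> derivatives, all of them \<open>O(W i x)\<close> with a constant that
does not depend on \<open>i\<close>. Being closed under sums, products and reciprocals, the class reduces the regularity of every
amplitude below to that of a few building blocks.
\<close>
primrec symbol :: "nat \<Rightarrow> ('i \<Rightarrow> real \<Rightarrow> real) \<Rightarrow> 'i set \<Rightarrow> ('i \<Rightarrow> real \<Rightarrow> complex) \<Rightarrow> bool" where
  "symbol 0 W I r \<longleftrightarrow> (\<exists>M\<ge>0. \<forall>i\<in>I. \<forall>x. cmod (r i x) \<le> M * W i x)"
| "symbol (Suc n) W I r \<longleftrightarrow> (\<exists>M\<ge>0. \<forall>i\<in>I. \<forall>x. cmod (r i x) \<le> M * W i x) \<and>
     (\<exists>r'. (\<forall>i\<in>I. \<forall>x. (r i has_vector_derivative r' i x) (at x)) \<and> symbol n W I r')"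

abbreviation flat :: "'i \<Rightarrow> real \<Rightarrow> real" where "flat \<equiv> \<lambda>_ _. 1"

lemma symbol_bounded: "symbol n W I r \<Longrightarrow> \<exists>M\<ge>0. \<forall>i\<in>I. \<forall>x. cmod (r i x) \<le> M * W i x"
  by (cases n) auto

lemma symbol_SucI:
  assumes "\<exists>M\<ge>0. \<forall>i\<in>I. \<forall>x. cmod (r i x) \<le> M * W i x"
    and "\<And>i x. i \<in> I \<Longrightarrow> (r i has_vector_derivative r' i x) (at x)"
    and "symbol n W I r'"
  shows "symbol (Suc n) W I r"
  using assms by auto

lemma symbol_SucE:
  assumes "symbol (Suc n) W I r"
  shows "\<exists>r'. (\<forall>i\<in>I. \<forall>x. (r i has_vector_derivative r' i x) (at x)) \<and> symbol n W I r'"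
  using assms by simp

lemma symbol_Suc_imp: "symbol (Suc n) W I r \<Longrightarrow> symbol n W I r"
proof (induction n arbitrary: r)
  case (Suc n)
  obtain r' where r': "\<And>i x. i \<in> I \<Longrightarrow> (r i has_vector_derivative r' i x) (at x)" "symbol (Suc n) W I r'"
    using symbol_SucE[OF Suc.prems] by blast
  show ?case
    by (rule symbol_SucI[OF symbol_bounded[OF Suc.prems] r'(1) Suc.IH[OF r'(2)]])
qed auto

lemma symbol_cong:
  assumes "symbol n W I r" "\<And>i x. i \<in> I \<Longrightarrow> r i x = s i x"
  shows "symbol n W I s"
proof -
  have e: "r i = s i" if "i \<in> I" for i using assms(2)[OF that] by auto
  show ?thesis using assms(1) by (cases n) (simp_all add: e cong: ball_cong)
qed

lemma symbol_add:
  assumes "symbol n W I r" "symbol n W I s"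
  shows "symbol n W I (\<lambda>i x. r i x + s i x)"
  using assms
proof (induction n arbitrary: r s)
  have b: "\<exists>M\<ge>0. \<forall>i\<in>I. \<forall>x. cmod (r i x + s i x) \<le> M * W i x"
    if r: "\<exists>M\<ge>0. \<forall>i\<in>I. \<forall>x. cmod (r i x) \<le> M * W i x" and s: "\<exists>M\<ge>0. \<forall>i\<in>I. \<forall>x. cmod (s i x) \<le> M * W i x" for r s :: "'a \<Rightarrow> real \<Rightarrow> complex"
  proof -
    obtain M where M: "M \<ge> 0" "\<And>i x. i \<in> I \<Longrightarrow> cmod (r i x) \<le> M * W i x" using r by auto
    obtain M' where M': "M' \<ge> 0" "\<And>i x. i \<in> I \<Longrightarrow> cmod (s i x) \<le> M' * W i x" using s by auto
    show ?thesis
    proof (intro exI[of _ "M + M'"] conjI ballI allI)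
      show "cmod (r i x + s i x) \<le> (M + M') * W i x" if "i \<in> I" for i x
        using norm_triangle_ineq[of "r i x" "s i x"] M(2)[OF that, of x] M'(2)[OF that, of x] by (simp add: algebra_simps)
    qed (use M M' in auto)
  qed
  {
    case 0
    then show ?case using b by simp
  next
    case (Suc n)
    obtain r' where r': "\<And>i x. i \<in> I \<Longrightarrow> (r i has_vector_derivative r' i x) (at x)" "symbol n W I r'"
      using symbol_SucE[OF Suc.prems(1)] by blast
    obtain s' where s': "\<And>i x. i \<in> I \<Longrightarrow> (s i has_vector_derivative s' i x) (at x)" "symbol n W I s'"
      using symbol_SucE[OF Suc.prems(2)] by blast
    show ?case
      by (rule symbol_SucI[where r'="\<lambda>i x. r' i x + s' i x"])
        (use b[OF symbol_bounded[OF Suc.prems(1)] symbol_bounded[OF Suc.prems(2)]] r' s' Suc.IH in \<open>auto intro: has_vector_derivative_add\<close>)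
  }
qed

text \<open>
One weighted factor suffices: the other one is bounded, with bounded derivatives.
\<close>
lemma symbol_mult:
  assumes "symbol n W I r" "symbol n flat I s"
  shows "symbol n W I (\<lambda>i x. r i x * s i x)"
  using assms
proof (induction n arbitrary: r s)
  have b: "\<exists>M\<ge>0. \<forall>i\<in>I. \<forall>x. cmod (r i x * s i x) \<le> M * W i x"
    if r: "\<exists>M\<ge>0. \<forall>i\<in>I. \<forall>x. cmod (r i x) \<le> M * W i x" and s: "\<exists>M\<ge>0. \<forall>i\<in>I. \<forall>x. cmod (s i x) \<le> M * 1" for r s :: "'a \<Rightarrow> real \<Rightarrow> complex"
  proof -
    obtain M where M: "M \<ge> 0" "\<And>i x. i \<in> I \<Longrightarrow> cmod (r i x) \<le> M * W i x" using r by auto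
    obtain M' where M': "M' \<ge> 0" "\<And>i x. i \<in> I \<Longrightarrow> cmod (s i x) \<le> M'" using s by auto
    show ?thesis
    proof (intro exI[of _ "M * M'"] conjI ballI allI)
      show "cmod (r i x * s i x) \<le> (M * M') * W i x" if "i \<in> I" for i x
      proof -
        have "0 \<le> M * W i x" using M(2)[OF that, of x] norm_ge_zero[of "r i x"] by linarith
        then have "cmod (r i x) * cmod (s i x) \<le> (M * W i x) * M'"
          using M(2)[OF that] M'(2)[OF that] by (intro mult_mono) auto
        then show ?thesis by (simp add: norm_mult mult_ac)
      qed
    qed (use M M' in auto)
  qed
  {
    case 0
    then show ?case using b by simp
  next
    case (Suc n)
    obtain r' where r': "\<And>i x. i \<in> I \<Longrightarrow> (r i has_vector_derivative r' i x) (at x)" "symbol n W I r'"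
      using symbol_SucE[OF Suc.prems(1)] by blast
    obtain s' where s': "\<And>i x. i \<in> I \<Longrightarrow> (s i has_vector_derivative s' i x) (at x)" "symbol n flat I s'"
      using symbol_SucE[OF Suc.prems(2)] by blast
    show ?case
    proof (rule symbol_SucI[where r'="\<lambda>i x. r i x * s' i x + r' i x * s i x"])
      show "\<exists>M\<ge>0. \<forall>i\<in>I. \<forall>x. cmod (r i x * s i x) \<le> M * W i x"
        by (rule b[OF symbol_bounded[OF Suc.prems(1)] symbol_bounded[OF Suc.prems(2)]])
      show "((\<lambda>x. r i x * s i x) has_vector_derivative r i x * s' i x + r' i x * s i x) (at x)" if "i \<in> I" for i x
        by (rule has_vector_derivative_mult[OF r'(1)[OF that] s'(1)[OF that]])
      show "symbol n W I (\<lambda>i x. r i x * s' i x + r' i x * s i x)"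
        by (intro symbol_add Suc.IH symbol_Suc_imp[OF Suc.prems(1)] symbol_Suc_imp[OF Suc.prems(2)] r' s')
    qed
  }
qed

lemma symbol_const:
  assumes "\<And>i. i \<in> I \<Longrightarrow> cmod (c i) \<le> M"
  shows "symbol n flat I (\<lambda>i x. c i)"
  using assms
proof (induction n arbitrary: c M)
  case 0
  then show ?case by (auto intro!: exI[of _ "\<bar>M\<bar>"] intro: order_trans[OF _ abs_ge_self])
next
  case (Suc n)
  show ?case
    by (rule symbol_SucI[where r'="\<lambda>i x. 0"]) (use Suc.prems Suc.IH[of "\<lambda>_. 0" 0] in \<open>auto intro!: exI[of _ "\<bar>M\<bar>"] intro: order_trans[OF _ abs_ge_self]\<close>)
qed

lemma symbol_const' [simp]: "symbol n flat I (\<lambda>i x. c)"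
  by (rule symbol_const[of I "\<lambda>_. c" "cmod c"]) auto

lemma symbol_cmult: "symbol n W I r \<Longrightarrow> symbol n W I (\<lambda>i x. c * r i x)"
  using symbol_mult[of n W I r "\<lambda>i x. c"] by (simp add: mult.commute)

lemma symbol_minus: "symbol n W I r \<Longrightarrow> symbol n W I (\<lambda>i x. - r i x)"
  using symbol_cmult[of n W I r "-1"] by simp

lemma symbol_diff: "symbol n W I r \<Longrightarrow> symbol n W I s \<Longrightarrow> symbol n W I (\<lambda>i x. r i x - s i x)"
  using symbol_add[of n W I r "\<lambda>i x. - s i x"] symbol_minus[of n W I s] by simp

lemma symbol_power: "symbol n flat I r \<Longrightarrow> symbol n flat I (\<lambda>i x. r i x ^ j)"
  by (induction j) (auto intro: symbol_mult)

lemma symbol_inverse: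
  assumes "symbol n flat I r" "c > 0" "\<And>i x. i \<in> I \<Longrightarrow> cmod (r i x) \<ge> c"
  shows "symbol n flat I (\<lambda>i x. 1 / r i x)"
  using assms(1)
proof (induction n)
  have b: "\<exists>M\<ge>0. \<forall>i\<in>I. \<forall>x. cmod (1 / r i x) \<le> M * 1"
  proof (intro exI[of _ "1 / c"] conjI ballI allI)
    show "cmod (1 / r i x) \<le> 1 / c * 1" if "i \<in> I" for i x
      using assms(2) assms(3)[OF that, of x] by (simp add: norm_divide frac_le)
  qed (use assms in auto)
  {
    case 0
    then show ?case using b by simp
  next
    case (Suc n)
    obtain r' where r': "\<And>i x. i \<in> I \<Longrightarrow> (r i has_vector_derivative r' i x) (at x)" "symbol n flat I r'"
      using symbol_SucE[OF Suc.prems(1)] by blast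
    show ?case
    proof (rule symbol_SucI[where r'="\<lambda>i x. - (r' i x * (1 / r i x) * (1 / r i x))", OF b])
      fix i x assume i: "i \<in> I"
      have nz: "r i x \<noteq> 0" using assms(2) assms(3)[OF i, of x] by auto
      have "((\<lambda>z. 1 / z) has_field_derivative - (1 / (r i x * r i x))) (at (r i x))"
        using nz by (auto intro!: derivative_eq_intros)
      from field_vector_diff_chain_at[OF r'(1)[OF i] this]
      show "((\<lambda>x. 1 / r i x) has_vector_derivative - (r' i x * (1 / r i x) * (1 / r i x))) (at x)"
        by (simp add: o_def)
    next
      show "symbol n flat I (\<lambda>i x. - (r' i x * (1 / r i x) * (1 / r i x)))"
        by (intro symbol_minus symbol_mult Suc.IH r' symbol_Suc_imp[OF Suc.prems])
    qed
  }
qed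

lemma symbol_continuous:
  assumes "symbol (Suc n) W I r" "i \<in> I"
  shows "continuous_on UNIV (r i)"
proof -
  obtain r' where r': "\<And>i x. i \<in> I \<Longrightarrow> (r i has_vector_derivative r' i x) (at x)" "symbol n W I r'"
    using symbol_SucE[OF assms(1)] by blast
  show ?thesis
    by (intro continuous_at_imp_continuous_on ballI has_vector_derivative_continuous[OF r'(1)[OF assms(2)]])
qed

lemma symbol_measurable:
  assumes "symbol (Suc n) W I r" "i \<in> I"
  shows "r i \<in> borel_measurable borel"
  by (rule borel_measurable_continuous_onI[OF symbol_continuous[OF assms]])

section \<open>Oscillatory integrals with a cubic phase\<close>

text \<open>
The hypothesis on \<open>E\<close> says that its complex phase has derivative \<open>- k x\<^sup>2 h\<close>, which vanishes to second order at \<open>0\<close>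
only. With \<open>c = k^(1/3)\<close>, the cut-off to the scale \<open>1 / c\<close> is made with the Lorentzian \<open>T = 1 / (1 + (c x)\<^sup>2)\<close>,
for which \<open>1 - T = (c x)\<^sup>2 T\<close>. The function \<open>\<psi> = i (1 - T) T / (c h)\<close> is chosen such that
\<open>\<psi> E' = (1 - T)\<^sup>2 E\<close>. Integrating \<open>(\<psi> f E)'\<close> therefore removes the part \<open>(1 - T)\<^sup>2 f E\<close> of the integrand, and what is left,
\<open>(2 T - T\<^sup>2) f E - \<psi>' f E - \<psi> f' E\<close>, has integral \<open>O(1 / c)\<close> because \<open>T\<close> and \<open>\<psi>'\<close> have, and
\<open>\<psi> = O(1 / c)\<close>.
\<close>
lemma van_der_corput_degenerate:
  fixes k H M L :: real and f f' h h' E :: "real \<Rightarrow> complex" and W :: "real \<Rightarrow> real"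
  assumes k: "k \<ge> 1"
    and E: "\<And>x. (E has_vector_derivative - (\<i> * complex_of_real (k * x\<^sup>2) * h x * E x)) (at x)" "\<And>x. cmod (E x) \<le> 1"
    and f: "\<And>x. (f has_vector_derivative f' x) (at x)" "f' \<in> borel_measurable borel"
    and fb: "\<And>x. cmod (f x) \<le> M * W x" "\<And>x. cmod (f' x) \<le> M * W x"
    and h: "\<And>x. (h has_vector_derivative h' x) (at x)" "h' \<in> borel_measurable borel"
    and hb: "\<And>x. cmod (h x) \<ge> 1 / 2" "\<And>x. cmod (h' x) \<le> H"
    and W: "integrable lborel W" "\<And>x. 0 \<le> W x" "\<And>x. W x \<le> 1" "(LINT x|lborel. W x) \<le> L" and M: "M \<ge> 0"
  shows "cmod (LINT x|lborel. f x * E x) \<le> M * ((4 + 4 * H) * pi + L) * k powr (-1/3)"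
proof -
  define c where "c = k powr (1/3)"
  have c1: "c \<ge> 1" using k by (simp add: c_def ge_one_powr_ge_zero)
  have c3: "c ^ 3 = k" using k by (simp add: c_def powr_powr flip: powr_numeral)
  define T where "T x = 1 / (1 + (0 + c * x)\<^sup>2)" for x
  have Tp: "1 + (c * x)\<^sup>2 > 0" for x by (simp add: add_pos_nonneg)
  have T01: "0 < T x" "T x \<le> 1" for x using Tp[of x] by (auto simp: T_def)
  have T1: "1 - T x = (c * x)\<^sup>2 * T x" for x using Tp[of x] by (simp add: T_def field_simps)
  have Ti: "has_bochner_integral lborel T (pi / c)"
    using has_bochner_integral_inverse_1_plus_square[of c 0] c1 by (simp add: T_def[abs_def])
  define T' where "T' x = - 2 * c\<^sup>2 * x * (T x)\<^sup>2" for x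
  have dT: "(T has_real_derivative T' x) (at x)" for x
  proof -
    have "((\<lambda>x. 1 / (1 + (0 + c * x)\<^sup>2)) has_real_derivative T' x) (at x)"
      using Tp[of x] unfolding T'_def T_def
      by (auto intro!: derivative_eq_intros simp: power2_eq_square)
    then show ?thesis by (simp add: T_def[abs_def])
  qed
  have T'b: "\<bar>T' x\<bar> \<le> c * T x" for x
  proof -
    have "0 \<le> (1 - c * \<bar>x\<bar>)\<^sup>2" by simp
    then have "2 * (c * \<bar>x\<bar>) \<le> 1 + (c * x)\<^sup>2" by (simp add: power2_diff power_mult_distrib)
    then have *: "2 * (c * \<bar>x\<bar>) * T x \<le> 1" using Tp[of x] by (simp add: T_def divide_le_eq)
    have "\<bar>T' x\<bar> = (2 * (c * \<bar>x\<bar>) * T x) * (c * T x)"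
      using c1 T01(1)[of x] by (simp add: T'_def abs_mult power2_eq_square)
    also have "\<dots> \<le> 1 * (c * T x)" using * c1 T01[of x] by (intro mult_right_mono) auto
    finally show ?thesis by simp
  qed
  have hn: "h x \<noteq> 0" for x using hb(1)[of x] by auto
  have hi: "cmod (1 / h x) \<le> 2" for x using hb(1)[of x] hn[of x] by (simp add: norm_divide divide_le_eq)
  define \<psi> where "\<psi> x = \<i> / c * complex_of_real ((1 - T x) * T x) * (1 / h x)" for x
  define \<psi>' where "\<psi>' x = \<i> / c * (complex_of_real ((1 - 2 * T x) * T' x) * (1 / h x) - complex_of_real ((1 - T x) * T x) * (h' x * (1 / h x) * (1 / h x)))" for x
  have d\<psi>: "(\<psi> has_vector_derivative \<psi>' x) (at x)" for x
  proof -
    have 1: "((\<lambda>x. complex_of_real ((1 - T x) * T x)) has_vector_derivative complex_of_real ((1 - 2 * T x) * T' x)) (at x)"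
    proof -
      have "((\<lambda>x. (1 - T x) * T x) has_real_derivative (1 - 2 * T x) * T' x) (at x)"
        by (rule derivative_eq_intros dT refl)+ (simp add: algebra_simps)
      then show ?thesis by (intro has_vector_derivative_of_real) (simp add: has_real_derivative_iff_has_vector_derivative)
    qed
    have 2: "((\<lambda>x. 1 / h x) has_vector_derivative - (h' x * (1 / h x) * (1 / h x))) (at x)"
    proof -
      have "((\<lambda>z. 1 / z) has_field_derivative - (1 / (h x * h x))) (at (h x))"
        using hn[of x] by (auto intro!: derivative_eq_intros)
      from field_vector_diff_chain_at[OF h(1) this] show ?thesis by (simp add: o_def)
    qed
    have "((\<lambda>x. \<i> / c * (complex_of_real ((1 - T x) * T x) * (1 / h x))) has_vector_derivative
        \<i> / c * (complex_of_real ((1 - T x) * T x) * (- (h' x * (1 / h x) * (1 / h x))) + complex_of_real ((1 - 2 * T x) * T' x) * (1 / h x))) (at x)"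
      by (intro has_vector_derivative_mult_right has_vector_derivative_mult 1 2)
    then show ?thesis by (simp add: \<psi>_def[abs_def] \<psi>'_def mult.assoc algebra_simps)
  qed
  have \<psi>b: "cmod (\<psi> x) \<le> 2 * T x / c" "cmod (\<psi> x) \<le> 1 / c" for x
  proof -
    have n: "cmod (\<psi> x) = ((1 - T x) * T x) / c * cmod (1 / h x)"
      using c1 T01[of x] by (simp add: \<psi>_def norm_mult norm_divide abs_mult del: of_real_mult of_real_diff)
    have "(1 - T x) * T x \<le> 1 * T x" using T01[of x] by (intro mult_right_mono) auto
    then show "cmod (\<psi> x) \<le> 2 * T x / c" unfolding n
      using mult_mono[of "(1 - T x) * T x / c" "T x / c" "cmod (1 / h x)" 2] hi[of x] c1 T01[of x] by (simp add: divide_right_mono mult.commute)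
    have "0 \<le> (T x - 1/2)\<^sup>2" by simp
    then have "(1 - T x) * T x \<le> 1 / 4" by (simp add: power2_eq_square algebra_simps)
    then have "((1 - T x) * T x) / c * cmod (1 / h x) \<le> (1 / 4 / c) * 2"
      using hi[of x] c1 by (intro mult_mono divide_right_mono) auto
    also have "\<dots> \<le> 1 / c" using c1 by (simp add: field_simps)
    finally show "cmod (\<psi> x) \<le> 1 / c" unfolding n .
  qed
  have \<psi>'b: "cmod (\<psi>' x) \<le> (2 + 4 * H) * T x" for x
  proof -
    have H0: "H \<ge> 0" using hb(2)[of x] norm_ge_zero[of "h' x"] by linarith
    have 1: "cmod (complex_of_real ((1 - 2 * T x) * T' x) * (1 / h x)) \<le> (1 * (c * T x)) * 2"
      unfolding norm_mult norm_of_real abs_mult using T01[of x] T'b[of x] hi[of x] c1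
      by (intro mult_mono) (auto simp: abs_mult)
    have 2: "cmod (complex_of_real ((1 - T x) * T x) * (h' x * (1 / h x) * (1 / h x))) \<le> (1 * T x) * (H * 2 * 2)"
      unfolding norm_mult norm_of_real abs_mult using T01[of x] hb(2)[of x] hi[of x] H0
      by (intro mult_mono) auto
    have "cmod (\<psi>' x) \<le> 1 / c * ((1 * (c * T x)) * 2 + (1 * T x) * (H * 2 * 2))"
      unfolding \<psi>'_def norm_mult
      using c1 by (intro mult_mono order_trans[OF norm_triangle_ineq4] add_mono 1 2) (auto simp: norm_divide)
    also have "\<dots> = 2 * T x + (4 * H * T x) / c" using c1 by (simp add: field_simps)
    also have "(4 * H * T x) / c \<le> 4 * H * T x" using frac_le[of "4 * H * T x" "4 * H * T x" 1 c] c1 H0 T01[of x] by simp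
    finally show ?thesis by (simp add: algebra_simps)
  qed
  have E0: "continuous_on UNIV E" "continuous_on UNIV f" "continuous_on UNIV h"
    by (intro continuous_at_imp_continuous_on ballI has_vector_derivative_continuous[OF E(1)]
         has_vector_derivative_continuous[OF f(1)] has_vector_derivative_continuous[OF h(1)])+
  have [measurable]: "E \<in> borel_measurable borel" "f \<in> borel_measurable borel" "h \<in> borel_measurable borel"
    using E0 by (auto intro: borel_measurable_continuous_onI)
  have [measurable]: "f' \<in> borel_measurable borel" "h' \<in> borel_measurable borel" by fact+
  have [measurable]: "T \<in> borel_measurable borel" "T' \<in> borel_measurable borel"
    by (simp_all add: T_def[abs_def] T'_def[abs_def])
  have [measurable]: "\<psi> \<in> borel_measurable borel" "\<psi>' \<in> borel_measurable borel"
    unfolding \<psi>_def[abs_def] \<psi>'_def[abs_def] by measurable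
  have fM: "cmod (f x) \<le> M" for x using fb(1)[of x] mult_left_mono[OF W(3) M, of x] by simp
  let ?g = "\<lambda>x. \<psi>' x * (f x * E x) + \<psi> x * (f' x * E x) + complex_of_real ((1 - T x)\<^sup>2) * (f x * E x)"
  have fE: "integrable lborel (\<lambda>x. f x * E x)"
  proof (rule Bochner_Integration.integrable_bound[OF integrable_mult_right[OF W(1), of M]])
    show "AE x in lborel. norm (f x * E x) \<le> norm (M * W x)"
    proof (rule AE_I2)
      fix x
      have "cmod (f x) * cmod (E x) \<le> (M * W x) * 1" using fb(1)[of x] E(2)[of x] W(2) M by (intro mult_mono) auto
      then show "norm (f x * E x) \<le> norm (M * W x)" using W(2) M by (simp add: norm_mult)
    qed
  qed measurable
  have i1: "integrable lborel (\<lambda>x. \<psi>' x * (f x * E x))"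
    and b1: "\<And>x. cmod (\<psi>' x * (f x * E x)) \<le> (2 + 4 * H) * M * T x"
  proof -
    show b: "cmod (\<psi>' x * (f x * E x)) \<le> (2 + 4 * H) * M * T x" for x
    proof -
      have "cmod (\<psi>' x) * (cmod (f x) * cmod (E x)) \<le> ((2 + 4 * H) * T x) * (M * 1)"
        using fM[of x] E(2)[of x] \<psi>'b[of x] M order_trans[OF norm_ge_zero \<psi>'b[of x]] by (intro mult_mono) auto
      then show ?thesis by (simp add: norm_mult mult_ac)
    qed
    show "integrable lborel (\<lambda>x. \<psi>' x * (f x * E x))"
      by (rule integrable_majorized[OF _ _ b]) (use Ti in \<open>auto simp: has_bochner_integral_iff\<close>)
  qed
  have i2: "integrable lborel (\<lambda>x. \<psi> x * (f' x * E x))"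
    and b2: "\<And>x. cmod (\<psi> x * (f' x * E x)) \<le> M / c * W x"
  proof -
    show b: "cmod (\<psi> x * (f' x * E x)) \<le> M / c * W x" for x
    proof -
      have "cmod (\<psi> x) * (cmod (f' x) * cmod (E x)) \<le> (1 / c) * ((M * W x) * 1)"
        using fb(2)[of x] E(2)[of x] \<psi>b(2)[of x] M W(2)[of x] c1 by (intro mult_mono) auto
      then show ?thesis by (simp add: norm_mult mult_ac)
    qed
    show "integrable lborel (\<lambda>x. \<psi> x * (f' x * E x))"
      by (rule integrable_majorized[OF _ _ b]) (use W(1) in auto)
  qed
  have i3: "integrable lborel (\<lambda>x. complex_of_real ((1 - T x)\<^sup>2) * (f x * E x))"
  proof (rule Bochner_Integration.integrable_bound[OF fE])
    show "AE x in lborel. norm (complex_of_real ((1 - T x)\<^sup>2) * (f x * E x)) \<le> norm (f x * E x)"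
    proof (rule AE_I2)
      fix x
      have "(1 - T x)\<^sup>2 \<le> 1" using T01[of x] by (simp add: power_le_one)
      then show "norm (complex_of_real ((1 - T x)\<^sup>2) * (f x * E x)) \<le> norm (f x * E x)"
        unfolding norm_mult[of "complex_of_real _"] norm_of_real by (simp add: mult_left_le_one_le)
    qed
  qed measurable
  have zero: "(LINT x|lborel. ?g x) = 0"
  proof (rule integral_vector_derivative_eq_0[where G="\<lambda>x. \<psi> x * (f x * E x)"])
    fix x
    have "((\<lambda>x. \<psi> x * (f x * E x)) has_vector_derivative
      \<psi> x * (f x * (- (\<i> * complex_of_real (k * x\<^sup>2) * h x * E x)) + f' x * E x) + \<psi>' x * (f x * E x)) (at x)"
      by (intro has_vector_derivative_mult d\<psi> f E)
    \<comment> \<open>The defining property of psi; it uses k / c = c^2.\<close>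
    moreover have "\<psi> x * (- (\<i> * complex_of_real (k * x\<^sup>2) * h x)) = complex_of_real ((1 - T x)\<^sup>2)"
    proof -
      have "\<psi> x * (- (\<i> * complex_of_real (k * x\<^sup>2) * h x))
          = - (\<i> * \<i>) * complex_of_real ((1 - T x) * T x * (k / c * x\<^sup>2)) * (1 / h x * h x)"
        by (simp add: \<psi>_def divide_inverse mult_ac)
      also have "\<dots> = complex_of_real ((1 - T x) * T x * (k / c * x\<^sup>2))"
        using hn[of x] by simp
      also have "k / c = c\<^sup>2" using c1 c3 by (simp add: power2_eq_square power3_eq_cube field_simps)
      also have "(1 - T x) * T x * (c\<^sup>2 * x\<^sup>2) = (1 - T x) * ((c * x)\<^sup>2 * T x)" by (simp add: power_mult_distrib)
      also have "\<dots> = (1 - T x)\<^sup>2" unfolding T1[symmetric] by (simp add: power2_eq_square)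
      finally show ?thesis .
    qed
    moreover have "\<psi> x * (f x * (- (\<i> * complex_of_real (k * x\<^sup>2) * h x * E x)) + f' x * E x) + \<psi>' x * (f x * E x)
      = \<psi>' x * (f x * E x) + \<psi> x * (f' x * E x) + (\<psi> x * (- (\<i> * complex_of_real (k * x\<^sup>2) * h x))) * (f x * E x)"
      by (simp add: algebra_simps)
    ultimately show "((\<lambda>x. \<psi> x * (f x * E x)) has_vector_derivative ?g x) (at x)" by (simp only:)
  next
    show "integrable lborel ?g" by (intro Bochner_Integration.integrable_add i1 i2 i3)
    have b: "norm (\<psi> x * (f x * E x)) \<le> 2 * M / c * T x" for x
    proof -
      have "cmod (\<psi> x) * (cmod (f x) * cmod (E x)) \<le> (2 * T x / c) * (M * 1)"
        using fM[of x] E(2)[of x] \<psi>b(1)[of x] M c1 T01(1)[of x] by (intro mult_mono) auto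
      then show ?thesis by (simp add: norm_mult mult_ac)
    qed
    have c0: "c > 0" using c1 by simp
    have T0: "(T \<longlongrightarrow> 0) at_top" "(T \<longlongrightarrow> 0) at_bot"
      unfolding T_def[abs_def] using c0 by real_asymp+
    show "((\<lambda>x. \<psi> x * (f x * E x)) \<longlongrightarrow> 0) at_top"
      by (rule Lim_null_comparison[OF _ tendsto_mult_right_zero[OF T0(1), of "2 * M / c"]]) (simp only: b eventually_True)
    show "((\<lambda>x. \<psi> x * (f x * E x)) \<longlongrightarrow> 0) at_bot"
      by (rule Lim_null_comparison[OF _ tendsto_mult_right_zero[OF T0(2), of "2 * M / c"]]) (simp only: b eventually_True)
  qed
  let ?X = "\<lambda>x. complex_of_real (2 * T x - (T x)\<^sup>2) * (f x * E x) - \<psi>' x * (f x * E x) - \<psi> x * (f' x * E x)"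
  have X: "(\<lambda>x. f x * E x - ?g x) = ?X"
    by (auto simp: fun_eq_iff power2_eq_square algebra_simps)
  have "(LINT x|lborel. f x * E x) = (LINT x|lborel. f x * E x - ?g x)"
    by (subst Bochner_Integration.integral_diff[OF fE]) (use zero i1 i2 i3 in auto)
  then have "cmod (LINT x|lborel. f x * E x) = cmod (LINT x|lborel. ?X x)" by (simp only: X)
  also have "\<dots> \<le> (LINT x|lborel. (4 + 4 * H) * M * T x + M / c * W x)"
  proof (rule Bochner_Integration.integral_norm_bound_integral)
    have "integrable lborel (\<lambda>x. f x * E x - ?g x)"
      by (intro Bochner_Integration.integrable_diff Bochner_Integration.integrable_add fE i1 i2 i3)
    then show "integrable lborel ?X"
      by (simp only: X)
    show "integrable lborel (\<lambda>x. (4 + 4 * H) * M * T x + M / c * W x)"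
      using Ti W(1) by (intro Bochner_Integration.integrable_add integrable_mult_right) (auto simp: has_bochner_integral_iff)
    fix x
    have "cmod (complex_of_real (2 * T x - (T x)\<^sup>2)) * (cmod (f x) * cmod (E x)) \<le> (2 * T x) * (M * 1)"
    proof (intro mult_mono fM E(2))
      have "T x * T x \<le> 1 * T x" using T01[of x] by (intro mult_right_mono) auto
      then show "cmod (complex_of_real (2 * T x - (T x)\<^sup>2)) \<le> 2 * T x"
        unfolding norm_of_real using T01[of x] by (simp add: power2_eq_square)
    qed (use M T01[of x] in auto)
    then have "cmod (complex_of_real (2 * T x - (T x)\<^sup>2) * (f x * E x)) \<le> 2 * M * T x"
      by (simp only: norm_mult mult_ac mult_1_right)
    then show "norm (complex_of_real (2 * T x - (T x)\<^sup>2) * (f x * E x) - \<psi>' x * (f x * E x) - \<psi> x * (f' x * E x)) \<le> (4 + 4 * H) * M * T x + M / c * W x"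
      using b1[of x] b2[of x]
        norm_triangle_ineq4[of "complex_of_real (2 * T x - (T x)\<^sup>2) * (f x * E x) - \<psi>' x * (f x * E x)" "\<psi> x * (f' x * E x)"]
        norm_triangle_ineq4[of "complex_of_real (2 * T x - (T x)\<^sup>2) * (f x * E x)" "\<psi>' x * (f x * E x)"]
      by (simp only: distrib_right)
  qed
  also have "\<dots> = (4 + 4 * H) * M * (pi / c) + M / c * (LINT x|lborel. W x)"
  proof -
    have iT: "integrable lborel (\<lambda>x. (4 + 4 * H) * M * T x)" and iW: "integrable lborel (\<lambda>x. M / c * W x)"
      and vT: "(LINT x|lborel. T x) = pi / c"
      using Ti W(1) by (auto simp: has_bochner_integral_iff)
    show ?thesis
      by (simp only: Bochner_Integration.integral_add[OF iT iW] integral_mult_right_zero vT)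
  qed
  also have "M / c * (LINT x|lborel. W x) \<le> M / c * L" using W(4) M c1 by (intro mult_left_mono) auto
  also have "(4 + 4 * H) * M * (pi / c) + M / c * L = M * ((4 + 4 * H) * pi + L) * (1 / c)"
    by (simp add: add_divide_distrib algebra_simps)
  also have "1 / c = k powr (-1/3)" by (simp add: c_def powr_minus_divide)
  finally show ?thesis by simp
qed

text \<open>
Weights for which all integrals and boundary terms below make sense. The factor \<open>1 + x\<^sup>2\<close> is for integrands that carry
\<open>x\<^sup>2\<close>; only the unweighted integral has to be bounded uniformly.
\<close>
definition good_weight :: "('i \<Rightarrow> real \<Rightarrow> real) \<Rightarrow> 'i set \<Rightarrow> bool" where
  "good_weight W I \<longleftrightarrow> (\<forall>i\<in>I. \<forall>x. 0 \<le> W i x \<and> W i x \<le> 1) \<and>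
     (\<forall>i\<in>I. integrable lborel (\<lambda>x. (1 + x\<^sup>2) * W i x) \<and> W i \<in> borel_measurable borel \<and> (W i \<longlongrightarrow> 0) at_top \<and> (W i \<longlongrightarrow> 0) at_bot) \<and>
     (\<exists>L. \<forall>i\<in>I. (LINT x|lborel. W i x) \<le> L)"

lemma integrable_of_good_weight:
  fixes f :: "real \<Rightarrow> complex"
  assumes "good_weight W I" "i \<in> I" "f \<in> borel_measurable borel" "\<And>x. cmod (f x) \<le> M * (1 + x\<^sup>2) * W i x"
  shows "integrable lborel f"
proof (rule Bochner_Integration.integrable_bound)
  show "integrable lborel (\<lambda>x. M * ((1 + x\<^sup>2) * W i x))"
    using assms(1,2) by (auto simp: good_weight_def)
  show "AE x in lborel. norm (f x) \<le> norm (M * ((1 + x\<^sup>2) * W i x))"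
    by (rule AE_I2) (use assms(4) in \<open>auto simp: mult.assoc intro: order_trans[OF _ abs_ge_self]\<close>)
qed (use assms(3) in simp)

lemma good_weight_integrable:
  assumes "good_weight W I" "i \<in> I"
  shows "integrable lborel (W i)"
proof (rule Bochner_Integration.integrable_bound)
  show "integrable lborel (\<lambda>x. (1 + x\<^sup>2) * W i x)" using assms by (auto simp: good_weight_def)
  show "AE x in lborel. norm (W i x) \<le> norm ((1 + x\<^sup>2) * W i x)"
    using assms by (intro AE_I2) (auto simp: good_weight_def algebra_simps)
qed (use assms in \<open>auto simp: good_weight_def\<close>)

text \<open>
The factor \<open>x\<^sup>2\<close> is what the derivative of the phase provides: with \<open>q = f / h\<close>, the derivative of \<open>q E\<close> is
\<open>q' E - i k x\<^sup>2 f E\<close>. So the integral of \<open>x\<^sup>2 f E\<close> is \<open>1 / (i k)\<close> times that of \<open>q' E\<close>, and the latter is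
\<open>O(k^(-1/3))\<close> by \<open>van_der_corput_degenerate\<close>. The third derivative makes \<open>q''\<close> continuous, hence measurable.
\<close>
lemma oscillatory_integral_square_bound:
  fixes W :: "'i \<Rightarrow> real \<Rightarrow> real"
  assumes W: "good_weight W I" and f: "symbol 3 W I f" and h: "symbol 3 flat I h"
    and hb: "\<And>i x. i \<in> I \<Longrightarrow> cmod (h i x) \<ge> 1 / 2"
  obtains C where "C \<ge> 0" "\<And>k i E. k \<ge> 1 \<Longrightarrow> i \<in> I \<Longrightarrow>
     (\<And>x. (E has_vector_derivative - (\<i> * complex_of_real (k * x\<^sup>2) * h i x * E x)) (at x)) \<Longrightarrow> (\<And>x. cmod (E x) \<le> 1) \<Longrightarrow>
     cmod (LINT x|lborel. complex_of_real (x\<^sup>2) * f i x * E x) \<le> C * k powr (-4/3)"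
proof -
  let ?q = "\<lambda>i x. f i x * (1 / h i x)"
  have q: "symbol 3 W I ?q"
    by (intro symbol_mult f symbol_inverse[OF h, of "1/2"] hb) auto
  obtain q1 where q1: "\<And>i x. i \<in> I \<Longrightarrow> (?q i has_vector_derivative q1 i x) (at x)" "symbol (Suc (Suc 0)) W I q1"
    using symbol_SucE[OF q[unfolded numeral_3_eq_3]] by blast
  obtain q2 where q2: "\<And>i x. i \<in> I \<Longrightarrow> (q1 i has_vector_derivative q2 i x) (at x)" "symbol (Suc 0) W I q2"
    using symbol_SucE[OF q1(2)] by blast
  obtain h1 where h1: "\<And>i x. i \<in> I \<Longrightarrow> (h i has_vector_derivative h1 i x) (at x)" "symbol (Suc (Suc 0)) flat I h1"
    using symbol_SucE[OF h[unfolded numeral_3_eq_3]] by blast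
  obtain M1 where M1: "M1 \<ge> 0" "\<And>i x. i \<in> I \<Longrightarrow> cmod (q1 i x) \<le> M1 * W i x" using symbol_bounded[OF q1(2)] by auto
  obtain M2 where M2: "M2 \<ge> 0" "\<And>i x. i \<in> I \<Longrightarrow> cmod (q2 i x) \<le> M2 * W i x" using symbol_bounded[OF q2(2)] by auto
  obtain M0 where M0: "M0 \<ge> 0" "\<And>i x. i \<in> I \<Longrightarrow> cmod (?q i x) \<le> M0 * W i x" using symbol_bounded[OF q] by auto
  obtain Mf where Mf: "Mf \<ge> 0" "\<And>i x. i \<in> I \<Longrightarrow> cmod (f i x) \<le> Mf * W i x" using symbol_bounded[OF f] by auto
  obtain H where H: "H \<ge> 0" "\<And>i x. i \<in> I \<Longrightarrow> cmod (h1 i x) \<le> H" using symbol_bounded[OF h1(2)] by auto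
  obtain L where L: "\<And>i. i \<in> I \<Longrightarrow> (LINT x|lborel. W i x) \<le> L" using W unfolding good_weight_def by blast
  define M where "M = max M1 M2"
  show ?thesis
  proof (rule that[of "\<bar>M * ((4 + 4 * H) * pi + L)\<bar>"])
    fix k :: real and i and E :: "real \<Rightarrow> complex"
    assume k: "k \<ge> 1" and i: "i \<in> I"
      and E: "\<And>x. (E has_vector_derivative - (\<i> * complex_of_real (k * x\<^sup>2) * h i x * E x)) (at x)" "\<And>x. cmod (E x) \<le> 1"
    have W01: "0 \<le> W i x" "W i x \<le> 1" for x using W i by (auto simp: good_weight_def)
    have Wlim: "(W i \<longlongrightarrow> 0) at_top" "(W i \<longlongrightarrow> 0) at_bot" using W i by (auto simp: good_weight_def)
    have [measurable]: "E \<in> borel_measurable borel"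
      by (rule borel_measurable_continuous_onI, intro continuous_at_imp_continuous_on ballI has_vector_derivative_continuous[OF E(1)])
    have [measurable]: "f i \<in> borel_measurable borel" using symbol_measurable[OF f[unfolded numeral_3_eq_3] i] .
    have [measurable]: "q1 i \<in> borel_measurable borel" using symbol_measurable[OF q1(2) i] .
    have m: "q2 i \<in> borel_measurable borel" "h1 i \<in> borel_measurable borel"
      using symbol_measurable[OF q2(2) i] symbol_measurable[OF h1(2) i] .
    have hn: "h i x \<noteq> 0" for x using hb[OF i, of x] by auto
    have v: "cmod (LINT x|lborel. q1 i x * E x) \<le> M * ((4 + 4 * H) * pi + L) * k powr (-1/3)"
    proof (rule van_der_corput_degenerate[OF k E q2(1)[OF i] m(1) _ _ h1(1)[OF i] m(2) hb[OF i] H(2)[OF i] good_weight_integrable[OF W i] W01 L[OF i]])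
      show "cmod (q1 i x) \<le> M * W i x" "cmod (q2 i x) \<le> M * W i x" for x
        using M1(2)[OF i, of x] M2(2)[OF i, of x] mult_right_mono[OF max.cobounded1[of M1 M2] W01(1)[of x]]
          mult_right_mono[OF max.cobounded2[of M2 M1] W01(1)[of x]] by (auto simp: M_def intro: order_trans)
      show "M \<ge> 0" using M1(1) by (simp add: M_def)
    qed
    have i1: "integrable lborel (\<lambda>x. q1 i x * E x)"
    proof (rule integrable_of_good_weight[OF W i])
      fix x
      have "cmod (q1 i x) * cmod (E x) \<le> (M1 * W i x) * 1" using M1 E(2)[of x] W01[of x] i by (intro mult_mono) auto
      also have "\<dots> \<le> M1 * (1 + x\<^sup>2) * W i x" using M1(1) W01[of x] by (simp add: algebra_simps)
      finally show "cmod (q1 i x * E x) \<le> M1 * (1 + x\<^sup>2) * W i x" by (simp add: norm_mult)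
    qed measurable
    have i2: "integrable lborel (\<lambda>x. complex_of_real (x\<^sup>2) * f i x * E x)"
    proof (rule integrable_of_good_weight[OF W i])
      fix x
      have "x\<^sup>2 * cmod (f i x) * cmod (E x) \<le> x\<^sup>2 * (Mf * W i x) * 1" using Mf E(2)[of x] W01[of x] i by (intro mult_mono) auto
      also have "\<dots> \<le> Mf * (1 + x\<^sup>2) * W i x" using Mf(1) W01[of x] by (simp add: algebra_simps)
      finally show "cmod (complex_of_real (x\<^sup>2) * f i x * E x) \<le> Mf * (1 + x\<^sup>2) * W i x"
        unfolding norm_mult norm_of_real by simp
    qed measurable
    have "(LINT x|lborel. q1 i x * E x - \<i> * complex_of_real k * (complex_of_real (x\<^sup>2) * f i x * E x)) = 0"
    proof (rule integral_vector_derivative_eq_0[where G="\<lambda>x. ?q i x * E x"])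
      fix x
      have "((\<lambda>x. ?q i x * E x) has_vector_derivative ?q i x * (- (\<i> * complex_of_real (k * x\<^sup>2) * h i x * E x)) + q1 i x * E x) (at x)"
        by (rule has_vector_derivative_mult[OF q1(1)[OF i] E(1)])
      moreover have "?q i x * (- (\<i> * complex_of_real (k * x\<^sup>2) * h i x * E x)) + q1 i x * E x
        = q1 i x * E x - \<i> * complex_of_real k * (complex_of_real (x\<^sup>2) * f i x * E x)"
        using hn[of x] by (simp add: mult_ac)
      ultimately show "((\<lambda>x. ?q i x * E x) has_vector_derivative q1 i x * E x - \<i> * complex_of_real k * (complex_of_real (x\<^sup>2) * f i x * E x)) (at x)"
        by (simp only:)
    next
      show "integrable lborel (\<lambda>x. q1 i x * E x - \<i> * complex_of_real k * (complex_of_real (x\<^sup>2) * f i x * E x))"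
        by (intro Bochner_Integration.integrable_diff integrable_mult_right i1 i2)
      have b: "norm (?q i x * E x) \<le> M0 * W i x" for x
      proof -
        have "cmod (?q i x) * cmod (E x) \<le> (M0 * W i x) * 1"
          using M0 E(2)[of x] W01[of x] i by (intro mult_mono) auto
        then show ?thesis by (simp only: norm_mult mult_1_right)
      qed
      show "((\<lambda>x. ?q i x * E x) \<longlongrightarrow> 0) at_top"
        by (rule Lim_null_comparison[where g="\<lambda>x. M0 * W i x"]) (use b tendsto_mult_right_zero[OF Wlim(1)] in auto)
      show "((\<lambda>x. ?q i x * E x) \<longlongrightarrow> 0) at_bot"
        by (rule Lim_null_comparison[where g="\<lambda>x. M0 * W i x"]) (use b tendsto_mult_right_zero[OF Wlim(2)] in auto)
    qed
    then have "(LINT x|lborel. q1 i x * E x) - \<i> * complex_of_real k * (LINT x|lborel. complex_of_real (x\<^sup>2) * f i x * E x) = 0"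
      by (subst (asm) Bochner_Integration.integral_diff[OF i1 integrable_mult_right[OF i2]]) (simp only: integral_mult_right_zero)
    then have "cmod (LINT x|lborel. q1 i x * E x) = k * cmod (LINT x|lborel. complex_of_real (x\<^sup>2) * f i x * E x)"
      using k by (simp add: norm_mult)
    with v have "cmod (LINT x|lborel. complex_of_real (x\<^sup>2) * f i x * E x) \<le> M * ((4 + 4 * H) * pi + L) * k powr (-1/3) / k"
      using k by (simp add: pos_le_divide_eq mult.commute)
    also have "\<dots> \<le> \<bar>M * ((4 + 4 * H) * pi + L)\<bar> * (k powr (-1/3) / k)"
      using k by (simp add: mult_right_mono divide_right_mono)
    also have "k powr (-1/3) / k = k powr (-4/3)"
      using k powr_diff[of k "-1/3" 1] by simp
    finally show "cmod (LINT x|lborel. complex_of_real (x\<^sup>2) * f i x * E x) \<le> \<bar>M * ((4 + 4 * H) * pi + L)\<bar> * k powr (-4/3)" .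
  qed simp
qed

section \<open>Phase and amplitude of the beams on the caustic\<close>

text \<open>
The beams as functions of the ray parameter \<open>\<sigma>\<close>, measured from the caustic. The condition \<open>Im \<gamma> > 0\<close>
expresses that the beams decay away from their central rays (lemma \<open>Im_P\<close>).
\<close>
locale beam_phase =
  fixes \<eta> :: real and \<gamma> :: complex
  assumes eta: "\<eta> > 0" and gam: "Im \<gamma> > 0"
begin

text \<open>
\<open>p\<close> is the beam quadratic divided by \<open>\<beta>\<close>, \<open>g\<close> the amplitude normalised by \<open>g(0) = 1\<close>, and \<open>P\<close> the quadratic beam phase,
which is quartic in \<open>\<sigma>\<close> because \<open>x\<^sub>c - x(s) = \<sigma>\<^sup>2\<close>. The functions \<open>u = 1 / p\<close> and \<open>v = \<sigma> / p\<close> are bounded, and their derivatives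
are polynomials in \<open>u\<close> and \<open>v\<close>. To see that products with \<open>\<sigma>\<close> are bounded too, they are written as polynomials in \<open>u\<close>
and \<open>v\<close>: \<open>X\<close> is \<open>\<sigma>\<^sup>2 / p\<close> and \<open>\<mu>\<close> is \<open>\<sigma> m'\<close> (lemmas \<open>sv\<close> and \<open>s_m'\<close>).
\<close>
definition p :: "real \<Rightarrow> complex" where
  "p \<sigma> = complex_of_real (\<eta>\<^sup>2) + 2 * \<gamma> * complex_of_real \<sigma> - (complex_of_real \<sigma>)\<^sup>2"
definition u :: "real \<Rightarrow> complex" where "u \<sigma> = 1 / p \<sigma>"
definition v :: "real \<Rightarrow> complex" where "v \<sigma> = complex_of_real \<sigma> / p \<sigma>"
definition g :: "real \<Rightarrow> complex" where "g \<sigma> = complex_of_real \<eta> / csqrt (p \<sigma>)"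
definition j :: "real \<Rightarrow> complex" where "j \<sigma> = 1 / (1 + g \<sigma>)"
definition m :: "real \<Rightarrow> complex" where "m \<sigma> = \<gamma> * u \<sigma> - v \<sigma> / 2"
definition X :: "real \<Rightarrow> complex" where "X \<sigma> = complex_of_real (\<eta>\<^sup>2) * u \<sigma> + 2 * \<gamma> * v \<sigma> - 1"
definition \<mu> :: "real \<Rightarrow> complex" where
  "\<mu> \<sigma> = \<gamma> * (2 * v \<sigma> * v \<sigma> - 2 * \<gamma> * u \<sigma> * v \<sigma>) - (v \<sigma> - 2 * \<gamma> * v \<sigma> * v \<sigma> + 2 * v \<sigma> * X \<sigma>) / 2"
definition P :: "real \<Rightarrow> complex" where "P \<sigma> = m \<sigma> * (complex_of_real \<sigma>) ^ 4 / 2"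

lemma Im_p: "Im (p \<sigma>) = 2 * Im \<gamma> * \<sigma>"
  by (simp add: p_def power2_eq_square)

lemma p_not_nonpos: "p \<sigma> \<notin> \<real>\<^sub>\<le>\<^sub>0"
proof
  assume "p \<sigma> \<in> \<real>\<^sub>\<le>\<^sub>0"
  then have 1: "Re (p \<sigma>) \<le> 0" "Im (p \<sigma>) = 0" by (auto simp: complex_nonpos_Reals_iff)
  then have "\<sigma> = 0" using gam by (simp add: Im_p)
  with 1(1) show False using eta by (simp add: p_def)
qed

lemma p_nonzero: "p \<sigma> \<noteq> 0" using p_not_nonpos[of \<sigma>] by auto

lemma norm_p_ge_linear: "cmod (p \<sigma>) \<ge> 2 * Im \<gamma> * \<bar>\<sigma>\<bar>"
  using abs_Im_le_cmod[of "p \<sigma>"] gam by (simp add: Im_p abs_mult)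

text \<open>
Near \<open>0\<close> the constant term of \<open>p\<close> dominates; elsewhere \<open>Im p = 2 Im \<gamma> \<sigma>\<close> does.
\<close>
lemma norm_p_ge: "\<exists>c>0. \<forall>\<sigma>. cmod (p \<sigma>) \<ge> c"
proof -
  define e where "e = min 1 (\<eta>\<^sup>2 / (2 * (2 * cmod \<gamma> + 1)))"
  have d: "2 * cmod \<gamma> + 1 > 0" by (simp add: add_nonneg_pos)
  have e: "e > 0" "e \<le> 1" using eta d by (auto simp: e_def)
  have "e \<le> \<eta>\<^sup>2 / (2 * (2 * cmod \<gamma> + 1))" by (simp add: e_def)
  then have e2: "(2 * cmod \<gamma> + 1) * e \<le> \<eta>\<^sup>2 / 2" using d by (simp add: field_simps)
  show ?thesis
  proof (intro exI[of _ "min (\<eta>\<^sup>2 / 2) (2 * Im \<gamma> * e)"] conjI allI)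
    show "min (\<eta>\<^sup>2 / 2) (2 * Im \<gamma> * e) > 0" using eta gam e by simp
    fix \<sigma>
    show "cmod (p \<sigma>) \<ge> min (\<eta>\<^sup>2 / 2) (2 * Im \<gamma> * e)"
    proof (cases "\<bar>\<sigma>\<bar> \<le> e")
      case True
      have "\<sigma>\<^sup>2 \<le> \<bar>\<sigma>\<bar>"
        using True e mult_left_mono[of "\<bar>\<sigma>\<bar>" 1 "\<bar>\<sigma>\<bar>"] by (simp add: power2_eq_square abs_mult_self_eq)
      then have "cmod (2 * \<gamma> * complex_of_real \<sigma>) + cmod ((complex_of_real \<sigma>)\<^sup>2) \<le> (2 * cmod \<gamma> + 1) * \<bar>\<sigma>\<bar>"
        by (simp add: norm_mult norm_power algebra_simps)
      also have "\<dots> \<le> (2 * cmod \<gamma> + 1) * e" using True d by (intro mult_left_mono) auto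
      finally have 1: "cmod (2 * \<gamma> * complex_of_real \<sigma>) + cmod ((complex_of_real \<sigma>)\<^sup>2) \<le> \<eta>\<^sup>2 / 2" using e2 by linarith
      have "cmod (complex_of_real (\<eta>\<^sup>2)) \<le> cmod (p \<sigma>) + (cmod (2 * \<gamma> * complex_of_real \<sigma>) + cmod ((complex_of_real \<sigma>)\<^sup>2))"
        using norm_triangle_ineq[of "p \<sigma>" "(complex_of_real \<sigma>)\<^sup>2 - 2 * \<gamma> * complex_of_real \<sigma>"]
          norm_triangle_ineq4[of "(complex_of_real \<sigma>)\<^sup>2" "2 * \<gamma> * complex_of_real \<sigma>"] by (simp add: p_def)
      moreover have "cmod (complex_of_real (\<eta>\<^sup>2)) = \<eta>\<^sup>2" unfolding norm_of_real by simp
      ultimately have "cmod (p \<sigma>) \<ge> \<eta>\<^sup>2 / 2" using 1 by linarith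
      then show ?thesis by simp
    next
      case False
      then have "2 * Im \<gamma> * e \<le> 2 * Im \<gamma> * \<bar>\<sigma>\<bar>" using gam by (intro mult_left_mono) auto
      then show ?thesis using norm_p_ge_linear[of \<sigma>] by linarith
    qed
  qed
qed

lemma u_deriv: "(u has_vector_derivative (2 * v \<sigma> * u \<sigma> - 2 * \<gamma> * u \<sigma> * u \<sigma>)) (at \<sigma>)"
  and v_deriv: "(v has_vector_derivative (u \<sigma> - 2 * \<gamma> * u \<sigma> * v \<sigma> + 2 * v \<sigma> * v \<sigma>)) (at \<sigma>)"
  and p_deriv: "(p has_vector_derivative (2 * \<gamma> - 2 * complex_of_real \<sigma>)) (at \<sigma>)"
proof -
  have s: "((\<lambda>x. complex_of_real x) has_vector_derivative 1) (at \<sigma>)"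
    by (auto intro!: derivative_eq_intros)
  have "((\<lambda>z. complex_of_real (\<eta>\<^sup>2) + 2 * \<gamma> * z - z\<^sup>2) has_field_derivative (2 * \<gamma> - 2 * z)) (at z)" for z
    by (auto intro!: derivative_eq_intros)
  from field_vector_diff_chain_at[OF s this] show p: "(p has_vector_derivative (2 * \<gamma> - 2 * complex_of_real \<sigma>)) (at \<sigma>)"
    by (simp add: o_def p_def[abs_def])
  have "((\<lambda>z. 1 / z) has_field_derivative - (1 / (p \<sigma> * p \<sigma>))) (at (p \<sigma>))"
    using p_nonzero by (auto intro!: derivative_eq_intros)
  from field_vector_diff_chain_at[OF p this]
  show u: "(u has_vector_derivative (2 * v \<sigma> * u \<sigma> - 2 * \<gamma> * u \<sigma> * u \<sigma>)) (at \<sigma>)"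
    using p_nonzero[of \<sigma>] by (simp add: o_def u_def[abs_def] v_def diff_divide_distrib algebra_simps)
  have "((\<lambda>x. complex_of_real x * u x) has_vector_derivative complex_of_real \<sigma> * (2 * v \<sigma> * u \<sigma> - 2 * \<gamma> * u \<sigma> * u \<sigma>) + 1 * u \<sigma>) (at \<sigma>)"
    by (rule has_vector_derivative_mult[OF s u])
  moreover have "(\<lambda>x. complex_of_real x * u x) = v" by (simp add: fun_eq_iff u_def v_def)
  moreover have "complex_of_real \<sigma> * (2 * v \<sigma> * u \<sigma> - 2 * \<gamma> * u \<sigma> * u \<sigma>) + 1 * u \<sigma> = u \<sigma> - 2 * \<gamma> * u \<sigma> * v \<sigma> + 2 * v \<sigma> * v \<sigma>"
    by (simp add: u_def v_def algebra_simps)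
  ultimately show "(v has_vector_derivative (u \<sigma> - 2 * \<gamma> * u \<sigma> * v \<sigma> + 2 * v \<sigma> * v \<sigma>)) (at \<sigma>)" by (simp only:)
qed

text \<open>
Simultaneous induction, since each derivative involves both functions.
\<close>
lemma symbol_u_v: "symbol n flat I (\<lambda>i. u) \<and> symbol n flat I (\<lambda>i. v)"
proof (induction n)
  obtain c where c: "c > 0" "\<And>\<sigma>. cmod (p \<sigma>) \<ge> c" using norm_p_ge by blast
  have bu: "\<exists>M\<ge>0. \<forall>i\<in>I. \<forall>x. cmod (u x) \<le> M * 1"
    by (intro exI[of _ "1 / c"]) (use c in \<open>auto simp: u_def norm_divide frac_le\<close>)
  have bv: "\<exists>M\<ge>0. \<forall>i\<in>I. \<forall>x. cmod (v x) \<le> M * 1"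
  proof (intro exI[of _ "1 / (2 * Im \<gamma>)"] conjI ballI allI)
    fix x
    have "cmod (v x) = \<bar>x\<bar> / cmod (p x)" by (simp add: v_def norm_divide)
    also have "\<dots> \<le> 1 / (2 * Im \<gamma>)"
      using norm_p_ge_linear[of x] gam p_nonzero[of x] by (simp add: divide_simps mult_ac)
    finally show "cmod (v x) \<le> 1 / (2 * Im \<gamma>) * 1" by simp
  qed (use gam in auto)
  {
    case 0
    show ?case using bu bv by simp
  next
    case (Suc n)
    then have un: "symbol n flat I (\<lambda>i. u)" "symbol n flat I (\<lambda>i. v)" by auto
    have "symbol (Suc n) flat I (\<lambda>i. u)"
      by (rule symbol_SucI[OF bu u_deriv]) (intro symbol_diff symbol_mult symbol_const' un)
    moreover have "symbol (Suc n) flat I (\<lambda>i. v)"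
      by (rule symbol_SucI[OF bv v_deriv]) (intro symbol_diff symbol_add symbol_mult symbol_const' un)
    ultimately show ?case by blast
  }
qed

lemma symbol_u: "symbol n flat I (\<lambda>i x. u x)" and symbol_v: "symbol n flat I (\<lambda>i x. v x)"
  using symbol_u_v by auto

lemma symbol_half: "symbol n W I r \<Longrightarrow> symbol n W I (\<lambda>i x. r i x / 2)"
  using symbol_cmult[of n W I r "1/2"] by simp

lemma symbol_m: "symbol n flat I (\<lambda>i x. m x)"
  unfolding m_def by (intro symbol_diff symbol_mult symbol_half symbol_const' symbol_u symbol_v)

lemma symbol_X: "symbol n flat I (\<lambda>i x. X x)"
  unfolding X_def by (intro symbol_diff symbol_add symbol_mult symbol_const' symbol_u symbol_v)

lemma symbol_mu: "symbol n flat I (\<lambda>i x. \<mu> x)"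
  unfolding \<mu>_def by (intro symbol_diff symbol_add symbol_half symbol_mult symbol_const' symbol_u symbol_v symbol_X)

lemma g_deriv: "(g has_vector_derivative - (g \<sigma> * (\<gamma> * u \<sigma> - v \<sigma>))) (at \<sigma>)"
proof -
  have c0: "csqrt (p \<sigma>) \<noteq> 0" using p_nonzero by simp
  have cc: "csqrt (p \<sigma>) * csqrt (p \<sigma>) = p \<sigma>" by (metis power2_csqrt power2_eq_square)
  have 1: "((\<lambda>x. csqrt (p x)) has_vector_derivative (2 * \<gamma> - 2 * complex_of_real \<sigma>) * (1 / (2 * csqrt (p \<sigma>)))) (at \<sigma>)"
    using field_vector_diff_chain_at[OF p_deriv has_field_derivative_csqrt'[OF DERIV_ident p_not_nonpos]]
    by (simp add: o_def inverse_eq_divide)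
  have "((\<lambda>z. complex_of_real \<eta> / z) has_field_derivative - (complex_of_real \<eta> / (csqrt (p \<sigma>) * csqrt (p \<sigma>)))) (at (csqrt (p \<sigma>)))"
    using c0 by (auto intro!: derivative_eq_intros)
  from field_vector_diff_chain_at[OF 1 this]
  have "(g has_vector_derivative (2 * \<gamma> - 2 * complex_of_real \<sigma>) * (1 / (2 * csqrt (p \<sigma>))) * - (complex_of_real \<eta> / p \<sigma>)) (at \<sigma>)"
    by (simp add: o_def g_def[abs_def] cc)
  moreover have "(2 * \<gamma> - 2 * complex_of_real \<sigma>) * (1 / (2 * csqrt (p \<sigma>))) * - (complex_of_real \<eta> / p \<sigma>) = - (g \<sigma> * (\<gamma> * u \<sigma> - v \<sigma>))"
    using c0 p_nonzero[of \<sigma>] by (simp add: g_def u_def v_def divide_simps)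
  ultimately show ?thesis by simp
qed

lemma symbol_g: "symbol n flat I (\<lambda>i x. g x)"
proof (induction n)
  obtain c where c: "c > 0" "\<And>\<sigma>. cmod (p \<sigma>) \<ge> c" using norm_p_ge by blast
  have b: "\<exists>M\<ge>0. \<forall>i\<in>I. \<forall>x. cmod (g x) \<le> M * 1"
  proof (intro exI[of _ "\<eta> / sqrt c"] conjI ballI allI)
    fix x
    have "(cmod (csqrt (p x)))\<^sup>2 = cmod (p x)" by (simp flip: norm_power)
    then have "cmod (csqrt (p x)) = sqrt (cmod (p x))" by (metis norm_ge_zero real_sqrt_unique)
    then have "cmod (g x) = \<eta> / sqrt (cmod (p x))" using eta by (simp add: g_def norm_divide)
    also have "\<dots> \<le> \<eta> / sqrt c" using c eta p_nonzero[of x] by (intro divide_left_mono mult_pos_pos) auto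
    finally show "cmod (g x) \<le> \<eta> / sqrt c * 1" by simp
  qed (use c eta in auto)
  {
    case 0
    show ?case using b by simp
  next
    case (Suc n)
    show ?case
      by (rule symbol_SucI[OF b g_deriv]) (intro symbol_minus symbol_mult symbol_diff symbol_const' symbol_u symbol_v Suc.IH)
  }
qed

text \<open>
The principal square root has non-negative real part, hence so has \<open>g\<close>.
\<close>
lemma norm_1_plus_g: "cmod (1 + g \<sigma>) \<ge> 1"
proof -
  have "Re (csqrt (p \<sigma>)) \<ge> 0" by (rule Re_csqrt)
  then have "Re (g \<sigma>) \<ge> 0" using eta by (simp add: g_def Re_divide)
  then have "1 \<le> Re (1 + g \<sigma>)" by simp
  also have "\<dots> \<le> cmod (1 + g \<sigma>)" by (rule complex_Re_le_cmod)
  finally show ?thesis .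
qed

lemma symbol_j: "symbol n flat I (\<lambda>i x. j x)"
  unfolding j_def
  by (rule symbol_inverse[of _ _ "\<lambda>i x. 1 + g x" 1]) (use norm_1_plus_g in \<open>auto intro!: symbol_add symbol_const' symbol_g\<close>)

lemma sv: "complex_of_real \<sigma> * u \<sigma> = v \<sigma>" "complex_of_real \<sigma> * v \<sigma> = X \<sigma>"
proof -
  show "complex_of_real \<sigma> * u \<sigma> = v \<sigma>" by (simp add: u_def v_def)
  have pu: "p \<sigma> * u \<sigma> = 1" using p_nonzero[of \<sigma>] by (simp add: u_def)
  have vu: "v \<sigma> = complex_of_real \<sigma> * u \<sigma>" by (simp add: u_def v_def)
  have "X \<sigma> = complex_of_real (\<eta>\<^sup>2) * u \<sigma> + 2 * \<gamma> * (complex_of_real \<sigma> * u \<sigma>) - p \<sigma> * u \<sigma>"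
    by (simp only: X_def vu pu)
  also have "\<dots> = complex_of_real \<sigma> * (complex_of_real \<sigma> * u \<sigma>)"
    by (simp add: p_def power2_eq_square algebra_simps)
  finally show "complex_of_real \<sigma> * v \<sigma> = X \<sigma>" by (simp only: vu)
qed

lemma g_sq: "g \<sigma> * g \<sigma> = complex_of_real (\<eta>\<^sup>2) * u \<sigma>"
proof -
  have "csqrt (p \<sigma>) * csqrt (p \<sigma>) = p \<sigma>" by (metis power2_csqrt power2_eq_square)
  then show ?thesis by (simp add: g_def u_def power2_eq_square)
qed

lemma j_g: "j \<sigma> * (1 + g \<sigma>) = 1"
  using norm_1_plus_g[of \<sigma>] by (auto simp: j_def)

text \<open>
The cancellation on which the rate rests. Since \<open>g\<^sup>2 - 1 = - 2 \<sigma> m\<close>, the amplitude deviates from \<open>1\<close> by \<open>- \<sigma> m\<close> to first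
order, exactly opposite to the contribution of the phase \<open>P\<close> after an integration by parts.
\<close>
lemma g_minus_1: "g \<sigma> - 1 = - 2 * complex_of_real \<sigma> * m \<sigma> * j \<sigma>"
proof -
  have "g \<sigma> - 1 = (g \<sigma> - 1) * (j \<sigma> * (1 + g \<sigma>))" by (simp add: j_g)
  also have "\<dots> = (g \<sigma> * g \<sigma> - 1) * j \<sigma>" by (simp add: algebra_simps)
  also have "g \<sigma> * g \<sigma> - 1 = - 2 * complex_of_real \<sigma> * m \<sigma>"
  proof -
    have "- 2 * complex_of_real \<sigma> * m \<sigma> = complex_of_real \<sigma> * v \<sigma> - 2 * \<gamma> * (complex_of_real \<sigma> * u \<sigma>)"
      by (simp add: m_def algebra_simps)
    also have "\<dots> = complex_of_real (\<eta>\<^sup>2) * u \<sigma> - 1" unfolding sv X_def by simp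
    finally show ?thesis by (simp add: g_sq)
  qed
  finally show ?thesis .
qed

definition m' :: "real \<Rightarrow> complex" where
  "m' \<sigma> = \<gamma> * (2 * v \<sigma> * u \<sigma> - 2 * \<gamma> * u \<sigma> * u \<sigma>) - (u \<sigma> - 2 * \<gamma> * u \<sigma> * v \<sigma> + 2 * v \<sigma> * v \<sigma>) / 2"

lemma m_deriv: "(m has_vector_derivative m' \<sigma>) (at \<sigma>)"
  unfolding m_def[abs_def] m'_def
  by (intro has_vector_derivative_diff has_vector_derivative_mult_right has_vector_derivative_divide u_deriv v_deriv)

lemma s_m': "complex_of_real \<sigma> * m' \<sigma> = \<mu> \<sigma>"
proof -
  have "complex_of_real \<sigma> * m' \<sigma> = \<gamma> * (2 * v \<sigma> * (complex_of_real \<sigma> * u \<sigma>) - 2 * \<gamma> * u \<sigma> * (complex_of_real \<sigma> * u \<sigma>))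
     - ((complex_of_real \<sigma> * u \<sigma>) - 2 * \<gamma> * (complex_of_real \<sigma> * u \<sigma>) * v \<sigma> + 2 * v \<sigma> * (complex_of_real \<sigma> * v \<sigma>)) / 2"
    by (simp add: m'_def algebra_simps)
  also have "\<dots> = \<mu> \<sigma>" unfolding sv \<mu>_def by (simp add: algebra_simps)
  finally show ?thesis .
qed

lemma Im_m: "Im (m \<sigma>) = \<eta>\<^sup>2 * Im \<gamma> / (cmod (p \<sigma>))\<^sup>2"
proof -
  have "m \<sigma> = (2 * \<gamma> - complex_of_real \<sigma>) / (2 * p \<sigma>)"
    using p_nonzero[of \<sigma>] by (simp add: m_def u_def v_def field_simps)
  also have "\<dots> = (2 * \<gamma> - complex_of_real \<sigma>) * cnj (p \<sigma>) / complex_of_real (2 * (cmod (p \<sigma>))\<^sup>2)"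
  proof -
    have "complex_of_real (2 * (cmod (p \<sigma>))\<^sup>2) = 2 * (p \<sigma> * cnj (p \<sigma>))"
      by (simp only: of_real_mult complex_norm_square) simp
    then show ?thesis using p_nonzero[of \<sigma>] by (simp only:) simp
  qed
  finally have "Im (m \<sigma>) = Im ((2 * \<gamma> - complex_of_real \<sigma>) * cnj (p \<sigma>)) / (2 * (cmod (p \<sigma>))\<^sup>2)"
    by (simp only: Im_divide_of_real)
  also have "Im ((2 * \<gamma> - complex_of_real \<sigma>) * cnj (p \<sigma>)) = 2 * (\<eta>\<^sup>2 * Im \<gamma>)"
    by (simp add: p_def power2_eq_square algebra_simps)
  finally show ?thesis by simp
qed

text \<open>
The imaginary part of \<open>m\<close> is that of \<open>(2 \<gamma> - \<sigma>) cnj p / (2 |p|\<^sup>2)\<close>, where the terms of higher order in \<open>\<sigma>\<close> cancel.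
\<close>
lemma Im_P: "Im (P \<sigma>) = \<eta>\<^sup>2 * Im \<gamma> / 2 * (\<sigma>\<^sup>2 / cmod (p \<sigma>))\<^sup>2"
proof -
  have "P \<sigma> = m \<sigma> * complex_of_real (\<sigma> ^ 4 / 2)" by (simp add: P_def)
  then have "Im (P \<sigma>) = Im (m \<sigma>) * (\<sigma> ^ 4 / 2)" by (simp only: Im_complex_of_real times_complex.sel Re_complex_of_real)
  then show ?thesis by (simp add: Im_m power_divide flip: power_mult)
qed

lemma Im_P_nonneg: "Im (P \<sigma>) \<ge> 0"
  using gam by (simp add: Im_P)

text \<open>
The lower bound gives the beams their decay: quartic near the caustic point, and uniform away from it.
\<close>
lemma Im_P_bounds: "\<exists>c>0. \<exists>C. \<forall>\<sigma>. c * (\<sigma>\<^sup>2 / (1 + \<sigma>\<^sup>2))\<^sup>2 \<le> Im (P \<sigma>) \<and> Im (P \<sigma>) \<le> C"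
proof -
  obtain M where M: "\<And>x. cmod (X x) \<le> M" using symbol_bounded[OF symbol_X[of 0 "{0::nat}"]] by auto
  define K where "K = \<eta>\<^sup>2 + 2 * cmod \<gamma> + 1"
  have K: "K > 0" using eta by (simp add: K_def add_pos_nonneg)
  have pK: "cmod (p \<sigma>) \<le> K * (1 + \<sigma>\<^sup>2)" for \<sigma>
  proof -
    have "cmod (p \<sigma>) \<le> cmod (complex_of_real (\<eta>\<^sup>2)) + cmod (2 * \<gamma> * complex_of_real \<sigma>) + cmod ((complex_of_real \<sigma>)\<^sup>2)"
      unfolding p_def by (intro order_trans[OF norm_triangle_ineq4] add_right_mono norm_triangle_ineq)
    also have "\<dots> = \<eta>\<^sup>2 + 2 * cmod \<gamma> * \<bar>\<sigma>\<bar> + \<sigma>\<^sup>2" by (simp add: norm_mult norm_power)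
    also have "\<dots> \<le> K * (1 + \<sigma>\<^sup>2)"
    proof -
      have "0 \<le> (\<bar>\<sigma>\<bar> - 1)\<^sup>2" by simp
      then have "\<bar>\<sigma>\<bar> \<le> 1 + \<sigma>\<^sup>2" by (simp add: power2_diff)
      then have "2 * cmod \<gamma> * \<bar>\<sigma>\<bar> \<le> 2 * cmod \<gamma> * (1 + \<sigma>\<^sup>2)" by (intro mult_left_mono) auto
      moreover have "0 \<le> \<eta>\<^sup>2 * \<sigma>\<^sup>2" by simp
      moreover have "K * (1 + \<sigma>\<^sup>2) = (\<eta>\<^sup>2 + \<sigma>\<^sup>2) + 2 * cmod \<gamma> * (1 + \<sigma>\<^sup>2) + (1 + \<eta>\<^sup>2 * \<sigma>\<^sup>2)"
        by (simp add: K_def algebra_simps)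
      ultimately show ?thesis by linarith
    qed
    finally show ?thesis .
  qed
  have q: "\<sigma>\<^sup>2 / cmod (p \<sigma>) = cmod (X \<sigma>)" for \<sigma>
    by (simp add: sv(2)[symmetric] v_def norm_mult norm_divide power2_eq_square abs_mult_self_eq)
  have "\<forall>\<sigma>. \<eta>\<^sup>2 * Im \<gamma> / 2 / K\<^sup>2 * (\<sigma>\<^sup>2 / (1 + \<sigma>\<^sup>2))\<^sup>2 \<le> Im (P \<sigma>) \<and> Im (P \<sigma>) \<le> \<eta>\<^sup>2 * Im \<gamma> / 2 * M\<^sup>2"
  proof (intro allI conjI)
    fix \<sigma>
    show "Im (P \<sigma>) \<le> \<eta>\<^sup>2 * Im \<gamma> / 2 * M\<^sup>2"
      unfolding Im_P q using gam M[of \<sigma>] by (intro mult_left_mono power_mono) auto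
    have "\<sigma>\<^sup>2 / (1 + \<sigma>\<^sup>2) / K \<le> \<sigma>\<^sup>2 / cmod (p \<sigma>)"
      using divide_left_mono[OF pK[of \<sigma>], of "\<sigma>\<^sup>2"] p_nonzero[of \<sigma>] K by (simp add: add_pos_nonneg mult_ac)
    then have "(\<sigma>\<^sup>2 / (1 + \<sigma>\<^sup>2) / K)\<^sup>2 \<le> (\<sigma>\<^sup>2 / cmod (p \<sigma>))\<^sup>2" using K by (intro power_mono) auto
    then have "\<eta>\<^sup>2 * Im \<gamma> / 2 * (\<sigma>\<^sup>2 / (1 + \<sigma>\<^sup>2) / K)\<^sup>2 \<le> \<eta>\<^sup>2 * Im \<gamma> / 2 * (\<sigma>\<^sup>2 / cmod (p \<sigma>))\<^sup>2"
      using gam by (intro mult_left_mono) auto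
    then show "\<eta>\<^sup>2 * Im \<gamma> / 2 / K\<^sup>2 * (\<sigma>\<^sup>2 / (1 + \<sigma>\<^sup>2))\<^sup>2 \<le> Im (P \<sigma>)"
      unfolding Im_P by (simp add: power_divide power_mult_distrib mult_ac)
  qed
  moreover have "\<eta>\<^sup>2 * Im \<gamma> / 2 / K\<^sup>2 > 0" using eta gam K by simp
  ultimately show ?thesis by blast
qed

end

section \<open>Cutting off the complex phase\<close>

text \<open>
The Lorentzian at the scale \<open>1 / N\<close> and its multiple by \<open>N x\<close>. The pair is closed under differentiation, and
\<open>1 - cut\<close> is again \<open>N x\<close> times a member of it.
\<close>
definition cut :: "real \<Rightarrow> real \<Rightarrow> real" where "cut N x = 1 / (1 + (N * x)\<^sup>2)"
definition cut1 :: "real \<Rightarrow> real \<Rightarrow> real" where "cut1 N x = N * x / (1 + (N * x)\<^sup>2)"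

lemma cut_pos: "1 + (N * x)\<^sup>2 > (0::real)" by (simp add: add_pos_nonneg)

lemma cut_bounds: "0 < cut N x" "cut N x \<le> 1" "\<bar>cut1 N x\<bar> \<le> 1 / 2"
proof -
  show "0 < cut N x" "cut N x \<le> 1" using cut_pos[of N x] by (auto simp: cut_def)
  have "0 \<le> (\<bar>N * x\<bar> - 1)\<^sup>2" by simp
  then have "2 * \<bar>N * x\<bar> \<le> 1 + (N * x)\<^sup>2" by (simp only: power2_diff power2_abs) simp
  then show "\<bar>cut1 N x\<bar> \<le> 1 / 2" using cut_pos[of N x] by (simp add: cut1_def pos_divide_le_eq abs_divide)
qed

lemma cut_identities: "cut1 N x = N * x * cut N x" "1 - cut N x = N * x * cut1 N x"
  using cut_pos[of N x] by (auto simp: cut_def cut1_def field_simps power2_eq_square)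

lemma cut_deriv: "(cut N has_real_derivative - 2 * N * cut1 N x * cut N x) (at x)"
  and cut1_deriv: "(cut1 N has_real_derivative N * cut N x - 2 * N * cut1 N x * cut1 N x) (at x)"
proof -
  have nz: "1 + (N * x)\<^sup>2 \<noteq> 0" using cut_pos[of N x] by simp
  have d: "((\<lambda>x. 1 + (N * x)\<^sup>2) has_real_derivative 2 * N * (N * x)) (at x)"
    by (auto intro!: derivative_eq_intros)
  have "((\<lambda>x. 1 / (1 + (N * x)\<^sup>2)) has_real_derivative (0 * (1 + (N * x)\<^sup>2) - 1 * (2 * N * (N * x))) / ((1 + (N * x)\<^sup>2) * (1 + (N * x)\<^sup>2))) (at x)"
    by (rule DERIV_divide[OF DERIV_const d nz])
  then show "(cut N has_real_derivative - 2 * N * cut1 N x * cut N x) (at x)"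
    by (simp add: cut_def[abs_def] cut1_def)
  have "((\<lambda>x. N * x / (1 + (N * x)\<^sup>2)) has_real_derivative (N * (1 + (N * x)\<^sup>2) - (N * x) * (2 * N * (N * x))) / ((1 + (N * x)\<^sup>2) * (1 + (N * x)\<^sup>2))) (at x)"
    by (rule DERIV_divide[OF _ d nz]) (auto intro!: derivative_eq_intros)
  then show "(cut1 N has_real_derivative N * cut N x - 2 * N * cut1 N x * cut1 N x) (at x)"
    using nz by (simp add: cut_def cut1_def[abs_def] diff_divide_distrib mult_ac)
qed

lemma symbol_cut_cut1:
  "symbol n flat I (\<lambda>i x. complex_of_real (cut N x)) \<and> symbol n flat I (\<lambda>i x. complex_of_real (cut1 N x))"
proof (induction n)
  have b: "\<exists>M\<ge>0. \<forall>i\<in>I. \<forall>x. cmod (complex_of_real (cut N x)) \<le> M * 1"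
    "\<exists>M\<ge>0. \<forall>i\<in>I. \<forall>x. cmod (complex_of_real (cut1 N x)) \<le> M * 1"
    using cut_bounds(2)[of N] order_trans[OF cut_bounds(3)[of N], of 1]
    by (auto intro!: exI[of _ 1] simp: abs_of_pos[OF cut_bounds(1)])
  have d: "((\<lambda>x. complex_of_real (cut N x)) has_vector_derivative (- 2 * complex_of_real N * complex_of_real (cut1 N x) * complex_of_real (cut N x))) (at x)" for x
    using has_vector_derivative_of_real[OF cut_deriv[of N x]] by simp
  have d1: "((\<lambda>x. complex_of_real (cut1 N x)) has_vector_derivative (complex_of_real N * complex_of_real (cut N x) - 2 * complex_of_real N * complex_of_real (cut1 N x) * complex_of_real (cut1 N x))) (at x)" for x
    using has_vector_derivative_of_real[OF cut1_deriv[of N x]] by simp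
  {
    case 0
    show ?case using b by simp
  next
    case (Suc n)
    then have IH: "symbol n flat I (\<lambda>i x. complex_of_real (cut N x))" "symbol n flat I (\<lambda>i x. complex_of_real (cut1 N x))" by auto
    have "symbol (Suc n) flat I (\<lambda>i x. complex_of_real (cut N x))"
      by (rule symbol_SucI[OF b(1) d]) (intro symbol_mult symbol_const' IH)
    moreover have "symbol (Suc n) flat I (\<lambda>i x. complex_of_real (cut1 N x))"
      by (rule symbol_SucI[OF b(2) d1]) (intro symbol_diff symbol_mult symbol_const' IH)
    ultimately show ?case by blast
  }
qed

context beam_phase
begin

text \<open>
The cut-off \<open>kap = 1 - (1 - T)\<^sup>3\<close> is of order \<open>x^(-2)\<close> at infinity, which for large \<open>N\<close> keeps the derivative of the
modified phase \<open>Pt = kap P\<close> small against \<open>x\<^sup>2\<close>, while \<open>1 - kap = O(x\<^sup>6)\<close> near \<open>0\<close>, which is flat enough for the error to be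
negligible. The factor \<open>nn\<close> is \<open>Pt' / x\<^sup>3\<close> (lemma \<open>Pt_deriv\<close>).
\<close>
definition T :: "real \<Rightarrow> real \<Rightarrow> complex" where "T N x = complex_of_real (cut N x)"
definition S :: "real \<Rightarrow> real \<Rightarrow> complex" where "S N x = complex_of_real (cut1 N x)"
definition kapr :: "real \<Rightarrow> real \<Rightarrow> real" where "kapr N x = 1 - (1 - cut N x) ^ 3"
definition kap :: "real \<Rightarrow> real \<Rightarrow> complex" where "kap N x = complex_of_real (kapr N x)"
definition nn :: "real \<Rightarrow> real \<Rightarrow> complex" where
  "nn N x = kap N x * (2 * m x + \<mu> x / 2) - 3 * m x * T N x * (1 - T N x) ^ 3"
definition Pt :: "real \<Rightarrow> real \<Rightarrow> complex" where "Pt N x = kap N x * P x"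

lemma kap_T: "kap N x = 1 - (1 - T N x) ^ 3" by (simp add: kap_def kapr_def T_def)

lemma kapr_bounds: "cut N x \<le> kapr N x" "kapr N x \<le> 1" "0 < kapr N x"
proof -
  let ?t = "1 - cut N x"
  have t: "0 \<le> ?t" "?t \<le> 1" using cut_bounds[of N x] by auto
  have "?t ^ 3 \<le> ?t ^ 1" using t by (intro power_decreasing) auto
  then show "cut N x \<le> kapr N x" by (simp add: kapr_def)
  then show "0 < kapr N x" using cut_bounds(1)[of N x] by linarith
  show "kapr N x \<le> 1" using t by (simp add: kapr_def)
qed

lemma symbol_T: "symbol k flat I (\<lambda>i x. T N x)" and symbol_S: "symbol k flat I (\<lambda>i x. S N x)"
  unfolding T_def S_def using symbol_cut_cut1 by auto

lemma symbol_kap: "symbol k flat I (\<lambda>i x. kap N x)"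
  unfolding kap_T by (intro symbol_diff symbol_power symbol_const' symbol_T)

lemma symbol_nn: "symbol k flat I (\<lambda>i x. nn N x)"
  unfolding nn_def by (intro symbol_diff symbol_add symbol_mult symbol_half symbol_power symbol_const' symbol_T symbol_kap symbol_m symbol_mu)

lemma T_S: "1 - T N x = complex_of_real N * complex_of_real x * S N x"
  unfolding T_def S_def using arg_cong[OF cut_identities(2)[of N x], of complex_of_real] by simp

lemma s_T: assumes "N > 0" shows "complex_of_real x * T N x = S N x / complex_of_real N"
  unfolding T_def S_def using arg_cong[OF cut_identities(1)[of N x], of complex_of_real] assms by simp

lemma s_kap:
  assumes "N > 0"
  shows "complex_of_real x * kap N x = S N x / complex_of_real N * (3 - 3 * T N x + T N x ^ 2)"
proof -
  have "complex_of_real x * kap N x = (complex_of_real x * T N x) * (3 - 3 * T N x + T N x ^ 2)"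
    by (simp add: kap_T power2_eq_square power3_eq_cube algebra_simps)
  then show ?thesis by (simp only: s_T[OF assms])
qed

lemma s_nn:
  assumes N: "N > 0"
  shows "complex_of_real x * nn N x = S N x / complex_of_real N * (3 - 3 * T N x + T N x ^ 2) * (2 * m x + \<mu> x / 2) - 3 * m x * (S N x / complex_of_real N) * (1 - T N x) ^ 3"
proof -
  have "complex_of_real x * nn N x = complex_of_real x * kap N x * (2 * m x + \<mu> x / 2) - 3 * m x * (complex_of_real x * T N x) * (1 - T N x) ^ 3"
    by (simp add: nn_def algebra_simps)
  then show ?thesis by (simp only: s_kap[OF N] s_T[OF N])
qed

text \<open>
The derivative of the total phase \<open>- x\<^sup>3 / 3 + t Pt\<close> is \<open>- x\<^sup>2 (1 - t x nn)\<close>. By \<open>s_nn\<close> the product \<open>x nn\<close> carries a factor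
\<open>1 / N\<close>, so for large \<open>N\<close> no critical point other than \<open>0\<close> appears for any \<open>t \<in> [0, 1]\<close>.
\<close>
lemma ex_small_cutoff: "\<exists>N>0. \<forall>x. cmod (complex_of_real x * nn N x) \<le> 1 / 2"
proof -
  obtain A1 where A1: "\<And>x. cmod (2 * m x + \<mu> x / 2) \<le> A1"
  proof -
    have "symbol 0 flat {0::nat} (\<lambda>i x. 2 * m x + \<mu> x / 2)" by (intro symbol_add symbol_mult symbol_const' symbol_m symbol_half symbol_mu)
    from symbol_bounded[OF this] that show ?thesis by auto
  qed
  obtain A2 where A2: "\<And>x. cmod (m x) \<le> A2" using symbol_bounded[OF symbol_m[of 0 "{0::nat}"]] by auto
  have A: "A1 \<ge> 0" "A2 \<ge> 0" using A1[of 0] A2[of 0] norm_ge_zero order_trans by blast+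
  \<comment> \<open>By cut_bounds, cmod S is at most 1/2; the 7 bounds 3 - 3 T + T^2.\<close>
  define N where "N = 7 * A1 + 3 * A2 + 1"
  have N: "N > 0" using A by (simp add: N_def)
  show ?thesis
  proof (intro exI[of _ N] conjI allI N)
    fix x
    have t: "cmod (T N x) \<le> 1" "cmod (1 - T N x) \<le> 1"
    proof -
      show "cmod (T N x) \<le> 1" unfolding T_def norm_of_real using cut_bounds(1,2)[of N x] by simp
      have "cmod (1 - T N x) = \<bar>1 - cut N x\<bar>" unfolding T_def by (metis norm_of_real of_real_1 of_real_diff)
      then show "cmod (1 - T N x) \<le> 1" using cut_bounds(1,2)[of N x] by simp
    qed
    have s: "cmod (S N x / complex_of_real N) \<le> 1 / (2 * N)"
      using cut_bounds(3)[of N x] N by (simp add: S_def norm_divide divide_simps)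
    have t2: "cmod (3 - 3 * T N x + T N x ^ 2) \<le> 7"
    proof -
      have "cmod (3 - 3 * T N x + T N x ^ 2) \<le> 3 + 3 * cmod (T N x) + cmod (T N x) ^ 2"
        by (intro order_trans[OF norm_triangle_ineq] add_mono order_trans[OF norm_triangle_ineq4]) (auto simp: norm_mult norm_power)
      also have "\<dots> \<le> 3 + 3 * 1 + 1" using t by (intro add_mono mult_left_mono) (auto simp: power_le_one)
      finally show ?thesis by simp
    qed
    note s_nn[OF N, of x]
    also have "cmod (S N x / complex_of_real N * (3 - 3 * T N x + T N x ^ 2) * (2 * m x + \<mu> x / 2) - 3 * m x * (S N x / complex_of_real N) * (1 - T N x) ^ 3) \<le> 1 / (2 * N) * 7 * A1 + 3 * A2 * (1 / (2 * N)) * 1"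
    proof (intro order_trans[OF norm_triangle_ineq4] add_mono)
      show "cmod (S N x / complex_of_real N * (3 - 3 * T N x + T N x ^ 2) * (2 * m x + \<mu> x / 2)) \<le> 1 / (2 * N) * 7 * A1"
        unfolding norm_mult[of _ "2 * m x + \<mu> x / 2"] norm_mult[of "S N x / complex_of_real N"]
        using s t2 A1 N by (intro mult_mono mult_nonneg_nonneg) auto
      have "cmod (3 * m x) \<le> 3 * A2" using A2[of x] by (simp add: norm_mult)
      moreover have "cmod ((1 - T N x) ^ 3) \<le> 1" using t by (simp add: norm_power power_le_one)
      ultimately show "cmod (3 * m x * (S N x / complex_of_real N) * (1 - T N x) ^ 3) \<le> 3 * A2 * (1 / (2 * N)) * 1"
        unfolding norm_mult[of _ "(1 - T N x) ^ 3"] norm_mult[of _ "S N x / complex_of_real N"]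
        using s N A by (intro mult_mono mult_nonneg_nonneg) auto
    qed
    also have "\<dots> = (7 * A1 + 3 * A2) / (2 * N)" using N by (simp add: field_simps)
    also have "\<dots> \<le> 1 / 2" using N by (simp add: N_def divide_simps)
    finally show "cmod (complex_of_real x * nn N x) \<le> 1 / 2" .
  qed
qed

lemma Pt_deriv: "(Pt N has_vector_derivative (complex_of_real x) ^ 3 * nn N x) (at x)"
proof -
  have k: "(kap N has_vector_derivative - 6 * complex_of_real N * S N x * T N x * (1 - T N x) ^ 2) (at x)"
  proof -
    have "(kapr N has_real_derivative - 6 * N * cut1 N x * cut N x * (1 - cut N x) ^ 2) (at x)"
      unfolding kapr_def[abs_def]
      by (rule derivative_eq_intros cut_deriv refl)+ (simp add: power2_eq_square)
    from has_vector_derivative_of_real[OF this] show ?thesis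
      by (simp add: kap_def[abs_def] T_def S_def)
  qed
  have q: "((\<lambda>x. complex_of_real x ^ 4 / 2) has_vector_derivative 2 * complex_of_real x ^ 3) (at x)"
  proof -
    have "((\<lambda>x. x ^ 4 / 2) has_real_derivative 2 * x ^ 3) (at x)" by (auto intro!: derivative_eq_intros)
    then have "((\<lambda>x. complex_of_real (x ^ 4 / 2)) has_vector_derivative complex_of_real (2 * x ^ 3)) (at x)"
      by (rule has_vector_derivative_of_real)
    then show ?thesis by simp
  qed
  have "((\<lambda>x. kap N x * (m x * (complex_of_real x ^ 4 / 2))) has_vector_derivative
     kap N x * (m x * (2 * complex_of_real x ^ 3) + m' x * (complex_of_real x ^ 4 / 2))
     + - 6 * complex_of_real N * S N x * T N x * (1 - T N x) ^ 2 * (m x * (complex_of_real x ^ 4 / 2))) (at x)"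
    by (intro has_vector_derivative_mult k m_deriv q)
  moreover have "kap N x * (m x * (2 * complex_of_real x ^ 3) + m' x * (complex_of_real x ^ 4 / 2))
     + - 6 * complex_of_real N * S N x * T N x * (1 - T N x) ^ 2 * (m x * (complex_of_real x ^ 4 / 2))
     = complex_of_real x ^ 3 * (kap N x * (2 * m x + (complex_of_real x * m' x) / 2)
         - 3 * m x * T N x * (1 - T N x) ^ 2 * (complex_of_real N * complex_of_real x * S N x))"
  proof -
    have e4: "complex_of_real x ^ 4 = complex_of_real x ^ 3 * complex_of_real x" by (simp flip: power_Suc2)
    show ?thesis unfolding e4 by (simp add: ring_distribs)
  qed
  moreover have "\<dots> = (complex_of_real x) ^ 3 * nn N x"
    unfolding s_m' T_S[symmetric] nn_def by (simp add: power3_eq_cube power2_eq_square mult_ac)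
  ultimately show ?thesis unfolding Pt_def[abs_def] P_def by (simp only: times_divide_eq_right)
qed

lemma Im_Pt: "Im (Pt N x) = kapr N x * Im (P x)"
  by (simp add: Pt_def kap_def)

lemma Im_Pt_nonneg: "Im (Pt N x) \<ge> 0"
  using kapr_bounds[of N x] Im_P_nonneg[of x] by (simp add: Im_Pt)

lemma norm_m_bound: "\<exists>C\<ge>0. \<forall>x. cmod (m x) \<le> C"
  using symbol_bounded[OF symbol_m[of 0 "{0::nat}"]] by auto

text \<open>
For \<open>|x| \<le> 1\<close> all exponentials are at most \<open>exp (- y)\<close> with \<open>y = k d x\<^sup>4\<close>. The changes of the phase, \<open>k x\<^sup>4 (1 - kap) = O(k x^(10))\<close>,
and of the amplitude, \<open>1 - kap\<^sup>2 = O(x\<^sup>6)\<close>, are \<open>k^(-3/2)\<close> times powers of \<open>y\<close>.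

For \<open>|x| \<ge> 1\<close> the imaginary part of \<open>P\<close> is bounded below, but \<open>kap\<close> tends to \<open>0\<close> and the damping \<open>exp (- k kap Im P)\<close> is lost
at infinity. This is why the modified amplitude carries \<open>kap\<^sup>2\<close>: the product \<open>t\<^sup>2 exp (- k t Im P)\<close> is
\<open>O(k^(-2))\<close> uniformly in \<open>t > 0\<close>, in particular for \<open>t = kap\<close>.
\<close>
lemma cut_error_pointwise:
  assumes N: "N > 0"
  shows "\<exists>C\<ge>0. \<forall>k\<ge>1. \<forall>x. cmod (exp (\<i> * complex_of_real k * P x) - kap N x ^ 2 * exp (\<i> * complex_of_real k * Pt N x)) \<le> C * k powr (-3/2)"
proof -
  obtain c where c: "c > 0" "\<And>x. c * (x\<^sup>2 / (1 + x\<^sup>2))\<^sup>2 \<le> Im (P x)" using Im_P_bounds by blast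
  obtain Cm where Cm: "Cm \<ge> 0" "\<And>x. cmod (m x) \<le> Cm" using norm_m_bound by blast
  define d where "d = 1 / (1 + N\<^sup>2) * (c / 4)"
  have d: "d > 0" using c by (simp add: d_def add_pos_nonneg)
  define K1 where "K1 = Cm / 2 * N ^ 6 * sqrt (5 ^ 5 / d ^ 5)"
  define K2 where "K2 = 2 * N ^ 6 * sqrt (3 ^ 3 / d ^ 3)"
  define K3 where "K3 = 2 * (64 / c\<^sup>2)"
  have K0: "K1 \<ge> 0" "K2 \<ge> 0" "K3 \<ge> 0" using Cm d N by (simp_all add: K1_def K2_def K3_def)
  show ?thesis
  proof (intro exI[of _ "K1 + K2 + K3"] conjI allI impI)
    show "K1 + K2 + K3 \<ge> 0" using K0 by simp
    fix k x :: real assume k: "k \<ge> 1"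
    let ?e = "exp (\<i> * complex_of_real k * P x)" and ?et = "exp (\<i> * complex_of_real k * Pt N x)"
    have ne: "cmod ?e = exp (- (k * Im (P x)))" "cmod ?et = exp (- (k * Im (Pt N x)))" by simp_all
    have nk: "cmod (kap N x) = kapr N x" using kapr_bounds[of N x] by (simp add: kap_def)
    have n1k: "cmod (1 - kap N x) = (1 - cut N x) ^ 3"
    proof -
      have "1 - kap N x = complex_of_real ((1 - cut N x) ^ 3)" by (simp add: kap_def kapr_def)
      then show ?thesis using cut_bounds(2)[of N x] by (simp only: norm_of_real) simp
    qed
    have k32: "(k powr - (3/2))\<^sup>2 = 1 / k ^ 3" using k by (simp add: power2_eq_square powr_minus_divide flip: powr_add powr_numeral)
    show "cmod (?e - kap N x ^ 2 * ?et) \<le> (K1 + K2 + K3) * k powr (-3/2)"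
    proof (cases "\<bar>x\<bar> \<le> 1")
      case True
      then have x2: "x\<^sup>2 \<le> 1" by (simp add: abs_square_le_1)
      define y where "y = k * d * x ^ 4"
      have x4: "0 \<le> x ^ 4" by simp
      have ee: "exp y * exp (- y) = 1" by (simp flip: exp_add)
      have e2: "(exp (- y))\<^sup>2 = exp (- (2 * y))" by (simp add: power2_eq_square flip: exp_add)
      have y5: "y ^ 5 = k ^ 5 * d ^ 5 * x ^ 20" and y3: "y ^ 3 = k ^ 3 * d ^ 3 * x ^ 12"
        by (simp_all add: y_def power_mult_distrib flip: power_mult)
      have k5: "k ^ 5 = k ^ 2 * k ^ 3" by (simp flip: power_add)
      have y: "y \<ge> 0" using k d x4 by (simp add: y_def)
      have yP: "y \<le> k * Im (Pt N x)"
      proof -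
        have "1 / (1 + N\<^sup>2) \<le> cut N x"
          using x2 mult_left_mono[of "x\<^sup>2" 1 "N\<^sup>2"] unfolding cut_def
          by (intro divide_left_mono mult_pos_pos) (auto simp: power_mult_distrib add_pos_nonneg)
        then have 1: "1 / (1 + N\<^sup>2) \<le> kapr N x" using kapr_bounds(1)[of N x] by linarith
        have "x\<^sup>2 / 2 \<le> x\<^sup>2 / (1 + x\<^sup>2)" using x2 by (intro divide_left_mono) (auto simp: add_pos_nonneg)
        then have "(x\<^sup>2 / 2)\<^sup>2 \<le> (x\<^sup>2 / (1 + x\<^sup>2))\<^sup>2" by (intro power_mono) auto
        then have "c * (x\<^sup>2 / 2)\<^sup>2 \<le> Im (P x)" using c(2)[of x] mult_left_mono[of "(x\<^sup>2 / 2)\<^sup>2" "(x\<^sup>2 / (1 + x\<^sup>2))\<^sup>2" c] c(1) by linarith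
        then have 2: "c / 4 * x ^ 4 \<le> Im (P x)" by (simp add: power_divide flip: power_mult)
        have "1 / (1 + N\<^sup>2) * (c / 4 * x ^ 4) \<le> kapr N x * Im (P x)"
          using 1 2 c(1) kapr_bounds[of N x] by (intro mult_mono) auto
        then have "k * (1 / (1 + N\<^sup>2) * (c / 4 * x ^ 4)) \<le> k * (kapr N x * Im (P x))" using k by (intro mult_left_mono) auto
        then show ?thesis unfolding y_def d_def Im_Pt mult.assoc .
      qed
      have et: "cmod ?et \<le> exp (- y)" using yP by (simp add: ne)
      have x6: "(1 - cut N x) ^ 3 \<le> N ^ 6 * x ^ 6"
      proof -
        have "1 - cut N x = (N * x)\<^sup>2 * cut N x" using cut_identities[of N x] by (simp add: power2_eq_square)
        also have "\<dots> \<le> (N * x)\<^sup>2 * 1" using cut_bounds[of N x] by (intro mult_left_mono) auto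
        finally have "(1 - cut N x) ^ 3 \<le> ((N * x)\<^sup>2) ^ 3" using cut_bounds[of N x] by (intro power_mono) auto
        then show ?thesis by (simp add: power_mult_distrib flip: power_mult)
      qed
      have A: "cmod (?e - ?et) \<le> K1 * k powr (-3/2)"
      proof -
        have "cmod (?e - ?et) \<le> exp (- y) * cmod (\<i> * complex_of_real k * P x - \<i> * complex_of_real k * Pt N x)"
        proof (rule cmod_exp_diff_le)
          have "kapr N x * Im (P x) \<le> 1 * Im (P x)" using kapr_bounds[of N x] Im_P_nonneg[of x] by (intro mult_right_mono) auto
          then have "k * Im (Pt N x) \<le> k * Im (P x)" using k by (simp add: Im_Pt)
          then show "Re (\<i> * complex_of_real k * P x) \<le> - y" using yP by simp
          show "Re (\<i> * complex_of_real k * Pt N x) \<le> - y" using yP by simp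
        qed
        also have "\<i> * complex_of_real k * P x - \<i> * complex_of_real k * Pt N x = \<i> * complex_of_real k * P x * (1 - kap N x)"
          by (simp add: Pt_def algebra_simps)
        finally have D: "cmod (?e - ?et) \<le> exp (- y) * cmod (\<i> * complex_of_real k * P x * (1 - kap N x))" .
        have "cmod (\<i> * complex_of_real k * P x * (1 - kap N x)) = k * (cmod (m x) * x ^ 4 / 2) * (1 - cut N x) ^ 3"
          using k by (simp add: norm_mult n1k P_def norm_divide norm_power)
        also have "k * (cmod (m x) * x ^ 4 / 2) * (1 - cut N x) ^ 3 \<le> k * (Cm * x ^ 4 / 2) * (N ^ 6 * x ^ 6)"
          using k Cm x6 cut_bounds[of N x] by (intro mult_mono divide_right_mono mult_left_mono mult_right_mono mult_nonneg_nonneg) auto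
        finally have "exp (- y) * cmod (\<i> * complex_of_real k * P x * (1 - kap N x)) \<le> exp (- y) * (k * (Cm * x ^ 4 / 2) * (N ^ 6 * x ^ 6))"
          by (rule mult_left_mono) simp
        with D have "cmod (?e - ?et) \<le> exp (- y) * (k * (Cm * x ^ 4 / 2) * (N ^ 6 * x ^ 6))" by (rule order_trans)
        also have "\<dots> = Cm / 2 * N ^ 6 * (k * x ^ 10 * exp (- y))"
          by (simp flip: power_add)
        finally have fin: "cmod (?e - ?et) \<le> Cm / 2 * N ^ 6 * (k * x ^ 10 * exp (- y))" .
        \<comment> \<open>The square is compared, so that only natural powers of k and y occur.\<close>
        have "k * x ^ 10 * exp (- y) \<le> sqrt (5 ^ 5 / d ^ 5) * k powr (-3/2)"
        proof (rule power2_le_imp_le)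
          have "(k * x ^ 10 * exp (- y))\<^sup>2 = y ^ 5 * exp (- (2 * y)) / (d ^ 5 * k ^ 3)"
          proof -
            have "(k * x ^ 10 * exp (- y))\<^sup>2 = k\<^sup>2 * x ^ 20 * exp (- (2 * y))"
              unfolding power_mult_distrib e2 by (simp flip: power_mult)
            also have "\<dots> = (k\<^sup>2 * x ^ 20 * exp (- (2 * y))) * (d ^ 5 * k ^ 3) / (d ^ 5 * k ^ 3)"
              by (rule nonzero_mult_div_cancel_right[symmetric]) (use k d in simp)
            also have "(k\<^sup>2 * x ^ 20 * exp (- (2 * y))) * (d ^ 5 * k ^ 3) = y ^ 5 * exp (- (2 * y))"
              unfolding y5 k5 by (simp only: mult_ac)
            finally show ?thesis .
          qed
          also have "\<dots> \<le> (5 ^ 5 * exp y) * exp (- y) / (d ^ 5 * k ^ 3)"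
            using power_le_exp[OF y, of 5] y k d by (intro divide_right_mono mult_mono) auto
          also have "\<dots> = (sqrt (5 ^ 5 / d ^ 5) * k powr (-3/2))\<^sup>2"
            using k d by (simp add: power_mult_distrib k32 mult.assoc ee)
          finally show "(k * x ^ 10 * exp (- y))\<^sup>2 \<le> (sqrt (5 ^ 5 / d ^ 5) * k powr (-3/2))\<^sup>2" .
        qed (use d in simp)
        then have "Cm / 2 * N ^ 6 * (k * x ^ 10 * exp (- y)) \<le> Cm / 2 * N ^ 6 * (sqrt (5 ^ 5 / d ^ 5) * k powr (-3/2))"
          using Cm N by (intro mult_left_mono) auto
        with fin show ?thesis unfolding K1_def mult.assoc by (rule order_trans)
      qed
      have B: "cmod ((1 - kap N x ^ 2) * ?et) \<le> K2 * k powr (-3/2)"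
      proof -
        have "(1 - kap N x ^ 2) = (1 - kap N x) * (1 + kap N x)" by (simp add: power2_eq_square algebra_simps)
        moreover have "cmod (1 + kap N x) \<le> 2" using norm_triangle_ineq[of 1 "kap N x"] kapr_bounds(2)[of N x] by (simp add: nk)
        ultimately have "cmod ((1 - kap N x ^ 2) * ?et) \<le> (N ^ 6 * x ^ 6 * 2) * exp (- y)"
          unfolding norm_mult using x6 et by (simp only: norm_mult n1k) (intro mult_mono mult_nonneg_nonneg, auto)
        also have "\<dots> = 2 * N ^ 6 * (x ^ 6 * exp (- y))" by simp
        finally have fin: "cmod ((1 - kap N x ^ 2) * ?et) \<le> 2 * N ^ 6 * (x ^ 6 * exp (- y))" .
        have "x ^ 6 * exp (- y) \<le> sqrt (3 ^ 3 / d ^ 3) * k powr (-3/2)"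
        proof (rule power2_le_imp_le)
          have "(x ^ 6 * exp (- y))\<^sup>2 = y ^ 3 * exp (- (2 * y)) / (d ^ 3 * k ^ 3)"
            unfolding power_mult_distrib y3 e2 using k d by (simp flip: power_mult)
          also have "\<dots> \<le> (3 ^ 3 * exp y) * exp (- y) / (d ^ 3 * k ^ 3)"
            using power_le_exp[OF y, of 3] y k d by (intro divide_right_mono mult_mono) auto
          also have "\<dots> = (sqrt (3 ^ 3 / d ^ 3) * k powr (-3/2))\<^sup>2"
            using k d by (simp add: power_mult_distrib k32 mult.assoc ee)
          finally show "(x ^ 6 * exp (- y))\<^sup>2 \<le> (sqrt (3 ^ 3 / d ^ 3) * k powr (-3/2))\<^sup>2" .
        qed (use d in simp)
        then have "2 * N ^ 6 * (x ^ 6 * exp (- y)) \<le> 2 * N ^ 6 * (sqrt (3 ^ 3 / d ^ 3) * k powr (-3/2))"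
          using N by (intro mult_left_mono) auto
        with fin show ?thesis unfolding K2_def mult.assoc by (rule order_trans)
      qed
      have "?e - kap N x ^ 2 * ?et = (?e - ?et) + (1 - kap N x ^ 2) * ?et" by (simp add: algebra_simps)
      then have "cmod (?e - kap N x ^ 2 * ?et) \<le> cmod (?e - ?et) + cmod ((1 - kap N x ^ 2) * ?et)" by (simp only: norm_triangle_ineq)
      moreover have "0 \<le> K3 * k powr (-3/2)" using K0 by simp
      ultimately show ?thesis using A B by (simp only: distrib_right)
    next
      case False
      then have "\<not> x\<^sup>2 \<le> 1" by (simp add: abs_square_le_1)
      then have "1 \<le> x\<^sup>2" by linarith
      then have "1 / 2 \<le> x\<^sup>2 / (1 + x\<^sup>2)" by (simp add: divide_simps add_pos_nonneg)
      then have "(1 / 2)\<^sup>2 \<le> (x\<^sup>2 / (1 + x\<^sup>2))\<^sup>2" by (intro power_mono) auto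
      then have "c * (1 / 2)\<^sup>2 \<le> c * (x\<^sup>2 / (1 + x\<^sup>2))\<^sup>2" using c(1) by (intro mult_left_mono) auto
      moreover have "c * (1 / 2)\<^sup>2 = c / 4" by (simp add: power2_eq_square)
      ultimately have P: "c / 4 \<le> Im (P x)" using c(2)[of x] by linarith
      have key: "t\<^sup>2 * exp (- (k * (t * Im (P x)))) \<le> 64 / c\<^sup>2 * k powr (-3/2)" if t: "t > 0" for t
      proof -
        define z where "z = k * t * (c / 4)"
        have z: "z \<ge> 0" using k t c by (simp add: z_def)
        have zP: "z \<le> k * (t * Im (P x))" unfolding z_def mult.assoc using P k t by (intro mult_left_mono) auto
        have "t\<^sup>2 * exp (- (k * (t * Im (P x)))) \<le> t\<^sup>2 * exp (- z)" using zP by (intro mult_left_mono) auto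
        also have "t\<^sup>2 * exp (- z) = 16 / (c\<^sup>2 * k\<^sup>2) * z\<^sup>2 * exp (- z)"
        proof -
          have "t\<^sup>2 = 16 / (c\<^sup>2 * k\<^sup>2) * z\<^sup>2" using k c by (simp add: z_def power_mult_distrib power_divide)
          then show ?thesis by (simp only:)
        qed
        also have "16 / (c\<^sup>2 * k\<^sup>2) * z\<^sup>2 * exp (- z) \<le> 16 / (c\<^sup>2 * k\<^sup>2) * (2\<^sup>2 * exp z) * exp (- z)"
          using power_le_exp[OF z, of 2] by (intro mult_right_mono mult_left_mono) auto
        also have "\<dots> = 64 / c\<^sup>2 * (1 / k\<^sup>2)" by (simp add: exp_minus)
        also have "1 / k\<^sup>2 = k powr (-2)" using k by (simp add: powr_minus_divide)
        also have "64 / c\<^sup>2 * k powr (-2) \<le> 64 / c\<^sup>2 * k powr (-3/2)" using k by (intro mult_left_mono powr_mono) auto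
        finally show ?thesis .
      qed
      have "cmod (?e - kap N x ^ 2 * ?et) \<le> cmod ?e + cmod (kap N x ^ 2 * ?et)" by (rule norm_triangle_ineq4)
      also have "cmod ?e = 1\<^sup>2 * exp (- (k * (1 * Im (P x))))" by (simp add: ne)
      also have "cmod (kap N x ^ 2 * ?et) = (kapr N x)\<^sup>2 * exp (- (k * (kapr N x * Im (P x))))"
        by (simp only: norm_mult norm_power nk ne Im_Pt)
      also have "1\<^sup>2 * exp (- (k * (1 * Im (P x)))) + (kapr N x)\<^sup>2 * exp (- (k * (kapr N x * Im (P x)))) \<le> 64 / c\<^sup>2 * k powr (-3/2) + 64 / c\<^sup>2 * k powr (-3/2)"
        by (intro add_mono key kapr_bounds) auto
      also have "\<dots> = K3 * k powr (-3/2)" by (simp add: K3_def)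
      also have "\<dots> \<le> (K1 + K2 + K3) * k powr (-3/2)" using K0 by (intro mult_right_mono) auto
      finally show ?thesis .
    qed
  qed
qed

end

section \<open>Homotopy from the Airy phase to the beam phase\<close>

locale beam_cut = beam_phase +
  fixes N :: real and A :: "real \<Rightarrow> complex"
  assumes N: "N > 0" and small: "\<And>x. cmod (complex_of_real x * nn N x) \<le> 1 / 2" and A: "schwartz A"
begin

abbreviation kkg :: "real \<Rightarrow> complex" where "kkg x \<equiv> kap N x * kap N x * g x - 1"

text \<open>
The parameters are pairs \<open>(t, w)\<close> of the homotopy parameter and the point of observation.
\<close>
abbreviation I :: "(real \<times> real) set" where "I \<equiv> {0..1} \<times> UNIV"

text \<open>
With \<open>B\<close> the shifted initial amplitude and \<open>kkg = kap\<^sup>2 g - 1\<close>, the homotopy has amplitude \<open>B G\<close>, \<open>G = 1 + t kkg\<close>, and phase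
\<open>- x\<^sup>3 / 3 + t Pt\<close>, whose derivative is \<open>- x\<^sup>2 h\<close>. The remaining functions are quotients by \<open>x\<close> in a form that shows
that they are bounded with all derivatives: \<open>b1\<close> is \<open>(1 - kap) / x\<close>, \<open>b2\<close> is \<open>b1 / x\<close>, \<open>a0\<close> is \<open>(g - 1) / x\<close>, \<open>a\<close> is \<open>kkg / x\<close>,
\<open>e\<close> is \<open>(G kap - 1) / x\<close> and, with \<open>r1\<close> from the integration by parts in \<open>J'_bound\<close>, \<open>\<rho>\<close> is \<open>(a + 2 r1) / x\<close>.
\<close>
definition W :: "real \<times> real \<Rightarrow> real \<Rightarrow> real" where
  "W i x = (1 / (1 + (snd i - 2 * \<eta> * x)\<^sup>2))\<^sup>2"
definition B :: "real \<times> real \<Rightarrow> real \<Rightarrow> complex" where "B i x = A (snd i - 2 * \<eta> * x)"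
definition h :: "real \<times> real \<Rightarrow> real \<Rightarrow> complex" where
  "h i x = 1 - complex_of_real (fst i) * (complex_of_real x * nn N x)"
definition G :: "real \<times> real \<Rightarrow> real \<Rightarrow> complex" where
  "G i x = 1 + complex_of_real (fst i) * kkg x"
definition b1 :: "real \<Rightarrow> complex" where "b1 x = complex_of_real N * S N x * (1 - T N x) * (1 - T N x)"
definition b2 :: "real \<Rightarrow> complex" where "b2 x = complex_of_real N * complex_of_real N * S N x * S N x * (1 - T N x)"
definition a0 :: "real \<Rightarrow> complex" where "a0 x = - 2 * m x * j x"
definition a :: "real \<Rightarrow> complex" where "a x = a0 x - b1 x * (1 + kap N x) * g x"
definition e :: "real \<times> real \<Rightarrow> real \<Rightarrow> complex" where
  "e i x = complex_of_real (fst i) * a x - b1 x - complex_of_real (fst i) * kkg x * b1 x"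
definition \<rho> :: "real \<times> real \<Rightarrow> real \<Rightarrow> complex" where
  "\<rho> i x = m x * j x * (1 / h i x) * (2 * e i x + a0 x + e i x * (g x - 1) + 2 * (complex_of_real (fst i) * nn N x)) - b2 x * (1 + kap N x) * g x"
definition r1 :: "real \<times> real \<Rightarrow> real \<Rightarrow> complex" where
  "r1 i x = G i x * m x * kap N x * (1 / h i x) / 2"

lemma W_bounds: "0 \<le> W i x" "W i x \<le> 1" "W i x \<le> 1 / (1 + (snd i + - 2 * \<eta> * x)\<^sup>2)"
proof -
  let ?V = "1 / (1 + (snd i - 2 * \<eta> * x)\<^sup>2)"
  have p: "1 + (snd i - 2 * \<eta> * x)\<^sup>2 > 0" by (simp add: add_pos_nonneg)
  have V: "0 \<le> ?V" "?V \<le> 1" using p by auto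
  show "0 \<le> W i x" by (simp add: W_def)
  show "W i x \<le> 1" unfolding W_def using V by (intro power_le_one) auto
  show "W i x \<le> 1 / (1 + (snd i + - 2 * \<eta> * x)\<^sup>2)"
    unfolding W_def power2_eq_square[of ?V] using V mult_right_mono[of ?V 1 ?V] by simp
qed

text \<open>
By the substitution \<open>y = w - 2 \<eta> x\<close> the integral of \<open>W\<close> is bounded independently of \<open>w\<close>, although \<open>W\<close> is centred at
\<open>x = w / (2 \<eta>)\<close>.
\<close>
lemma good_W: "good_weight W I"
  unfolding good_weight_def
proof (intro conjI ballI allI W_bounds)
  have V: "has_bochner_integral lborel (\<lambda>x. 1 / (1 + (w + - 2 * \<eta> * x)\<^sup>2)) (pi / (2 * \<eta>))" for w
    using has_bochner_integral_inverse_1_plus_square[of "- 2 * \<eta>" w] eta by (simp add: abs_mult)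
  show meas: "W i \<in> borel_measurable borel" for i unfolding W_def[abs_def] by measurable
  show "\<exists>L. \<forall>i\<in>I. (LINT x|lborel. W i x) \<le> L"
  proof (intro exI ballI)
    fix i :: "real \<times> real"
    have V': "integrable lborel (\<lambda>x. 1 / (1 + (snd i + - 2 * \<eta> * x)\<^sup>2))" using V[of "snd i"] by (simp add: has_bochner_integral_iff)
    have "integrable lborel (W i)"
      by (rule Bochner_Integration.integrable_bound[OF V'])
        (use meas[of i] W_bounds[of i] in \<open>auto intro!: AE_I2 order_trans[OF _ abs_ge_self]\<close>)
    then have "(LINT x|lborel. W i x) \<le> (LINT x|lborel. 1 / (1 + (snd i + - 2 * \<eta> * x)\<^sup>2))"
      using V' by (rule integral_mono) (rule W_bounds)
    then show "(LINT x|lborel. W i x) \<le> pi / (2 * \<eta>)" using V[of "snd i"] by (simp only: has_bochner_integral_iff)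
  qed
  fix i :: "real \<times> real"
  let ?w = "snd i"
  let ?K = "1 + (1 + ?w\<^sup>2) / (2 * \<eta>\<^sup>2)"
  show "integrable lborel (\<lambda>x. (1 + x\<^sup>2) * W i x)"
  proof (rule Bochner_Integration.integrable_bound)
    show "integrable lborel (\<lambda>x. ?K * (1 / (1 + (?w + - 2 * \<eta> * x)\<^sup>2)))"
      using V[of ?w] by (intro integrable_mult_right) (simp add: has_bochner_integral_iff)
    show "(\<lambda>x. (1 + x\<^sup>2) * W i x) \<in> borel_measurable lborel" using meas[of i] by measurable
    show "AE x in lborel. norm ((1 + x\<^sup>2) * W i x) \<le> norm (?K * (1 / (1 + (?w + - 2 * \<eta> * x)\<^sup>2)))"
    proof (rule AE_I2)
      fix x :: real
      define y where "y = ?w - 2 * \<eta> * x"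
      have p: "1 + y\<^sup>2 > 0" by (simp add: add_pos_nonneg)
      have x: "x = (?w - y) / (2 * \<eta>)" using eta by (simp add: y_def)
      have "0 \<le> (?w + y)\<^sup>2" by simp
      then have "(?w - y)\<^sup>2 \<le> 2 * (?w\<^sup>2 + y\<^sup>2)" by (simp add: power2_eq_square algebra_simps)
      then have "x\<^sup>2 \<le> 2 * (?w\<^sup>2 + y\<^sup>2) / (2 * \<eta>)\<^sup>2" unfolding x power_divide by (intro divide_right_mono) auto
      also have "\<dots> = (?w\<^sup>2 + y\<^sup>2) / (2 * \<eta>\<^sup>2)" using eta by (simp add: power_mult_distrib field_simps)
      finally have "1 + x\<^sup>2 \<le> 1 + (?w\<^sup>2 + y\<^sup>2) / (2 * \<eta>\<^sup>2)" by simp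
      also have "\<dots> \<le> ?K * (1 + y\<^sup>2)"
      proof -
        have "?w\<^sup>2 + y\<^sup>2 \<le> (1 + ?w\<^sup>2) * (1 + y\<^sup>2)" by (simp add: algebra_simps)
        then have "(?w\<^sup>2 + y\<^sup>2) / (2 * \<eta>\<^sup>2) \<le> (1 + ?w\<^sup>2) * (1 + y\<^sup>2) / (2 * \<eta>\<^sup>2)" by (intro divide_right_mono) auto
        moreover have "?K * (1 + y\<^sup>2) = 1 + y\<^sup>2 + (1 + ?w\<^sup>2) * (1 + y\<^sup>2) / (2 * \<eta>\<^sup>2)" by (simp add: distrib_right)
        moreover have "0 \<le> y\<^sup>2" by simp
        ultimately show ?thesis by linarith
      qed
      finally have "(1 + x\<^sup>2) * W i x \<le> ?K * (1 + y\<^sup>2) * W i x" by (intro mult_right_mono W_bounds)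
      also have "\<dots> = ?K * (1 / (1 + y\<^sup>2))" using p by (simp add: W_def y_def[symmetric] power2_eq_square[of "1 / _"])
      finally have "(1 + x\<^sup>2) * W i x \<le> ?K * (1 / (1 + (?w + - 2 * \<eta> * x)\<^sup>2))" by (simp add: y_def)
      moreover have "0 \<le> (1 + x\<^sup>2) * W i x" by (intro mult_nonneg_nonneg W_bounds) auto
      ultimately show "norm ((1 + x\<^sup>2) * W i x) \<le> norm (?K * (1 / (1 + (?w + - 2 * \<eta> * x)\<^sup>2)))" by simp
    qed
  qed
  show "(W i \<longlongrightarrow> 0) at_top" unfolding W_def[abs_def] using eta by real_asymp
  show "(W i \<longlongrightarrow> 0) at_bot" unfolding W_def[abs_def] using eta by real_asymp
qed

lemma symbol_A: "symbol n W I (\<lambda>i x. nth_deriv k A (snd i - 2 * \<eta> * x))"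
proof (induction n arbitrary: k)
  have b: "\<exists>M\<ge>0. \<forall>i\<in>I. \<forall>x. cmod (nth_deriv k A (snd i - 2 * \<eta> * x)) \<le> M * W i x" for k
  proof -
    obtain M where "M > 0" "\<And>x. cmod (nth_deriv k A x) \<le> M * (1 / (1 + x\<^sup>2))\<^sup>2"
      using schwartz_decay_square[OF A] by blast
    then show ?thesis by (intro exI[of _ M]) (auto simp: W_def)
  qed
  {
    case 0
    show ?case using b by simp
  next
    case (Suc n)
    show ?case
    proof (rule symbol_SucI[OF b, where r'="\<lambda>i x. complex_of_real (- 2 * \<eta>) * nth_deriv (Suc k) A (snd i - 2 * \<eta> * x)"])
      fix i :: "real \<times> real" and x
      have "((\<lambda>x. snd i - 2 * \<eta> * x) has_vector_derivative - 2 * \<eta>) (at x)" by (auto intro!: derivative_eq_intros)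
      from vector_diff_chain_at[OF this schwartz_has_vector_derivative[OF A]]
      show "((\<lambda>x. nth_deriv k A (snd i - 2 * \<eta> * x)) has_vector_derivative complex_of_real (- 2 * \<eta>) * nth_deriv (Suc k) A (snd i - 2 * \<eta> * x)) (at x)"
        by (simp add: o_def scaleR_conv_of_real)
    next
      show "symbol n W I (\<lambda>i x. complex_of_real (- 2 * \<eta>) * nth_deriv (Suc k) A (snd i - 2 * \<eta> * x))"
        by (intro symbol_cmult Suc.IH)
    qed
  }
qed

lemma symbol_B: "symbol n W I (\<lambda>i x. B i x)"
  using symbol_A[of n 0] by (simp add: B_def)

lemma symbol_fst: "symbol n flat I (\<lambda>i x. complex_of_real (fst i))"
  by (rule symbol_const[where M=1]) auto

lemma symbol_divc: "symbol n V J r \<Longrightarrow> symbol n V J (\<lambda>i x. r i x / c)"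
  using symbol_cmult[of n V J r "1 / c"] by simp

lemma symbol_snn: "symbol n flat J (\<lambda>i x. complex_of_real x * nn N x)"
  unfolding s_nn[OF N] by (intro symbol_diff symbol_add symbol_mult symbol_half symbol_divc symbol_power symbol_const' symbol_T symbol_S symbol_m symbol_mu)

lemma symbol_h: "symbol n flat I (\<lambda>i x. h i x)"
  unfolding h_def by (intro symbol_diff symbol_mult symbol_const' symbol_fst symbol_snn)

lemma h_lower: "i \<in> I \<Longrightarrow> cmod (h i x) \<ge> 1 / 2"
proof -
  assume "i \<in> I"
  then have "\<bar>fst i\<bar> \<le> 1" by auto
  then have "cmod (complex_of_real (fst i) * (complex_of_real x * nn N x)) \<le> 1 * (1 / 2)"
    unfolding norm_mult[of "complex_of_real (fst i)"] norm_of_real by (intro mult_mono small) auto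
  moreover have "1 \<le> cmod (h i x) + cmod (complex_of_real (fst i) * (complex_of_real x * nn N x))"
    using norm_triangle_ineq[of "h i x" "complex_of_real (fst i) * (complex_of_real x * nn N x)"] by (simp add: h_def)
  ultimately show ?thesis by linarith
qed

lemma symbol_invh: "symbol n flat I (\<lambda>i x. 1 / h i x)"
  by (rule symbol_inverse[OF symbol_h, of "1/2"]) (use h_lower in auto)

lemma symbol_kkg: "symbol n flat J (\<lambda>i x. kkg x)"
  by (intro symbol_diff symbol_mult symbol_kap symbol_g symbol_const')

lemma symbol_G: "symbol n flat I (\<lambda>i x. G i x)"
  unfolding G_def by (intro symbol_add symbol_mult symbol_const' symbol_fst symbol_kkg)

lemma symbol_b1: "symbol n flat J (\<lambda>i x. b1 x)" and symbol_b2: "symbol n flat J (\<lambda>i x. b2 x)"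
  unfolding b1_def b2_def by (intro symbol_mult symbol_diff symbol_const' symbol_S symbol_T)+

lemma symbol_a0: "symbol n flat J (\<lambda>i x. a0 x)"
  unfolding a0_def by (intro symbol_mult symbol_const' symbol_m symbol_j)

lemma symbol_a: "symbol n flat J (\<lambda>i x. a x)"
  unfolding a_def by (intro symbol_diff symbol_mult symbol_add symbol_const' symbol_a0 symbol_b1 symbol_kap symbol_g)

lemma symbol_e: "symbol n flat I (\<lambda>i x. e i x)"
  unfolding e_def by (intro symbol_diff symbol_mult symbol_fst symbol_a symbol_b1 symbol_kkg)

lemma symbol_g1: "symbol n flat J (\<lambda>i x. g x - 1)" by (intro symbol_diff symbol_g symbol_const')

lemma symbol_rho: "symbol n flat I (\<lambda>i x. \<rho> i x)"
  unfolding \<rho>_def by (intro symbol_diff[of _ _ _ _ "\<lambda>i x. b2 x * (1 + kap N x) * g x"] symbol_mult symbol_add symbol_const' symbol_m symbol_j symbol_invh symbol_e symbol_a0 symbol_g1 symbol_fst symbol_nn symbol_b2 symbol_kap symbol_g)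

lemma symbol_r1: "symbol n flat I (\<lambda>i x. r1 i x)"
  unfolding r1_def by (intro symbol_half symbol_mult symbol_G symbol_m symbol_kap symbol_invh)

lemma kap_b1: "kap N x = 1 - complex_of_real x * b1 x"
proof -
  have "complex_of_real x * b1 x = (complex_of_real N * complex_of_real x * S N x) * (1 - T N x) * (1 - T N x)"
    by (simp add: b1_def)
  also have "\<dots> = (1 - T N x) ^ 3" unfolding T_S[symmetric] by (simp add: power3_eq_cube)
  finally show ?thesis by (simp add: kap_T)
qed

lemma b1_b2: "b1 x = complex_of_real x * b2 x"
proof -
  have "complex_of_real x * b2 x = complex_of_real N * S N x * (complex_of_real N * complex_of_real x * S N x) * (1 - T N x)"
    by (simp add: b2_def)
  then show ?thesis unfolding T_S[symmetric] by (simp add: b1_def)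
qed

lemma s_a: "complex_of_real x * a x = kkg x"
proof -
  have "complex_of_real x * a x = (- 2 * complex_of_real x * m x * j x) - (complex_of_real x * b1 x) * (1 + kap N x) * g x"
    by (simp add: a_def a0_def algebra_simps)
  also have "\<dots> = (g x - 1) - (1 - kap N x) * (1 + kap N x) * g x"
    unfolding g_minus_1[symmetric] using kap_b1[of x] by simp
  also have "\<dots> = kkg x" by (simp add: algebra_simps)
  finally show ?thesis .
qed

text \<open>
The cancellation in its global form: \<open>a + 2 r1\<close> vanishes at \<open>x = 0\<close> because \<open>a = - 2 m j + O(x)\<close> and
\<open>r1 = G m kap / (2 h)\<close>, where \<open>j(0) = 1/2\<close> and \<open>G\<close>, \<open>kap\<close> and \<open>h\<close> are \<open>1\<close> at \<open>0\<close>.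
\<close>
lemma key_identity:
  assumes "i \<in> I"
  shows "complex_of_real x * \<rho> i x = a x + 2 * r1 i x"
proof -
  let ?s = "complex_of_real x" and ?t = "complex_of_real (fst i)" and ?k = "kap N x" and ?H = "1 / h i x"
  have hn: "h i x \<noteq> 0" using h_lower[OF assms, of x] by auto
  have hH: "h i x * ?H = 1" using hn by simp
  have 1: "G i x * ?k = 1 + ?s * e i x"
  proof -
    have "G i x * ?k = (1 + ?t * (?s * a x)) * (1 - ?s * b1 x)" by (simp only: G_def s_a[symmetric] kap_b1[symmetric])
    also have "\<dots> = 1 + ?s * (?t * a x - b1 x - ?t * (?s * a x) * b1 x)" by (simp add: algebra_simps)
    finally show ?thesis by (simp only: e_def s_a)
  qed
  have 2: "?s * a0 x = g x - 1" by (simp add: a0_def g_minus_1)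
  have 3: "?s * (2 * e i x + a0 x + e i x * (g x - 1) + 2 * (?t * nn N x)) = G i x * ?k * (1 + g x) - 2 * h i x"
  proof -
    have "G i x * ?k * (1 + g x) - 2 * h i x = (1 + ?s * e i x) * (2 + (g x - 1)) - 2 * (1 - ?t * (?s * nn N x))"
      by (simp add: 1 h_def)
    also have "\<dots> = ?s * (2 * e i x) + (g x - 1) + ?s * (e i x * (g x - 1)) + ?s * (2 * (?t * nn N x))"
      by (simp add: algebra_simps)
    also have "\<dots> = ?s * (2 * e i x + a0 x + e i x * (g x - 1) + 2 * (?t * nn N x))"
      unfolding 2[symmetric] by (simp add: algebra_simps)
    finally show ?thesis by simp
  qed
  have "?s * \<rho> i x = m x * j x * ?H * (?s * (2 * e i x + a0 x + e i x * (g x - 1) + 2 * (?t * nn N x))) - (?s * b2 x) * (1 + ?k) * g x"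
    by (simp add: \<rho>_def right_diff_distrib mult_ac)
  also have "\<dots> = m x * j x * ?H * (G i x * ?k * (1 + g x) - 2 * h i x) - b1 x * (1 + ?k) * g x"
    by (simp only: 3 b1_b2[symmetric])
  also have "m x * j x * ?H * (G i x * ?k * (1 + g x) - 2 * h i x) = (j x * (1 + g x)) * (G i x * m x * ?k * ?H) - 2 * m x * j x * (h i x * ?H)"
    by (simp only: right_diff_distrib mult_ac)
  also have "\<dots> = 2 * r1 i x + a0 x" by (simp only: j_g hH) (simp add: r1_def a0_def)
  finally show ?thesis by (simp add: a_def)
qed

definition E :: "real \<Rightarrow> real \<Rightarrow> real \<Rightarrow> complex" where
  "E k t x = exp (\<i> * complex_of_real k * (complex_of_real (- (x ^ 3 / 3)) + complex_of_real t * Pt N x))"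

lemma norm_E: "cmod (E k t x) = exp (- (k * t * Im (Pt N x)))"
  by (simp add: E_def)

lemma norm_E_le_1: "k \<ge> 0 \<Longrightarrow> t \<ge> 0 \<Longrightarrow> cmod (E k t x) \<le> 1"
  using Im_Pt_nonneg by (simp add: norm_E)

lemma E_deriv_x:
  "(E k (fst i) has_vector_derivative - (\<i> * complex_of_real (k * x\<^sup>2) * h i x * E k (fst i) x)) (at x)"
proof -
  have "((\<lambda>x. - (x ^ 3 / 3)) has_real_derivative - x\<^sup>2) (at x)"
    by (auto intro!: derivative_eq_intros)
  then have c: "((\<lambda>x. complex_of_real (- (x ^ 3 / 3))) has_vector_derivative complex_of_real (- x\<^sup>2)) (at x)"
    by (rule has_vector_derivative_of_real)
  have 1: "((\<lambda>x. \<i> * complex_of_real k * (complex_of_real (- (x ^ 3 / 3)) + complex_of_real (fst i) * Pt N x)) has_vector_derivative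
     \<i> * complex_of_real k * (complex_of_real (- x\<^sup>2) + complex_of_real (fst i) * ((complex_of_real x) ^ 3 * nn N x))) (at x)"
    by (intro has_vector_derivative_mult_right has_vector_derivative_add c Pt_deriv)
  have "\<i> * complex_of_real k * (complex_of_real (- x\<^sup>2) + complex_of_real (fst i) * ((complex_of_real x) ^ 3 * nn N x))
    = - (\<i> * complex_of_real (k * x\<^sup>2) * h i x)"
    by (simp add: h_def power3_eq_cube power2_eq_square algebra_simps)
  with field_vector_diff_chain_at[OF 1 DERIV_exp] show ?thesis by (simp add: o_def E_def[abs_def])
qed

lemma E_deriv_t: "((\<lambda>t. E k t x) has_vector_derivative \<i> * complex_of_real k * Pt N x * E k t x) (at t)"
proof -
  have "((\<lambda>t. complex_of_real t) has_vector_derivative 1) (at t)" by (auto intro!: derivative_eq_intros)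
  then have 1: "((\<lambda>t. \<i> * complex_of_real k * (complex_of_real (- (x ^ 3 / 3)) + complex_of_real t * Pt N x)) has_vector_derivative
     \<i> * complex_of_real k * (0 + 1 * Pt N x)) (at t)"
    by (intro has_vector_derivative_mult_right has_vector_derivative_add has_vector_derivative_const has_vector_derivative_mult_left)
  from field_vector_diff_chain_at[OF 1 DERIV_exp] show ?thesis by (simp add: o_def E_def)
qed

lemma measurable_E: "E k t \<in> borel_measurable borel"
  by (rule borel_measurable_continuous_onI, intro continuous_at_imp_continuous_on ballI
      has_vector_derivative_continuous[OF E_deriv_x[of k "(t, 0)", simplified]])

lemma symbol_measurable': "(\<And>n. symbol n flat {0::nat} (\<lambda>i x. r x)) \<Longrightarrow> r \<in> borel_measurable borel"
  using symbol_measurable[of 0 flat "{0::nat}" "\<lambda>i x. r x" 0] by simp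

lemma measurable_facts [measurable]:
  "kap N \<in> borel_measurable borel" "g \<in> borel_measurable borel" "m \<in> borel_measurable borel"
  "B i \<in> borel_measurable borel" "Pt N \<in> borel_measurable borel" "E k t \<in> borel_measurable borel"
proof -
  show k[measurable]: "kap N \<in> borel_measurable borel" by (rule symbol_measurable', rule symbol_kap)
  show "g \<in> borel_measurable borel" by (rule symbol_measurable', rule symbol_g)
  show m[measurable]: "m \<in> borel_measurable borel" by (rule symbol_measurable', rule symbol_m)
  have [measurable]: "A \<in> borel_measurable borel" using borel_measurable_schwartz[OF A, of 0] by simp
  show "B i \<in> borel_measurable borel" unfolding B_def[abs_def] by measurable
  show "Pt N \<in> borel_measurable borel" unfolding Pt_def[abs_def] P_def[abs_def] by measurable
qed (rule measurable_E)

text \<open>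
\<open>x\<^sup>2 kap\<close> and \<open>x m\<close> are bounded, which leaves one of the four factors \<open>x\<close> of \<open>Pt\<close>.
\<close>
lemma Pt_linear_bound: "\<exists>C\<ge>0. \<forall>x. cmod (Pt N x) \<le> C * (1 + x\<^sup>2)"
proof -
  let ?q = "\<lambda>x. (1 - T N x) / (complex_of_real N * complex_of_real N) * (3 - 3 * T N x + T N x ^ 2) * (\<gamma> * v x - X x / 2) / 2"
  have eq: "Pt N x = ?q x * complex_of_real x" for x
  proof -
    let ?s = "complex_of_real x"
    have sS: "?s * S N x = (1 - T N x) / complex_of_real N" using N by (simp add: T_S)
    have "?s * (?s * kap N x) = (?s * S N x) / complex_of_real N * (3 - 3 * T N x + T N x ^ 2)"
      by (simp add: s_kap[OF N])
    then have k2: "?s * (?s * kap N x) = (1 - T N x) / (complex_of_real N * complex_of_real N) * (3 - 3 * T N x + T N x ^ 2)"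
      by (simp add: sS)
    have sm: "?s * m x = \<gamma> * v x - X x / 2"
      unfolding sv[symmetric] m_def by (simp add: algebra_simps)
    have "Pt N x = (?s * (?s * kap N x)) * (?s * m x) / 2 * ?s"
      by (simp add: Pt_def P_def power4_eq_xxxx)
    then show ?thesis unfolding k2 sm .
  qed
  have "symbol 0 flat {0::nat} (\<lambda>i x. ?q x)"
    by (intro symbol_half symbol_mult symbol_divc symbol_diff symbol_add symbol_power symbol_const' symbol_T symbol_v symbol_X)
  from symbol_bounded[OF this] obtain C where C: "C \<ge> 0" "\<And>x. cmod (?q x) \<le> C" by auto
  show ?thesis
  proof (intro exI[of _ C] conjI allI C(1))
    fix x :: real
    have "0 \<le> (\<bar>x\<bar> - 1)\<^sup>2" by simp
    then have "\<bar>x\<bar> \<le> 1 + x\<^sup>2" by (simp add: power2_diff)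
    then have "cmod (?q x) * \<bar>x\<bar> \<le> C * (1 + x\<^sup>2)" using C by (intro mult_mono) auto
    then show "cmod (Pt N x) \<le> C * (1 + x\<^sup>2)" unfolding eq norm_mult[of _ "complex_of_real x"] norm_of_real .
  qed
qed

text \<open>
\<open>J k w 0\<close> is the Airy integral and \<open>J k w 1\<close> the beam integral with cut-off phase; \<open>J'\<close> is the derivative in \<open>t\<close>.
\<close>
definition J :: "real \<Rightarrow> real \<Rightarrow> real \<Rightarrow> complex" where
  "J k w t = (LINT x|lborel. B (t, w) x * (G (t, w) x * E k t x))"
definition J' :: "real \<Rightarrow> real \<Rightarrow> real \<Rightarrow> complex" where
  "J' k w t = (LINT x|lborel. B (t, w) x * (kkg x * E k t x + G (t, w) x * (\<i> * complex_of_real k * Pt N x * E k t x)))"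

lemma kkg_bound: "\<exists>M\<ge>0. \<forall>x. cmod (kkg x) \<le> M"
  using symbol_bounded[OF symbol_kkg[of 0 "{0::nat}"]] by auto

text \<open>
Domination on a neighbourhood of \<open>[0, 1]\<close>, for fixed \<open>k\<close>. Slightly negative \<open>t\<close> is harmless because \<open>Im Pt\<close> is
bounded. These bounds only justify manipulations of integrals and need not be uniform in \<open>k\<close>.
\<close>
lemma J_integrand_bounds:
  assumes k: "k \<ge> 0"
  shows "\<exists>K. \<forall>t\<in>{-1<..<2}. \<forall>w x.
     cmod (B (t, w) x * (G (t, w) x * E k t x)) \<le> K * (1 + x\<^sup>2) * W (0, w) x \<and>
     cmod (B (t, w) x * (kkg x * E k t x + G (t, w) x * (\<i> * complex_of_real k * Pt N x * E k t x))) \<le> K * (1 + x\<^sup>2) * W (0, w) x"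
proof -
  obtain M where M: "M \<ge> 0" "\<And>i x. i \<in> I \<Longrightarrow> cmod (B i x) \<le> M * W i x" using symbol_bounded[OF symbol_B[of 0]] by blast
  have MB: "cmod (B (t, w) x) \<le> M * W (0, w) x" for t w x
    using M(2)[of "(0, w)" x] by (simp add: B_def)
  obtain Q where Q: "Q \<ge> 0" "\<And>x. cmod (kkg x) \<le> Q" using kkg_bound by blast
  obtain R where R: "R \<ge> 0" "\<And>x. cmod (Pt N x) \<le> R * (1 + x\<^sup>2)" using Pt_linear_bound by blast
  obtain Z where Z: "\<And>x. Im (P x) \<le> Z" using Im_P_bounds by blast
  have ImPt: "Im (Pt N x) \<le> Z" for x
  proof -
    have "kapr N x * Im (P x) \<le> 1 * Im (P x)" using kapr_bounds[of N x] Im_P_nonneg[of x] by (intro mult_right_mono) auto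
    then show ?thesis using Z[of x] by (simp add: Im_Pt)
  qed
  have E: "cmod (E k t x) \<le> exp (k * Z)" if "t > -1" for t x
  proof -
    have "- (t * Im (Pt N x)) \<le> 1 * Im (Pt N x)"
      using mult_right_mono[of "- t" 1 "Im (Pt N x)"] that Im_Pt_nonneg[of N x] by simp
    then have "k * (- (t * Im (Pt N x))) \<le> k * Z" using ImPt[of x] k by (intro mult_left_mono) auto
    then show ?thesis by (simp add: norm_E mult.assoc)
  qed
  have G: "cmod (G (t, w) x) \<le> 1 + 2 * Q" if "\<bar>t\<bar> \<le> 2" for t w x
  proof -
    have "cmod (G (t, w) x) \<le> 1 + \<bar>t\<bar> * cmod (kkg x)"
      unfolding G_def using norm_triangle_ineq[of 1 "complex_of_real t * kkg x"] by (simp add: norm_mult)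
    also have "\<dots> \<le> 1 + 2 * Q" using Q that by (intro add_left_mono mult_mono) auto
    finally show ?thesis .
  qed
  define K where "K = M * ((Q + (1 + 2 * Q) * (k * R) + (1 + 2 * Q)) * exp (k * Z))"
  show ?thesis
  proof (intro exI[of _ K] ballI allI conjI)
    fix t w x :: real assume t: "t \<in> {-1<..<2}"
    have Et: "cmod (E k t x) \<le> exp (k * Z)" and Gt: "cmod (G (t, w) x) \<le> 1 + 2 * Q" using E G t by auto
    have W0: "0 \<le> W (0, w) x" by (rule W_bounds)
    have x1: "1 \<le> 1 + x\<^sup>2" by simp
    have "cmod (G (t, w) x * E k t x) \<le> (1 + 2 * Q) * exp (k * Z)"
      unfolding norm_mult using Et Gt Q by (intro mult_mono) auto
    also have "\<dots> \<le> (Q + (1 + 2 * Q) * (k * R) + (1 + 2 * Q)) * exp (k * Z) * 1"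
      using Q k R by (simp add: mult_right_mono)
    also have "\<dots> \<le> (Q + (1 + 2 * Q) * (k * R) + (1 + 2 * Q)) * exp (k * Z) * (1 + x\<^sup>2)"
      using Q k R by (intro mult_left_mono) auto
    finally have 1: "cmod (G (t, w) x * E k t x) \<le> (Q + (1 + 2 * Q) * (k * R) + (1 + 2 * Q)) * exp (k * Z) * (1 + x\<^sup>2)" .
    have "cmod (B (t, w) x * (G (t, w) x * E k t x)) \<le> (M * W (0, w) x) * ((Q + (1 + 2 * Q) * (k * R) + (1 + 2 * Q)) * exp (k * Z) * (1 + x\<^sup>2))"
      unfolding norm_mult[of "B (t, w) x"] using MB 1 M W0 by (intro mult_mono) auto
    then show "cmod (B (t, w) x * (G (t, w) x * E k t x)) \<le> K * (1 + x\<^sup>2) * W (0, w) x" by (simp add: K_def mult_ac)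
    have "cmod (kkg x * E k t x + G (t, w) x * (\<i> * complex_of_real k * Pt N x * E k t x))
      \<le> Q * exp (k * Z) + (1 + 2 * Q) * ((k * (R * (1 + x\<^sup>2))) * exp (k * Z))"
    proof (intro order_trans[OF norm_triangle_ineq] add_mono)
      show "cmod (kkg x * E k t x) \<le> Q * exp (k * Z)"
        unfolding norm_mult[of "kkg x"] using Q Et by (intro mult_mono) auto
      have "cmod (\<i> * complex_of_real k * Pt N x * E k t x) \<le> (k * (R * (1 + x\<^sup>2))) * exp (k * Z)"
        unfolding norm_mult norm_of_real norm_ii using R Et k by (intro mult_mono mult_nonneg_nonneg) auto
      then show "cmod (G (t, w) x * (\<i> * complex_of_real k * Pt N x * E k t x)) \<le> (1 + 2 * Q) * ((k * (R * (1 + x\<^sup>2))) * exp (k * Z))"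
        unfolding norm_mult[of "G (t, w) x"] using Gt Q by (intro mult_mono) auto
    qed
    also have "\<dots> \<le> (Q + (1 + 2 * Q) * (k * R) + (1 + 2 * Q)) * exp (k * Z) * (1 + x\<^sup>2)"
    proof -
      have "Q * exp (k * Z) * 1 \<le> Q * exp (k * Z) * (1 + x\<^sup>2)" using Q by (intro mult_left_mono) auto
      moreover have "0 \<le> (1 + 2 * Q) * exp (k * Z) * (1 + x\<^sup>2)" using Q by (intro mult_nonneg_nonneg) auto
      moreover have "(Q + (1 + 2 * Q) * (k * R) + (1 + 2 * Q)) * exp (k * Z) * (1 + x\<^sup>2)
        = Q * exp (k * Z) * (1 + x\<^sup>2) + (1 + 2 * Q) * ((k * (R * (1 + x\<^sup>2))) * exp (k * Z)) + (1 + 2 * Q) * exp (k * Z) * (1 + x\<^sup>2)"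
        by (simp add: algebra_simps)
      ultimately show ?thesis by linarith
    qed
    finally have 2: "cmod (kkg x * E k t x + G (t, w) x * (\<i> * complex_of_real k * Pt N x * E k t x))
      \<le> (Q + (1 + 2 * Q) * (k * R) + (1 + 2 * Q)) * exp (k * Z) * (1 + x\<^sup>2)" .
    have "cmod (B (t, w) x * (kkg x * E k t x + G (t, w) x * (\<i> * complex_of_real k * Pt N x * E k t x)))
       \<le> (M * W (0, w) x) * ((Q + (1 + 2 * Q) * (k * R) + (1 + 2 * Q)) * exp (k * Z) * (1 + x\<^sup>2))"
      unfolding norm_mult[of "B (t, w) x"] using MB 2 M W0 by (intro mult_mono) auto
    then show "cmod (B (t, w) x * (kkg x * E k t x + G (t, w) x * (\<i> * complex_of_real k * Pt N x * E k t x))) \<le> K * (1 + x\<^sup>2) * W (0, w) x"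
      by (simp add: K_def mult_ac)
  qed
qed

lemma measurable_G [measurable]: "G i \<in> borel_measurable borel"
  unfolding G_def[abs_def] by measurable

lemma J_deriv:
  assumes k: "k \<ge> 0" and t: "t \<in> {-1<..<2}"
  shows "(J k w has_vector_derivative J' k w t) (at t)"
proof -
  obtain K where K: "\<And>t w x. t \<in> {-1<..<2} \<Longrightarrow> cmod (B (t, w) x * (G (t, w) x * E k t x)) \<le> K * (1 + x\<^sup>2) * W (0, w) x"
     "\<And>t w x. t \<in> {-1<..<2} \<Longrightarrow> cmod (B (t, w) x * (kkg x * E k t x + G (t, w) x * (\<i> * complex_of_real k * Pt N x * E k t x))) \<le> K * (1 + x\<^sup>2) * W (0, w) x"
    using J_integrand_bounds[OF k] by blast
  have i0: "(0, w) \<in> I" by simp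
  show ?thesis
    unfolding J_def[abs_def] J'_def
  proof (rule has_vector_derivative_integral[where S="{-1<..<2}" and w="\<lambda>x. K * ((1 + x\<^sup>2) * W (0, w) x)"])
    show "((\<lambda>s. B (s, w) x * (G (s, w) x * E k s x)) has_vector_derivative
        B (s, w) x * (kkg x * E k s x + G (s, w) x * (\<i> * complex_of_real k * Pt N x * E k s x))) (at s)" for s x
    proof -
      have dG: "((\<lambda>s. G (s, w) x) has_vector_derivative (kkg x)) (at s)"
      proof -
        have "((\<lambda>t. complex_of_real t) has_vector_derivative 1) (at s)" by (auto intro!: derivative_eq_intros)
        then have "((\<lambda>s. 1 + complex_of_real s * kkg x) has_vector_derivative 0 + 1 * kkg x) (at s)"
          by (intro has_vector_derivative_add has_vector_derivative_const has_vector_derivative_mult_left)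
        then show ?thesis by (simp add: G_def)
      qed
      have "((\<lambda>s. A (w - 2 * \<eta> * x) * (G (s, w) x * E k s x)) has_vector_derivative
        A (w - 2 * \<eta> * x) * (G (s, w) x * (\<i> * complex_of_real k * Pt N x * E k s x) + kkg x * E k s x)) (at s)"
        by (intro has_vector_derivative_mult_right has_vector_derivative_mult dG E_deriv_t)
      then show ?thesis by (simp only: B_def snd_conv add.commute)
    qed
    show "integrable lborel (\<lambda>x. B (s, w) x * (G (s, w) x * E k s x))" if "s \<in> {-1<..<2}" for s
      by (rule integrable_of_good_weight[OF good_W i0 _ K(1)[OF that]]) measurable
    show "cmod (B (s, w) x * (kkg x * E k s x + G (s, w) x * (\<i> * complex_of_real k * Pt N x * E k s x))) \<le> K * ((1 + x\<^sup>2) * W (0, w) x)"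
      if "s \<in> {-1<..<2}" for s x
      using K(2)[OF that] by (simp only: mult.assoc)
    show "integrable lborel (\<lambda>x. K * ((1 + x\<^sup>2) * W (0, w) x))"
      using good_W i0 unfolding good_weight_def by (intro integrable_mult_right) blast
  qed (use t in auto)
qed

text \<open>
The integrand of \<open>J'\<close> is \<open>B (kkg + i k G Pt) E\<close>. By the choice of \<open>r1\<close>, \<open>G Pt = x\<^sup>4 r1 h\<close>, so that
\<open>i k G Pt E = - x\<^sup>2 r1 E'\<close>, and integrating by parts leaves the amplitude
\<open>B (kkg + 2 x r1) + x\<^sup>2 (B r1)'\<close>. Here \<open>kkg + 2 x r1 = x (a + 2 r1) = x\<^sup>2 \<rho>\<close>, so the total amplitude is \<open>x\<^sup>2\<close> times a symbol.
\<close>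
lemma J'_bound: "\<exists>C\<ge>0. \<forall>k\<ge>1. \<forall>t\<in>{0..1}. \<forall>w. cmod (J' k w t) \<le> C * k powr (-4/3)"
proof -
  obtain r1' where r1': "\<And>i x. i \<in> I \<Longrightarrow> (r1 i has_vector_derivative r1' i x) (at x)" "symbol 4 flat I r1'"
    using symbol_SucE[OF symbol_r1[of "Suc 4"]] by blast
  obtain B' where B': "\<And>i x. i \<in> I \<Longrightarrow> (B i has_vector_derivative B' i x) (at x)" "symbol 4 W I B'"
    using symbol_SucE[OF symbol_B[of "Suc 4"]] by blast
  have r1'3: "symbol 3 flat I (\<lambda>i x. r1' i x)" and B'3: "symbol 3 W I (\<lambda>i x. B' i x)"
    using r1'(2) B'(2) symbol_Suc_imp[of 3] by (auto simp: eval_nat_numeral)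
  let ?F = "\<lambda>i x. B i x * \<rho> i x + (B i x * r1' i x + B' i x * r1 i x)"
  have F: "symbol 3 W I ?F"
    by (intro symbol_add symbol_mult symbol_B symbol_rho r1'3 B'3 symbol_r1)
  obtain C where C: "C \<ge> 0" "\<And>k i E. k \<ge> 1 \<Longrightarrow> i \<in> I \<Longrightarrow>
     (\<And>x. (E has_vector_derivative - (\<i> * complex_of_real (k * x\<^sup>2) * h i x * E x)) (at x)) \<Longrightarrow> (\<And>x. cmod (E x) \<le> 1) \<Longrightarrow>
     cmod (LINT x|lborel. complex_of_real (x\<^sup>2) * ?F i x * E x) \<le> C * k powr (-4/3)"
    using oscillatory_integral_square_bound[OF good_W F symbol_h h_lower] by blast
  obtain MF where MF: "MF \<ge> 0" "\<And>i x. i \<in> I \<Longrightarrow> cmod (?F i x) \<le> MF * W i x" using symbol_bounded[OF F] by blast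
  obtain MB where MB: "MB \<ge> 0" "\<And>i x. i \<in> I \<Longrightarrow> cmod (B i x) \<le> MB * W i x" using symbol_bounded[OF symbol_B[of 0]] by blast
  \<comment> \<open>Boundedness of x^2 r1 makes the boundary terms at infinity vanish.\<close>
  have q: "symbol 0 flat I (\<lambda>i x. (complex_of_real x)\<^sup>2 * r1 i x)"
  proof (rule symbol_cong)
    show "symbol 0 flat I (\<lambda>i x. G i x * (\<gamma> * v x - X x / 2) * (S N x / complex_of_real N * (3 - 3 * T N x + T N x ^ 2)) * (1 / h i x) / 2)"
      by (intro symbol_half symbol_mult symbol_divc symbol_diff symbol_add symbol_power symbol_const' symbol_T symbol_S symbol_v symbol_X symbol_invh symbol_G)
    fix i :: "real \<times> real" and x
    have sm: "complex_of_real x * m x = \<gamma> * v x - X x / 2"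
      unfolding sv[symmetric] m_def by (simp add: algebra_simps)
    show "G i x * (\<gamma> * v x - X x / 2) * (S N x / complex_of_real N * (3 - 3 * T N x + T N x ^ 2)) * (1 / h i x) / 2 = (complex_of_real x)\<^sup>2 * r1 i x"
      unfolding s_kap[OF N, symmetric] sm[symmetric] by (simp add: r1_def power2_eq_square)
  qed
  obtain Mq where Mq: "Mq \<ge> 0" "\<And>i x. i \<in> I \<Longrightarrow> cmod ((complex_of_real x)\<^sup>2 * r1 i x) \<le> Mq" using symbol_bounded[OF q] by auto
  show ?thesis
  proof (intro exI[of _ C] conjI allI ballI impI C(1))
    fix k t w :: real assume k: "k \<ge> 1" and t: "t \<in> {0..1}"
    let ?i = "(t, w)"
    have i: "?i \<in> I" and i0: "(0, w) \<in> I" using t by auto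
    let ?E = "E k t"
    have E1: "cmod (?E x) \<le> 1" for x using k t by (intro norm_E_le_1) auto
    have dE: "(?E has_vector_derivative - (\<i> * complex_of_real (k * x\<^sup>2) * h ?i x * ?E x)) (at x)" for x
      using E_deriv_x[of k ?i x] by simp
    obtain K where K: "\<And>t w x. t \<in> {-1<..<2} \<Longrightarrow> cmod (B (t, w) x * (kkg x * E k t x + G (t, w) x * (\<i> * complex_of_real k * Pt N x * E k t x))) \<le> K * (1 + x\<^sup>2) * W (0, w) x"
      using J_integrand_bounds[of k] k by fastforce
    let ?D = "\<lambda>x. B ?i x * (kkg x * ?E x + G ?i x * (\<i> * complex_of_real k * Pt N x * ?E x))"
    have iD: "integrable lborel ?D"
      by (rule integrable_of_good_weight[OF good_W i0 _ K]) (use t in \<open>measurable, auto\<close>)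
    have [measurable]: "?F ?i \<in> borel_measurable borel" using symbol_measurable[OF F[unfolded numeral_3_eq_3] i] .
    have iF: "integrable lborel (\<lambda>x. complex_of_real (x\<^sup>2) * ?F ?i x * ?E x)"
    proof (rule integrable_of_good_weight[OF good_W i])
      fix x
      have "cmod (complex_of_real (x\<^sup>2) * ?F ?i x * ?E x) = x\<^sup>2 * cmod (?F ?i x) * cmod (?E x)"
        unfolding norm_mult[of "complex_of_real (x\<^sup>2) * ?F ?i x"] norm_mult[of "complex_of_real (x\<^sup>2)"] norm_of_real by simp
      also have "\<dots> \<le> x\<^sup>2 * (MF * W ?i x) * 1" using MF i E1 W_bounds by (intro mult_mono mult_nonneg_nonneg) auto
      also have "\<dots> \<le> MF * (1 + x\<^sup>2) * W ?i x" using MF(1) W_bounds(1)[of ?i x] by (simp add: algebra_simps)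
      finally show "cmod (complex_of_real (x\<^sup>2) * ?F ?i x * ?E x) \<le> MF * (1 + x\<^sup>2) * W ?i x" .
    qed measurable
    have "(LINT x|lborel. complex_of_real (x\<^sup>2) * ?F ?i x * ?E x - ?D x) = 0"
    proof (rule integral_vector_derivative_eq_0[where G="\<lambda>x. ((complex_of_real x)\<^sup>2 * (r1 ?i x * B ?i x)) * ?E x"])
      fix x
      let ?s = "complex_of_real x"
      have s2: "((\<lambda>x. (complex_of_real x)\<^sup>2) has_vector_derivative 2 * ?s) (at x)"
      proof -
        have "((\<lambda>x. x\<^sup>2) has_real_derivative 2 * x) (at x)" by (auto intro!: derivative_eq_intros)
        then have "((\<lambda>x. complex_of_real (x\<^sup>2)) has_vector_derivative complex_of_real (2 * x)) (at x)"
          by (rule has_vector_derivative_of_real)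
        then show ?thesis by simp
      qed
      have "((\<lambda>x. ((complex_of_real x)\<^sup>2 * (r1 ?i x * B ?i x)) * ?E x) has_vector_derivative
        (?s\<^sup>2 * (r1 ?i x * B ?i x)) * - (\<i> * complex_of_real (k * x\<^sup>2) * h ?i x * ?E x)
        + (?s\<^sup>2 * (r1 ?i x * B' ?i x + r1' ?i x * B ?i x) + 2 * ?s * (r1 ?i x * B ?i x)) * ?E x) (at x)"
        by (intro has_vector_derivative_mult s2 r1'(1)[OF i] B'(1)[OF i] dE)
      moreover have "(?s\<^sup>2 * (r1 ?i x * B ?i x)) * - (\<i> * complex_of_real (k * x\<^sup>2) * h ?i x * ?E x)
        + (?s\<^sup>2 * (r1 ?i x * B' ?i x + r1' ?i x * B ?i x) + 2 * ?s * (r1 ?i x * B ?i x)) * ?E x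
        = complex_of_real (x\<^sup>2) * ?F ?i x * ?E x - ?D x"
      proof -
        have hn: "h ?i x \<noteq> 0" using h_lower[OF i, of x] by auto
        have e1: "?s\<^sup>2 * ?s\<^sup>2 * r1 ?i x * h ?i x = G ?i x * Pt N x"
          using hn by (simp add: r1_def Pt_def P_def power4_eq_xxxx power2_eq_square)
        have e2: "2 * ?s * r1 ?i x = ?s * (?s * \<rho> ?i x) - kkg x"
          unfolding key_identity[OF i] s_a[symmetric] by (simp add: algebra_simps)
        have "(?s\<^sup>2 * (r1 ?i x * B ?i x)) * - (\<i> * complex_of_real (k * x\<^sup>2) * h ?i x * ?E x)
          = - (\<i> * complex_of_real k) * (?s\<^sup>2 * ?s\<^sup>2 * r1 ?i x * h ?i x) * B ?i x * ?E x"
          by simp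
        also have "\<dots> = - (B ?i x * (G ?i x * (\<i> * complex_of_real k * Pt N x * ?E x)))"
          unfolding e1 by simp
        finally have A1: "(?s\<^sup>2 * (r1 ?i x * B ?i x)) * - (\<i> * complex_of_real (k * x\<^sup>2) * h ?i x * ?E x)
          = - (B ?i x * (G ?i x * (\<i> * complex_of_real k * Pt N x * ?E x)))" .
        have "2 * ?s * (r1 ?i x * B ?i x) = (2 * ?s * r1 ?i x) * B ?i x" by simp
        also have "\<dots> = ?s\<^sup>2 * (B ?i x * \<rho> ?i x) - B ?i x * kkg x"
          unfolding e2 by (simp add: power2_eq_square algebra_simps)
        finally have A2: "2 * ?s * (r1 ?i x * B ?i x) = ?s\<^sup>2 * (B ?i x * \<rho> ?i x) - B ?i x * kkg x" .
        show ?thesis unfolding A1 A2 by (simp add: algebra_simps)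
      qed
      ultimately show "((\<lambda>x. ((complex_of_real x)\<^sup>2 * (r1 ?i x * B ?i x)) * ?E x) has_vector_derivative
         complex_of_real (x\<^sup>2) * ?F ?i x * ?E x - ?D x) (at x)" by (simp only:)
    next
      show "integrable lborel (\<lambda>x. complex_of_real (x\<^sup>2) * ?F ?i x * ?E x - ?D x)"
        by (rule Bochner_Integration.integrable_diff[OF iF iD])
      have b: "norm (((complex_of_real x)\<^sup>2 * (r1 ?i x * B ?i x)) * ?E x) \<le> Mq * MB * W ?i x" for x
      proof -
        have "cmod ((complex_of_real x)\<^sup>2 * r1 ?i x) * cmod (B ?i x) * cmod (?E x) \<le> Mq * (MB * W ?i x) * 1"
          using Mq MB i E1 W_bounds by (intro mult_mono mult_nonneg_nonneg) auto
        then show ?thesis by (simp add: norm_mult mult_ac)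
      qed
      have Wl: "(W ?i \<longlongrightarrow> 0) at_top" "(W ?i \<longlongrightarrow> 0) at_bot" using good_W i unfolding good_weight_def by blast+
      show "((\<lambda>x. ((complex_of_real x)\<^sup>2 * (r1 ?i x * B ?i x)) * ?E x) \<longlongrightarrow> 0) at_top"
        by (rule Lim_null_comparison[OF _ tendsto_mult_right_zero[OF Wl(1), of "Mq * MB"]]) (simp only: b eventually_True)
      show "((\<lambda>x. ((complex_of_real x)\<^sup>2 * (r1 ?i x * B ?i x)) * ?E x) \<longlongrightarrow> 0) at_bot"
        by (rule Lim_null_comparison[OF _ tendsto_mult_right_zero[OF Wl(2), of "Mq * MB"]]) (simp only: b eventually_True)
    qed
    then have "J' k w t = (LINT x|lborel. complex_of_real (x\<^sup>2) * ?F ?i x * ?E x)"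
      unfolding J'_def by (subst (asm) Bochner_Integration.integral_diff[OF iF iD]) simp
    then show "cmod (J' k w t) \<le> C * k powr (-4/3)"
      using C(2)[OF k i dE E1] by (simp only:)
  qed
qed

lemma J_difference: "\<exists>C\<ge>0. \<forall>k\<ge>1. \<forall>w. cmod (J k w 1 - J k w 0) \<le> C * k powr (-4/3)"
proof -
  obtain C where C: "C \<ge> 0" "\<And>k t w. k \<ge> 1 \<Longrightarrow> t \<in> {0..1} \<Longrightarrow> cmod (J' k w t) \<le> C * k powr (-4/3)"
    using J'_bound by blast
  show ?thesis
  proof (intro exI[of _ C] conjI allI impI C(1))
    fix k w :: real assume k: "k \<ge> 1"
    have "norm (J k w 1 - J k w 0) \<le> (C * k powr (-4/3)) * norm (1 - 0 :: real)"
    proof (rule differentiable_bound[where S="{0..1}" and f'="\<lambda>t h. h *\<^sub>R J' k w t"])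
      fix t :: real assume t: "t \<in> {0..1}"
      then show "(J k w has_derivative (\<lambda>h. h *\<^sub>R J' k w t)) (at t within {0..1})"
        using J_deriv[of k t w] k unfolding has_vector_derivative_def by (auto intro: has_derivative_at_withinI)
      show "onorm (\<lambda>h. h *\<^sub>R J' k w t) \<le> C * k powr (-4/3)"
        by (rule onorm_le) (use C(2)[OF k t, of w] in \<open>auto simp: mult.commute[of _ "\<bar>_\<bar>"] intro: mult_left_mono\<close>)
    qed auto
    then show "cmod (J k w 1 - J k w 0) \<le> C * k powr (-4/3)" by simp
  qed
qed

text \<open>
The homotopy connects the Airy integral with the cut-off beam integral \<open>J k w 1\<close>; the cut-off itself costs
\<open>k^(-3/2)\<close> pointwise, and the weight \<open>W\<close> makes the integral of this error finite.
\<close>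
lemma beam_integral_bound:
  "\<exists>C\<ge>0. \<forall>k\<ge>1. \<forall>w. cmod ((LINT x|lborel. A (w - 2 * \<eta> * x) * (g x * exp (\<i> * complex_of_real k * (complex_of_real (- (x ^ 3 / 3)) + P x))))
      - (LINT x|lborel. A (w - 2 * \<eta> * x) * exp (\<i> * complex_of_real k * complex_of_real (- (x ^ 3 / 3))))) \<le> C * k powr (-4/3)"
proof -
  obtain C where C: "C \<ge> 0" "\<And>k w. k \<ge> 1 \<Longrightarrow> cmod (J k w 1 - J k w 0) \<le> C * k powr (-4/3)"
    using J_difference by blast
  obtain D where D: "D \<ge> 0" "\<And>k x. k \<ge> 1 \<Longrightarrow> cmod (exp (\<i> * complex_of_real k * P x) - kap N x ^ 2 * exp (\<i> * complex_of_real k * Pt N x)) \<le> D * k powr (-3/2)"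
    using cut_error_pointwise[OF N] by blast
  obtain M where M: "M \<ge> 0" "\<And>i x. i \<in> I \<Longrightarrow> cmod (B i x) \<le> M * W i x" using symbol_bounded[OF symbol_B[of 0]] by blast
  obtain Mg where Mg: "Mg \<ge> 0" "\<And>x. cmod (g x) \<le> Mg" using symbol_bounded[OF symbol_g[of 0 "{0::nat}"]] by auto
  obtain L where L: "\<And>i. i \<in> I \<Longrightarrow> (LINT x|lborel. W i x) \<le> L" using good_W unfolding good_weight_def by blast
  have L0: "L \<ge> 0"
  proof -
    have "0 \<le> (LINT x|lborel. W (0,0) x)" by (rule integral_nonneg_AE) (simp add: W_bounds)
    then show ?thesis using L[of "(0,0)"] by simp
  qed
  have Pm[measurable]: "P \<in> borel_measurable borel" unfolding P_def[abs_def] by measurable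
  show ?thesis
  proof (intro exI[of _ "C + M * Mg * D * L"] conjI allI impI)
    show "C + M * Mg * D * L \<ge> 0" using C M Mg D L0 by simp
    fix k w :: real assume k: "k \<ge> 1"
    have i0: "(0, w) \<in> I" "(1, w) \<in> I" by auto
    let ?c = "\<lambda>x. exp (\<i> * complex_of_real k * complex_of_real (- (x ^ 3 / 3)))"
    let ?Q = "\<lambda>x. A (w - 2 * \<eta> * x) * (g x * exp (\<i> * complex_of_real k * (complex_of_real (- (x ^ 3 / 3)) + P x)))"
    let ?R = "\<lambda>x. B (1, w) x * (G (1, w) x * E k 1 x)"
    have J0: "J k w 0 = (LINT x|lborel. A (w - 2 * \<eta> * x) * ?c x)"
      by (simp add: J_def B_def G_def E_def)
    obtain K where K: "\<And>t w x. t \<in> {-1<..<2} \<Longrightarrow> cmod (B (t, w) x * (G (t, w) x * E k t x)) \<le> K * (1 + x\<^sup>2) * W (0, w) x"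
      using J_integrand_bounds[of k] k by fastforce
    have mR: "?R \<in> borel_measurable borel" by measurable
    have t1: "(1::real) \<in> {-1<..<2}" by simp
    have iR: "integrable lborel ?R"
      by (rule integrable_of_good_weight[OF good_W i0(1) mR K[OF t1]])
    have iW: "integrable lborel (W (0, w))" by (rule good_weight_integrable[OF good_W i0(1)])
    have QR: "?Q x - ?R x = B (0, w) x * (g x * (?c x * (exp (\<i> * complex_of_real k * P x) - kap N x ^ 2 * exp (\<i> * complex_of_real k * Pt N x))))" for x
    proof -
      have 1: "exp (\<i> * complex_of_real k * (complex_of_real (- (x ^ 3 / 3)) + z)) = ?c x * exp (\<i> * complex_of_real k * z)" for z
        unfolding distrib_left exp_add by simp
      have "G (1, w) x = kap N x ^ 2 * g x" by (simp add: G_def power2_eq_square)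
      moreover have "E k 1 x = ?c x * exp (\<i> * complex_of_real k * Pt N x)"
        unfolding E_def of_real_1 mult_1_left 1 ..
      ultimately show ?thesis unfolding 1 B_def by (simp add: algebra_simps)
    qed
    have bQR: "cmod (?Q x - ?R x) \<le> M * Mg * D * k powr (-3/2) * W (0, w) x" for x
    proof -
      have "cmod (?c x) = 1" by simp
      then have "cmod (?Q x - ?R x) = cmod (B (0, w) x) * (cmod (g x) * cmod (exp (\<i> * complex_of_real k * P x) - kap N x ^ 2 * exp (\<i> * complex_of_real k * Pt N x)))"
        unfolding QR by (simp only: norm_mult mult_1_left)
      also have "\<dots> \<le> (M * W (0, w) x) * (Mg * (D * k powr (-3/2)))"
        using M(2)[OF i0(1)] M(1) Mg D(2)[OF k, of x] W_bounds by (intro mult_mono mult_nonneg_nonneg) auto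
      finally show ?thesis by (simp only: mult_ac)
    qed
    have mQ[measurable]: "?Q \<in> borel_measurable borel"
    proof -
      have [measurable]: "A \<in> borel_measurable borel" using borel_measurable_schwartz[OF A, of 0] by simp
      show ?thesis by measurable
    qed
    have iQR: "integrable lborel (\<lambda>x. ?Q x - ?R x)"
      by (rule integrable_majorized[OF integrable_mult_right[OF iW] _ bQR]) measurable
    then have iQ: "integrable lborel ?Q" using Bochner_Integration.integrable_add[OF iQR iR] by simp
    have "cmod ((LINT x|lborel. ?Q x) - J k w 1) = cmod (LINT x|lborel. ?Q x - ?R x)"
      unfolding J_def by (simp only: Bochner_Integration.integral_diff[OF iQ iR])
    also have "\<dots> \<le> (LINT x|lborel. M * Mg * D * k powr (-3/2) * W (0, w) x)"
      by (rule Bochner_Integration.integral_norm_bound_integral[OF iQR integrable_mult_right[OF iW] bQR])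
    also have "\<dots> = M * Mg * D * k powr (-3/2) * (LINT x|lborel. W (0, w) x)" by (rule integral_mult_right_zero)
    also have "\<dots> \<le> M * Mg * D * k powr (-3/2) * L" using M Mg D L[OF i0(1)] by (intro mult_left_mono) auto
    also have "\<dots> = M * Mg * D * L * k powr (-3/2)" by (simp only: mult_ac)
    also have "\<dots> \<le> M * Mg * D * L * k powr (-4/3)" using k M Mg D L0 by (intro mult_left_mono powr_mono) auto
    finally have 1: "cmod ((LINT x|lborel. ?Q x) - J k w 1) \<le> M * Mg * D * L * k powr (-4/3)" .
    have "(LINT x|lborel. ?Q x) - J k w 0 = ((LINT x|lborel. ?Q x) - J k w 1) + (J k w 1 - J k w 0)" by simp
    then have "cmod ((LINT x|lborel. ?Q x) - J k w 0) \<le> cmod ((LINT x|lborel. ?Q x) - J k w 1) + cmod (J k w 1 - J k w 0)"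
      by (simp only: norm_triangle_ineq)
    also have "\<dots> \<le> (C + M * Mg * D * L) * k powr (-4/3)" using 1 C(2)[OF k, of w] by (simp only: distrib_right)
    finally show "cmod ((LINT x|lborel. ?Q x) - (LINT x|lborel. A (w - 2 * \<eta> * x) * ?c x)) \<le> (C + M * Mg * D * L) * k powr (-4/3)"
      unfolding J0 .
  qed
qed

end

text \<open>
The outcome of the homotopy, free of the cut-off scale \<open>N\<close>.
\<close>
lemma (in beam_phase) gaussian_beam_integral_bound:
  assumes "schwartz A"
  shows "\<exists>C\<ge>0. \<forall>k\<ge>1. \<forall>w. cmod ((LINT x|lborel. A (w - 2 * \<eta> * x) * (g x * exp (\<i> * complex_of_real k * (complex_of_real (- (x ^ 3 / 3)) + P x))))
      - (LINT x|lborel. A (w - 2 * \<eta> * x) * exp (\<i> * complex_of_real k * complex_of_real (- (x ^ 3 / 3))))) \<le> C * k powr (-4/3)"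
proof -
  obtain N where "N > 0" "\<And>x. cmod (complex_of_real x * nn N x) \<le> 1 / 2" using ex_small_cutoff by blast
  then interpret beam_cut \<eta> \<gamma> N A using assms by unfold_locales auto
  show ?thesis by (rule beam_integral_bound)
qed

section \<open>The transfer function of the exact solution\<close>

text \<open>
The multiplier that maps the transform of the incident amplitude to that of the solution on the caustic, as a function of
the unscaled frequency offset \<open>z\<close>, and its limiting form.
\<close>
definition transfer :: "real \<Rightarrow> real \<Rightarrow> real \<Rightarrow> complex" where
  "transfer k \<Theta> z = cnj \<alpha> * (Ai (complex_of_real (k powr (2/3) * (x_c \<Theta> - X_turn \<Theta> (z / k))))
      / ai_alpha (k powr (2/3) * X_turn \<Theta> (z / k)))"

definition transfer0 :: "real \<Rightarrow> real \<Rightarrow> real \<Rightarrow> complex" where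
  "transfer0 k \<Theta> z = cis (- (pi / 4)) * complex_of_real (2 * sqrt pi * k powr (1/6)) *
      (complex_of_real (sqrt (\<xi>\<^sub>0 \<Theta>)) * cis (2/3 * k * \<xi>\<^sub>0 \<Theta> ^ 3 - 2 * \<xi>\<^sub>0 \<Theta> * \<eta>\<^sub>0 \<Theta> * z)) *
      Ai (complex_of_real (2 * \<eta>\<^sub>0 \<Theta> * k powr (-1/3) * z))"

text \<open>
For \<open>X \<le> 0\<close> the numerator is evaluated at a positive argument and the denominator is at least \<open>|Ai 0|\<close>. For
\<open>0 < X \<le> 1\<close> both arguments are at most \<open>k^(2/3)\<close> in modulus, and the numerator and the reciprocal of the denominator grow at
most linearly.
\<close>
lemma transfer_global_bound:
  assumes \<Theta>: "0 < \<Theta>" "\<Theta> < pi / 2"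
  shows "\<exists>C\<ge>0. \<forall>k>0. \<forall>z. cmod (transfer k \<Theta> z) \<le> C * (1 + k powr (2/3))\<^sup>2"
proof -
  define \<xi> where "\<xi> = \<xi>\<^sub>0 \<Theta>"
  define \<eta> where "\<eta> = \<eta>\<^sub>0 \<Theta>"
  have eta: "0 < \<eta>" "\<eta> \<le> 1" using \<Theta> by (auto simp: \<eta>_def \<eta>\<^sub>0_def sin_gt_zero2)
  have xi: "0 < \<xi>" "\<xi> \<le> 1" using \<Theta> by (auto simp: \<xi>_def \<xi>\<^sub>0_def cos_gt_zero)
  obtain C1 where C1: "C1 > 0" "\<And>s::real. cmod (Ai s) \<le> C1 * exp (- s)" using Ai_real_exp_decay by blast
  obtain C2 where C2: "C2 > 0" "\<And>s::real. cmod (Ai s) \<le> C2 * (1 + \<bar>s\<bar>)" using Ai_real_linear_growth by blast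
  obtain C3 where C3: "C3 > 0" "\<And>t. 1 / cmod (ai_alpha t) \<le> C3 * (1 + \<bar>t\<bar>)" using inverse_ai_alpha_bound by blast
  define c0 where "c0 = 1 / cmod (ai_alpha 0)"
  have c0: "c0 > 0" using ai_alpha_nonzero[of 0] by (simp add: c0_def)
  show ?thesis
  proof (intro exI[of _ "C1 * c0 + 8 * C2 * C3"] conjI allI impI)
    show "0 \<le> C1 * c0 + 8 * C2 * C3" using C1 C2 C3 c0 by simp
    fix k z :: real assume k: "k > 0"
    define L where "L = k powr (2/3)"
    define X where "X = X_turn \<Theta> (z / k)"
    have L: "L > 0" using k by (simp add: L_def)
    have n: "cmod (transfer k \<Theta> z) = cmod (Ai (complex_of_real (L * (\<xi>\<^sup>2 - X)))) * (1 / cmod (ai_alpha (L * X)))"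
      by (simp add: transfer_def norm_mult norm_divide norm_alpha L_def X_def x_c_def \<xi>_def)
    have one: "1 \<le> (1 + L)\<^sup>2" using L by simp
    show "cmod (transfer k \<Theta> z) \<le> (C1 * c0 + 8 * C2 * C3) * (1 + k powr (2/3))\<^sup>2"
    proof (cases "X \<le> 0")
      case True
      have "0 \<le> L * (\<xi>\<^sup>2 - X)" using True L zero_le_power2[of \<xi>] by (intro mult_nonneg_nonneg) linarith+
      then have "C1 * exp (- (L * (\<xi>\<^sup>2 - X))) \<le> C1 * 1" using C1 by (intro mult_left_mono) auto
      then have 1: "cmod (Ai (complex_of_real (L * (\<xi>\<^sup>2 - X)))) \<le> C1" using C1(2)[of "L * (\<xi>\<^sup>2 - X)"] by simp
      have "L * X \<le> 0" using True L by (simp add: mult_nonneg_nonpos)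
      then have "cmod (ai_alpha 0) \<le> cmod (ai_alpha (L * X))" by (rule norm_ai_alpha_ge_neg)
      then have 2: "1 / cmod (ai_alpha (L * X)) \<le> c0"
        unfolding c0_def using ai_alpha_nonzero[of 0] ai_alpha_nonzero[of "L * X"] by (intro divide_left_mono mult_pos_pos) auto
      have "cmod (transfer k \<Theta> z) \<le> C1 * c0" unfolding n using 1 2 C1 by (intro mult_mono) auto
      also have "\<dots> \<le> (C1 * c0 + 8 * C2 * C3) * 1" using C2 C3 by simp
      also have "\<dots> \<le> (C1 * c0 + 8 * C2 * C3) * (1 + L)\<^sup>2"
        using one C1 C2 C3 c0 by (intro mult_left_mono) auto
      finally show ?thesis by (simp add: L_def)
    next
      case False
      have X1: "X \<le> 1" by (simp add: X_def X_turn_def)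
      have "\<xi>\<^sup>2 \<le> 1" using xi by (simp add: power_le_one)
      then have "\<bar>\<xi>\<^sup>2 - X\<bar> \<le> 1" using X1 False zero_le_power2[of \<xi>] by (intro abs_leI) linarith+
      then have "\<bar>L * (\<xi>\<^sup>2 - X)\<bar> \<le> L * 1" unfolding abs_mult using L by (intro mult_mono) auto
      then have "C2 * (1 + \<bar>L * (\<xi>\<^sup>2 - X)\<bar>) \<le> C2 * (1 + L)" using C2 by (intro mult_left_mono) auto
      then have 1: "cmod (Ai (complex_of_real (L * (\<xi>\<^sup>2 - X)))) \<le> C2 * (1 + L)" using C2(2)[of "L * (\<xi>\<^sup>2 - X)"] by linarith
      have "\<bar>L * X\<bar> \<le> L * 1" unfolding abs_mult using L X1 False by (intro mult_mono) auto
      then have "C3 * (1 + \<bar>L * X\<bar>) \<le> C3 * (1 + L)" using C3 by (intro mult_left_mono) auto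
      then have 2: "1 / cmod (ai_alpha (L * X)) \<le> C3 * (1 + L)" using C3(2)[of "L * X"] by linarith
      have "cmod (transfer k \<Theta> z) \<le> (C2 * (1 + L)) * (C3 * (1 + L))"
        unfolding n using 1 2 C2 L by (intro mult_mono) auto
      also have "\<dots> = C2 * C3 * (1 + L)\<^sup>2" by (simp add: power2_eq_square)
      also have "\<dots> \<le> (C1 * c0 + 8 * C2 * C3) * (1 + L)\<^sup>2"
        using C1 C2 C3 c0 by (intro mult_right_mono) auto
      finally show ?thesis by (simp add: L_def)
    qed
  qed
qed

text \<open>
With \<open>q = z / k\<close>, \<open>X = \<xi>\<^sup>2 - 2 \<eta> q - q\<^sup>2\<close>, \<open>t = k^(2/3) X\<close> and \<open>r = sqrt X\<close>, three approximations are made where \<open>|q| < \<delta>\<close>: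
\<open>Ai (\<alpha> t)\<close> is replaced by its leading term, whose reciprocal is \<open>k^(1/6) sqrt r cis (2/3 k r\<^sup>3)\<close> up to a constant
factor; \<open>sqrt r\<close> and \<open>2/3 k r\<^sup>3\<close> are replaced by their expansions of order \<open>0\<close> and \<open>1\<close> in \<open>q\<close>, with errors \<open>O(|q|)\<close> and
\<open>O(k q\<^sup>2)\<close>, both \<open>O(k^(-1))\<close> up to powers of \<open>|z|\<close>; and the argument of the numerator, \<open>s = k^(2/3) (2 \<eta> q + q\<^sup>2)\<close>, is replaced by its
linear part.

Where \<open>|q| \<ge> \<delta>\<close> no approximation is made: \<open>k \<le> (1 + |z|) / \<delta>\<close> turns every power of \<open>k\<close> into a power of \<open>1 + |z|\<close>.
\<close>
lemma transfer_asymptotics: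
  assumes \<Theta>: "0 < \<Theta>" "\<Theta> < pi / 2"
  shows "\<exists>C\<ge>0. \<forall>k\<ge>1. \<forall>z. cmod (transfer k \<Theta> z - transfer0 k \<Theta> z) \<le> C * k powr (-5/6) * (1 + \<bar>z\<bar>) ^ 6"
proof -
  define \<xi> where "\<xi> = \<xi>\<^sub>0 \<Theta>"
  define \<eta> where "\<eta> = \<eta>\<^sub>0 \<Theta>"
  have eta: "0 < \<eta>" "\<eta> \<le> 1" using \<Theta> by (auto simp: \<eta>_def \<eta>\<^sub>0_def sin_gt_zero2)
  have xi: "0 < \<xi>" "\<xi> \<le> 1" using \<Theta> by (auto simp: \<xi>_def \<xi>\<^sub>0_def cos_gt_zero)
  have pyth: "\<eta>\<^sup>2 + \<xi>\<^sup>2 = 1" by (simp add: \<eta>_def \<eta>\<^sub>0_def \<xi>_def \<xi>\<^sub>0_def)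
  have xi2: "\<xi>\<^sup>2 \<le> 1" using xi by (simp add: power_le_one)
  \<comment> \<open>For |q| < delta this gives X >= xi^2 / 2, so t is bounded below by t0.\<close>
  define \<delta> where "\<delta> = \<xi>\<^sup>2 / 6"
  have delta: "\<delta> > 0" "\<delta> \<le> 1" using xi xi2 by (auto simp: \<delta>_def)
  define t0 where "t0 = \<xi>\<^sup>2 / 2"
  have t0: "t0 > 0" using xi by (simp add: t0_def)
  obtain C1 where C1: "C1 \<ge> 0" "\<And>k z. k > 0 \<Longrightarrow> cmod (transfer k \<Theta> z) \<le> C1 * (1 + k powr (2/3))\<^sup>2" using transfer_global_bound[OF \<Theta>] by blast
  obtain C2 where C2: "C2 > 0" "\<And>s::real. cmod (Ai s) \<le> C2 * (1 + \<bar>s\<bar>)" using Ai_real_linear_growth by blast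
  obtain C3 where C3: "C3 > 0" "\<And>s h::real. cmod (Ai (complex_of_real (s + h)) - Ai (complex_of_real s)) \<le> C3 * \<bar>h\<bar> * (1 + \<bar>s\<bar> + \<bar>h\<bar>)\<^sup>2"
    using Ai_real_lipschitz by blast
  obtain C4 where C4: "C4 > 0" "\<And>t. t \<ge> t0 \<Longrightarrow> cmod (1 / ai_alpha t - 1 / airy_osc t) \<le> C4 * t powr (-5/4)"
    using inverse_ai_alpha_asymptotics[OF t0] by blast
  define Dfar where "Dfar = (4 * C1 + 2 * sqrt pi * (2 * C2)) / \<delta> ^ 3"
  define D1 where "D1 = C2 * (C4 * t0 powr (-5/4))"
  define D2 where "D2 = 2 * sqrt pi * ((3 / (\<xi> * sqrt \<xi>) + 2/3 * (9 / \<xi>\<^sup>2 * 3) + 1) * C2)"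
  define D3 where "D3 = 2 * sqrt pi * (4 * C3)"
  have D0: "Dfar \<ge> 0" "D1 \<ge> 0" "D2 \<ge> 0" "D3 \<ge> 0"
    using C1 C2 C3 C4 delta xi t0 by (auto simp: Dfar_def D1_def D2_def D3_def intro!: mult_nonneg_nonneg divide_nonneg_nonneg add_nonneg_nonneg)
  have nT0: "cmod (transfer0 k \<Theta> z) \<le> 2 * sqrt pi * k powr (1/6) * (C2 * (1 + \<bar>2 * \<eta> * k powr (-1/3) * z\<bar>))" if "k > 0" for k z
  proof -
    have "cmod (transfer0 k \<Theta> z) = 2 * sqrt pi * k powr (1/6) * sqrt \<xi> * cmod (Ai (complex_of_real (2 * \<eta> * k powr (-1/3) * z)))"
      using xi by (simp add: transfer0_def norm_mult \<eta>_def \<xi>_def)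
    also have "\<dots> \<le> 2 * sqrt pi * k powr (1/6) * 1 * (C2 * (1 + \<bar>2 * \<eta> * k powr (-1/3) * z\<bar>))"
      using xi C2(1) by (intro mult_mono mult_nonneg_nonneg C2(2)) auto
    finally show ?thesis by simp
  qed
  show ?thesis
  proof (intro exI[of _ "Dfar + D1 + D2 + D3"] conjI allI impI)
    show "0 \<le> Dfar + D1 + D2 + D3" using D0 by simp
    fix k z :: real assume k: "k \<ge> 1"
    then have k0: "k > 0" by simp
    have z1: "1 \<le> 1 + \<bar>z\<bar>" by simp
    have km1: "1 / k \<le> k powr (-5/6)"
    proof -
      have "1 / k = k powr (-1)" using k0 by (simp add: powr_minus_divide)
      also have "\<dots> \<le> k powr (-5/6)" using k by (intro powr_mono) auto
      finally show ?thesis .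
    qed
    have k13: "k powr (-1/3) \<le> 1" using k by (simp add: powr_minus_divide divide_le_eq ge_one_powr_ge_zero)
    show "cmod (transfer k \<Theta> z - transfer0 k \<Theta> z) \<le> (Dfar + D1 + D2 + D3) * k powr (-5/6) * (1 + \<bar>z\<bar>) ^ 6"
    proof (cases "\<bar>z\<bar> < \<delta> * k")
      case False
      then have kz: "k \<le> (1 + \<bar>z\<bar>) / \<delta>" using delta by (simp add: pos_le_divide_eq mult.commute)
      have "k powr (2/3) \<le> k powr 1" using k by (intro powr_mono) auto
      then have "1 + k powr (2/3) \<le> 2 * k" using k by simp
      then have "(1 + k powr (2/3))\<^sup>2 \<le> (2 * k)\<^sup>2" by (intro power_mono) auto
      then have "C1 * (1 + k powr (2/3))\<^sup>2 \<le> C1 * (2 * k)\<^sup>2" using C1 by (intro mult_left_mono) auto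
      then have 1: "cmod (transfer k \<Theta> z) \<le> 4 * C1 * k\<^sup>2" using C1(2)[OF k0, of z] by (simp add: power_mult_distrib)
      have s: "\<bar>2 * \<eta> * k powr (-1/3) * z\<bar> \<le> 2 * \<bar>z\<bar>"
      proof -
        have "2 * \<eta> * k powr (-1/3) * \<bar>z\<bar> \<le> 2 * 1 * 1 * \<bar>z\<bar>" using eta k13 by (intro mult_mono) auto
        then show ?thesis using eta by (simp add: abs_mult)
      qed
      have "k powr (1/6) \<le> k powr 1" using k by (intro powr_mono) auto
      then have k16: "k powr (1/6) \<le> k" using k by simp
      have "cmod (transfer0 k \<Theta> z) \<le> 2 * sqrt pi * k * (C2 * (2 * (1 + \<bar>z\<bar>)))"
        using s k16 C2 k0 by (intro order_trans[OF nT0[OF k0]] mult_mono mult_nonneg_nonneg mult_left_mono) auto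
      then have "cmod (transfer k \<Theta> z - transfer0 k \<Theta> z) \<le> 4 * C1 * k\<^sup>2 + 2 * sqrt pi * k * (C2 * (2 * (1 + \<bar>z\<bar>)))"
        using 1 norm_triangle_ineq4[of "transfer k \<Theta> z" "transfer0 k \<Theta> z"] by linarith
      also have "\<dots> = 1 / k * (4 * C1 * k ^ 3 + 2 * sqrt pi * (2 * C2) * (k\<^sup>2 * (1 + \<bar>z\<bar>)))"
        using k0 by (simp add: power2_eq_square power3_eq_cube distrib_left)
      also have "\<dots> \<le> k powr (-5/6) * (4 * C1 * ((1 + \<bar>z\<bar>) ^ 6 / \<delta> ^ 3) + 2 * sqrt pi * (2 * C2) * ((1 + \<bar>z\<bar>) ^ 6 / \<delta> ^ 3))"
      proof (intro mult_mono km1 add_mono mult_left_mono)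
        have "k ^ 3 \<le> ((1 + \<bar>z\<bar>) / \<delta>) ^ 3" using kz k0 by (intro power_mono) auto
        also have "\<dots> = (1 + \<bar>z\<bar>) ^ 3 / \<delta> ^ 3" by (simp add: power_divide)
        also have "\<dots> \<le> (1 + \<bar>z\<bar>) ^ 6 / \<delta> ^ 3" using delta z1 by (intro divide_right_mono power_increasing) auto
        finally show "k ^ 3 \<le> (1 + \<bar>z\<bar>) ^ 6 / \<delta> ^ 3" .
        have "k\<^sup>2 \<le> ((1 + \<bar>z\<bar>) / \<delta>)\<^sup>2" using kz k0 by (intro power_mono) auto
        then have "k\<^sup>2 * (1 + \<bar>z\<bar>) \<le> ((1 + \<bar>z\<bar>) / \<delta>)\<^sup>2 * (1 + \<bar>z\<bar>)" by (intro mult_right_mono) auto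
        also have "\<dots> = (1 + \<bar>z\<bar>) ^ 3 / \<delta>\<^sup>2" by (simp add: power_divide power2_eq_square power3_eq_cube)
        also have "\<dots> \<le> (1 + \<bar>z\<bar>) ^ 6 / \<delta> ^ 3"
          using delta z1 by (intro frac_le power_increasing power_decreasing) auto
        finally show "k\<^sup>2 * (1 + \<bar>z\<bar>) \<le> (1 + \<bar>z\<bar>) ^ 6 / \<delta> ^ 3" .
      qed (use C1 C2 k0 in auto)
      also have "\<dots> = Dfar * k powr (-5/6) * (1 + \<bar>z\<bar>) ^ 6"
        by (simp add: Dfar_def add_divide_distrib algebra_simps)
      also have "\<dots> \<le> (Dfar + D1 + D2 + D3) * k powr (-5/6) * (1 + \<bar>z\<bar>) ^ 6"
        using D0 by (intro mult_right_mono) auto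
      finally show ?thesis .
    next
      case True
      define q where "q = z / k"
      have q: "\<bar>q\<bar> < \<delta>" using True k0 by (simp add: q_def pos_divide_less_eq)
      define X where "X = X_turn \<Theta> q"
      have X: "X = \<xi>\<^sup>2 - (2 * \<eta> * q + q\<^sup>2)"
        using pyth by (simp add: X_def X_turn_def \<eta>_def[symmetric] power2_eq_square algebra_simps)
      have q3: "\<bar>2 * \<eta> * q + q\<^sup>2\<bar> \<le> 3 * \<bar>q\<bar>"
      proof -
        have "\<bar>q\<bar> * \<bar>q\<bar> \<le> 1 * \<bar>q\<bar>" using q delta by (intro mult_right_mono) auto
        moreover have "2 * \<eta> * \<bar>q\<bar> \<le> 2 * 1 * \<bar>q\<bar>" using eta by (intro mult_right_mono mult_left_mono) auto
        moreover have "\<bar>2 * \<eta> * q + q\<^sup>2\<bar> \<le> 2 * \<eta> * \<bar>q\<bar> + \<bar>q\<bar> * \<bar>q\<bar>"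
          using abs_triangle_ineq[of "2 * \<eta> * q" "q\<^sup>2"] eta by (simp add: abs_mult power2_eq_square)
        ultimately show ?thesis by linarith
      qed
      have Xb: "t0 \<le> X" "X \<le> 4"
        using q3 q xi2 unfolding X t0_def \<delta>_def by linarith+
      have X0: "X > 0" using Xb t0 by linarith
      define L where "L = k powr (2/3)"
      have L1: "L \<ge> 1" using k by (simp add: L_def ge_one_powr_ge_zero)
      define s where "s = L * (2 * \<eta> * q + q\<^sup>2)"
      define s0 where "s0 = 2 * \<eta> * k powr (-1/3) * z"
      have Lq: "L * q = k powr (-1/3) * z"
        using k0 powr_diff[of k "2/3" 1] by (simp add: L_def q_def)
      define hh where "hh = L * q\<^sup>2"
      have ss0: "s = s0 + hh"
        using Lq by (simp add: s_def s0_def hh_def algebra_simps)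
      have s0b: "\<bar>s0\<bar> \<le> 2 * \<bar>z\<bar>"
      proof -
        have "2 * \<eta> * k powr (-1/3) * \<bar>z\<bar> \<le> 2 * 1 * 1 * \<bar>z\<bar>" using eta k13 by (intro mult_mono) auto
        then show ?thesis using eta by (simp add: abs_mult s0_def)
      qed
      have hb: "\<bar>hh\<bar> \<le> z\<^sup>2 * (1 / k)"
      proof -
        have "hh = (k powr (-1/3) * z) * q" using Lq by (simp add: hh_def power2_eq_square mult.assoc[symmetric])
        then have "\<bar>hh\<bar> = k powr (-1/3) * (\<bar>z\<bar> * \<bar>q\<bar>)" by (simp add: abs_mult)
        also have "\<dots> \<le> 1 * (\<bar>z\<bar> * \<bar>q\<bar>)" using k13 by (intro mult_right_mono) auto
        also have "\<dots> = z\<^sup>2 * (1 / k)" using k0 by (simp add: q_def abs_mult power2_eq_square abs_mult_self_eq)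
        finally show ?thesis .
      qed
      have hb': "\<bar>hh\<bar> \<le> z\<^sup>2"
      proof -
        have "1 / k \<le> 1" using k by simp
        then have "z\<^sup>2 * (1 / k) \<le> z\<^sup>2 * 1" by (intro mult_left_mono) auto
        then show ?thesis using hb by linarith
      qed
      have sb: "1 + \<bar>s0\<bar> + \<bar>hh\<bar> \<le> (1 + \<bar>z\<bar>)\<^sup>2" using s0b hb' by (simp add: power2_eq_square algebra_simps abs_mult_self_eq)
      have Ais: "cmod (Ai (complex_of_real s)) \<le> C2 * (1 + \<bar>z\<bar>)\<^sup>2"
      proof -
        have "1 + \<bar>s\<bar> \<le> (1 + \<bar>z\<bar>)\<^sup>2" using sb unfolding ss0 by linarith
        then have "C2 * (1 + \<bar>s\<bar>) \<le> C2 * (1 + \<bar>z\<bar>)\<^sup>2" using C2 by (intro mult_left_mono) auto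
        then show ?thesis using C2(2)[of s] by linarith
      qed
      define t where "t = L * X"
      have tt0: "t0 \<le> t" using mult_mono[of 1 L t0 X] L1 Xb t0 by (simp add: t_def)
      have t: "t > 0" using tt0 t0 by linarith
      have T: "transfer k \<Theta> z = cnj \<alpha> * Ai (complex_of_real s) * (1 / ai_alpha t)"
        using X by (simp add: transfer_def s_def t_def q_def[symmetric] X_def[symmetric] L_def[symmetric] x_c_def \<xi>_def[symmetric])
      define r where "r = sqrt X"
      have r: "r > 0" "r\<^sup>2 = X" "r \<le> 2" using X0 Xb real_sqrt_le_mono[of X 4] by (auto simp: r_def)
      define c0 where "c0 = cis (- (pi / 4)) * complex_of_real (2 * sqrt pi * k powr (1/6))"
      define U where "U = complex_of_real (sqrt r) * cis (2/3 * k * r ^ 3)"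
      define U0 where "U0 = complex_of_real (sqrt \<xi>) * cis (2/3 * k * \<xi> ^ 3 - 2 * \<xi> * \<eta> * z)"
      have osc: "cnj \<alpha> * (1 / airy_osc t) = c0 * U"
      proof -
        have t32: "t powr (3/2) = k * r ^ 3"
        proof -
          have "t powr (3/2) = L powr (3/2) * X powr (3/2)" using L1 X0 by (simp add: t_def powr_mult)
          also have "L powr (3/2) = k" using k0 by (simp add: L_def powr_powr)
          also have "X powr (3/2) = X powr (1 + 1/2)" by simp
          also have "\<dots> = X * r" using X0 by (simp only: powr_add powr_half_sqrt less_imp_le) (simp add: r_def)
          also have "\<dots> = r ^ 3" using r by (simp add: power3_eq_cube power2_eq_square)
          finally show ?thesis .
        qed
        have t14: "t powr (1/4) = k powr (1/6) * sqrt r"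
        proof -
          have "t powr (1/4) = L powr (1/4) * X powr (1/4)" using L1 X0 by (simp add: t_def powr_mult)
          also have "L powr (1/4) = k powr (1/6)" by (simp add: L_def powr_powr)
          also have "X powr (1/4) = (X powr (1/2)) powr (1/2)" by (simp add: powr_powr)
          also have "\<dots> = sqrt r" using X0 r by (simp add: powr_half_sqrt r_def)
          finally show ?thesis .
        qed
        have al: "cnj \<alpha> = cis (- (pi / 3))" by (simp add: \<alpha>_def cis_cnj flip: cis_conv_exp)
          (simp add: cis_conv_exp exp_cnj)
        have "1 / airy_osc t = 2 * sqrt pi * cis (pi / 12) * complex_of_real (t powr (1/4)) * cis (2/3 * t powr (3/2))"
          using t by (simp add: airy_osc_def cis_conv_exp exp_minus field_simps)
        then have "cnj \<alpha> * (1 / airy_osc t) = (cis (- (pi / 3)) * cis (pi / 12)) * (complex_of_real (2 * sqrt pi) * complex_of_real (t powr (1/4)) * cis (2/3 * t powr (3/2)))"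
          unfolding al by (simp add: mult_ac)
        also have "cis (- (pi / 3)) * cis (pi / 12) = cis (- (pi / 4))" by (simp add: cis_mult)
        finally show ?thesis unfolding t14 t32 by (simp add: c0_def U_def mult_ac)
      qed
      have T0: "transfer0 k \<Theta> z = c0 * U0 * Ai (complex_of_real s0)"
        by (simp add: transfer0_def c0_def U0_def s0_def \<xi>_def \<eta>_def)
      \<comment> \<open>One term for each of the three approximations.\<close>
      have split: "transfer k \<Theta> z - transfer0 k \<Theta> z
         = cnj \<alpha> * Ai (complex_of_real s) * (1 / ai_alpha t - 1 / airy_osc t)
         + c0 * (U - U0) * Ai (complex_of_real s) + c0 * U0 * (Ai (complex_of_real s) - Ai (complex_of_real s0))"
      proof -
        have "cnj \<alpha> * Ai (complex_of_real s) * (1 / ai_alpha t - 1 / airy_osc t)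
          = transfer k \<Theta> z - (cnj \<alpha> * (1 / airy_osc t)) * Ai (complex_of_real s)"
          unfolding T by (simp add: algebra_simps)
        then show ?thesis unfolding osc T0 by (simp add: algebra_simps)
      qed
      have nc0: "cmod c0 = 2 * sqrt pi * k powr (1/6)" by (simp add: c0_def norm_mult)
      have p2: "(1 + \<bar>z\<bar>)\<^sup>2 \<le> (1 + \<bar>z\<bar>) ^ 6" using z1 by (intro power_increasing) auto
      have kk: "k powr (1/6) * (1 / k) = k powr (-5/6)" using k0 powr_diff[of k "1/6" 1] by simp
      have b1: "cmod (cnj \<alpha> * Ai (complex_of_real s) * (1 / ai_alpha t - 1 / airy_osc t)) \<le> D1 * k powr (-5/6) * (1 + \<bar>z\<bar>) ^ 6"
      proof -
        have "t powr (-5/4) \<le> (L * t0) powr (-5/4)"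
          using L1 t0 Xb by (intro powr_mono2') (auto simp: t_def)
        also have "\<dots> = k powr (-5/6) * t0 powr (-5/4)" using L1 t0 by (simp add: powr_mult L_def powr_powr)
        finally have "C4 * t powr (-5/4) \<le> C4 * (k powr (-5/6) * t0 powr (-5/4))" using C4 by (intro mult_left_mono) auto
        then have "cmod (1 / ai_alpha t - 1 / airy_osc t) \<le> C4 * (k powr (-5/6) * t0 powr (-5/4))" using C4(2)[OF tt0] by linarith
        then have "cmod (cnj \<alpha> * Ai (complex_of_real s) * (1 / ai_alpha t - 1 / airy_osc t)) \<le> 1 * (C2 * (1 + \<bar>z\<bar>)\<^sup>2) * (C4 * (k powr (-5/6) * t0 powr (-5/4)))"
          unfolding norm_mult using Ais C2 by (intro mult_mono mult_nonneg_nonneg) (auto simp: norm_alpha)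
        also have "\<dots> = D1 * k powr (-5/6) * (1 + \<bar>z\<bar>)\<^sup>2" by (simp add: D1_def)
        also have "\<dots> \<le> D1 * k powr (-5/6) * (1 + \<bar>z\<bar>) ^ 6" using D0 p2 by (intro mult_left_mono) auto
        finally show ?thesis .
      qed
      have rxi: "\<bar>r - \<xi>\<bar> \<le> 3 * \<bar>q\<bar> / \<xi>"
      proof -
        have "\<bar>r - \<xi>\<bar> * \<xi> \<le> \<bar>r - \<xi>\<bar> * (r + \<xi>)" using r by (intro mult_left_mono) auto
        also have "\<dots> = \<bar>(r - \<xi>) * (r + \<xi>)\<bar>" using r xi by (simp add: abs_mult)
        also have "(r - \<xi>) * (r + \<xi>) = - (2 * \<eta> * q + q\<^sup>2)" using r X by (simp add: power2_eq_square algebra_simps)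
        also have "\<bar>- (2 * \<eta> * q + q\<^sup>2)\<bar> \<le> 3 * \<bar>q\<bar>" using q3 by simp
        finally show ?thesis using xi by (simp add: pos_le_divide_eq)
      qed
      have UU: "cmod (U - U0) \<le> (3 / (\<xi> * sqrt \<xi>) + 2/3 * (9 / \<xi>\<^sup>2 * 3) + 1) * ((1 + \<bar>z\<bar>)\<^sup>2 * (1 / k))"
      proof -
        let ?a = "2/3 * k * r ^ 3" and ?b = "2/3 * k * \<xi> ^ 3 - 2 * \<xi> * \<eta> * z"
        have "U - U0 = complex_of_real (sqrt r - sqrt \<xi>) * cis ?a + complex_of_real (sqrt \<xi>) * (cis ?a - cis ?b)"
          by (simp add: U_def U0_def algebra_simps)
        then have "cmod (U - U0) \<le> cmod (complex_of_real (sqrt r - sqrt \<xi>) * cis ?a) + cmod (complex_of_real (sqrt \<xi>) * (cis ?a - cis ?b))"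
          by (simp only: norm_triangle_ineq)
        also have "\<dots> \<le> \<bar>sqrt r - sqrt \<xi>\<bar> + 1 * \<bar>?a - ?b\<bar>"
        proof (intro add_mono)
          show "cmod (complex_of_real (sqrt r - sqrt \<xi>) * cis ?a) \<le> \<bar>sqrt r - sqrt \<xi>\<bar>" unfolding norm_mult norm_of_real by simp
          show "cmod (complex_of_real (sqrt \<xi>) * (cis ?a - cis ?b)) \<le> 1 * \<bar>?a - ?b\<bar>"
            unfolding norm_mult norm_of_real using xi cmod_cis_diff by (intro mult_mono) auto
        qed
        also have "\<bar>sqrt r - sqrt \<xi>\<bar> \<le> 3 / (\<xi> * sqrt \<xi>) * \<bar>q\<bar>"
        proof -
          have "\<bar>sqrt r - sqrt \<xi>\<bar> * sqrt \<xi> \<le> \<bar>sqrt r - sqrt \<xi>\<bar> * (sqrt r + sqrt \<xi>)" using r by (intro mult_left_mono) auto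
          also have "\<dots> = \<bar>(sqrt r - sqrt \<xi>) * (sqrt r + sqrt \<xi>)\<bar>" using r xi by (simp add: abs_mult)
          also have "(sqrt r - sqrt \<xi>) * (sqrt r + sqrt \<xi>) = r - \<xi>" using r xi by (simp add: algebra_simps)
          also have "\<bar>r - \<xi>\<bar> \<le> 3 * \<bar>q\<bar> / \<xi>" by (rule rxi)
          finally show ?thesis using xi by (simp add: field_simps)
        qed
        also have "\<bar>?a - ?b\<bar> \<le> (2/3 * (9 / \<xi>\<^sup>2 * 3) + 1) * (k * q\<^sup>2)"
        proof -
          have zk: "z = k * q" using k0 by (simp add: q_def)
          \<comment> \<open>Taylor expansion of X^(3/2) at xi^2, with the remainder in closed form.\<close>
          have "r ^ 3 - \<xi> ^ 3 - 3/2 * \<xi> * (r\<^sup>2 - \<xi>\<^sup>2) = (r - \<xi>)\<^sup>2 * (r + \<xi> / 2)"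
            by (simp add: power2_eq_square power3_eq_cube field_simps)
          moreover have "r\<^sup>2 - \<xi>\<^sup>2 = - (2 * \<eta> * q + q\<^sup>2)" using r X by simp
          ultimately have r3: "r ^ 3 = \<xi> ^ 3 - 3/2 * \<xi> * (2 * \<eta> * q + q\<^sup>2) + (r - \<xi>)\<^sup>2 * (r + \<xi> / 2)" by (simp add: algebra_simps)
          then have "?a - ?b = k * (2/3 * ((r - \<xi>)\<^sup>2 * (r + \<xi> / 2)) - \<xi> * q\<^sup>2)"
            unfolding zk r3 by (simp add: field_simps)
          then have "\<bar>?a - ?b\<bar> = k * \<bar>2/3 * ((r - \<xi>)\<^sup>2 * (r + \<xi> / 2)) - \<xi> * q\<^sup>2\<bar>" using k0 by (simp add: abs_mult)
          also have "\<dots> \<le> k * (2/3 * ((9 / \<xi>\<^sup>2 * q\<^sup>2) * 3) + 1 * q\<^sup>2)"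
          proof (intro mult_left_mono order_trans[OF abs_triangle_ineq4] add_mono)
            have "(r - \<xi>)\<^sup>2 \<le> (3 * \<bar>q\<bar> / \<xi>)\<^sup>2" using rxi by (metis abs_ge_zero power2_abs power_mono)
            also have "\<dots> = 9 / \<xi>\<^sup>2 * q\<^sup>2" by (simp add: power_divide power_mult_distrib)
            finally have "(r - \<xi>)\<^sup>2 * (r + \<xi> / 2) \<le> (9 / \<xi>\<^sup>2 * q\<^sup>2) * 3" using r xi by (intro mult_mono) auto
            then show "\<bar>2/3 * ((r - \<xi>)\<^sup>2 * (r + \<xi> / 2))\<bar> \<le> 2/3 * ((9 / \<xi>\<^sup>2 * q\<^sup>2) * 3)" using r xi by (simp add: abs_mult)
            show "\<bar>\<xi> * q\<^sup>2\<bar> \<le> 1 * q\<^sup>2" unfolding abs_mult using xi by (intro mult_mono) auto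
          qed (use k0 in auto)
          also have "\<dots> = (2/3 * (9 / \<xi>\<^sup>2 * 3) + 1) * (k * q\<^sup>2)" by (simp add: algebra_simps)
          finally show ?thesis .
        qed
        finally have "cmod (U - U0) \<le> 3 / (\<xi> * sqrt \<xi>) * \<bar>q\<bar> + (2/3 * (9 / \<xi>\<^sup>2 * 3) + 1) * (k * q\<^sup>2)" by simp
        also have "\<dots> \<le> 3 / (\<xi> * sqrt \<xi>) * ((1 + \<bar>z\<bar>)\<^sup>2 * (1 / k)) + (2/3 * (9 / \<xi>\<^sup>2 * 3) + 1) * ((1 + \<bar>z\<bar>)\<^sup>2 * (1 / k))"
        proof (intro add_mono mult_left_mono)
          have "\<bar>z\<bar> * (1 / k) \<le> (1 + \<bar>z\<bar>)\<^sup>2 * (1 / k)" using k0 by (intro mult_right_mono) (auto simp: power2_eq_square algebra_simps)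
          then show "\<bar>q\<bar> \<le> (1 + \<bar>z\<bar>)\<^sup>2 * (1 / k)" using k0 by (simp add: q_def)
          have "z\<^sup>2 * (1 / k) \<le> (1 + \<bar>z\<bar>)\<^sup>2 * (1 / k)" using k0 by (intro mult_right_mono) (auto simp: power2_eq_square algebra_simps)
          moreover have "k * q\<^sup>2 = z\<^sup>2 * (1 / k)" using k0 by (simp add: q_def power_divide power2_eq_square)
          ultimately show "k * q\<^sup>2 \<le> (1 + \<bar>z\<bar>)\<^sup>2 * (1 / k)" by simp
        qed (use xi in auto)
        finally show ?thesis by (simp only: distrib_right add.assoc)
      qed
      have b2: "cmod (c0 * (U - U0) * Ai (complex_of_real s)) \<le> D2 * k powr (-5/6) * (1 + \<bar>z\<bar>) ^ 6"
      proof -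
        have "cmod (c0 * (U - U0) * Ai (complex_of_real s)) \<le> 2 * sqrt pi * k powr (1/6) * ((3 / (\<xi> * sqrt \<xi>) + 2/3 * (9 / \<xi>\<^sup>2 * 3) + 1) * ((1 + \<bar>z\<bar>)\<^sup>2 * (1 / k))) * (C2 * (1 + \<bar>z\<bar>)\<^sup>2)"
          unfolding norm_mult nc0 using UU Ais xi k0 by (intro mult_mono mult_nonneg_nonneg add_nonneg_nonneg) auto
        also have "\<dots> = D2 * (k powr (1/6) * (1 / k)) * ((1 + \<bar>z\<bar>)\<^sup>2 * (1 + \<bar>z\<bar>)\<^sup>2)" by (simp add: D2_def)
        also have "(1 + \<bar>z\<bar>)\<^sup>2 * (1 + \<bar>z\<bar>)\<^sup>2 = (1 + \<bar>z\<bar>) ^ 4" by (simp flip: power_add)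
        also have "D2 * (k powr (1/6) * (1 / k)) * (1 + \<bar>z\<bar>) ^ 4 \<le> D2 * (k powr (1/6) * (1 / k)) * (1 + \<bar>z\<bar>) ^ 6"
          using D0 z1 k0 by (intro mult_left_mono power_increasing) auto
        finally show ?thesis by (simp only: kk)
      qed
      have b3: "cmod (c0 * U0 * (Ai (complex_of_real s) - Ai (complex_of_real s0))) \<le> D3 * k powr (-5/6) * (1 + \<bar>z\<bar>) ^ 6"
      proof -
        have "cmod (Ai (complex_of_real s) - Ai (complex_of_real s0)) \<le> C3 * \<bar>hh\<bar> * (1 + \<bar>s0\<bar> + \<bar>hh\<bar>)\<^sup>2"
          unfolding ss0 by (rule C3(2))
        also have "\<dots> \<le> C3 * ((1 + \<bar>z\<bar>)\<^sup>2 * (1 / k)) * ((1 + \<bar>z\<bar>)\<^sup>2)\<^sup>2"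
        proof (intro mult_mono power_mono mult_left_mono sb)
          have "z\<^sup>2 * (1 / k) \<le> (1 + \<bar>z\<bar>)\<^sup>2 * (1 / k)" using k0 by (intro mult_right_mono) (auto simp: power2_eq_square algebra_simps)
          then show "\<bar>hh\<bar> \<le> (1 + \<bar>z\<bar>)\<^sup>2 * (1 / k)" using hb by linarith
        qed (use C3 k0 in auto)
        also have "\<dots> = C3 * (1 / k) * ((1 + \<bar>z\<bar>)\<^sup>2 * ((1 + \<bar>z\<bar>)\<^sup>2)\<^sup>2)" by simp
        also have "(1 + \<bar>z\<bar>)\<^sup>2 * ((1 + \<bar>z\<bar>)\<^sup>2)\<^sup>2 = (1 + \<bar>z\<bar>) ^ 6" by (simp flip: power_mult power_add)
        finally have A: "cmod (Ai (complex_of_real s) - Ai (complex_of_real s0)) \<le> C3 * (1 / k) * (1 + \<bar>z\<bar>) ^ 6" .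
        have "cmod U0 \<le> 1" using xi by (simp add: U0_def norm_mult)
        then have "cmod (c0 * U0 * (Ai (complex_of_real s) - Ai (complex_of_real s0))) \<le> 2 * sqrt pi * k powr (1/6) * 1 * (C3 * (1 / k) * (1 + \<bar>z\<bar>) ^ 6)"
          unfolding norm_mult nc0 using A k0 by (intro mult_mono mult_nonneg_nonneg) auto
        also have "\<dots> = (D3 / 4) * (k powr (1/6) * (1 / k)) * (1 + \<bar>z\<bar>) ^ 6" by (simp add: D3_def)
        also have "\<dots> \<le> D3 * (k powr (1/6) * (1 / k)) * (1 + \<bar>z\<bar>) ^ 6"
          using D0 k0 by (intro mult_right_mono) auto
        finally show ?thesis by (simp only: kk)
      qed
      have "cmod (transfer k \<Theta> z - transfer0 k \<Theta> z) \<le> D1 * k powr (-5/6) * (1 + \<bar>z\<bar>) ^ 6 + D2 * k powr (-5/6) * (1 + \<bar>z\<bar>) ^ 6 + D3 * k powr (-5/6) * (1 + \<bar>z\<bar>) ^ 6"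
        unfolding split by (intro order_trans[OF norm_triangle_ineq] add_mono b1 b2 b3)
      also have "\<dots> = (D1 + D2 + D3) * k powr (-5/6) * (1 + \<bar>z\<bar>) ^ 6" by (simp only: distrib_right)
      also have "\<dots> \<le> (Dfar + D1 + D2 + D3) * k powr (-5/6) * (1 + \<bar>z\<bar>) ^ 6"
        using D0 by (intro mult_right_mono) auto
      finally show ?thesis .
    qed
  qed
qed

section \<open>Comparison on the caustic\<close>

text \<open>
The common factor of both solutions; \<open>2/3 \<xi>\<^sup>3\<close>, the integral of \<open>sqrt (\<xi>\<^sup>2 - x)\<close> over \<open>[0, x\<^sub>c]\<close>, is the phase
that a ray accumulates in the direction of \<open>x\<close> before it touches the caustic.
\<close>
definition beam_prefactor :: "real \<Rightarrow> real \<Rightarrow> real \<Rightarrow> complex" where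
  "beam_prefactor k \<Theta> y = complex_of_real (sqrt (k * \<xi>\<^sub>0 \<Theta> / pi)) * cis (- (pi / 4)) * cis (k * (\<eta>\<^sub>0 \<Theta> * y + 2/3 * \<xi>\<^sub>0 \<Theta> ^ 3))"

text \<open>
Solves \<open>q(\<xi> + \<sigma>) = \<beta> p(\<sigma>)\<close> for the linear coefficient of \<open>p\<close>.
\<close>
definition beam_gamma :: "real \<Rightarrow> complex" where
  "beam_gamma \<Theta> = \<i> / \<beta> \<Theta> - complex_of_real (\<xi>\<^sub>0 \<Theta>)"

lemma beta_nonzero: "\<beta> \<Theta> \<noteq> 0"
  by (simp add: \<beta>_def complex_eq_iff)

lemma beam_phase_instance:
  assumes "0 < \<Theta>" "\<Theta> < pi / 2"
  shows "beam_phase (\<eta>\<^sub>0 \<Theta>) (beam_gamma \<Theta>)"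
proof
  show "\<eta>\<^sub>0 \<Theta> > 0" using assms by (simp add: \<eta>\<^sub>0_def sin_gt_zero2)
  show "Im (beam_gamma \<Theta>) > 0"
    by (simp add: beam_gamma_def \<beta>_def Im_divide add_pos_nonneg)
qed

lemma csqrt_mult_of_real:
  assumes "r > 0"
  shows "csqrt (complex_of_real r * z) = complex_of_real (sqrt r) * csqrt z"
proof (rule csqrt_unique)
  show "(complex_of_real (sqrt r) * csqrt z)\<^sup>2 = complex_of_real r * z"
    using assms by (simp add: power_mult_distrib flip: of_real_power)
  show "0 < Re (complex_of_real (sqrt r) * csqrt z) \<or> Re (complex_of_real (sqrt r) * csqrt z) = 0 \<and> 0 \<le> Im (complex_of_real (sqrt r) * csqrt z)"
    using csqrt_principal[of z] assms by (auto simp: zero_less_mult_iff zero_le_mult_iff simp del: csqrt.sel)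
qed

context
  fixes \<Theta> :: real
  assumes \<Theta>: "0 < \<Theta>" "\<Theta> < pi / 2"
begin

interpretation beam_phase "\<eta>\<^sub>0 \<Theta>" "beam_gamma \<Theta>" by (rule beam_phase_instance[OF \<Theta>])

lemma xi_eta: "0 < \<xi>\<^sub>0 \<Theta>" "\<xi>\<^sub>0 \<Theta> \<le> 1" "0 < \<eta>\<^sub>0 \<Theta>" "(\<eta>\<^sub>0 \<Theta>)\<^sup>2 = 1 - (\<xi>\<^sub>0 \<Theta>)\<^sup>2"
  using \<Theta> by (auto simp: \<xi>\<^sub>0_def \<eta>\<^sub>0_def sin_gt_zero2 cos_gt_zero sin_squared_eq)

lemma q_beam_eq: "q_beam \<Theta> (\<xi>\<^sub>0 \<Theta> + \<sigma>) = \<beta> \<Theta> * p \<sigma>"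
proof -
  have b: "\<beta> \<Theta> * beam_gamma \<Theta> = \<i> - \<beta> \<Theta> * complex_of_real (\<xi>\<^sub>0 \<Theta>)"
    using beta_nonzero[of \<Theta>] by (simp add: beam_gamma_def right_diff_distrib)
  have "\<beta> \<Theta> * p \<sigma> = \<beta> \<Theta> * complex_of_real ((\<eta>\<^sub>0 \<Theta>)\<^sup>2) + 2 * (\<beta> \<Theta> * beam_gamma \<Theta>) * complex_of_real \<sigma> - \<beta> \<Theta> * (complex_of_real \<sigma>)\<^sup>2"
    by (simp add: p_def algebra_simps)
  also have "\<dots> = q_beam \<Theta> (\<xi>\<^sub>0 \<Theta> + \<sigma>)"
    unfolding b xi_eta(4) by (simp add: q_beam_def \<beta>_def power2_eq_square algebra_simps)
  finally show ?thesis by simp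
qed

lemma m11_eq: "m11 \<Theta> (\<xi>\<^sub>0 \<Theta> + \<sigma>) = m \<sigma>"
proof -
  have b: "2 * \<i> = 2 * (\<beta> \<Theta> * beam_gamma \<Theta>) + 2 * \<beta> \<Theta> * complex_of_real (\<xi>\<^sub>0 \<Theta>)"
    using beta_nonzero[of \<Theta>] by (simp add: beam_gamma_def right_diff_distrib)
  have "m11 \<Theta> (\<xi>\<^sub>0 \<Theta> + \<sigma>) = (\<beta> \<Theta> * (2 * beam_gamma \<Theta> - complex_of_real \<sigma>)) / (\<beta> \<Theta> * (2 * p \<sigma>))"
    unfolding m11_def q_beam_eq b by (simp add: algebra_simps)
  also have "\<dots> = (2 * beam_gamma \<Theta> - complex_of_real \<sigma>) / (2 * p \<sigma>)"
    using beta_nonzero[of \<Theta>] by simp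
  also have "\<dots> = m \<sigma>" using p_nonzero[of \<sigma>] by (simp add: m_def u_def v_def field_simps)
  finally show ?thesis .
qed

text \<open>
The square root of \<open>q\<close> was chosen such that its argument \<open>q cnj \<beta> = |\<beta>|\<^sup>2 p\<close> never meets the branch cut; so it becomes the
principal square root of \<open>p\<close>, and \<open>\<beta>\<close> cancels against \<open>m22(0)\<close>.
\<close>
lemma amplitude_eq:
  "amplitude \<Theta> A (\<xi>\<^sub>0 \<Theta> + \<sigma>) z = A z * (complex_of_real (sqrt (\<xi>\<^sub>0 \<Theta> / 2) / \<eta>\<^sub>0 \<Theta>) * cis (- (pi / 4))) * g \<sigma>"
proof -
  let ?b = "\<beta> \<Theta>" and ?x = "\<xi>\<^sub>0 \<Theta>"
  let ?B = "(cmod ?b)\<^sup>2"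
  have B: "?B > 0" using beta_nonzero[of \<Theta>] by simp
  have bb: "?b * cnj ?b = complex_of_real ?B" by (simp only: complex_norm_square)
  have "q_beam \<Theta> (?x + \<sigma>) * cnj ?b = complex_of_real ?B * p \<sigma>"
    unfolding q_beam_eq bb[symmetric] by (simp add: mult_ac)
  then have sq: "sqrt_q \<Theta> (?x + \<sigma>) = complex_of_real (cmod ?b) * csqrt (p \<sigma>) / csqrt (cnj ?b)"
    unfolding sqrt_q_def using csqrt_mult_of_real[OF B, of "p \<sigma>"] by simp
  have m22: "- \<i> * m22_0 \<Theta> * cnj ?b = complex_of_real (?x / 2 * ?B) * (- \<i>)"
  proof -
    have "- \<i> * m22_0 \<Theta> * cnj ?b = complex_of_real (?x / 2) * (?b * cnj ?b) * (- \<i>)" by (simp add: m22_0_def)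
    then show ?thesis by (simp only: bb of_real_mult)
  qed
  have "Re (- \<i> * m22_0 \<Theta>) > 0" "Re (cnj ?b) > 0"
    using xi_eta(1) by (simp_all add: m22_0_def \<beta>_def)
  then have a1: "\<bar>Arg (- \<i> * m22_0 \<Theta>)\<bar> < pi / 2" and a2: "\<bar>Arg (cnj ?b)\<bar> < pi / 2"
    using Arg_Re_pos by blast+
  have "csqrt (- \<i> * m22_0 \<Theta>) * csqrt (cnj ?b) = csqrt (- \<i> * m22_0 \<Theta> * cnj ?b)"
    by (rule csqrt_mult[symmetric]) (use a1 a2 in auto)
  also have "\<dots> = complex_of_real (sqrt (?x / 2 * ?B)) * csqrt (- \<i>)"
    unfolding m22 using xi_eta(1) B by (intro csqrt_mult_of_real) simp
  also have "csqrt (- \<i>) = cis (- (pi / 4))"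
    by (rule csqrt_unique) (auto simp: Complex.DeMoivre complex_eq_iff cos_45 sin_45)
  also have "sqrt (?x / 2 * ?B) = sqrt (?x / 2) * cmod ?b" by (simp only: real_sqrt_mult real_sqrt_abs abs_norm_cancel)
  finally have num: "csqrt (- \<i> * m22_0 \<Theta>) * csqrt (cnj ?b) = complex_of_real (sqrt (?x / 2) * cmod ?b) * cis (- (pi / 4))" .
  have c0: "csqrt (cnj ?b) \<noteq> 0" "csqrt (p \<sigma>) \<noteq> 0" "complex_of_real (cmod ?b) \<noteq> 0" using beta_nonzero[of \<Theta>] p_nonzero[of \<sigma>] by auto
  have "amplitude \<Theta> A (?x + \<sigma>) z = A z * (csqrt (- \<i> * m22_0 \<Theta>) * csqrt (cnj ?b)) / (complex_of_real (cmod ?b) * csqrt (p \<sigma>))"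
    unfolding amplitude_def sq by simp
  also have "\<dots> = A z * (complex_of_real (sqrt (?x / 2)) * cis (- (pi / 4))) / csqrt (p \<sigma>)"
    unfolding num using c0 by simp
  also have "\<dots> = A z * (complex_of_real (sqrt (?x / 2) / \<eta>\<^sub>0 \<Theta>) * cis (- (pi / 4))) * g \<sigma>"
    using xi_eta(3) by (simp add: g_def)
  finally show ?thesis .
qed

definition gb_integral :: "(real \<Rightarrow> complex) \<Rightarrow> real \<Rightarrow> real \<Rightarrow> complex" where
  "gb_integral A k w = (LINT x|lborel. A (w - 2 * \<eta>\<^sub>0 \<Theta> * x) * (g x * exp (\<i> * complex_of_real k * (complex_of_real (- (x ^ 3 / 3)) + P x))))"

definition airy_integral :: "(real \<Rightarrow> complex) \<Rightarrow> real \<Rightarrow> real \<Rightarrow> complex" where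
  "airy_integral A k w = (LINT x|lborel. A (w - 2 * \<eta>\<^sub>0 \<Theta> * x) * exp (\<i> * complex_of_real k * complex_of_real (- (x ^ 3 / 3))))"

text \<open>
The substitution \<open>z = w - 2 \<eta> \<sigma>\<close> in a single beam, that is \<open>s = \<xi> + \<sigma>\<close>. The real phase collapses to
\<open>\<eta> y + 2/3 \<xi>\<^sup>3 - \<sigma>\<^sup>3 / 3\<close> because \<open>\<xi>\<^sup>2 + \<eta>\<^sup>2 = 1\<close>.
\<close>
lemma v_beam_eq:
  fixes y \<sigma> :: real
  defines "w \<equiv> y - 2 * \<eta>\<^sub>0 \<Theta> * \<xi>\<^sub>0 \<Theta>"
  shows "v_beam k \<Theta> A (x_c \<Theta>) y (w - 2 * \<eta>\<^sub>0 \<Theta> * \<sigma>)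
    = (complex_of_real (sqrt (\<xi>\<^sub>0 \<Theta> / 2) / \<eta>\<^sub>0 \<Theta>) * cis (- (pi / 4)) * cis (k * (\<eta>\<^sub>0 \<Theta> * y + 2/3 * \<xi>\<^sub>0 \<Theta> ^ 3)))
      * (A (w - 2 * \<eta>\<^sub>0 \<Theta> * \<sigma>) * (g \<sigma> * exp (\<i> * complex_of_real k * (complex_of_real (- (\<sigma> ^ 3 / 3)) + P \<sigma>))))"
proof -
  let ?e = "\<eta>\<^sub>0 \<Theta>" and ?x = "\<xi>\<^sub>0 \<Theta>"
  let ?z = "w - 2 * ?e * \<sigma>"
  have s: "(y - ?z) / (2 * ?e) = ?x + \<sigma>" using xi_eta(3) by (simp add: w_def field_simps)
  have d: "x_c \<Theta> - x_ray \<Theta> (?x + \<sigma>) = \<sigma>\<^sup>2" by (simp add: x_c_def x_ray_def power2_eq_square algebra_simps)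
  have xr: "\<xi>_ray \<Theta> (?x + \<sigma>) = - \<sigma>" by (simp add: \<xi>_ray_def)
  have ph: "S_phase \<Theta> (?x + \<sigma>) ?z + \<sigma>\<^sup>2 * (- \<sigma>) = (?e * y + 2/3 * ?x ^ 3) + - (\<sigma> ^ 3 / 3)"
  proof -
    have "S_phase \<Theta> (?x + \<sigma>) ?z + \<sigma>\<^sup>2 * (- \<sigma>) = ?e * y - 2 * ?e\<^sup>2 * (?x + \<sigma>) + 2 * (?x + \<sigma>) - 2 * (?x + \<sigma>)\<^sup>2 * ?x + 2 / 3 * (?x + \<sigma>) ^ 3 - \<sigma> ^ 3"
      by (simp add: S_phase_def w_def power2_eq_square power3_eq_cube algebra_simps)
    also have "\<dots> = (?e * y + 2/3 * ?x ^ 3) + - (\<sigma> ^ 3 / 3)"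
      unfolding xi_eta(4) by (simp add: power2_eq_square power3_eq_cube field_simps)
    finally show ?thesis .
  qed
  have P4: "1 / 2 * m11 \<Theta> (?x + \<sigma>) * (complex_of_real (\<sigma>\<^sup>2))\<^sup>2 = P \<sigma>"
    unfolding m11_eq by (simp add: P_def flip: power_mult)
  have "complex_of_real (S_phase \<Theta> (?x + \<sigma>) ?z) + complex_of_real (\<sigma>\<^sup>2 * (- \<sigma>)) + 1 / 2 * m11 \<Theta> (?x + \<sigma>) * (complex_of_real (\<sigma>\<^sup>2))\<^sup>2
     = complex_of_real (?e * y + 2/3 * ?x ^ 3) + (complex_of_real (- (\<sigma> ^ 3 / 3)) + P \<sigma>)"
    unfolding P4 using arg_cong[OF ph, of complex_of_real] by (simp only: of_real_add add.assoc)
  then have ex: "\<i> * complex_of_real k * (complex_of_real (S_phase \<Theta> (?x + \<sigma>) ?z) + complex_of_real (\<sigma>\<^sup>2 * (- \<sigma>)) + 1 / 2 * m11 \<Theta> (?x + \<sigma>) * (complex_of_real (\<sigma>\<^sup>2))\<^sup>2)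
     = \<i> * complex_of_real (k * (?e * y + 2/3 * ?x ^ 3)) + \<i> * complex_of_real k * (complex_of_real (- (\<sigma> ^ 3 / 3)) + P \<sigma>)"
    by (simp only: of_real_mult[of k] distrib_left[of "\<i> * complex_of_real k"] mult.assoc[symmetric])
  have "v_beam k \<Theta> A (x_c \<Theta>) y ?z = amplitude \<Theta> A (?x + \<sigma>) ?z *
     exp (\<i> * complex_of_real k * (complex_of_real (S_phase \<Theta> (?x + \<sigma>) ?z) + complex_of_real (\<sigma>\<^sup>2 * (- \<sigma>)) + 1 / 2 * m11 \<Theta> (?x + \<sigma>) * (complex_of_real (\<sigma>\<^sup>2))\<^sup>2))"
    unfolding v_beam_def Let_def s d xr by simp
  also have "\<dots> = amplitude \<Theta> A (?x + \<sigma>) ?z * (cis (k * (?e * y + 2/3 * ?x ^ 3)) * exp (\<i> * complex_of_real k * (complex_of_real (- (\<sigma> ^ 3 / 3)) + P \<sigma>)))"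
    unfolding ex exp_add cis_conv_exp ..
  finally show ?thesis unfolding amplitude_eq by (simp only: mult_ac)
qed

lemma u_GB_eq:
  assumes k: "k > 0"
  shows "u_GB k \<Theta> A (x_c \<Theta>) y = beam_prefactor k \<Theta> y * gb_integral A k (y - 2 * \<eta>\<^sub>0 \<Theta> * \<xi>\<^sub>0 \<Theta>)"
proof -
  let ?e = "\<eta>\<^sub>0 \<Theta>" and ?x = "\<xi>\<^sub>0 \<Theta>"
  let ?w = "y - 2 * ?e * ?x"
  let ?c = "complex_of_real (sqrt (?x / 2) / ?e) * cis (- (pi / 4)) * cis (k * (?e * y + 2/3 * ?x ^ 3))"
  have "(LINT z|lborel. v_beam k \<Theta> A (x_c \<Theta>) y z) = \<bar>- 2 * ?e\<bar> *\<^sub>R (LINT \<sigma>|lborel. v_beam k \<Theta> A (x_c \<Theta>) y (?w + (- 2 * ?e) * \<sigma>))"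
    by (rule lborel_integral_real_affine) (use xi_eta(3) in auto)
  also have "(\<lambda>\<sigma>. v_beam k \<Theta> A (x_c \<Theta>) y (?w + (- 2 * ?e) * \<sigma>)) = (\<lambda>\<sigma>. ?c * (A (?w - 2 * ?e * \<sigma>) * (g \<sigma> * exp (\<i> * complex_of_real k * (complex_of_real (- (\<sigma> ^ 3 / 3)) + P \<sigma>)))))"
  proof
    fix \<sigma>
    have "?w + (- 2 * ?e) * \<sigma> = ?w - 2 * ?e * \<sigma>" by simp
    then show "v_beam k \<Theta> A (x_c \<Theta>) y (?w + (- 2 * ?e) * \<sigma>) = ?c * (A (?w - 2 * ?e * \<sigma>) * (g \<sigma> * exp (\<i> * complex_of_real k * (complex_of_real (- (\<sigma> ^ 3 / 3)) + P \<sigma>))))"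
      by (simp only: v_beam_eq)
  qed
  finally have "(LINT z|lborel. v_beam k \<Theta> A (x_c \<Theta>) y z) = complex_of_real (2 * ?e) * (?c * gb_integral A k ?w)"
    unfolding gb_integral_def integral_mult_right_zero using xi_eta(3) by (simp add: scaleR_conv_of_real)
  then have "u_GB k \<Theta> A (x_c \<Theta>) y = complex_of_real (sqrt (k / (2 * pi)) * (2 * ?e) * (sqrt (?x / 2) / ?e)) * (cis (- (pi / 4)) * cis (k * (?e * y + 2/3 * ?x ^ 3))) * gb_integral A k ?w"
    unfolding u_GB_def by (simp only: of_real_mult mult_ac)
  also have "sqrt (k / (2 * pi)) * (2 * ?e) * (sqrt (?x / 2) / ?e) = sqrt (k * ?x / pi)"
  proof -
    have "sqrt (k / (2 * pi)) * (2 * ?e) * (sqrt (?x / 2) / ?e) = 2 * (sqrt (k / (2 * pi)) * sqrt (?x / 2))" using xi_eta(3) by simp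
    also have "sqrt (k / (2 * pi)) * sqrt (?x / 2) = sqrt (k * ?x / pi / 2\<^sup>2)" by (simp flip: real_sqrt_mult)
    also have "\<dots> = sqrt (k * ?x / pi) / 2" by (simp only: real_sqrt_divide real_sqrt_abs abs_numeral)
    finally show ?thesis by simp
  qed
  finally show ?thesis by (simp only: beam_prefactor_def mult_ac)
qed

lemma kfourier_eq: "kfourier k A (z / k) = complex_of_real (sqrt (k / (2 * pi))) * fourier A z" if "k > 0"
proof -
  have "- \<i> * complex_of_real k * complex_of_real x * complex_of_real (z / k) = \<i> * complex_of_real (- (x * z))" for x
    using that by simp
  then show ?thesis unfolding kfourier_def fourier_def by simp
qed

lemma u_exact_eq:
  assumes k: "k > 0"
  shows "u_exact k \<Theta> A (x_c \<Theta>) y = 1 / (2 * pi) * (cis (k * \<eta>\<^sub>0 \<Theta> * y) * (LINT z|lborel. transfer k \<Theta> z * fourier A z * iexp (y * z)))"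
proof -
  let ?e = "\<eta>\<^sub>0 \<Theta>"
  let ?r = "complex_of_real (sqrt (k / (2 * pi)))"
  have "(LINT \<zeta>|lborel. u_hat k \<Theta> A (x_c \<Theta>) \<zeta> * exp (\<i> * k * y * \<zeta>))
     = \<bar>1 / k\<bar> *\<^sub>R (LINT z|lborel. u_hat k \<Theta> A (x_c \<Theta>) (?e + 1 / k * z) * exp (\<i> * k * y * complex_of_real (?e + 1 / k * z)))"
    by (rule lborel_integral_real_affine) (use k in auto)
  also have "(\<lambda>z. u_hat k \<Theta> A (x_c \<Theta>) (?e + 1 / k * z) * exp (\<i> * k * y * complex_of_real (?e + 1 / k * z)))
     = (\<lambda>z. (?r * cis (k * ?e * y)) * (transfer k \<Theta> z * fourier A z * iexp (y * z)))"
  proof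
    fix z
    have a: "\<i> * k * y * complex_of_real (?e + 1 / k * z) = \<i> * complex_of_real (k * ?e * y) + \<i> * complex_of_real (y * z)"
      using k by (simp add: distrib_left mult_ac)
    have b: "u_hat k \<Theta> A (x_c \<Theta>) (?e + 1 / k * z) = transfer k \<Theta> z * (?r * fourier A z)"
      using kfourier_eq[OF k, of A z] by (simp add: u_hat_def u_hat_shifted_def transfer_def)
    show "u_hat k \<Theta> A (x_c \<Theta>) (?e + 1 / k * z) * exp (\<i> * k * y * complex_of_real (?e + 1 / k * z))
      = (?r * cis (k * ?e * y)) * (transfer k \<Theta> z * fourier A z * iexp (y * z))"
      unfolding a b exp_add cis_conv_exp by (simp only: mult_ac)
  qed
  finally have "u_exact k \<Theta> A (x_c \<Theta>) y = ?r * (complex_of_real (1 / k) * ((?r * cis (k * ?e * y)) * (LINT z|lborel. transfer k \<Theta> z * fourier A z * iexp (y * z))))"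
    unfolding u_exact_def kfourier_inv_def integral_mult_right_zero using k by (simp add: scaleR_conv_of_real)
  also have "\<dots> = (?r * ?r * complex_of_real (1 / k)) * (cis (k * ?e * y) * (LINT z|lborel. transfer k \<Theta> z * fourier A z * iexp (y * z)))"
    by (simp only: mult_ac)
  also have "?r * ?r * complex_of_real (1 / k) = 1 / (2 * pi)"
  proof -
    have "sqrt (k / (2 * pi)) * sqrt (k / (2 * pi)) * (1 / k) = 1 / (2 * pi)" using k by simp
    then show ?thesis by (metis of_real_mult)
  qed
  finally show ?thesis .
qed

text \<open>
The approximate transfer function produces exactly the common main term: this is \<open>fourier_times_airy\<close> and the rescaling
\<open>v = k^(1/3) x\<close>.
\<close>
lemma airy_integral_transfer0:
  assumes A: "schwartz A" and k: "k > 0"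
  shows "1 / (2 * pi) * (cis (k * \<eta>\<^sub>0 \<Theta> * y) * (LINT z|lborel. transfer0 k \<Theta> z * fourier A z * iexp (y * z)))
     = beam_prefactor k \<Theta> y * airy_integral A k (y - 2 * \<eta>\<^sub>0 \<Theta> * \<xi>\<^sub>0 \<Theta>)"
proof -
  let ?e = "\<eta>\<^sub>0 \<Theta>" and ?x = "\<xi>\<^sub>0 \<Theta>"
  let ?w = "y - 2 * ?e * ?x"
  let ?c = "2 * ?e * k powr (-1/3)"
  let ?p = "cis (- (pi / 4)) * (complex_of_real (2 * sqrt pi * k powr (1/6)) * complex_of_real (sqrt ?x))"
  let ?d = "?p * cis (2/3 * k * ?x ^ 3)"
  have c: "?c \<noteq> 0" using xi_eta(3) k by simp
  have "(\<lambda>z. transfer0 k \<Theta> z * fourier A z * iexp (y * z)) = (\<lambda>z. ?d * (fourier A z * iexp (?w * z) * Ai (complex_of_real (?c * z))))"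
  proof
    fix z
    have "cis (2/3 * k * ?x ^ 3 - 2 * ?x * ?e * z) * iexp (y * z) = cis (2/3 * k * ?x ^ 3) * iexp (?w * z)"
      unfolding cis_conv_exp[symmetric] cis_mult by (simp add: algebra_simps)
    note e = arg_cong[OF this, of "\<lambda>t. t * (?p * (fourier A z * Ai (complex_of_real (?c * z))))"]
    show "transfer0 k \<Theta> z * fourier A z * iexp (y * z) = ?d * (fourier A z * iexp (?w * z) * Ai (complex_of_real (?c * z)))"
      unfolding transfer0_def using e by (simp only: mult_ac)
  qed
  then have "(LINT z|lborel. transfer0 k \<Theta> z * fourier A z * iexp (y * z)) = ?d * (LINT z|lborel. fourier A z * iexp (?w * z) * Ai (complex_of_real (?c * z)))"
    by (simp only: integral_mult_right_zero)
  also have "(LINT z|lborel. fourier A z * iexp (?w * z) * Ai (complex_of_real (?c * z))) = (LINT v|lborel. iexp (- (v ^ 3 / 3)) * A (?w - ?c * v))"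
    by (rule fourier_times_airy[OF A c])
  also have "\<dots> = \<bar>k powr (1/3)\<bar> *\<^sub>R (LINT x|lborel. iexp (- ((0 + k powr (1/3) * x) ^ 3 / 3)) * A (?w - ?c * (0 + k powr (1/3) * x)))"
    by (rule lborel_integral_real_affine) (use k in auto)
  also have "(\<lambda>x. iexp (- ((0 + k powr (1/3) * x) ^ 3 / 3)) * A (?w - ?c * (0 + k powr (1/3) * x)))
     = (\<lambda>x. A (?w - 2 * ?e * x) * exp (\<i> * complex_of_real k * complex_of_real (- (x ^ 3 / 3))))"
  proof
    fix x
    have k3: "(k powr (1/3)) ^ 3 = k" using k by (simp add: powr_powr flip: powr_numeral)
    have "(0 + k powr (1/3) * x) ^ 3 / 3 = k * (x ^ 3 / 3)" by (simp add: power_mult_distrib k3)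
    moreover have "?c * (0 + k powr (1/3) * x) = 2 * ?e * x * (k powr (-1/3) * k powr (1/3))" by simp
    moreover have "k powr (-1/3) * k powr (1/3) = 1" using k by (simp flip: powr_add)
    ultimately show "iexp (- ((0 + k powr (1/3) * x) ^ 3 / 3)) * A (?w - ?c * (0 + k powr (1/3) * x))
      = A (?w - 2 * ?e * x) * exp (\<i> * complex_of_real k * complex_of_real (- (x ^ 3 / 3)))"
      by (simp add: mult_ac)
  qed
  finally have I: "(LINT z|lborel. transfer0 k \<Theta> z * fourier A z * iexp (y * z)) = ?d * (complex_of_real (k powr (1/3)) * airy_integral A k ?w)"
    unfolding airy_integral_def by (simp add: scaleR_conv_of_real)
  have r: "1 / (2 * pi) * (2 * sqrt pi * k powr (1/6) * sqrt ?x) * k powr (1/3) = sqrt (k * ?x / pi)"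
  proof -
    have "k powr (1/6) * k powr (1/3) = k powr (1/2)" by (simp flip: powr_add)
    then have kk: "k powr (1/6) * k powr (1/3) = sqrt k" using k by (simp add: powr_half_sqrt)
    have "1 / (2 * pi) * (2 * sqrt pi * k powr (1/6) * sqrt ?x) * k powr (1/3) = (k powr (1/6) * k powr (1/3)) * sqrt ?x * (sqrt pi / pi)" by simp
    also have "sqrt pi / pi = 1 / sqrt pi" by (simp add: field_simps)
    finally show ?thesis unfolding kk by (simp add: real_sqrt_mult real_sqrt_divide)
  qed
  have "1 / (2 * pi) * (cis (k * ?e * y) * (LINT z|lborel. transfer0 k \<Theta> z * fourier A z * iexp (y * z)))
    = complex_of_real (1 / (2 * pi) * (2 * sqrt pi * k powr (1/6) * sqrt ?x) * k powr (1/3)) * cis (- (pi / 4)) * (cis (k * ?e * y) * cis (2/3 * k * ?x ^ 3)) * airy_integral A k ?w"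
    unfolding I by (simp only: of_real_mult mult_ac of_real_divide of_real_1)
  also have "cis (k * ?e * y) * cis (2/3 * k * ?x ^ 3) = cis (k * (?e * y + 2/3 * ?x ^ 3))"
    unfolding cis_mult by (simp add: algebra_simps)
  finally show ?thesis unfolding r beam_prefactor_def .
qed

lemma norm_beam_prefactor: "k > 0 \<Longrightarrow> cmod (beam_prefactor k \<Theta> y) \<le> sqrt k"
proof -
  assume k: "k > 0"
  have "k * \<xi>\<^sub>0 \<Theta> / pi \<le> k"
    using xi_eta(1,2) k pi_gt3 mult_left_mono[of "\<xi>\<^sub>0 \<Theta>" pi k] by (simp add: divide_le_eq)
  then have "sqrt (k * \<xi>\<^sub>0 \<Theta> / pi) \<le> sqrt k" by simp
  then show ?thesis using xi_eta(1) k by (simp add: beam_prefactor_def norm_mult)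
qed

lemma measurable_Ai_real [measurable]: "(\<lambda>s. Ai (complex_of_real s)) \<in> borel_measurable borel"
  by (rule borel_measurable_continuous_onI[OF continuous_on_Ai_real])

lemma measurable_ai_alpha [measurable]: "ai_alpha \<in> borel_measurable borel"
  by (rule borel_measurable_continuous_onI[OF continuous_on_ai_alpha])

lemma measurable_transfer [measurable]: "transfer k \<Theta> \<in> borel_measurable borel" "transfer0 k \<Theta> \<in> borel_measurable borel"
proof -
  have [measurable]: "(\<lambda>z. X_turn \<Theta> (z / k)) \<in> borel_measurable borel" unfolding X_turn_def by measurable
  show "transfer k \<Theta> \<in> borel_measurable borel"
    unfolding transfer_def[abs_def] by measurable
  have [measurable]: "cis \<in> borel_measurable borel" by (intro borel_measurable_continuous_onI continuous_intros)
  show "transfer0 k \<Theta> \<in> borel_measurable borel"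
    unfolding transfer0_def[abs_def] by measurable
qed

text \<open>
The essential supremum of a non-measurable function is infinite, so a pointwise bound alone does not suffice.
\<close>
lemma measurable_difference:
  assumes A: "schwartz A" and k: "k > 0"
  shows "(\<lambda>y. u_GB k \<Theta> A (x_c \<Theta>) y - u_exact k \<Theta> A (x_c \<Theta>) y) \<in> borel_measurable borel"
proof -
  have [measurable]: "A \<in> borel_measurable borel" using borel_measurable_schwartz[OF A, of 0] by simp
  have [measurable]: "fourier A \<in> borel_measurable borel" by (rule borel_measurable_fourier) measurable
  have sm: "r \<in> borel_measurable borel" if "\<And>n. symbol n flat {0::nat} (\<lambda>i x. r x)" for r
    using symbol_measurable[of 0 flat "{0::nat}" "\<lambda>i x. r x" 0] that by simp
  have [measurable]: "g \<in> borel_measurable borel" by (rule sm, rule symbol_g)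
  have [measurable]: "m \<in> borel_measurable borel" by (rule sm, rule symbol_m)
  have [measurable]: "P \<in> borel_measurable borel" unfolding P_def[abs_def] by measurable
  have [measurable]: "cis \<in> borel_measurable borel" by (intro borel_measurable_continuous_onI continuous_intros)
  have [measurable]: "(\<lambda>w. gb_integral A k w) \<in> borel_measurable borel"
    unfolding gb_integral_def by (rule lborel.borel_measurable_lebesgue_integral) measurable
  have 1: "(\<lambda>y. LINT z|lborel. transfer k \<Theta> z * fourier A z * iexp (y * z)) \<in> borel_measurable borel"
    by (rule lborel.borel_measurable_lebesgue_integral) measurable
  note [measurable] = 1
  show ?thesis unfolding u_GB_eq[OF k] u_exact_eq[OF k] beam_prefactor_def by measurable
qed

text \<open>
Both solutions are bounded uniformly in \<open>k \<le> 1\<close>, while \<open>k^(-5/6) \<ge> 1\<close>.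
\<close>
lemma small_k_bound:
  assumes A: "schwartz A"
  shows "\<exists>C\<ge>0. \<forall>k>0. k \<le> 1 \<longrightarrow> (\<forall>y. cmod (u_GB k \<Theta> A (x_c \<Theta>) y - u_exact k \<Theta> A (x_c \<Theta>) y) \<le> C * k powr (-5/6))"
proof -
  let ?e = "\<eta>\<^sub>0 \<Theta>"
  obtain C1 where C1: "C1 \<ge> 0" "\<And>k z. k > 0 \<Longrightarrow> cmod (transfer k \<Theta> z) \<le> C1 * (1 + k powr (2/3))\<^sup>2"
    using transfer_global_bound[OF \<Theta>] by blast
  obtain Mg where Mg: "Mg \<ge> 0" "\<And>x. cmod (g x) \<le> Mg" using symbol_bounded[OF symbol_g[of 0 "{0::nat}"]] by auto
  have iA: "integrable lborel A" using schwartz_integrable[OF A, of 0] by simp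
  have iF: "integrable lborel (fourier A)" by (rule integrable_fourier[OF A])
  define a where "a = 1 / (2 * ?e) * (LINT x|lborel. cmod (A x))"
  define f where "f = (LINT x|lborel. cmod (fourier A x))"
  have af: "a \<ge> 0" "f \<ge> 0" using xi_eta(3) by (auto simp: a_def f_def intro!: mult_nonneg_nonneg integral_nonneg_AE)
  show ?thesis
  proof (intro exI[of _ "Mg * a + 4 * C1 * f"] conjI allI impI)
    show "0 \<le> Mg * a + 4 * C1 * f" using Mg C1 af by simp
    fix k y :: real assume k: "k > 0" "k \<le> 1"
    let ?w = "y - 2 * ?e * \<xi>\<^sub>0 \<Theta>"
    have shift: "(LINT x|lborel. cmod (A (?w - 2 * ?e * x))) = a"
    proof -
      have "(LINT x|lborel. cmod (A x)) = \<bar>- 2 * ?e\<bar> *\<^sub>R (LINT x|lborel. cmod (A (?w + (- 2 * ?e) * x)))"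
        by (rule lborel_integral_real_affine) (use xi_eta(3) in auto)
      then show ?thesis using xi_eta(3) by (simp add: a_def)
    qed
    have iA': "integrable lborel (\<lambda>x. cmod (A (?w - 2 * ?e * x)))"
      using integrable_norm[OF lborel_integrable_real_affine[OF iA, of "- 2 * ?e" ?w]] xi_eta(3) by simp
    have "cmod (gb_integral A k ?w) \<le> (LINT x|lborel. cmod (A (?w - 2 * ?e * x) * (g x * exp (\<i> * complex_of_real k * (complex_of_real (- (x ^ 3 / 3)) + P x)))))"
      unfolding gb_integral_def by (rule integral_norm_bound)
    also have "\<dots> \<le> (LINT x|lborel. Mg * cmod (A (?w - 2 * ?e * x)))"
    proof (rule integral_mono_AE')
      show "integrable lborel (\<lambda>x. Mg * cmod (A (?w - 2 * ?e * x)))" using iA' by (rule integrable_mult_right)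
      show "AE x in lborel. cmod (A (?w - 2 * ?e * x) * (g x * exp (\<i> * complex_of_real k * (complex_of_real (- (x ^ 3 / 3)) + P x)))) \<le> Mg * cmod (A (?w - 2 * ?e * x))"
      proof (rule AE_I2)
        fix x
        have "cmod (exp (\<i> * complex_of_real k * (complex_of_real (- (x ^ 3 / 3)) + P x))) \<le> 1"
          using k Im_P_nonneg[of x] by simp
        then have "cmod (A (?w - 2 * ?e * x)) * (cmod (g x) * cmod (exp (\<i> * complex_of_real k * (complex_of_real (- (x ^ 3 / 3)) + P x)))) \<le> cmod (A (?w - 2 * ?e * x)) * (Mg * 1)"
          using Mg by (intro mult_left_mono mult_mono) auto
        then show "cmod (A (?w - 2 * ?e * x) * (g x * exp (\<i> * complex_of_real k * (complex_of_real (- (x ^ 3 / 3)) + P x)))) \<le> Mg * cmod (A (?w - 2 * ?e * x))"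
          by (simp only: norm_mult mult_1_right mult.commute)
      qed
      show "AE x in lborel. 0 \<le> Mg * cmod (A (?w - 2 * ?e * x))" using Mg by simp
    qed
    also have "\<dots> = Mg * a" by (simp only: integral_mult_right_zero shift)
    finally have g1: "cmod (gb_integral A k ?w) \<le> Mg * a" .
    have "sqrt k \<le> 1" using k by simp
    then have "cmod (beam_prefactor k \<Theta> y) \<le> 1" using norm_beam_prefactor[OF k(1), of y] by linarith
    then have GB: "cmod (u_GB k \<Theta> A (x_c \<Theta>) y) \<le> Mg * a"
      unfolding u_GB_eq[OF k(1)] norm_mult using g1 mult_mono[of "cmod (beam_prefactor k \<Theta> y)" 1 "cmod (gb_integral A k ?w)" "Mg * a"] by simp
    have "k powr (2/3) \<le> 1" using k powr_mono2[of "2/3" k 1] by simp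
    then have "(1 + k powr (2/3))\<^sup>2 \<le> 2\<^sup>2" by (intro power_mono) auto
    then have "C1 * (1 + k powr (2/3))\<^sup>2 \<le> C1 * 2\<^sup>2" using C1(1) by (intro mult_left_mono) auto
    then have T: "cmod (transfer k \<Theta> z) \<le> 4 * C1" for z using C1(2)[OF k(1), of z] by simp
    have "cmod (LINT z|lborel. transfer k \<Theta> z * fourier A z * iexp (y * z)) \<le> (LINT z|lborel. cmod (transfer k \<Theta> z * fourier A z * iexp (y * z)))"
      by (rule integral_norm_bound)
    also have "\<dots> \<le> (LINT z|lborel. 4 * C1 * cmod (fourier A z))"
    proof (rule integral_mono_AE')
      show "integrable lborel (\<lambda>z. 4 * C1 * cmod (fourier A z))" using iF by (intro integrable_mult_right integrable_norm)
      show "AE z in lborel. cmod (transfer k \<Theta> z * fourier A z * iexp (y * z)) \<le> 4 * C1 * cmod (fourier A z)"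
        by (rule AE_I2) (use T in \<open>simp add: norm_mult mult_right_mono\<close>)
      show "AE z in lborel. 0 \<le> 4 * C1 * cmod (fourier A z)" using C1 by simp
    qed
    also have "\<dots> = 4 * C1 * f" by (simp only: integral_mult_right_zero f_def)
    finally have I: "cmod (LINT z|lborel. transfer k \<Theta> z * fourier A z * iexp (y * z)) \<le> 4 * C1 * f" .
    have "1 / (2 * pi) \<le> 1" using pi_gt3 by simp
    then have ex: "cmod (u_exact k \<Theta> A (x_c \<Theta>) y) \<le> 4 * C1 * f"
      unfolding u_exact_eq[OF k(1)] using I mult_mono[of "1 / (2 * pi)" 1 "cmod (LINT z|lborel. transfer k \<Theta> z * fourier A z * iexp (y * z))" "4 * C1 * f"]
      by (simp add: norm_mult norm_divide)
    have "1 \<le> k powr (-5/6)" using k by (simp add: powr_minus_divide powr_le1)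
    then have "(Mg * a + 4 * C1 * f) * 1 \<le> (Mg * a + 4 * C1 * f) * k powr (-5/6)" using Mg C1 af by (intro mult_left_mono) auto
    moreover have "cmod (u_GB k \<Theta> A (x_c \<Theta>) y - u_exact k \<Theta> A (x_c \<Theta>) y) \<le> (Mg * a + 4 * C1 * f) * 1"
      using order_trans[OF norm_triangle_ineq4 add_mono[OF GB ex]] by (simp only: mult_1_right)
    ultimately show "cmod (u_GB k \<Theta> A (x_c \<Theta>) y - u_exact k \<Theta> A (x_c \<Theta>) y) \<le> (Mg * a + 4 * C1 * f) * k powr (-5/6)"
      by (rule order_trans[rotated])
  qed
qed

text \<open>
The beams differ from the main term by \<open>k^(1/2) k^(-4/3)\<close>, the exact solution by \<open>k^(1/6) k^(-1)\<close>.
\<close>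
lemma large_k_bound:
  assumes A: "schwartz A"
  shows "\<exists>C\<ge>0. \<forall>k\<ge>1. \<forall>y. cmod (u_GB k \<Theta> A (x_c \<Theta>) y - u_exact k \<Theta> A (x_c \<Theta>) y) \<le> C * k powr (-5/6)"
proof -
  let ?e = "\<eta>\<^sub>0 \<Theta>"
  obtain C1 where C1: "C1 \<ge> 0" "\<And>k z. k \<ge> 1 \<Longrightarrow> cmod (transfer k \<Theta> z - transfer0 k \<Theta> z) \<le> C1 * k powr (-5/6) * (1 + \<bar>z\<bar>) ^ 6"
    using transfer_asymptotics[OF \<Theta>] by blast
  obtain C2 where C2: "C2 \<ge> 0" "\<And>k w. k \<ge> 1 \<Longrightarrow> cmod (gb_integral A k w - airy_integral A k w) \<le> C2 * k powr (-4/3)"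
    using gaussian_beam_integral_bound[OF A] unfolding gb_integral_def airy_integral_def by blast
  obtain C3 where C3: "C3 \<ge> 0" "\<And>k z. k > 0 \<Longrightarrow> cmod (transfer k \<Theta> z) \<le> C3 * (1 + k powr (2/3))\<^sup>2"
    using transfer_global_bound[OF \<Theta>] by blast
  have iF: "integrable lborel (fourier A)" by (rule integrable_fourier[OF A])
  have iFw: "integrable lborel (\<lambda>z. (1 + \<bar>z\<bar>) ^ 6 * cmod (fourier A z))" by (rule integrable_fourier_weighted[OF A])
  have [measurable]: "fourier A \<in> borel_measurable borel" using iF by auto
  define f where "f = (LINT z|lborel. (1 + \<bar>z\<bar>) ^ 6 * cmod (fourier A z))"
  have f: "f \<ge> 0" unfolding f_def by (rule integral_nonneg_AE) simp
  show ?thesis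
  proof (intro exI[of _ "C2 + C1 * f"] conjI allI impI)
    show "0 \<le> C2 + C1 * f" using C1 C2 f by simp
    fix k y :: real assume k: "k \<ge> 1"
    then have k0: "k > 0" by simp
    let ?w = "y - 2 * ?e * \<xi>\<^sub>0 \<Theta>"
    let ?T = "\<lambda>z. transfer k \<Theta> z * fourier A z * iexp (y * z)" and ?R = "\<lambda>z. transfer0 k \<Theta> z * fourier A z * iexp (y * z)"
    have b: "cmod (?T z - ?R z) \<le> C1 * k powr (-5/6) * ((1 + \<bar>z\<bar>) ^ 6 * cmod (fourier A z))" for z
    proof -
      have "?T z - ?R z = (transfer k \<Theta> z - transfer0 k \<Theta> z) * fourier A z * iexp (y * z)" by (simp add: algebra_simps)
      then have "cmod (?T z - ?R z) = cmod (transfer k \<Theta> z - transfer0 k \<Theta> z) * cmod (fourier A z)" by (simp only: norm_mult norm_exp_i_times mult_1_right)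
      also have "\<dots> \<le> (C1 * k powr (-5/6) * (1 + \<bar>z\<bar>) ^ 6) * cmod (fourier A z)" by (intro mult_right_mono C1(2)[OF k]) auto
      finally show ?thesis by (simp only: mult.assoc)
    qed
    have iD: "integrable lborel (\<lambda>z. ?T z - ?R z)"
      by (rule integrable_majorized[OF integrable_mult_right[OF iFw] _ b]) measurable
    have iT: "integrable lborel ?T"
    proof (rule integrable_majorized[OF integrable_mult_right[OF integrable_norm[OF iF]]])
      show "cmod (?T z) \<le> C3 * (1 + k powr (2/3))\<^sup>2 * cmod (fourier A z)" for z
        using mult_right_mono[OF C3(2)[OF k0, of z], of "cmod (fourier A z)"] by (simp add: norm_mult)
    qed measurable
    have iT0: "integrable lborel ?R" using Bochner_Integration.integrable_diff[OF iT iD] by simp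
    have "cmod (LINT z|lborel. ?T z - ?R z) \<le> (LINT z|lborel. C1 * k powr (-5/6) * ((1 + \<bar>z\<bar>) ^ 6 * cmod (fourier A z)))"
      by (rule Bochner_Integration.integral_norm_bound_integral[OF iD integrable_mult_right[OF iFw] b])
    also have "\<dots> = C1 * k powr (-5/6) * f" by (simp only: integral_mult_right_zero f_def)
    finally have I: "cmod ((LINT z|lborel. ?T z) - (LINT z|lborel. ?R z)) \<le> C1 * k powr (-5/6) * f"
      by (simp only: Bochner_Integration.integral_diff[OF iT iT0])
    have "u_exact k \<Theta> A (x_c \<Theta>) y - beam_prefactor k \<Theta> y * airy_integral A k ?w
        = 1 / (2 * pi) * (cis (k * ?e * y) * ((LINT z|lborel. ?T z) - (LINT z|lborel. ?R z)))"
      unfolding u_exact_eq[OF k0] airy_integral_transfer0[OF A k0, symmetric] by (simp only: right_diff_distrib)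
    then have "cmod (u_exact k \<Theta> A (x_c \<Theta>) y - beam_prefactor k \<Theta> y * airy_integral A k ?w) = 1 / (2 * pi) * cmod ((LINT z|lborel. ?T z) - (LINT z|lborel. ?R z))"
      by (simp add: norm_mult norm_divide)
    also have "\<dots> \<le> 1 * (C1 * k powr (-5/6) * f)" using I pi_gt3 by (intro mult_mono) auto
    finally have E: "cmod (u_exact k \<Theta> A (x_c \<Theta>) y - beam_prefactor k \<Theta> y * airy_integral A k ?w) \<le> C1 * f * k powr (-5/6)" by (simp only: mult_1_left mult_ac)
    have "cmod (beam_prefactor k \<Theta> y * (gb_integral A k ?w - airy_integral A k ?w)) \<le> sqrt k * (C2 * k powr (-4/3))"
      unfolding norm_mult using norm_beam_prefactor[OF k0] C2(2)[OF k] k0 by (intro mult_mono) auto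
    also have "\<dots> = C2 * (k powr (1/2) * k powr (-4/3))" using k0 by (simp add: powr_half_sqrt)
    also have "k powr (1/2) * k powr (-4/3) = k powr (-5/6)" by (simp flip: powr_add)
    finally have G: "cmod (beam_prefactor k \<Theta> y * (gb_integral A k ?w - airy_integral A k ?w)) \<le> C2 * k powr (-5/6)" .
    have "u_GB k \<Theta> A (x_c \<Theta>) y - u_exact k \<Theta> A (x_c \<Theta>) y
      = beam_prefactor k \<Theta> y * (gb_integral A k ?w - airy_integral A k ?w) - (u_exact k \<Theta> A (x_c \<Theta>) y - beam_prefactor k \<Theta> y * airy_integral A k ?w)"
      unfolding u_GB_eq[OF k0] by (simp add: right_diff_distrib)
    then have "cmod (u_GB k \<Theta> A (x_c \<Theta>) y - u_exact k \<Theta> A (x_c \<Theta>) y) \<le> C2 * k powr (-5/6) + C1 * f * k powr (-5/6)"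
      using order_trans[OF norm_triangle_ineq4 add_mono[OF G E]] by (simp only:)
    then show "cmod (u_GB k \<Theta> A (x_c \<Theta>) y - u_exact k \<Theta> A (x_c \<Theta>) y) \<le> (C2 + C1 * f) * k powr (-5/6)"
      by (simp only: distrib_right)
  qed
qed

end

theorem theorem1p1:
  fixes A :: "real \<Rightarrow> complex" and \<Theta> \<Theta>\<^sub>0 \<Theta>\<^sub>1 :: real
  assumes "schwartz A"
    and "0 < \<Theta>\<^sub>0" and "\<Theta>\<^sub>0 \<le> \<Theta>" and "\<Theta> \<le> \<Theta>\<^sub>1" and "\<Theta>\<^sub>1 < pi / 2"
  shows "\<exists>C::real. \<forall>k>0.
           Linfty_norm (\<lambda>y. u_GB k \<Theta> A (x_c \<Theta>) y - u_exact k \<Theta> A (x_c \<Theta>) y)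
             \<le> ereal (C * k powr (-5/6))"
proof -
  have \<Theta>: "0 < \<Theta>" "\<Theta> < pi / 2" using assms by auto
  obtain C1 where C1: "C1 \<ge> 0" "\<And>k y. k > 0 \<Longrightarrow> k \<le> 1 \<Longrightarrow> cmod (u_GB k \<Theta> A (x_c \<Theta>) y - u_exact k \<Theta> A (x_c \<Theta>) y) \<le> C1 * k powr (-5/6)"
    using small_k_bound[OF \<Theta> assms(1)] by blast
  obtain C2 where C2: "C2 \<ge> 0" "\<And>k y. k \<ge> 1 \<Longrightarrow> cmod (u_GB k \<Theta> A (x_c \<Theta>) y - u_exact k \<Theta> A (x_c \<Theta>) y) \<le> C2 * k powr (-5/6)"
    using large_k_bound[OF \<Theta> assms(1)] by blast
  show ?thesis
  proof (intro exI[of _ "max C1 C2"] allI impI)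
    fix k :: real assume k: "k > 0"
    have b: "cmod (u_GB k \<Theta> A (x_c \<Theta>) y - u_exact k \<Theta> A (x_c \<Theta>) y) \<le> max C1 C2 * k powr (-5/6)" for y
    proof (cases "k \<le> 1")
      case True
      have "C1 * k powr (-5/6) \<le> max C1 C2 * k powr (-5/6)" by (intro mult_right_mono) auto
      with C1(2)[OF k True, of y] show ?thesis by linarith
    next
      case False
      have "C2 * k powr (-5/6) \<le> max C1 C2 * k powr (-5/6)" by (intro mult_right_mono) auto
      with C2(2)[of k y] False show ?thesis by linarith
    qed
    show "Linfty_norm (\<lambda>y. u_GB k \<Theta> A (x_c \<Theta>) y - u_exact k \<Theta> A (x_c \<Theta>) y) \<le> ereal (max C1 C2 * k powr (-5/6))"
      unfolding Linfty_norm_def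
    proof (rule esssup_I)
      show "(\<lambda>y. ereal (cmod (u_GB k \<Theta> A (x_c \<Theta>) y - u_exact k \<Theta> A (x_c \<Theta>) y))) \<in> borel_measurable lborel"
        using measurable_difference[OF \<Theta> assms(1) k] by measurable
      show "AE y in lborel. ereal (cmod (u_GB k \<Theta> A (x_c \<Theta>) y - u_exact k \<Theta> A (x_c \<Theta>) y)) \<le> ereal (max C1 C2 * k powr (-5/6))"
        by (rule AE_I2) (use b in simp)
    qed
  qed
qed

end
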